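(* Let $\mathcal V$ be a normal algebra of differential functions in $\ell<\infty$ differential variables $u_i$, $i\in I=\{1,\dots,\ell\}$, and assume that the subalgebra of quasiconstants $\mathcal F\subset\mathcal V$ is a field. Let $K(\partial)=(K_{ij}(\partial))_{i,j\in I}$ be an $\ell\times\ell$ matrix differential operator of order $N$ with quasiconstant coefficients and invertible leading coefficient $K_N\in\mathrm{Mat}_{\ell\times\ell}(\mathcal F)$. Then: (a) The inclusion $(\tilde\Omega^\bullet_{0,0},0)\subset(\tilde\Omega^\bullet(\mathcal V),\delta_K)$ is a quasi-isomorphism of complexes, i.e. it induces a canonical Lie conformal superalgebra isomorphism of cohomology: $H^k(\tilde\Omega^\bullet(\mathcal V),\delta_K)\simeq\tilde\Omega^k_{0,0}$. (b) For $k\ge0$, $H^k(\tilde\Omega^\bullet(\mathcal V),\delta_K)$ is a vector space over $\mathcal F$ of dimension $\binom{N\ell}{k}$.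
   Context: The base field $\mathbb F$ has characteristic $0$. A hat over an entry means that it is omitted. Algebra of differential functions in $u_i$, $i\in I=\{1,\dots,\ell\}$: a unital commutative associative $\mathbb F$-algebra $\mathcal V$ with a derivation $\partial$ and commuting derivations $\frac{\partial}{\partial u_i^{(n)}}$ ($i\in I,n\in\mathbb Z_+$) such that for each $f\in\mathcal V$ all but finitely many $\frac{\partial f}{\partial u_i^{(n)}}$ vanish and $[\frac{\partial}{\partial u_i^{(n)}},\partial]=\frac{\partial}{\partial u_i^{(n-1)}}$ (the right side is $0$ if $n=0$). Quasiconstants: $\mathcal F=\{f\in\mathcal V:\frac{\partial f}{\partial u_i^{(n)}}=0\ \forall i,n\}$. For $m\in\mathbb Z_+$, $i\in I$ let $\mathcal V_{m,i}=\{f\in\mathcal V:\frac{\partial f}{\partial u_j^{(n)}}=0\text{ if }(n,j)>(m,i)\text{ lexicographically}\}$. $\mathcal V$ is normal if $\frac{\partial}{\partial u_i^{(m)}}(\mathcal V_{m,i})=\mathcal V_{m,i}$ for all $i,m$. (A normal $\mathcal V$ is automatically a differential algebra extension of the algebra of differential polynomials $\mathbb F[u_i^{(n)}\,|\,i\in I,n\in\mathbb Z_+]$, so $u_i\in\mathcal V$.) The complex: $\tilde\Omega^k(\mathcal V)$ is the space of arrays $P=(P_{i_1,\dots,i_k}(\lambda_1,\dots,\lambda_k))_{i_1,\dots,i_k\in I}$ with entries in $\mathcal V[\lambda_1,\dots,\lambda_k]$, skewsymmetric under simultaneous permutations of the indices and the variables ($\tilde\Omega^0(\mathcal V)=\mathcal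 V$). For $K(\partial)=\sum_{n=0}^NK_n\partial^n$ with $K_n\in\mathrm{Mat}_{\ell\times\ell}(\mathcal F)$ and symbol $K_{ij}(\lambda)=\sum_n(K_n)_{ij}\lambda^n$, define $\delta_K:\tilde\Omega^k(\mathcal V)\to\tilde\Omega^{k+1}(\mathcal V)$ by $$(\delta_KP)_{i_0,\dots,i_k}(\lambda_0,\dots,\lambda_k)=\sum_{\alpha=0}^k(-1)^\alpha\sum_{j\in I,n\in\mathbb Z_+}\frac{\partial P_{i_0,\dots,\widehat{i_\alpha},\dots,i_k}(\lambda_0,\dots,\widehat{\lambda_\alpha},\dots,\lambda_k)}{\partial u_j^{(n)}}(\lambda_\alpha+\partial)^nK_{j,i_\alpha}(\lambda_\alpha),$$ where $\partial$ acts on the coefficients of $K$; $\delta_K^2=0$ and $\delta_K$ is $\mathcal F$-linear. $\tilde\Omega^k_{0,0}\subset\tilde\Omega^k(\mathcal V)$ is the subspace of arrays whose entries have coefficients in $\mathcal F$ and degree at most $N-1$ in each variable $\lambda_1,\dots,\lambda_k$; $\delta_K$ vanishes on it. Lie conformal superalgebra structure on $\tilde\Omega^\bullet(\mathcal V)$: $\tilde\Omega^{k+1}(\mathcal V)$ has parity $k$ mod $2$, and $\partial$ acts by $(\partial P)_{i_1,\dots,i_k}(\lambda_1,\dots,\lambda_k)=(\partial+\lambda_1+\dots+\lambda_k)P_{i_1,\dots,i_k}(\lambda_1,\dots,\lambda_k)$. To $P\in\tilde\Omega^{k+1}(\mathcal V)$ associate the multilinear map $X^P:\mathcal V^{\otimes(k+1)}\to\mathcal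 V[\lambda_0,\dots,\lambda_k]$, $$X^P_{\lambda_0,\dots,\lambda_k}(f_0,\dots,f_k)=\sum_{i_0,\dots,i_k\in I;\ m_0,\dots,m_k\in\mathbb Z_+}\Big(e^{\partial\partial_{\lambda_0}}\tfrac{\partial f_0}{\partial u_{i_0}^{(m_0)}}\Big)\cdots\Big(e^{\partial\partial_{\lambda_k}}\tfrac{\partial f_k}{\partial u_{i_k}^{(m_k)}}\Big)(-\lambda_0)^{m_0}\cdots(-\lambda_k)^{m_k}P_{i_0,\dots,i_k}(\lambda_0,\dots,\lambda_k),$$ where $(e^{\partial\partial_\lambda}f)p(\lambda)=\sum_{n\ge0}\frac1{n!}(\partial^nf)\,\partial_\lambda^np(\lambda)$. For $P\in\tilde\Omega^{h+1}(\mathcal V)$, $Q\in\tilde\Omega^{k-h+1}(\mathcal V)$ ($h\ge-1$, $k\ge h-1$) let $P\Box_\lambda Q=0$ if $h=-1$, and otherwise $$(P\Box_\lambda Q)_{i_0,\dots,i_k}(\lambda_0,\dots,\lambda_k)=\sum_\sigma\mathrm{sign}(\sigma)\,X^P_{-\lambda-\lambda_{\sigma(k-h+1)}-\dots-\lambda_{\sigma(k)}-\partial,\,\lambda_{\sigma(k-h+1)},\dots,\lambda_{\sigma(k)}}\big(Q_{i_{\sigma(0)},\dots,i_{\sigma(k-h)}}(\lambda_{\sigma(0)},\dots,\lambda_{\sigma(k-h)}),u_{i_{\sigma(k-h+1)}},\dots,u_{i_{\sigma(k)}}\big),$$ the sum being over permutations $\sigma$ of $\{0,\dots,k\}$ with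 $\sigma(0)<\dots<\sigma(k-h)$ and $\sigma(k-h+1)<\dots<\sigma(k)$, with $\partial$ in the subscript moved to the left. The $\lambda$-bracket is $$[P_\lambda Q]=P\Box_\lambda Q-(-1)^{h(k-h)}Q\Box_{-\lambda-\partial}P\in\mathbb F[\lambda]\otimes\tilde\Omega^{k+1}(\mathcal V)$$ (with $\partial$ moved to the left); it satisfies the axioms of a Lie conformal superalgebra (sesquilinearity, skewcommutativity, Jacobi identity). The restriction of this $\lambda$-bracket to $\tilde\Omega^\bullet_{0,0}$ is zero, and $\tilde\Omega^\bullet_{0,0}$ is regarded, with this zero $\lambda$-bracket, as a subalgebra of the Lie conformal superalgebra $\tilde\Omega^\bullet(\mathcal V)$.
   Formalization: For arbitrary K the λ-bracket need not pass to cohomology (e.g. ℓ=1, K=1), so bracket compatibility is claimed whenever it does, which is proved for skewadjoint K; as Ω̃_{0,0} is not stable under ∂ for N≥1, compatibility with ∂ is stated in cohomology. *)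

theory Defs
  imports
    "HOL-Analysis.Finite_Cartesian_Product"
    "HOL-Computational_Algebra.Polynomial"
    "HOL-Library.Poly_Mapping"
    "HOL-Library.Function_Algebras"
    "HOL-Library.Set_Algebras"
    "HOL-Combinatorics.Permutations"
    "HOL-Algebra.Module"
begin

section \<open>Algebras of differential functions\<close>

text \<open>
  \<open>dv\<close> is the total derivation \<open>\<partial>\<close> and \<open>pd i n\<close> is \<open>\<partial>/\<partial>u\<^sub>i\<^sup>(\<^sup>n\<^sup>)\<close>. The index set \<open>I = {1,\<dots>,\<ell>}\<close> is
  a finite linearly ordered type, so \<open>\<ell> = CARD('i)\<close>; the order enters the filtration below.
\<close>

definition derivation :: "('f::field \<Rightarrow> 'v \<Rightarrow> 'v) \<Rightarrow> ('v::comm_ring_1 \<Rightarrow> 'v) \<Rightarrow> bool" where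
  "derivation smul D \<longleftrightarrow>
     Vector_Spaces.linear smul smul D \<and> (\<forall>f g. D (f * g) = D f * g + f * D g)"

locale diff_function_algebra =
  fixes smul :: "'f::field_char_0 \<Rightarrow> 'v::comm_ring_1 \<Rightarrow> 'v"
    and dv :: "'v \<Rightarrow> 'v"
    and pd :: "'i::{finite,linorder} \<Rightarrow> nat \<Rightarrow> 'v \<Rightarrow> 'v"
  assumes vector_space_smul: "vector_space smul"
    and smul_mult: "smul c (f * g) = smul c f * g"
    and derivation_dv: "derivation smul dv"
    and derivation_pd: "derivation smul (pd i n)"
    and pd_commute: "pd i m (pd j n f) = pd j n (pd i m f)"
    and finite_pd: "finite {(i, n). pd i n f \<noteq> 0}"
    and pd_dv: "pd i n (dv f) - dv (pd i n f) = (if n = 0 then 0 else pd i (n - 1) f)"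

definition quasiconst :: "('i \<Rightarrow> nat \<Rightarrow> 'v \<Rightarrow> 'v::zero) \<Rightarrow> 'v set" where
  "quasiconst pd = {f. \<forall>i n. pd i n f = 0}"

definition Vfilt :: "('i::linorder \<Rightarrow> nat \<Rightarrow> 'v \<Rightarrow> 'v::zero) \<Rightarrow> nat \<Rightarrow> 'i \<Rightarrow> 'v set" where
  "Vfilt pd m i = {f. \<forall>n j. n > m \<or> (n = m \<and> j > i) \<longrightarrow> pd j n f = 0}"

definition normal_alg :: "('i::linorder \<Rightarrow> nat \<Rightarrow> 'v \<Rightarrow> 'v::zero) \<Rightarrow> bool" where
  "normal_alg pd \<longleftrightarrow> (\<forall>i m. pd i m ` Vfilt pd m i = Vfilt pd m i)"

definition diff_variables ::
  "('i \<Rightarrow> nat \<Rightarrow> 'v \<Rightarrow> 'v::zero_neq_one) \<Rightarrow> ('i \<Rightarrow> 'v) \<Rightarrow> bool" where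
  "diff_variables pd u \<longleftrightarrow> (\<forall>i j n. pd j n (u i) = (if j = i \<and> n = 0 then 1 else 0))"

text \<open>The quasiconstants, as a ring object over which modules can be formed.\<close>

definition qc_ring :: "('i \<Rightarrow> nat \<Rightarrow> 'v \<Rightarrow> 'v::comm_ring_1) \<Rightarrow> 'v ring" where
  "qc_ring pd = \<lparr>carrier = quasiconst pd, monoid.mult = (*), one = 1, ring.zero = 0, add = (+)\<rparr>"


section \<open>Polynomials in several variables\<close>

text \<open>
  Polynomials over \<open>'v\<close> in the variables \<open>\<lambda>\<^sub>0, \<lambda>\<^sub>1, \<dots>\<close>; variables are numbered from 0, so an
  array of degree \<open>k\<close> has entries in \<open>\<lambda>\<^sub>0,\<dots>,\<lambda>\<^bsub>k-1\<^esub>\<close>.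
\<close>

type_synonym 'v mpol = "(nat \<Rightarrow>\<^sub>0 nat) \<Rightarrow>\<^sub>0 'v"

definition mconst :: "'v::zero \<Rightarrow> 'v mpol" where
  "mconst c = Poly_Mapping.single 0 c"

definition mvar :: "nat \<Rightarrow> 'v::zero_neq_one mpol" where
  "mvar a = Poly_Mapping.single (Poly_Mapping.single a 1) 1"

text \<open>Application of an additive map of \<open>'v\<close> to all coefficients:\<close>

abbreviation cmap :: "('v::zero \<Rightarrow> 'v) \<Rightarrow> 'v mpol \<Rightarrow> 'v mpol" where
  "cmap \<equiv> Poly_Mapping.map"

definition mrename :: "(nat \<Rightarrow> nat) \<Rightarrow> 'v::comm_ring_1 mpol \<Rightarrow> 'v mpol" where
  "mrename s p = (\<Sum>m\<in>Poly_Mapping.keys p. mconst (Poly_Mapping.lookup p m) *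
     (\<Prod>a\<in>Poly_Mapping.keys m. mvar (s a) ^ Poly_Mapping.lookup m a))"

definition mpderiv :: "nat \<Rightarrow> 'v::comm_ring_1 mpol \<Rightarrow> 'v mpol" where
  "mpderiv a p = (\<Sum>m\<in>Poly_Mapping.keys p.
     Poly_Mapping.single (m - Poly_Mapping.single a 1)
       (of_nat (Poly_Mapping.lookup m a) * Poly_Mapping.lookup p m))"


section \<open>The complex\<close>

text \<open>
  An array of degree \<open>k\<close> is a function on index lists that vanishes off the lists of length \<open>k\<close>.
  Addition of arrays is the pointwise one.
\<close>

type_synonym ('i, 'v) arr = "'i list \<Rightarrow> 'v mpol"

definition Omega :: "nat \<Rightarrow> ('i, 'v::comm_ring_1) arr set" where
  "Omega k = {P.
     (\<forall>is. length is \<noteq> k \<longrightarrow> P is = 0) \<and>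
     (\<forall>is. \<forall>m\<in>Poly_Mapping.keys (P is). Poly_Mapping.keys m \<subseteq> {..<k}) \<and>
     (\<forall>s is. s permutes {..<k} \<and> length is = k \<longrightarrow>
        mrename s (P (permute_list s is)) = of_int (sign s) * P is)}"

definition Ksym :: "(nat \<Rightarrow> 'v::comm_ring_1 ^ 'i ^ 'i) \<Rightarrow> nat \<Rightarrow> 'i \<Rightarrow> 'i \<Rightarrow> nat \<Rightarrow> 'v mpol" where
  "Ksym K N i j a = (\<Sum>n\<le>N. mconst (K n $ i $ j) * mvar a ^ n)"

definition delta ::
  "('v::comm_ring_1 \<Rightarrow> 'v) \<Rightarrow> ('i::finite \<Rightarrow> nat \<Rightarrow> 'v \<Rightarrow> 'v) \<Rightarrow> (nat \<Rightarrow> 'v ^ 'i ^ 'i) \<Rightarrow> nat \<Rightarrow>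
   ('i, 'v) arr \<Rightarrow> ('i, 'v) arr" where
  "delta dv pd K N P is = (\<Sum>a<length is. (-1) ^ a *
     (\<Sum>(j, n). mrename (\<lambda>b. if b < a then b else Suc b)
                   (cmap (pd j n) (P (take a is @ drop (Suc a) is))) *
                 ((\<lambda>p. mvar a * p + cmap dv p) ^^ n) (Ksym K N j (is ! a) a)))"

text \<open>Degree at most \<open>N - 1\<close> is written as degree \<open>< N\<close>, so that \<open>N = 0\<close> leaves only 0 for \<open>k > 0\<close>.\<close>

definition Omega00 :: "('i \<Rightarrow> nat \<Rightarrow> 'v \<Rightarrow> 'v::comm_ring_1) \<Rightarrow> nat \<Rightarrow> nat \<Rightarrow> ('i, 'v) arr set" where
  "Omega00 pd N k = {P \<in> Omega k. \<forall>is. \<forall>m\<in>Poly_Mapping.keys (P is).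
     Poly_Mapping.lookup (P is) m \<in> quasiconst pd \<and> (\<forall>a<k. Poly_Mapping.lookup m a < N)}"

definition arr_smult :: "'v::comm_ring_1 \<Rightarrow> ('i, 'v) arr \<Rightarrow> ('i, 'v) arr" where
  "arr_smult f P is = mconst f * P is"

definition arr_der :: "('v::comm_ring_1 \<Rightarrow> 'v) \<Rightarrow> ('i, 'v) arr \<Rightarrow> ('i, 'v) arr" where
  "arr_der dv P is = cmap dv (P is) + (\<Sum>a<length is. mvar a) * P is"

definition cocycles where
  "cocycles dv pd K N k = {P \<in> Omega k. delta dv pd K N P = 0}"

definition coboundaries where
  "coboundaries dv pd K N k = (case k of 0 \<Rightarrow> {0} | Suc j \<Rightarrow> delta dv pd K N ` Omega j)"

definition coh_class where
  "coh_class dv pd K N k P = P +o coboundaries dv pd K N k"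

text \<open>
  The cohomology space, with elements the cosets \<open>P + B\<close>; sums of cosets are sums of sets. The
  multiplicative fields of the module records carry no meaning.
\<close>

definition cohomology ::
  "('v::comm_ring_1 \<Rightarrow> 'v) \<Rightarrow> ('i::finite \<Rightarrow> nat \<Rightarrow> 'v \<Rightarrow> 'v) \<Rightarrow> (nat \<Rightarrow> 'v ^ 'i ^ 'i) \<Rightarrow> nat \<Rightarrow> nat \<Rightarrow>
   ('v, ('i, 'v) arr set) module" where
  "cohomology dv pd K N k =
     \<lparr>carrier = coh_class dv pd K N k ` cocycles dv pd K N k,
      monoid.mult = undefined, one = undefined,
      ring.zero = coboundaries dv pd K N k,
      add = (+),
      smult = (\<lambda>f X. arr_smult f ` X + coboundaries dv pd K N k)\<rparr>"

definition Omega00_module ::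
  "('i \<Rightarrow> nat \<Rightarrow> 'v \<Rightarrow> 'v::comm_ring_1) \<Rightarrow> nat \<Rightarrow> nat \<Rightarrow> ('v, ('i, 'v) arr) module" where
  "Omega00_module pd N k =
     \<lparr>carrier = Omega00 pd N k, monoid.mult = undefined, one = undefined,
      ring.zero = 0, add = (+), smult = arr_smult\<rparr>"

definition linear_iso ::
  "('a, 'r) ring_scheme \<Rightarrow> ('a, 'b, 'm) module_scheme \<Rightarrow> ('a, 'c, 'n) module_scheme \<Rightarrow> ('b \<Rightarrow> 'c) \<Rightarrow> bool"
where
  "linear_iso R M M' h \<longleftrightarrow>
     bij_betw h (carrier M) (carrier M') \<and>
     (\<forall>x\<in>carrier M. \<forall>y\<in>carrier M. h (x \<oplus>\<^bsub>M\<^esub> y) = h x \<oplus>\<^bsub>M'\<^esub> h y) \<and>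
     (\<forall>a\<in>carrier R. \<forall>x\<in>carrier M. h (a \<odot>\<^bsub>M\<^esub> x) = a \<odot>\<^bsub>M'\<^esub> h x)"

definition has_dimension :: "('a, 'r) ring_scheme \<Rightarrow> ('a, 'b, 'm) module_scheme \<Rightarrow> nat \<Rightarrow> bool" where
  "has_dimension R M d \<longleftrightarrow>
     (\<exists>b \<in> {..<d} \<rightarrow> carrier M. \<forall>x\<in>carrier M. \<exists>!c. c \<in> {..<d} \<rightarrow>\<^sub>E carrier R \<and>
        x = (\<Oplus>\<^bsub>M\<^esub>i\<in>{..<d}. c i \<odot>\<^bsub>M\<^esub> b i))"


section \<open>The \<open>\<lambda>\<close>-bracket\<close>

text \<open>\<open>exp_op smul dv a f p\<close> is \<open>(e\<^bsup>\<partial>\<partial>_\<lambda>\<^esup> f) p\<close> for \<open>\<lambda> = \<lambda>\<^sub>a\<close>.\<close>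

definition exp_op ::
  "('f::field_char_0 \<Rightarrow> 'v \<Rightarrow> 'v) \<Rightarrow> ('v::comm_ring_1 \<Rightarrow> 'v) \<Rightarrow> nat \<Rightarrow> 'v \<Rightarrow> 'v mpol \<Rightarrow> 'v mpol" where
  "exp_op smul dv a f p =
     (\<Sum>n. mconst (smul (1 / fact n) ((dv ^^ n) f)) * (mpderiv a ^^ n) p)"

text \<open>\<open>Xmap smul dv pd p P fs\<close> is \<open>X\<^bsup>P\<^esup>(fs)\<close> for \<open>P\<close> of degree \<open>p\<close> and a list \<open>fs\<close> of length \<open>p\<close>.\<close>

definition Xmap ::
  "('f::field_char_0 \<Rightarrow> 'v \<Rightarrow> 'v) \<Rightarrow> ('v::comm_ring_1 \<Rightarrow> 'v) \<Rightarrow> ('i::finite \<Rightarrow> nat \<Rightarrow> 'v \<Rightarrow> 'v) \<Rightarrow>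
   nat \<Rightarrow> ('i, 'v) arr \<Rightarrow> 'v list \<Rightarrow> 'v mpol" where
  "Xmap smul dv pd p P fs = (\<Sum>(is, ms).
     if length is = p \<and> length ms = p
     then foldr (\<lambda>a. exp_op smul dv a (pd (is ! a) (ms ! a) (fs ! a))) [0..<p]
            ((\<Prod>a<p. (- mvar a) ^ (ms ! a)) * P is)
     else 0)"

text \<open>
  Elements of \<open>\<F>[\<lambda>] \<otimes> \<Omega>\<close> are arrays whose entries are univariate polynomials in the bracket
  variable \<open>\<lambda>\<close> over the ring of polynomials in \<open>\<lambda>\<^sub>0, \<lambda>\<^sub>1, \<dots>\<close>. For \<open>l\<close> a sum of variables,
  \<open>neg_shift dv l\<close> is the operator \<open>-\<lambda> - l - \<partial>\<close>, with \<open>\<partial>\<close> acting on all coefficients; substituting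
  it for a variable, with \<open>\<partial>\<close> moved to the left, is applying its powers to the remaining factor.
\<close>

definition neg_shift ::
  "('v::comm_ring_1 \<Rightarrow> 'v) \<Rightarrow> 'v mpol \<Rightarrow> 'v mpol poly \<Rightarrow> 'v mpol poly" where
  "neg_shift dv l g = - pCons 0 g - Polynomial.smult l g - map_poly (cmap dv) g"

definition shuffles_perm :: "nat \<Rightarrow> nat \<Rightarrow> (nat \<Rightarrow> nat) set" where
  "shuffles_perm q h = {s. s permutes {..<q + h} \<and>
     strict_mono_on {..<q} s \<and> strict_mono_on {q..<q + h} s}"

text \<open>
  \<open>box \<dots> p q P Q\<close> is \<open>P \<box>\<^bsub>\<lambda>\<^esub> Q\<close> for \<open>P\<close> of degree \<open>p = h + 1\<close> and \<open>Q\<close> of degree \<open>q = k - h + 1\<close>;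
  the result has degree \<open>q + h = k + 1\<close>. \<open>Xmap\<close> is extended linearly in its first argument over
  the monomials \<open>m\<close> of the entry of \<open>Q\<close>.
\<close>

definition box ::
  "('f::field_char_0 \<Rightarrow> 'v \<Rightarrow> 'v) \<Rightarrow> ('v::comm_ring_1 \<Rightarrow> 'v) \<Rightarrow> ('i::finite \<Rightarrow> nat \<Rightarrow> 'v \<Rightarrow> 'v) \<Rightarrow>
   ('i \<Rightarrow> 'v) \<Rightarrow> nat \<Rightarrow> nat \<Rightarrow> ('i, 'v) arr \<Rightarrow> ('i, 'v) arr \<Rightarrow> 'i list \<Rightarrow> 'v mpol poly" where
  "box smul dv pd u p q P Q is = (case p of 0 \<Rightarrow> 0 | Suc h \<Rightarrow>
     if length is \<noteq> q + h then 0
     else \<Sum>s\<in>shuffles_perm q h. of_int (sign s) *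
       (let Qs = mrename s (Q (map (\<lambda>a. is ! s a) [0..<q])) in
        \<Sum>m\<in>Poly_Mapping.keys Qs. Polynomial.smult (Poly_Mapping.single m 1)
          (let X = Xmap smul dv pd p P
                     (Poly_Mapping.lookup Qs m # map (\<lambda>b. u (is ! s b)) [q..<q + h]) in
           \<Sum>e\<in>Poly_Mapping.keys X.
             (neg_shift dv (\<Sum>b<h. mvar (s (q + b))) ^^ Poly_Mapping.lookup e 0)
               [:mconst (Poly_Mapping.lookup X e) *
                 (\<Prod>b<h. mvar (s (q + b)) ^ Poly_Mapping.lookup e (Suc b)):])))"

text \<open>
  In \<open>Q \<box>\<^bsub>-\<lambda>-\<partial>\<^esub> P\<close> the derivation is the one of the conformal module, i.e. \<open>arr_der\<close>, whence the
  sum of all variables. The exponent \<open>(p + 1) * (q + 1)\<close> has the parity of \<open>h * (k - h)\<close>.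
\<close>

definition lambda_bracket ::
  "('f::field_char_0 \<Rightarrow> 'v \<Rightarrow> 'v) \<Rightarrow> ('v::comm_ring_1 \<Rightarrow> 'v) \<Rightarrow> ('i::finite \<Rightarrow> nat \<Rightarrow> 'v \<Rightarrow> 'v) \<Rightarrow>
   ('i \<Rightarrow> 'v) \<Rightarrow> nat \<Rightarrow> nat \<Rightarrow> ('i, 'v) arr \<Rightarrow> ('i, 'v) arr \<Rightarrow> 'i list \<Rightarrow> 'v mpol poly" where
  "lambda_bracket smul dv pd u p q P Q is = box smul dv pd u p q P Q is -
     (-1) ^ ((p + 1) * (q + 1)) *
     (let g = box smul dv pd u q p Q P is in
      \<Sum>n\<le>degree g. (neg_shift dv (\<Sum>a<length is. mvar a) ^^ n) [:poly.coeff g n:])"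

text \<open>
  The coefficient of \<open>\<lambda>\<^sup>n\<close> in the bracket. The result has degree \<open>p + q - 1\<close>; for \<open>p = q = 0\<close>, where
  the bracket is 0, truncated subtraction is harmless.
\<close>

definition bracket_coeff ::
  "('f::field_char_0 \<Rightarrow> 'v \<Rightarrow> 'v) \<Rightarrow> ('v::comm_ring_1 \<Rightarrow> 'v) \<Rightarrow> ('i::finite \<Rightarrow> nat \<Rightarrow> 'v \<Rightarrow> 'v) \<Rightarrow>
   ('i \<Rightarrow> 'v) \<Rightarrow> nat \<Rightarrow> nat \<Rightarrow> nat \<Rightarrow> ('i, 'v) arr \<Rightarrow> ('i, 'v) arr \<Rightarrow> ('i, 'v) arr" where
  "bracket_coeff smul dv pd u p q n P Q = (\<lambda>is. poly.coeff (lambda_bracket smul dv pd u p q P Q is) n)"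


section \<open>The conformal structure on cohomology\<close>

definition coh_der where
  "coh_der dv pd K N k X = arr_der dv ` X + coboundaries dv pd K N k"

text \<open>
  All brackets of representatives of \<open>X\<close> and \<open>Y\<close>, up to coboundaries. This set is a cohomology
  class iff those brackets are cocycles (up to coboundaries) and all lie in one class, so the
  bracket descends to cohomology iff it is always an element of the cohomology space.
\<close>

definition coh_bracket where
  "coh_bracket smul dv pd u K N p q n X Y =
     {bracket_coeff smul dv pd u p q n P Q |P Q. P \<in> X \<and> Q \<in> Y} +
     coboundaries dv pd K N (p + q - 1)"

definition bracket_descends where
  "bracket_descends smul dv pd u K N \<longleftrightarrow>
     (\<forall>p q n. \<forall>X\<in>carrier (cohomology dv pd K N p). \<forall>Y\<in>carrier (cohomology dv pd K N q).
        coh_bracket smul dv pd u K N p q n X Y \<in> carrier (cohomology dv pd K N (p + q - 1)))"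

text \<open>\<open>K\<^sup>* = -K\<close>, where \<open>(K\<^sup>*)\<^sub>i\<^sub>j = \<Sum>\<^sub>n (-\<partial>)\<^sup>n \<circ> (K\<^sub>n)\<^sub>j\<^sub>i\<close> has the symbol
  \<open>\<Sum>\<^sub>n (-\<lambda>-\<partial>)\<^sup>n (K\<^sub>n)\<^sub>j\<^sub>i\<close>. For such \<open>K\<close> the map \<open>\<delta>\<^sub>K\<close> is, up to sign, the bracket at \<open>\<lambda> = 0\<close> with an
  element of degree 2, hence a derivation of the bracket, which therefore descends to cohomology.
  For general \<open>K\<close> it need not: if \<open>\<ell> = 1\<close>, \<open>N = 0\<close>, \<open>K = 1\<close>, then \<open>u\<^sup>2\<close> and \<open>u' \<lambda>\<^sub>0\<close> are cocycles of
  degree 1, and the constant coefficient \<open>-2u'\<^sup>2\<close> of their bracket is not a cocycle.\<close>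

definition skewadjoint ::
  "('v::comm_ring_1 \<Rightarrow> 'v) \<Rightarrow> (nat \<Rightarrow> 'v ^ 'i ^ 'i) \<Rightarrow> nat \<Rightarrow> bool" where
  "skewadjoint dv K N \<longleftrightarrow> (\<forall>i j.
     (\<Sum>n\<le>N. ((\<lambda>p. - (mvar 0 * p) - cmap dv p) ^^ n) (mconst (K n $ j $ i))) = - Ksym K N i j 0)"


section \<open>Existence of the differential variables\<close>

text \<open>\<open>diff_variables pd u\<close> is satisfiable whenever the algebra is normal.\<close>

context diff_function_algebra
begin

lemma pd_add: "pd i n (f + g) = pd i n f + pd i n g"
  and pd_diff: "pd i n (f - g) = pd i n f - pd i n g"
proof -
  interpret Vector_Spaces.linear smul smul "pd i n"
    using derivation_pd[of i n] by (simp add: derivation_def)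
  show "pd i n (f + g) = pd i n f + pd i n g" "pd i n (f - g) = pd i n f - pd i n g"
    by (fact add, fact diff)
qed

lemma pd_0: "pd i n 0 = 0"
  using pd_diff[of i n 0 0] by simp

lemma pd_1: "pd i n 1 = 0"
proof -
  have "pd i n (1 * 1) = pd i n 1 * 1 + 1 * pd i n 1"
    using derivation_pd[of i n] unfolding derivation_def by blast
  then show ?thesis by simp
qed

lemma diff_variables_exist:
  assumes nrm: "normal_alg pd"
  shows "\<exists>u. diff_variables pd u"
proof -
  have surj: "\<exists>g\<in>Vfilt pd m i. pd i m g = f" if "f \<in> Vfilt pd m i" for f m i
    using nrm that unfolding normal_alg_def by (metis imageE)
  have "\<exists>v. \<forall>j n. pd j n v = (if j = i \<and> n = 0 then 1 else 0)" for i
  proof -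
    have step: "\<exists>v\<in>Vfilt pd 0 i. pd i 0 v = 1 \<and> (\<forall>j\<in>A. pd j 0 v = 0)"
      if "finite A" "A \<subseteq> {..<i}" "\<And>j k. j \<in> A \<Longrightarrow> j < k \<Longrightarrow> k < i \<Longrightarrow> k \<in> A" for A
      using that
    proof (induction A rule: finite_linorder_min_induct)
      case empty
      have "1 \<in> Vfilt pd 0 i" by (simp add: Vfilt_def pd_1)
      then show ?case using surj by blast
    next
      case (insert b A)
      have "k \<in> A" if "j \<in> A" "j < k" "k < i" for j k
        using insert.prems(2)[of j k] insert.hyps(2) that by (metis insert_iff less_asym)
      then obtain v where v: "v \<in> Vfilt pd 0 i" "pd i 0 v = 1" "\<forall>j\<in>A. pd j 0 v = 0"
        using insert.IH insert.prems(1) by blast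
      have bi: "b < i" using insert.prems by auto
      have up: "pd j 0 v = 0" if "b < j" "j \<noteq> i" for j
      proof (cases "j < i")
        case True
        then have "j \<in> A" using insert.prems(2)[of b j] that by auto
        then show ?thesis using v by blast
      next
        case False
        then have "i < j" using that(2) by auto
        then show ?thesis using v(1) by (auto simp: Vfilt_def)
      qed
      have "pd b 0 v \<in> Vfilt pd 0 b"
        unfolding Vfilt_def
      proof (intro CollectI allI impI)
        fix n :: nat and j assume nj: "0 < n \<or> n = 0 \<and> b < j"
        have c: "pd j n (pd b 0 v) = pd b 0 (pd j n v)" by (rule pd_commute)
        show "pd j n (pd b 0 v) = 0"
        proof (cases "0 < n")
          case True
          then have "pd j n v = 0" using v(1) by (auto simp: Vfilt_def)
          then show ?thesis using c by (simp add: pd_0)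
        next
          case False
          then show ?thesis using nj c up[of j] v(2) by (cases "j = i") (auto simp: pd_0 pd_1)
        qed
      qed
      then obtain w where w: "w \<in> Vfilt pd 0 b" "pd b 0 w = pd b 0 v" using surj by blast
      have w0: "pd j n w = 0" if "0 < n \<or> n = 0 \<and> b < j" for j and n :: nat
        using w(1) that by (auto simp: Vfilt_def)
      have "v - w \<in> Vfilt pd 0 i"
        using v(1) w0 bi by (auto simp: Vfilt_def pd_diff)
      moreover have "pd i 0 (v - w) = 1" using v(2) w0[of 0 i] bi by (simp add: pd_diff)
      moreover have "pd j 0 (v - w) = 0" if "j \<in> insert b A" for j
        using that v(3) w(2) w0[of 0 j] insert.hyps(2) by (auto simp: pd_diff)
      ultimately show ?case by blast
    qed
    obtain v where v: "v \<in> Vfilt pd 0 i" "pd i 0 v = 1" "\<forall>j\<in>{..<i}. pd j 0 v = 0"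
      using step[of "{..<i}"] by auto
    have "pd j n v = (if j = i \<and> n = 0 then 1 else 0)" for j n
    proof (cases "n = 0")
      case True
      then show ?thesis using v by (cases j i rule: linorder_cases) (auto simp: Vfilt_def)
    next
      case False
      then show ?thesis using v(1) by (auto simp: Vfilt_def)
    qed
    then show ?thesis by blast
  qed
  then have "\<forall>i. \<exists>v. \<forall>j n. pd j n v = (if j = i \<and> n = 0 then 1 else 0)" by blast
  then show ?thesis unfolding diff_variables_def by metis
qed

end

end

theory Submission
  imports Defs
begin

text \<open>
An array of degree \<open>k\<close> is an alternating, finitely supported function on words of length \<open>k\<close> in the
letters \<open>(i, m)\<close>: its value on \<open>(i\<^sub>1, m\<^sub>1) \<dots> (i\<^sub>k, m\<^sub>k)\<close> is the coefficient of
\<open>\<lambda>\<^sub>1^m\<^sub>1 \<dots> \<lambda>\<^sub>k^m\<^sub>k\<close> in the entry with indices \<open>i\<^sub>1, \<dots>, i\<^sub>k\<close>. In this picture \<open>\<delta>\<^sub>K\<close> is the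
Koszul differential of a family of commuting derivations \<open>D\<^bsub>(i,m)\<^esub>\<close>. After a constant change of letters
that makes the leading coefficient of \<open>K\<close> the identity, \<open>D\<^bsub>(j,n+N)\<^esub>\<close> acts as \<open>\<partial>/\<partial>u\<^sub>j\<^sup>(\<^sup>n\<^sup>)\<close> on functions of order
at most \<open>n\<close>. Normality provides a right inverse of \<open>\<partial>/\<partial>u\<^sub>j\<^sup>(\<^sup>n\<^sup>)\<close>, so the variables \<open>u\<^sub>j\<^sup>(\<^sup>n\<^sup>)\<close> can be eliminated
one by one, in decreasing order, together with the letters \<open>(j, n + N)\<close>, modulo coboundaries. What remains has
quasiconstant values and letters \<open>(i, m)\<close> with \<open>m < N\<close> only; there are \<open>N \<ell>\<close> of these, hence the dimension.
The same elimination, applied to a primitive, shows that no nonzero form of this kind is exact.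

In these coordinates \<open>P \<box>\<^sub>\<lambda> Q\<close> is the sum of \<open>\<partial>Q/\<partial>u\<^sub>i\<^sup>(\<^sup>m\<^sup>) \<and> (\<lambda> + \<partial>)\<^sup>m (-\<lambda> - \<partial>)\<^sup>r \<iota>\<^bsub>(i,r)\<^esub> P\<close>. If \<open>K\<close> is skewadjoint, this
gives an explicit primitive of the bracket of an exact form with a closed one; together with the elimination,
the bracket of any two cocycles is exact, so the bracket descends to cohomology.
\<close>

section \<open>Forms on words\<close>

text \<open>Closedness enters the elimination only on words that contain a letter
  \<open>(i, m)\<close> with \<open>m \<ge> N\<close>. This weak form yields injectivity: a
  primitive \<gamma> of a form with quasiconstant values and letters below N need not be closed, but
  its differential vanishes on all those words, so \<gamma> can itself be eliminated modulo exact
  forms, and what remains of it is closed. The shift by N comes from the symbol: (\<lambda> +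
  \<partial>)^n K(\<lambda>) has degree at most n + N in \<lambda>, with coefficient K_N there. So
  the derivation at a letter \<open>(i, n + N)\<close> involves no variable of order below n. Words
  are read from the left: contraction with the first letter turns the differential, the exterior
  product and \<partial> into recursions, and their commutation rules into inductions. For the
  bracket the obstacle is that -\<lambda> - \<partial> is substituted to the left of coefficients on
  which \<partial> acts. The exponential in X^P undoes this action on the differentiated argument;
  then only the operators \<lambda> + \<partial> and -\<lambda> - \<partial> on forms are
  left.\<close>

definition contr :: "'x \<Rightarrow> ('x list \<Rightarrow> 'w) \<Rightarrow> 'x list \<Rightarrow> 'w" where
  "contr x A = (\<lambda>xs. A (x # xs))"

text \<open>The parity involution of the exterior algebra. It carries the sign that arises when a
  letter passes the left factor of an exterior product.\<close>

definition signed :: "('x list \<Rightarrow> 'w::comm_ring_1) \<Rightarrow> 'x list \<Rightarrow> 'w" where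
  "signed A = (\<lambda>xs. (-1) ^ length xs * A xs)"

text \<open>Cartan's formula for the contraction of a differential, read as a recursion;
  \<open>dl_explicit\<close> recovers the usual alternating sum.\<close>

fun dl :: "('x \<Rightarrow> 'w \<Rightarrow> 'w) \<Rightarrow> ('x list \<Rightarrow> 'w::comm_ring_1) \<Rightarrow> 'x list \<Rightarrow> 'w" where
  "dl D A [] = 0"
| "dl D A (x # xs) = D x (A xs) - dl D (contr x A) xs"

text \<open>The exterior product, determined by the demand that contraction be an antiderivation.
  Unrolled, it is the signed sum over shuffles without factorials, see
  \<open>shuffle_wedge\<close>.\<close>

fun wedge :: "('x list \<Rightarrow> 'w::comm_ring_1) \<Rightarrow> ('x list \<Rightarrow> 'w) \<Rightarrow> 'x list \<Rightarrow> 'w" where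
  "wedge A B [] = A [] * B []"
| "wedge A B (x # xs) = wedge (contr x A) B xs + wedge (signed A) (contr x B) xs"

text \<open>The action of \<open>\<partial> + \<lambda>\<^sub>1 + \<dots> + \<lambda>\<^sub>k\<close> on coefficients, for a derivation \<open>d = \<partial>\<close> of the values.\<close>

fun dhat :: "('w \<Rightarrow> 'w) \<Rightarrow> (('i \<times> nat) list \<Rightarrow> 'w::comm_ring_1) \<Rightarrow> ('i \<times> nat) list \<Rightarrow> 'w" where
  "dhat d A [] = d (A [])"
| "dhat d A (x # xs) = dhat d (contr x A) xs + (if snd x = 0 then 0 else A ((fst x, snd x - 1) # xs))"

text \<open>Adjacent swaps suffice: they generate all permutations, see \<open>alt_permute\<close>,
  and they can be checked by induction on the prefix of the word.\<close>

definition alt :: "('x list \<Rightarrow> 'w::ab_group_add) \<Rightarrow> bool" where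
  "alt A \<longleftrightarrow> (\<forall>xs x y ys. A (xs @ x # y # ys) = - A (xs @ y # x # ys))"

definition homog :: "nat \<Rightarrow> ('x list \<Rightarrow> 'w::zero) \<Rightarrow> bool" where
  "homog k A \<longleftrightarrow> (\<forall>xs. length xs \<noteq> k \<longrightarrow> A xs = 0)"

text \<open>Finiteness is imposed on the letters. For homogeneous forms this bounds the words too,
  by \<open>finite_homog_support\<close>, and letters are easier to follow through the operators
  below.\<close>

definition fsupp :: "('x list \<Rightarrow> 'w::zero) \<Rightarrow> bool" where
  "fsupp A \<longleftrightarrow> (\<exists>X. finite X \<and> (\<forall>xs. A xs \<noteq> 0 \<longrightarrow> set xs \<subseteq> X))"

text \<open>The common denominator of the maps in use: derivations, coefficient extraction,
  multiplication by a scalar, and operators on whole spaces of forms. They are linear over different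
  rings, if at all.\<close>

definition additive_map :: "('w::ab_group_add \<Rightarrow> 'u::ab_group_add) \<Rightarrow> bool" where
  "additive_map f \<longleftrightarrow> (\<forall>a b. f (a + b) = f a + f b)"

definition deriv_map :: "('w::comm_ring_1 \<Rightarrow> 'w) \<Rightarrow> bool" where
  "deriv_map f \<longleftrightarrow> additive_map f \<and> (\<forall>a b. f (a * b) = f a * b + a * f b)"

lemma additive_map_add: "additive_map f \<Longrightarrow> f (a + b) = f a + f b"
  by (simp add: additive_map_def)

lemma additive_map_0: "additive_map f \<Longrightarrow> f 0 = 0"
  using additive_map_add[of f 0 0] by simp

lemma additive_map_minus: "additive_map f \<Longrightarrow> f (- a) = - f a"
  using additive_map_add[of f a "- a"] additive_map_0[of f] by (simp add: eq_neg_iff_add_eq_0 add.commute)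

lemma additive_map_diff: "additive_map f \<Longrightarrow> f (a - b) = f a - f b"
  using additive_map_add[of f a "- b"] additive_map_minus[of f b] by simp

lemma additive_map_sum: "additive_map f \<Longrightarrow> f (sum g I) = (\<Sum>i\<in>I. f (g i))"
  by (induction I rule: infinite_finite_induct) (auto simp: additive_map_0 additive_map_add)

lemmas additive_simps = additive_map_add additive_map_0 additive_map_minus additive_map_diff

lemma deriv_additive: "deriv_map f \<Longrightarrow> additive_map f"
  by (simp add: deriv_map_def)

lemma deriv_mult: "deriv_map f \<Longrightarrow> f (a * b) = f a * b + a * f b"
  by (simp add: deriv_map_def)

lemma additive_sign: "additive_map f \<Longrightarrow> f ((-1) ^ n * a) = (-1) ^ n * (f a :: 'w::comm_ring_1)"
  for a :: "'v::comm_ring_1"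
  by (cases "even n") (auto simp: additive_map_minus)

lemma deriv_1: "deriv_map f \<Longrightarrow> f 1 = 0"
  using deriv_mult[of f 1 1] by simp

lemma sum_fun_apply: "(\<Sum>i\<in>I. f i) x = (\<Sum>i\<in>I. f i x)"
  for f :: "'a \<Rightarrow> 'b \<Rightarrow> 'c::comm_monoid_add"
  by (induction I rule: infinite_finite_induct) auto

lemma contr_apply: "contr x A xs = A (x # xs)" by (simp add: contr_def)

lemma contr_add [simp]: "contr x (A + B) = contr x A + contr x B"
  and contr_0 [simp]: "contr x 0 = 0"
  and contr_minus [simp]: "contr x (- C) = - contr x C"
  and contr_diff [simp]: "contr x (C - E) = contr x C - contr x E"
  and contr_comp [simp]: "contr x (f \<circ> F) = f \<circ> contr x F"
  by (auto simp: contr_def fun_eq_iff)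

lemma signed_add [simp]: "signed (A + B) = signed A + signed B"
  and signed_0 [simp]: "signed 0 = 0"
  and signed_minus [simp]: "signed (- A) = - signed A"
  and signed_diff [simp]: "signed (A - B) = signed A - signed B"
  by (auto simp: signed_def fun_eq_iff algebra_simps)

lemma signed_signed [simp]: "signed (signed A) = A"
  by (auto simp: signed_def fun_eq_iff)

lemma contr_signed [simp]: "contr x (signed A) = - signed (contr x A)"
  by (auto simp: contr_def signed_def fun_eq_iff)

lemma signed_Nil [simp]: "signed A [] = A []"
  and signed_Cons [simp]: "signed A (x # xs) = - signed (contr x A) xs"
  by (simp_all add: signed_def contr_def)

lemma additive_signed: "additive_map f \<Longrightarrow> f (signed A xs) = signed (f \<circ> A) xs"
  by (simp add: signed_def additive_sign)

lemma signed_comp: "additive_map f \<Longrightarrow> f \<circ> signed A = signed (f \<circ> A)"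
  by (auto simp: signed_def fun_eq_iff additive_sign)

lemma comp_add_form: "additive_map f \<Longrightarrow> f \<circ> (A + B) = (f \<circ> A) + (f \<circ> B)"
  and comp_0_form: "additive_map f \<Longrightarrow> f \<circ> 0 = (0 :: 'x \<Rightarrow> _)"
  and comp_minus_form: "additive_map f \<Longrightarrow> f \<circ> (- A) = - (f \<circ> A)"
  and comp_diff_form: "additive_map f \<Longrightarrow> f \<circ> (A - B) = (f \<circ> A) - (f \<circ> B)"
  by (auto simp: fun_eq_iff additive_simps)

lemmas comp_forms = comp_add_form comp_0_form comp_minus_form comp_diff_form

lemma contr_dl [simp]: "contr x (dl D A) = (D x \<circ> A) - dl D (contr x A)"
  by (simp add: fun_eq_iff contr_apply)

lemma contr_wedge [simp]:
  "contr x (wedge A B) = wedge (contr x A) B + wedge (signed A) (contr x B)"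
  by (simp add: fun_eq_iff contr_apply)

lemma contr_dhat: "contr x (dhat d A) =
    dhat d (contr x A) + (if snd x = 0 then 0 else contr (fst x, snd x - 1) A)"
  by (simp add: fun_eq_iff contr_apply)

section \<open>Commutation rules for the differential, the exterior product and \<partial>\<close>

lemma dl_add [simp]: "(\<And>x. additive_map (D x)) \<Longrightarrow> dl D (A + B) = dl D A + dl D B"
proof
  fix xs assume "\<And>x. additive_map (D x)"
  then show "dl D (A + B) xs = (dl D A + dl D B) xs"
    by (induction xs arbitrary: A B) (auto simp: additive_simps)
qed

lemma additive_dl: "(\<And>x. additive_map (D x)) \<Longrightarrow> additive_map (dl D)"
  by (simp add: additive_map_def[of "dl D"])

lemma wedge_add_left: "wedge (A + B) C = wedge A C + wedge B C"
proof
  fix xs show "wedge (A + B) C xs = (wedge A C + wedge B C) xs"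
    by (induction xs arbitrary: A B C) (auto simp: algebra_simps)
qed

lemma wedge_add_right: "wedge C (A + B) = wedge C A + wedge C B"
proof
  fix xs show "wedge C (A + B) xs = (wedge C A + wedge C B) xs"
    by (induction xs arbitrary: A B C) (auto simp: algebra_simps)
qed

lemma additive_wedge_left: "additive_map (\<lambda>A. wedge A C)"
  and additive_wedge_right: "additive_map (wedge C)"
  by (simp_all add: additive_map_def wedge_add_left wedge_add_right)

lemmas wedge_left_simps = additive_simps[OF additive_wedge_left]
lemmas wedge_right_simps = additive_simps[OF additive_wedge_right]
lemmas wedge_lin = wedge_left_simps wedge_right_simps

lemma dhat_add: "additive_map d \<Longrightarrow> dhat d (A + B) = dhat d A + dhat d B"
proof
  fix xs assume "additive_map d"
  then show "dhat d (A + B) xs = (dhat d A + dhat d B) xs"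
    by (induction xs arbitrary: A B) (auto simp: additive_simps)
qed

lemma additive_dhat: "additive_map d \<Longrightarrow> additive_map (dhat d)"
  by (simp add: additive_map_def[of "dhat d"] dhat_add)

lemmas dl_lin = additive_simps[OF additive_dl]
lemmas dhat_lin = additive_simps[OF additive_dhat]

lemma dl_signed: "(\<And>x. additive_map (D x)) \<Longrightarrow> dl D (signed A) = - signed (dl D A)"
proof
  fix xs assume a: "\<And>x. additive_map (D x)"
  note [simp] = dl_lin a
  show "dl D (signed A) xs = (- signed (dl D A)) xs"
    by (induction xs arbitrary: A)
      (auto simp: additive_signed[OF a])
qed

lemma dhat_signed: "additive_map d \<Longrightarrow> dhat d (signed A) = signed (dhat d A)"
proof
  fix xs assume a: "additive_map d"
  note [simp] = dhat_lin a
  show "dhat d (signed A) xs = (signed (dhat d A)) xs"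
    by (induction xs arbitrary: A) (auto simp: contr_dhat contr_apply)
qed

lemma deriv_wedge:
  assumes "deriv_map f"
  shows "f \<circ> wedge A B = wedge (f \<circ> A) B + wedge A (f \<circ> B)"
proof
  note a = deriv_additive[OF assms]
  fix xs show "(f \<circ> wedge A B) xs = (wedge (f \<circ> A) B + wedge A (f \<circ> B)) xs"
  proof (induction xs arbitrary: A B)
    case Nil then show ?case by (simp add: deriv_mult[OF assms])
  next
    case (Cons x xs)
    have "(f \<circ> wedge A B) xs = (wedge (f \<circ> A) B + wedge A (f \<circ> B)) xs" for A B
      by (rule Cons.IH)
    then show "(f \<circ> wedge A B) (x # xs) = (wedge (f \<circ> A) B + wedge A (f \<circ> B)) (x # xs)"
      by (simp add: additive_map_add[OF a] signed_comp[OF a])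
  qed
qed

text \<open>Graded Leibniz rule. After contraction with a letter, the terms in which the letter
  falls into the second factor match because the differential anticommutes with the parity
  involution.\<close>

lemma dl_wedge:
  assumes D: "\<And>x. deriv_map (D x)"
  shows "dl D (wedge A B) = wedge (dl D A) B + wedge (signed A) (dl D B)"
proof
  have a: "additive_map (D x)" for x using D deriv_additive by blast
  fix xs show "dl D (wedge A B) xs = (wedge (dl D A) B + wedge (signed A) (dl D B)) xs"
  proof (induction xs arbitrary: A B)
    case Nil then show ?case by simp
  next
    case (Cons x xs)
    have IH: "dl D (wedge A B) xs = (wedge (dl D A) B + wedge (signed A) (dl D B)) xs" for A B
      by (rule Cons.IH)
    have "D x (wedge A B xs) = (wedge (D x \<circ> A) B + wedge A (D x \<circ> B)) xs"
      using deriv_wedge[OF D, of x A B] by (simp add: fun_eq_iff)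
    then show ?case
      by (simp add: dl_add[OF a] IH dl_signed[OF a] wedge_lin)
  qed
qed

lemma dhat_wedge:
  assumes "deriv_map d"
  shows "dhat d (wedge A B) = wedge (dhat d A) B + wedge A (dhat d B)"
proof
  note a = deriv_additive[OF assms]
  fix xs show "dhat d (wedge A B) xs = (wedge (dhat d A) B + wedge A (dhat d B)) xs"
  proof (induction xs arbitrary: A B)
    case Nil then show ?case by (simp add: deriv_mult[OF assms])
  next
    case (Cons x xs)
    have "dhat d (wedge A B) xs = (wedge (dhat d A) B + wedge A (dhat d B)) xs" for A B
      by (rule Cons.IH)
    then show ?case
      by (simp add: dhat_add[OF a] contr_dhat dhat_signed[OF a] wedge_lin contr_apply[of _ "wedge A B", symmetric])
  qed
qed

text \<open>Since the derivations commute with each other, each of them commutes with the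
  differential. Contraction therefore commutes with the square of the differential, and induction
  ends at the empty word.\<close>

lemma dl_dl:
  assumes a: "\<And>x. additive_map (D x)" and c: "\<And>x y a. D x (D y a) = D y (D x a)"
  shows "dl D (dl D A) = 0"
proof
  have cc: "dl D (D x \<circ> A) xs = D x (dl D A xs)" for x A xs
    by (induction xs arbitrary: A) (auto simp: additive_simps[OF a] c[of x])
  fix xs show "dl D (dl D A) xs = 0 xs"
    by (induction xs arbitrary: A) (auto simp: dl_lin a cc)
qed

lemma wedge_0 [simp]: "wedge 0 B = 0" "wedge A 0 = 0"
  by (simp_all add: wedge_lin)

lemma wedge_commute:
  assumes "homog p A" "homog q B"
  shows "wedge A B xs = (-1) ^ (p * q) * wedge B A xs"
  using assms
proof (induction xs arbitrary: A B p q)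
  case Nil
  then show ?case by (cases p; cases q) (auto simp: homog_def mult.commute)
next
  case (Cons x xs)
  have hc: "homog p A \<Longrightarrow> p > 0 \<Longrightarrow> homog (p - 1) (contr x A)" "homog 0 A \<Longrightarrow> contr x A = 0"
    for p and A :: "'a list \<Rightarrow> 'b"
    by (auto simp: homog_def contr_def fun_eq_iff)
  \<comment> \<open>On a homogeneous form the parity involution is the scalar (-1)^p.\<close>
  have hs: "wedge (signed A) C xs = (-1) ^ p * wedge A C xs" if "homog p A" for p and A C :: "'a list \<Rightarrow> 'b"
  proof -
    have "signed A = (if even p then A else - A)"
    proof (rule ext)
      fix ys show "signed A ys = (if even p then A else - A) ys"
        using that by (cases "length ys = p") (auto simp: signed_def homog_def)
    qed
    then show ?thesis by (auto simp: wedge_lin)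
  qed
  \<comment> \<open>The exponent (p - 1) q is written as p q + q, which has the same parity and
    avoids truncated subtraction.\<close>
  have 1: "wedge (contr x A) B xs = (-1) ^ (p * q + q) * wedge B (contr x A) xs"
    using Cons.IH[of "p - 1" "contr x A" q B] hc(1)[of p A] hc(2)[of A] Cons.prems
    by (cases p; cases "even q") (auto simp: power_add)
  have 2: "wedge A (contr x B) xs = (-1) ^ (p * q + p) * wedge (contr x B) A xs"
    using Cons.IH[of p A "q - 1" "contr x B"] hc(1)[of q B] hc(2)[of B] Cons.prems
    by (cases q; cases "even p") (auto simp: power_add)
  show ?case
    by (cases "even p"; cases "even q")
      (simp_all add: hs[OF Cons.prems(1)] hs[OF Cons.prems(2)] 1 2 power_add)
qed

subsection \<open>Alternating forms\<close>

text \<open>Separates the swap of the first two letters from the swaps further right, which are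
  swaps in a contraction; this is the shape that recursion on words needs.\<close>

lemma alt_Cons: "alt A \<longleftrightarrow> (\<forall>x. alt (contr x A)) \<and> (\<forall>x y ys. A (x # y # ys) = - A (y # x # ys))"
proof (intro iffI conjI allI)
  assume a: "alt A"
  show "alt (contr x A)" for x unfolding alt_def contr_def
  proof (intro allI)
    fix xs y z ys show "A (x # xs @ y # z # ys) = - A (x # xs @ z # y # ys)"
      using a unfolding alt_def by (metis append_Cons)
  qed
  show "A (x # y # ys) = - A (y # x # ys)" for x y ys
    using a unfolding alt_def by (metis append_Nil)
next
  assume a: "(\<forall>x. alt (contr x A)) \<and> (\<forall>x y ys. A (x # y # ys) = - A (y # x # ys))"
  show "alt A" unfolding alt_def
  proof (intro allI)
    fix xs x y ys show "A (xs @ x # y # ys) = - A (xs @ y # x # ys)"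
    proof (cases xs)
      case Nil
      show ?thesis using a unfolding Nil append_Nil by blast
    next
      case (Cons z zs)
      have "contr z A (zs @ x # y # ys) = - contr z A (zs @ y # x # ys)" using a unfolding alt_def by blast
      then show ?thesis by (simp add: Cons contr_def)
    qed
  qed
qed

lemma altD: "alt A \<Longrightarrow> A (xs @ x # y # ys) = - A (xs @ y # x # ys)"
  unfolding alt_def by blast

lemma altI: "(\<And>xs x y ys. A (xs @ x # y # ys) = - A (xs @ y # x # ys)) \<Longrightarrow> alt A"
  unfolding alt_def by blast

lemma alt_contr: "alt A \<Longrightarrow> alt (contr x A)" using alt_Cons[of A] by blast

lemma alt_head: "alt A \<Longrightarrow> A (x # y # ys) = - A (y # x # ys)" using alt_Cons[of A] by blast

lemma alt_swap: "alt A \<Longrightarrow> contr y (contr x A) = - contr x (contr y A)"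
  unfolding fun_eq_iff contr_def by (simp add: alt_head[of A x y])

lemma alt_add:
  assumes "alt A" "alt B" shows "alt (A + B)"
proof (rule altI)
  show "(A + B) (xs @ x # y # ys) = - (A + B) (xs @ y # x # ys)" for xs x y ys
    using altD[OF assms(1), of xs x y ys] altD[OF assms(2), of xs x y ys] by simp
qed

lemma alt_minus:
  assumes "alt A" shows "alt (- A)"
proof (rule altI)
  show "(- A) (xs @ x # y # ys) = - (- A) (xs @ y # x # ys)" for xs x y ys
    using altD[OF assms(1), of xs x y ys] by simp
qed

lemma alt_diff: "alt A \<Longrightarrow> alt B \<Longrightarrow> alt (A - B)"
  using alt_add[of A "- B"] alt_minus[of B] by simp

lemma alt_0: "alt 0"
  by (simp add: alt_def)

lemma alt_comp:
  assumes "additive_map f" "alt A" shows "alt (f \<circ> A)"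
proof (rule altI)
  show "(f \<circ> A) (xs @ x # y # ys) = - (f \<circ> A) (xs @ y # x # ys)" for xs x y ys
    using altD[OF assms(2), of xs x y ys] by (simp add: additive_map_minus[OF assms(1)])
qed

lemma alt_signed: "alt A \<Longrightarrow> alt (signed A)"
proof (rule altI)
  assume a: "alt A"
  show "signed A (xs @ x # y # ys) = - signed A (xs @ y # x # ys)" for xs x y ys
    using altD[OF a, of xs x y ys] by (simp add: signed_def)
qed

lemma alt_sum: "(\<And>i. i \<in> I \<Longrightarrow> alt (f i)) \<Longrightarrow> alt (\<Sum>i\<in>I. f i)"
  by (induction I rule: infinite_finite_induct) (auto simp: alt_0 alt_add)

lemma alt_dl:
  assumes a: "\<And>x. additive_map (D x)"
  shows "alt A \<Longrightarrow> alt (dl D A)"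
proof -
  have "alt A \<Longrightarrow> dl D A (xs @ x # y # ys) = - dl D A (xs @ y # x # ys)" for xs x y ys
  proof (induction xs arbitrary: A)
    case Nil
    have "dl D (contr y (contr x A)) ys = - dl D (contr x (contr y A)) ys"
      by (simp only: alt_swap[OF Nil, of y x] dl_lin(3)[where D=D, OF a] uminus_apply)
    then show ?case by (simp add: contr_apply)
  next
    case (Cons z xs)
    have "A (xs @ x # y # ys) = - A (xs @ y # x # ys)" by (rule altD[OF Cons.prems])
    then show ?case using Cons.IH[OF alt_contr[OF Cons.prems]]
      by (simp add: additive_simps[OF a])
  qed
  then show "alt A \<Longrightarrow> alt (dl D A)" by (intro altI)
qed

lemma alt_wedge: "alt A \<Longrightarrow> alt B \<Longrightarrow> alt (wedge A B)"
proof -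
  have "alt A \<Longrightarrow> alt B \<Longrightarrow> wedge A B (xs @ x # y # ys) = - wedge A B (xs @ y # x # ys)" for xs x y ys
  proof (induction xs arbitrary: A B)
    case Nil
    then show ?case
      using alt_swap[OF Nil(1), of y x] alt_swap[OF Nil(2), of y x] by (simp add: wedge_lin)
  next
    case (Cons z xs)
    then show ?case by (simp add: alt_contr alt_signed)
  qed
  then show "alt A \<Longrightarrow> alt B \<Longrightarrow> alt (wedge A B)" by (intro altI)
qed

lemma alt_dhat:
  assumes a: "additive_map d"
  shows "alt A \<Longrightarrow> alt (dhat d A)"
proof -
  have "alt A \<Longrightarrow> dhat d A (xs @ x # y # ys) = - dhat d A (xs @ y # x # ys)" for xs x y ys
  proof (induction xs arbitrary: A)
    case Nil
    have s: "A (u # v # ys) = - A (v # u # ys)" for u v by (rule alt_head[OF Nil])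
    have "dhat d (contr y (contr x A)) ys = - dhat d (contr x (contr y A)) ys"
      by (simp only: alt_swap[OF Nil, of y x] dhat_lin(3)[OF a] uminus_apply)
    then show ?case
      by (simp add: contr_apply s[of x "(fst y, snd y - Suc 0)"] s[of y "(fst x, snd x - Suc 0)"])
  next
    case (Cons z xs)
    have "A (u # xs @ x # y # ys) = - A (u # xs @ y # x # ys)" for u
      using altD[OF Cons.prems, of "u # xs" x y ys] by simp
    then show ?case using Cons.IH[OF alt_contr[OF Cons.prems]] by simp
  qed
  then show "alt A \<Longrightarrow> alt (dhat d A)" by (intro altI)
qed

subsection \<open>Degrees and supports\<close>

lemma homog_contr: "homog k A \<Longrightarrow> homog (k - 1) (contr x A)"
  by (auto simp: homog_def contr_def)

lemma
  fixes A B :: "'x list \<Rightarrow> 'a::ab_group_add"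
  shows homog_add: "homog k A \<Longrightarrow> homog k B \<Longrightarrow> homog k (A + B)"
    and homog_diff: "homog k A \<Longrightarrow> homog k B \<Longrightarrow> homog k (A - B)"
    and homog_minus: "homog k A \<Longrightarrow> homog k (- A)"
  by (auto simp: homog_def)

lemma homog_0: "homog k 0"
  by (simp add: homog_def)

lemma homog_sum: "(\<And>i. i \<in> I \<Longrightarrow> homog k (f i)) \<Longrightarrow> homog k (\<Sum>i\<in>I. f i)"
  by (auto simp: homog_def sum_fun_apply)

lemma homog_comp: "f 0 = 0 \<Longrightarrow> homog k A \<Longrightarrow> homog k (f \<circ> A)"
  by (simp add: homog_def)

lemma homog_signed: "homog k A \<Longrightarrow> homog k (signed A)"
  by (simp add: homog_def signed_def)

lemma homog_dl:
  assumes a: "\<And>x. additive_map (D x)"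
  shows "homog k A \<Longrightarrow> homog (Suc k) (dl D A)"
proof -
  have "homog k A \<Longrightarrow> length xs \<noteq> Suc k \<Longrightarrow> dl D A xs = 0" for xs
  proof (induction xs arbitrary: A k)
    case Nil then show ?case by simp
  next
    case (Cons x xs)
    have "dl D (contr x A) xs = 0"
    proof (cases k)
      case 0
      then have "contr x A = 0" using Cons.prems by (auto simp: homog_def contr_def fun_eq_iff)
      then show ?thesis by (simp add: dl_lin a)
    next
      case (Suc j)
      then show ?thesis using Cons.IH[OF homog_contr[OF Cons.prems(1)]] Cons.prems(2) by simp
    qed
    then show ?case using Cons.prems by (simp add: homog_def additive_simps[OF a])
  qed
  then show "homog k A \<Longrightarrow> homog (Suc k) (dl D A)" by (auto simp: homog_def)
qed

lemma homog_wedge: "homog p A \<Longrightarrow> homog q B \<Longrightarrow> homog (p + q) (wedge A B)"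
proof -
  have "homog p A \<Longrightarrow> homog q B \<Longrightarrow> length xs \<noteq> p + q \<Longrightarrow> wedge A B xs = 0" for xs
  proof (induction xs arbitrary: A B p q)
    case Nil then show ?case by (auto simp: homog_def)
  next
    case (Cons x xs)
    have z: "contr x C = 0" if "homog 0 C" for C :: "'a list \<Rightarrow> 'b"
      using that by (auto simp: homog_def contr_def fun_eq_iff)
    have "wedge (contr x A) B xs = 0"
    proof (cases p)
      case 0 then show ?thesis using z Cons.prems by simp
    next
      case (Suc j) then show ?thesis
        using Cons.IH[OF homog_contr[OF Cons.prems(1)] Cons.prems(2)] Cons.prems(3) by simp
    qed
    moreover have "wedge (signed A) (contr x B) xs = 0"
    proof (cases q)
      case 0 then show ?thesis using z Cons.prems by simp
    next
      case (Suc j) then show ?thesis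
        using Cons.IH[OF homog_signed[OF Cons.prems(1)] homog_contr[OF Cons.prems(2)]] Cons.prems(3) by simp
    qed
    ultimately show ?case by simp
  qed
  then show "homog p A \<Longrightarrow> homog q B \<Longrightarrow> homog (p + q) (wedge A B)" by (auto simp: homog_def)
qed

lemma homog_dhat:
  assumes a: "additive_map d"
  shows "homog k A \<Longrightarrow> homog k (dhat d A)"
proof -
  have "homog k A \<Longrightarrow> length xs \<noteq> k \<Longrightarrow> dhat d A xs = 0" for xs
  proof (induction xs arbitrary: A k)
    case Nil then show ?case by (simp add: homog_def additive_simps[OF a])
  next
    case (Cons x xs)
    have "dhat d (contr x A) xs = 0"
    proof (cases k)
      case 0
      then have "contr x A = 0" using Cons.prems by (auto simp: homog_def contr_def fun_eq_iff)
      then show ?thesis by (simp add: dhat_lin a)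
    next
      case (Suc j)
      then show ?thesis using Cons.IH[OF homog_contr[OF Cons.prems(1)]] Cons.prems(2) by simp
    qed
    then show ?case using Cons.prems by (simp add: homog_def)
  qed
  then show "homog k A \<Longrightarrow> homog k (dhat d A)" by (auto simp: homog_def)
qed

lemma fsuppE:
  assumes "fsupp A"
  obtains X where "finite X" "\<And>xs. \<not> set xs \<subseteq> X \<Longrightarrow> A xs = 0"
  using assms unfolding fsupp_def by blast

lemma fsuppI: "finite X \<Longrightarrow> (\<And>xs. \<not> set xs \<subseteq> X \<Longrightarrow> A xs = 0) \<Longrightarrow> fsupp A"
  unfolding fsupp_def by blast

lemma fsupp_0: "fsupp 0" by (auto simp: fsupp_def)

lemma fsupp_add: "fsupp A \<Longrightarrow> fsupp B \<Longrightarrow> fsupp (A + B)" for A :: "_ \<Rightarrow> 'a::ab_group_add"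
proof -
  assume f: "fsupp A" "fsupp B"
  obtain X Y where "finite X" "finite Y" "\<And>xs. \<not> set xs \<subseteq> X \<Longrightarrow> A xs = 0" "\<And>xs. \<not> set xs \<subseteq> Y \<Longrightarrow> B xs = 0"
    using fsuppE[OF f(1)] fsuppE[OF f(2)] by metis
  then show ?thesis by (intro fsuppI[of "X \<union> Y"]) (auto, metis (no_types, lifting) add.right_neutral subsetD)
qed

lemma fsupp_minus: "fsupp A \<Longrightarrow> fsupp (- A)" for A :: "_ \<Rightarrow> 'a::ab_group_add"
  by (auto simp: fsupp_def)

lemma fsupp_diff: "fsupp A \<Longrightarrow> fsupp B \<Longrightarrow> fsupp (A - B)" for A :: "_ \<Rightarrow> 'a::ab_group_add"
  using fsupp_add[of A "- B"] fsupp_minus[of B] by simp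

lemma fsupp_sum: "(\<And>i. i \<in> I \<Longrightarrow> fsupp (f i)) \<Longrightarrow> fsupp (\<Sum>i\<in>I. f i)"
  for f :: "'i \<Rightarrow> _ \<Rightarrow> 'a::ab_group_add"
  by (induction I rule: infinite_finite_induct) (auto simp: fsupp_0 fsupp_add)

lemma fsupp_comp: "f 0 = 0 \<Longrightarrow> fsupp A \<Longrightarrow> fsupp (f \<circ> A)"
  by (auto simp: fsupp_def) metis

lemma fsupp_contr: "fsupp A \<Longrightarrow> fsupp (contr x A)"
  by (auto simp: fsupp_def contr_def) (meson insert_subset list.simps(15) set_subset_Cons subset_trans)

lemma fsupp_signed: "fsupp A \<Longrightarrow> fsupp (signed A)"
  by (auto simp: fsupp_def signed_def) (metis mult_zero_right)

lemma fsupp_wedge: "fsupp A \<Longrightarrow> fsupp B \<Longrightarrow> fsupp (wedge A B)"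
proof -
  have w: "(\<And>xs. \<not> set xs \<subseteq> X \<Longrightarrow> A xs = 0) \<Longrightarrow> (\<And>xs. \<not> set xs \<subseteq> X \<Longrightarrow> B xs = 0) \<Longrightarrow>
      \<not> set xs \<subseteq> X \<Longrightarrow> wedge A B xs = 0" for X xs
  proof (induction xs arbitrary: A B)
    case Nil then show ?case by simp
  next
    case (Cons x xs)
    show ?case
    proof (cases "x \<in> X")
      case True
      then show ?thesis using Cons by (simp add: contr_apply signed_def)
    next
      case False
      then have "contr x A = 0" "contr x B = 0" using Cons.prems by (auto simp: contr_def fun_eq_iff)
      then show ?thesis by simp
    qed
  qed
  assume f: "fsupp A" "fsupp B"
  obtain X Y where XY: "finite X" "finite Y" "\<And>xs. \<not> set xs \<subseteq> X \<Longrightarrow> A xs = 0" "\<And>xs. \<not> set xs \<subseteq> Y \<Longrightarrow> B xs = 0"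
    using fsuppE[OF f(1)] fsuppE[OF f(2)] by metis
  show ?thesis using XY by (intro fsuppI[of "X \<union> Y"] w) (auto simp: le_supI1 le_supI2)
qed

text \<open>Multiplication by the sum of the variables raises one exponent by one, so the letters of
  X together with their successors suffice.\<close>

lemma fsupp_dhat: "additive_map d \<Longrightarrow> fsupp A \<Longrightarrow> fsupp (dhat d A)"
proof -
  assume a: "additive_map d"
  have w: "(\<And>xs. \<not> set xs \<subseteq> X \<Longrightarrow> A xs = 0) \<Longrightarrow> (\<And>i m. (i, m) \<in> X \<Longrightarrow> (i, Suc m) \<in> Y) \<Longrightarrow>
      X \<subseteq> Y \<Longrightarrow> \<not> set xs \<subseteq> Y \<Longrightarrow> dhat d A xs = 0" for X Y xs
  proof (induction xs arbitrary: A)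
    case Nil then show ?case by simp
  next
    case (Cons x xs)
    have 1: "A ((fst x, snd x - 1) # xs) = 0" if "snd x \<noteq> 0"
    proof (rule ccontr)
      assume "A ((fst x, snd x - 1) # xs) \<noteq> 0"
      then have "set ((fst x, snd x - 1) # xs) \<subseteq> X" using Cons.prems(1) by blast
      then show False using Cons.prems(2)[of "fst x" "snd x - 1"] Cons.prems(3,4) that by auto
    qed
    have 2: "dhat d (contr x A) xs = 0"
    proof (cases "x \<in> X")
      case True
      show ?thesis
        by (rule Cons.IH) (use Cons.prems True in \<open>auto simp: contr_apply\<close>)
    next
      case False
      then have "contr x A = 0" using Cons.prems by (auto simp: contr_def fun_eq_iff)
      then show ?thesis by (simp add: dhat_lin a)
    qed
    show ?case using 1 2 by simp
  qed
  assume f: "fsupp A"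
  obtain X where X: "finite X" "\<And>xs. \<not> set xs \<subseteq> X \<Longrightarrow> A xs = 0"
    using fsuppE[OF f] by metis
  let ?Y = "X \<union> (\<lambda>(i, m). (i, Suc m)) ` X"
  have "dhat d A xs = 0" if "\<not> set xs \<subseteq> ?Y" for xs
    by (rule w[of X ?Y]) (use X(2) that in \<open>auto simp: image_iff\<close>)
  then show ?thesis using X(1) by (intro fsuppI[of ?Y]) auto
qed

lemma finite_homog_support:
  assumes "homog k A" "fsupp A"
  shows "finite {xs. A xs \<noteq> 0}"
proof -
  obtain X where X: "finite X" "\<And>xs. \<not> set xs \<subseteq> X \<Longrightarrow> A xs = 0" using fsuppE[OF assms(2)] by metis
  have "{xs. A xs \<noteq> 0} \<subseteq> {xs. set xs \<subseteq> X \<and> length xs = k}"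
    using X assms(1) by (auto simp: homog_def)
  then show ?thesis using finite_lists_length_eq[OF X(1)] finite_subset by blast
qed

text \<open>Homogeneity makes the set of nonzero values finite; hence only finitely many derivations
  act nontrivially on one of them.\<close>

lemma fsupp_dl:
  assumes a: "\<And>x. additive_map (D x)" and h: "homog k A" and f: "fsupp A"
    and D: "\<And>a. finite {x. D x a \<noteq> 0}"
  shows "fsupp (dl D A)"
proof -
  obtain X where X: "finite X" "\<And>xs. \<not> set xs \<subseteq> X \<Longrightarrow> A xs = 0" using fsuppE[OF f] by metis
  let ?Y = "\<Union>a\<in>{xs. A xs \<noteq> 0}. {x. D x (A a) \<noteq> 0}"
  have w: "(\<And>xs. \<not> set xs \<subseteq> X \<Longrightarrow> A xs = 0) \<Longrightarrow> (\<And>x xs. x \<notin> Y \<Longrightarrow> D x (A xs) = 0) \<Longrightarrow>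
     \<not> set xs \<subseteq> X \<union> Y \<Longrightarrow> dl D A xs = 0" for xs A X Y
  proof (induction xs arbitrary: A)
    case Nil then show ?case by simp
  next
    case (Cons x xs)
    have 1: "dl D (contr x A) xs = 0"
    proof (cases "x \<in> X")
      case True
      show ?thesis using Cons.prems True
        by (intro Cons.IH) (auto simp: contr_apply)
    next
      case False
      then have "contr x A = 0" using Cons.prems by (auto simp: contr_def fun_eq_iff)
      then show ?thesis by (simp add: dl_lin a)
    qed
    have 2: "D x (A xs) = 0"
    proof (cases "set xs \<subseteq> X")
      case True
      show ?thesis
      proof (cases "x \<in> Y")
        case True
        then show ?thesis using \<open>set xs \<subseteq> X\<close> Cons.prems(3) by auto
      qed (use Cons.prems(2) in auto)
    next
      case False
      then show ?thesis using Cons.prems(1) by (simp add: additive_map_0[OF a])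
    qed
    show ?case using 1 2 by simp
  qed
  have "D x (A xs) = 0" if "x \<notin> ?Y" for x xs
    using that additive_map_0[OF a, of x] by (cases "A xs = 0") auto
  then have "\<not> set xs \<subseteq> X \<union> ?Y \<Longrightarrow> dl D A xs = 0" for xs
    using w[of X A ?Y] X(2) by blast
  then show ?thesis
    using X(1) D finite_homog_support[OF h f] by (intro fsuppI[of "X \<union> ?Y"]) auto
qed

lemma alt_move:
  assumes "alt A" shows "A (as @ x # bs) = (-1) ^ length as * (A (x # as @ bs) :: 'w::comm_ring_1)"
  using assms
proof (induction as arbitrary: A)
  case Nil then show ?case by simp
next
  case (Cons a as)
  have "A (a # as @ x # bs) = (-1) ^ length as * A (a # x # as @ bs)"
    using Cons.IH[OF alt_contr[OF Cons.prems, of a]] by (simp add: contr_apply)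
  also have "A (a # x # as @ bs) = - A (x # a # as @ bs)"
    by (rule alt_head[OF Cons.prems])
  finally show ?case by simp
qed

lemma alt_swap_gen:
  assumes "alt A"
  shows "A (as @ x # bs @ y # cs) = - (A (as @ y # bs @ x # cs) :: 'w::comm_ring_1)"
proof -
  have "B (x # bs @ y # cs) = - B (y # bs @ x # cs)" if "alt B" for B :: "'a list \<Rightarrow> 'w"
  proof -
    have "B (x # bs @ y # cs) = (-1) ^ length bs * B (x # y # bs @ cs)"
      using alt_move[OF alt_contr[OF that, of x], of bs y cs] by (simp add: contr_apply)
    moreover have "B (y # bs @ x # cs) = (-1) ^ length bs * B (y # x # bs @ cs)"
      using alt_move[OF alt_contr[OF that, of y], of bs x cs] by (simp add: contr_apply)
    moreover have "B (x # y # bs @ cs) = - B (y # x # bs @ cs)"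
      by (rule alt_head[OF that])
    ultimately show ?thesis by simp
  qed
  note * = this
  show ?thesis using assms
  proof (induction as arbitrary: A)
    case Nil then show ?case using * by simp
  next
    case (Cons a as)
    then show ?case using Cons.IH[OF alt_contr[OF Cons.prems, of a]] by (simp add: contr_apply)
  qed
qed

text \<open>Rearranging a word changes the value by a sign at most. Stating only the vanishing
  avoids naming a permutation.\<close>

lemma alt_mset_zero:
  assumes "alt A" "mset xs = mset ys" "A ys = 0"
  shows "A xs = (0 :: 'w::comm_ring_1)"
  using assms
proof (induction xs arbitrary: A ys)
  case Nil then show ?case by simp
next
  case (Cons x xs)
  have "x \<in> set ys" using Cons.prems(2) by (metis list.set_intros(1) set_mset_mset)
  then obtain as bs where ys: "ys = as @ x # bs" by (auto simp: in_set_conv_decomp)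
  have "A (as @ x # bs) = (-1) ^ length as * A (x # as @ bs)" by (rule alt_move[OF Cons.prems(1)])
  then have "A (x # as @ bs) = 0" using Cons.prems(3) ys
    by (cases "even (length as)") auto
  moreover have "mset xs = mset (as @ bs)" using Cons.prems(2) ys by simp
  ultimately show ?case using Cons.IH[OF alt_contr[OF Cons.prems(1), of x], of "as @ bs"]
    by (simp add: contr_apply)
qed

subsection \<open>Linear substitutions of the letters\<close>

text \<open>The matrix acts on the index of every letter and leaves the exponents alone: the map
  induced on alternating forms by a change of letters. Its purpose is to turn K_N into the
  identity.\<close>

fun tw :: "('i::finite \<Rightarrow> 'i \<Rightarrow> 'w) \<Rightarrow> (('i \<times> nat) list \<Rightarrow> 'w::comm_ring_1) \<Rightarrow> ('i \<times> nat) list \<Rightarrow> 'w" where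
  "tw T A [] = A []"
| "tw T A (x # xs) = (\<Sum>i\<in>UNIV. T (fst x) i * tw T (contr (i, snd x) A) xs)"

lemma tw_add: "tw T (A + B) = tw T A + tw T B"
proof
  fix xs show "tw T (A + B) xs = (tw T A + tw T B) xs"
    by (induction xs arbitrary: A B) (auto simp: algebra_simps sum.distrib)
qed

lemma additive_tw: "additive_map (tw T)"
  by (simp add: additive_map_def tw_add)

lemmas tw_lin = additive_simps[OF additive_tw]

lemma tw_scale: "tw T ((*) c \<circ> A) xs = c * tw T A xs"
proof (induction xs arbitrary: A)
  case Nil then show ?case by simp
next
  case (Cons x xs)
  have "tw T ((*) c \<circ> A) xs = c * tw T A xs" for A by (rule Cons.IH)
  then show "tw T ((*) c \<circ> A) (x # xs) = c * tw T A (x # xs)"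
    by (simp add: sum_distrib_left mult.left_commute)
qed

lemma tw_sum: "tw T (\<Sum>i\<in>I. f i) xs = (\<Sum>i\<in>I. tw T (f i) xs)"
  by (simp add: additive_map_sum[OF additive_tw] sum_fun_apply)

lemma contr_tw: "contr x (tw T A) = (\<Sum>i\<in>UNIV. (*) (T (fst x) i) \<circ> tw T (contr (i, snd x) A))"
  by (simp add: fun_eq_iff contr_apply sum_fun_apply)

lemma tw_tw:
  assumes ST: "\<And>i k. (\<Sum>j\<in>UNIV. S i j * T j k) = (if i = k then 1 else 0)"
  shows "tw S (tw T A) = A"
proof
  fix xs show "tw S (tw T A) xs = A xs"
  proof (induction xs arbitrary: A)
    case Nil then show ?case by simp
  next
    case (Cons x xs)
    have IH: "tw S (tw T A) xs = A xs" for A by (rule Cons.IH)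
    have "tw S (tw T A) (x # xs) = (\<Sum>i\<in>UNIV. \<Sum>j\<in>UNIV. S (fst x) i * T i j * A ((j, snd x) # xs))"
      by (simp add: contr_tw tw_sum tw_scale IH sum_distrib_left mult.assoc contr_apply)
    also have "\<dots> = (\<Sum>j\<in>UNIV. (\<Sum>i\<in>UNIV. S (fst x) i * T i j) * A ((j, snd x) # xs))"
      by (subst sum.swap) (simp add: sum_distrib_right)
    also have "\<dots> = A (x # xs)"
      by (simp add: ST if_distrib[of "\<lambda>a. a * _"] cong: if_cong)
    finally show ?case .
  qed
qed

lemma alt_tw: "alt A \<Longrightarrow> alt (tw T A)"
proof -
  have "alt A \<Longrightarrow> tw T A (xs @ x # y # ys) = - tw T A (xs @ y # x # ys)" for xs x y ys
  proof (induction xs arbitrary: A)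
    case Nil
    have e: "tw T A (u # v # ys) = (\<Sum>i\<in>UNIV. \<Sum>j\<in>UNIV. T (fst u) i * (T (fst v) j *
        tw T (contr (j, snd v) (contr (i, snd u) A)) ys))" for u v
      by (simp add: sum_distrib_left)
    show ?case unfolding append_Nil e[of x y]
      unfolding e[of y x] alt_swap[OF Nil, of "(_, snd y)"] sum_negf[symmetric]
      by (subst sum.swap) (simp add: tw_lin mult.left_commute)
  next
    case (Cons z xs)
    have "tw T (contr (i, snd z) A) (xs @ x # y # ys) = - tw T (contr (i, snd z) A) (xs @ y # x # ys)" for i
      by (rule Cons.IH[OF alt_contr[OF Cons.prems]])
    then show "tw T A ((z # xs) @ x # y # ys) = - tw T A ((z # xs) @ y # x # ys)"
      by (simp add: sum_negf)
  qed
  then show "alt A \<Longrightarrow> alt (tw T A)" by (intro altI)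
qed

text \<open>The substitution mixes only words with the same exponents, so every vanishing condition
  that is phrased by exponents survives it.\<close>

lemma tw_zero:
  assumes "\<And>ys. map snd ys = map snd xs \<Longrightarrow> A ys = 0" shows "tw T A xs = 0"
  using assms
proof (induction xs arbitrary: A)
  case (Cons x xs)
  have "tw T (contr (i, snd x) A) xs = 0" for i
    by (rule Cons.IH) (use Cons.prems in \<open>auto simp: contr_apply\<close>)
  then show ?case by simp
qed simp

lemma homog_tw: "homog k A \<Longrightarrow> homog k (tw T A)"
  unfolding homog_def by (metis tw_zero length_map)

lemma fsupp_tw:
  fixes A :: "('i::finite \<times> nat) list \<Rightarrow> 'w::comm_ring_1"
  assumes "fsupp A" shows "fsupp (tw T A)"
proof -
  obtain X where X: "finite X" "\<And>xs. \<not> set xs \<subseteq> X \<Longrightarrow> A xs = 0" using fsuppE[OF assms] by metis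
  have "tw T A xs = 0" if "\<not> set xs \<subseteq> UNIV \<times> snd ` X" for xs
  proof (rule tw_zero)
    fix ys :: "('i \<times> nat) list" assume e: "map snd ys = map snd xs"
    have "snd ` set ys = snd ` set xs" using arg_cong[OF e, of set] by simp
    moreover from that obtain x where "x \<in> set xs" "snd x \<notin> snd ` X" by (auto simp: mem_Times_iff subset_eq)
    ultimately have "\<not> set ys \<subseteq> X" by (metis image_eqI image_mono subsetD)
    then show "A ys = 0" by (rule X)
  qed
  then show ?thesis using X(1) by (intro fsuppI[of "UNIV \<times> snd ` X"]) auto
qed

lemma dl_comp:
  assumes "additive_map f" "\<And>x a. f (D x a) = D' x (f a)"
  shows "f (dl D A xs) = dl D' (f \<circ> A) xs"
proof (induction xs arbitrary: A)
  case Nil then show ?case by (simp add: additive_simps[OF assms(1)])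
next
  case (Cons x xs)
  have "f (dl D A xs) = dl D' (f \<circ> A) xs" for A by (rule Cons.IH)
  then show "f (dl D A (x # xs)) = dl D' (f \<circ> A) (x # xs)"
    by (simp add: additive_simps[OF assms(1)] assms(2))
qed

text \<open>The derivations are transformed by the same matrix as the letters; as they are linear
  over its entries, the matrix can be pulled out of the differential.\<close>

lemma dl_tw:
  assumes a: "\<And>x. additive_map (D x)"
    and lin: "\<And>x i k a. D x (T i k * a) = T i k * D x a"
  shows "dl (\<lambda>x a. \<Sum>i\<in>UNIV. T (fst x) i * D (i, snd x) a) (tw T A) = tw T (dl D A)"
proof
  let ?D = "\<lambda>x a. \<Sum>i\<in>UNIV. T (fst x) i * D (i, snd x) a"
  have a': "additive_map (?D x)" for x
    by (auto simp: additive_map_def additive_simps[OF a] distrib_left sum.distrib)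
  have lin': "T i k * ?D x b = ?D x (T i k * b)" for x i k b
    by (simp add: lin sum_distrib_left mult.left_commute)
  have DT: "D y (tw T A xs) = tw T (D y \<circ> A) xs" for y A xs
  proof (induction xs arbitrary: A)
    case (Cons x xs)
    have "D y (tw T A xs) = tw T (D y \<circ> A) xs" for A by (rule Cons.IH)
    then show "D y (tw T A (x # xs)) = tw T (D y \<circ> A) (x # xs)"
      by (simp add: additive_map_sum[OF a] lin)
  qed simp
  fix xs show "dl ?D (tw T A) xs = tw T (dl D A) xs"
  proof (induction xs arbitrary: A)
    case (Cons x xs)
    have IH: "dl ?D (tw T A) xs = tw T (dl D A) xs" for A by (rule Cons.IH)
    have s: "dl ?D ((*) (T i k) \<circ> B) xs = T i k * dl ?D B xs" for i k B
      by (rule dl_comp[symmetric]) (auto simp: additive_map_def distrib_left lin')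
    show "dl ?D (tw T A) (x # xs) = tw T (dl D A) (x # xs)"
      by (simp add: contr_tw additive_map_sum[OF additive_dl[of ?D, OF a']] sum_fun_apply s IH
          tw_lin DT right_diff_distrib sum_subtractf)
  qed simp
qed

section \<open>The differential in coordinates\<close>

locale diff_complex = diff_function_algebra smul dv pd
  for smul :: "'f::field_char_0 \<Rightarrow> 'v::comm_ring_1 \<Rightarrow> 'v" and dv
    and pd :: "'i::{finite,linorder} \<Rightarrow> nat \<Rightarrow> 'v \<Rightarrow> 'v" +
  fixes K :: "nat \<Rightarrow> (('v, 'i) vec, 'i) vec" and N :: nat
  assumes Kq: "n \<le> N \<Longrightarrow> K n $ i $ j \<in> quasiconst pd"
begin

abbreviation "\<F> \<equiv> quasiconst pd"

sublocale vs: vector_space smul by (rule vector_space_smul)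

lemma deriv_map_of_derivation:
  assumes "derivation smul f" shows "deriv_map f" "f (smul c a) = smul c (f a)"
proof -
  interpret l: Vector_Spaces.linear smul smul f using assms by (simp add: derivation_def)
  show "deriv_map f" using assms by (simp add: derivation_def deriv_map_def additive_map_def l.add)
  show "f (smul c a) = smul c (f a)" by (rule l.scale)
qed

lemma deriv_pd: "deriv_map (pd i n)" and pd_smul: "pd i n (smul c a) = smul c (pd i n a)"
  using deriv_map_of_derivation[OF derivation_pd] by auto

lemma deriv_dv: "deriv_map dv" and dv_smul: "dv (smul c a) = smul c (dv a)"
  using deriv_map_of_derivation[OF derivation_dv] by auto

lemma additive_pd: "additive_map (pd i n)" and additive_dv: "additive_map dv"
  using deriv_pd deriv_dv deriv_additive by blast+

lemmas pd_simps = additive_simps[OF additive_pd]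
lemmas dv_simps = additive_simps[OF additive_dv]
lemmas pd_mult = deriv_mult[OF deriv_pd]
lemmas dv_mult = deriv_mult[OF deriv_dv]

text \<open>Characteristic 0 makes 2 invertible. This serves the vanishing of alternating forms on
  repeated letters and the odd right inverse of a partial derivative.\<close>

lemma half_double: "smul (1/2) (a + a) = a"
proof -
  have "smul (1/2) (a + a) = smul (1/2 + 1/2) a" by (simp only: vs.scale_left_distrib vs.scale_right_distrib)
  then show ?thesis by simp
qed

lemma eq_minus_zero: "a = - a \<Longrightarrow> a = (0::'v)"
proof -
  assume "a = - a"
  then have "a + a = 0" by (simp add: eq_neg_iff_add_eq_0)
  then show "a = 0" using half_double[of a] by simp
qed

lemma qc_D: "f \<in> \<F> \<Longrightarrow> pd i n f = 0" by (simp add: quasiconst_def)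

lemma qc_0: "0 \<in> \<F>" and qc_1: "1 \<in> \<F>"
  and qc_add: "f \<in> \<F> \<Longrightarrow> g \<in> \<F> \<Longrightarrow> f + g \<in> \<F>"
  and qc_diff: "f \<in> \<F> \<Longrightarrow> g \<in> \<F> \<Longrightarrow> f - g \<in> \<F>"
  and qc_minus: "f \<in> \<F> \<Longrightarrow> - f \<in> \<F>"
  and qc_mult: "f \<in> \<F> \<Longrightarrow> g \<in> \<F> \<Longrightarrow> f * g \<in> \<F>"
  by (auto simp: quasiconst_def pd_simps pd_mult deriv_1[OF deriv_pd])

lemma qc_sum: "(\<And>i. i \<in> I \<Longrightarrow> f i \<in> \<F>) \<Longrightarrow> sum f I \<in> \<F>"
  by (induction I rule: infinite_finite_induct) (auto simp: qc_0 qc_add)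

lemma qc_dv: "f \<in> \<F> \<Longrightarrow> dv f \<in> \<F>"
  unfolding quasiconst_def
proof safe
  fix i n assume "\<forall>i n. pd i n f = 0"
  then show "pd i n (dv f) = 0" using pd_dv[of i n f] by (simp add: dv_simps split: if_splits)
qed

lemma pd_qc_mult: "c \<in> \<F> \<Longrightarrow> pd i n (c * f) = c * pd i n f"
  by (simp add: pd_mult qc_D)

section \<open>The symbols of (\<lambda> + \<partial>)^n K and the derivations they define\<close>

definition lamdv :: "'v poly \<Rightarrow> 'v poly" where
  "lamdv p = pCons 0 p + map_poly dv p"

definition Kpoly :: "'i \<Rightarrow> 'i \<Rightarrow> 'v poly" where
  "Kpoly j i = (\<Sum>t\<le>N. monom (K t $ j $ i) t)"

definition dsym :: "nat \<Rightarrow> 'i \<Rightarrow> 'i \<Rightarrow> 'v poly" where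
  "dsym n j i = (lamdv ^^ n) (Kpoly j i)"

text \<open>\<open>Dx (i, m)\<close> collects the coefficients of \<open>\<lambda>\<^sup>m\<close> in \<open>(\<lambda> + \<partial>)\<^sup>n K\<^bsub>ji\<^esub>(\<lambda>) \<partial>/\<partial>u\<^sub>j\<^sup>(\<^sup>n\<^sup>)\<close>. The sum has infinite
index set, but only finitely many of its terms are nonzero.\<close>

definition Dx :: "'i \<times> nat \<Rightarrow> 'v \<Rightarrow> 'v" where
  "Dx x f = (\<Sum>(j, n). coeff (dsym n j (fst x)) (snd x) * pd j n f)"

lemma coeff_lamdv: "coeff (lamdv p) m = (if m = 0 then 0 else coeff p (m - 1)) + dv (coeff p m)"
  by (simp add: lamdv_def coeff_map_poly dv_simps coeff_pCons split: nat.split)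

lemma coeff_Kpoly: "coeff (Kpoly j i) m = (if m \<le> N then K m $ j $ i else 0)"
  by (simp add: Kpoly_def coeff_sum)

lemma dsym_0 [simp]: "dsym 0 j i = Kpoly j i"
  and dsym_Suc: "dsym (Suc n) j i = lamdv (dsym n j i)"
  by (simp_all add: dsym_def)

lemma qc_dsym: "coeff (dsym n j i) m \<in> \<F>"
proof (induction n arbitrary: m)
  case 0 then show ?case by (simp add: coeff_Kpoly Kq qc_0)
next
  case (Suc n) then show ?case by (simp add: dsym_Suc coeff_lamdv qc_add qc_dv qc_0)
qed

text \<open>Each application of \<lambda> + \<partial> raises the degree by one and keeps the
  coefficient in front of the top power, so K_N persists; this is the origin of the pairing of order
  n with exponent n + N.\<close>

lemma dsym_top: "coeff (dsym n j i) (n + N) = K N $ j $ i"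
  and dsym_above: "m > n + N \<Longrightarrow> coeff (dsym n j i) m = 0"
proof -
  have ab: "m > n + N \<Longrightarrow> coeff (dsym n j i) m = 0" for m n
    by (induction n arbitrary: m) (auto simp: coeff_Kpoly dsym_Suc coeff_lamdv dv_simps)
  then show "m > n + N \<Longrightarrow> coeff (dsym n j i) m = 0" .
  show "coeff (dsym n j i) (n + N) = K N $ j $ i"
    by (induction n) (auto simp: coeff_Kpoly dsym_Suc coeff_lamdv ab dv_simps)
qed

text \<open>Cruder than \<open>Vfilt\<close>, as all indices are treated alike; it only serves to
  truncate sums over the variables.\<close>

definition order_lt :: "nat \<Rightarrow> 'v \<Rightarrow> bool" where
  "order_lt M f \<longleftrightarrow> (\<forall>j n. n \<ge> M \<longrightarrow> pd j n f = 0)"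

lemma order_ltD: "order_lt M f \<Longrightarrow> n \<ge> M \<Longrightarrow> pd j n f = 0"
  by (simp add: order_lt_def)

lemma order_lt_mono: "order_lt M f \<Longrightarrow> M \<le> M' \<Longrightarrow> order_lt M' f"
  by (simp add: order_lt_def)

lemma order_lt_ex: "\<exists>M. order_lt M f"
proof -
  have "finite (snd ` {(i, n). pd i n f \<noteq> 0})" using finite_pd by (rule finite_imageI)
  then obtain M where "\<forall>n\<in>snd ` {(i, n). pd i n f \<noteq> 0}. n < M"
    by (auto simp: finite_nat_set_iff_bounded)
  then have "order_lt M f" unfolding order_lt_def by (force simp: image_iff)
  then show ?thesis ..
qed

lemma order_lt_finite: "finite S \<Longrightarrow> \<exists>M. \<forall>f\<in>S. order_lt M f"
proof (induction S rule: finite_induct)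
  case (insert f S)
  then obtain M M' where "\<forall>f\<in>S. order_lt M f" "order_lt M' f" using order_lt_ex by blast
  then show ?case by (intro exI[of _ "max M M'"]) (auto intro: order_lt_mono)
qed simp

text \<open>Any bound on the order may be used, so several functions can be compared under a common
  one.\<close>

lemma Dx_bound: "order_lt M f \<Longrightarrow> Dx x f = (\<Sum>j\<in>UNIV. \<Sum>n<M. coeff (dsym n j (fst x)) (snd x) * pd j n f)"
  unfolding Dx_def
  by (subst Sum_any.expand_superset[of "UNIV \<times> {..<M}"])
     (auto simp: sum.cartesian_product order_lt_def not_le[symmetric])

lemma additive_Dx: "additive_map (Dx x)"
  unfolding additive_map_def
proof (intro allI)
  fix a b :: 'v
  obtain M where M: "\<forall>f\<in>{a, b, a + b}. order_lt M f" using order_lt_finite[of "{a, b, a + b}"] by auto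
  then show "Dx x (a + b) = Dx x a + Dx x b"
    by (simp add: Dx_bound[where M=M] pd_simps distrib_left sum.distrib)
qed

lemma deriv_Dx: "deriv_map (Dx x)"
  unfolding deriv_map_def
proof (intro conjI allI additive_Dx)
  fix a b :: 'v
  obtain M where M: "\<forall>f\<in>{a, b, a * b}. order_lt M f" using order_lt_finite[of "{a, b, a * b}"] by auto
  then show "Dx x (a * b) = Dx x a * b + a * Dx x b"
    by (simp add: Dx_bound[where M=M] pd_mult distrib_left sum.distrib sum_distrib_left sum_distrib_right mult_ac)
qed

lemmas Dx_simps = additive_simps[OF additive_Dx]

lemma order_lt_pd: "order_lt M f \<Longrightarrow> order_lt M (pd i n f)"
  using pd_commute[of _ _ i n f] by (simp add: order_lt_def pd_simps)

lemma Dx_qc: "c \<in> \<F> \<Longrightarrow> Dx x c = 0"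
  by (simp add: Dx_def qc_D)

lemma Dx_qc_mult: "c \<in> \<F> \<Longrightarrow> Dx x (c * f) = c * Dx x f"
  by (simp add: deriv_mult[OF deriv_Dx] Dx_qc)

lemma pd_Dx: "pd i n (Dx x f) = Dx x (pd i n f)"
proof -
  obtain M where "order_lt M f" using order_lt_ex by blast
  then show ?thesis
    by (simp add: Dx_bound[where M=M] order_lt_pd additive_map_sum[OF additive_pd] pd_qc_mult qc_dsym
        pd_commute[of i n])
qed

lemma order_lt_Dx: "order_lt M f \<Longrightarrow> order_lt M (Dx x f)"
  by (simp add: order_lt_def pd_Dx Dx_simps)

text \<open>The coefficients are quasiconstant and hence killed by all these derivations, so
  commutation is inherited from the partial derivatives. This is the source of \<delta>^2 =
  0.\<close>

lemma Dx_commute: "Dx x (Dx y f) = Dx y (Dx x f)"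
proof -
  obtain M where M: "order_lt M f" using order_lt_ex by blast
  let ?c = "\<lambda>x j n. coeff (dsym n j (fst x)) (snd x)"
  have "Dx x (Dx y f) = (\<Sum>j\<in>UNIV. \<Sum>n<M. ?c x j n * Dx y (pd j n f))" for x y
    by (simp add: Dx_bound[OF order_lt_Dx[OF M]] pd_Dx)
  then have "Dx x (Dx y f) = (\<Sum>j\<in>UNIV. \<Sum>n<M. Dx y (?c x j n * pd j n f))"
    by (simp add: Dx_qc_mult qc_dsym)
  also have "\<dots> = Dx y (Dx x f)"
    by (simp add: Dx_bound[OF M] additive_map_sum[OF additive_Dx])
  finally show ?thesis .
qed

lemma finite_Dx: "finite {x. Dx x f \<noteq> 0}"
proof -
  obtain M where M: "order_lt M f" using order_lt_ex by blast
  have "Dx (i, m) f = 0" if "m \<ge> M + N" for i m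
  proof -
    have "coeff (dsym n j i) m = 0" if "n < M" for n j using that \<open>m \<ge> M + N\<close> by (intro dsym_above) simp
    then show ?thesis by (simp add: Dx_bound[OF M])
  qed
  then have "{x. Dx x f \<noteq> 0} \<subseteq> UNIV \<times> {..<M + N}" by (auto simp: not_le[symmetric])
  then show ?thesis by (rule finite_subset) simp
qed

text \<open>Symbols with k < n have degree below n + N, and f has no derivatives of order above n;
  only the leading coefficient at order n is left.\<close>

lemma Dx_top:
  assumes "order_lt (Suc n) f" shows "Dx (i, n + N) f = (\<Sum>j\<in>UNIV. K N $ j $ i * pd j n f)"
proof -
  have "(\<Sum>k<Suc n. coeff (dsym k j i) (n + N) * pd j k f) = K N $ j $ i * pd j n f" for j
  proof -
    have "coeff (dsym k j i) (n + N) * pd j k f = 0" if "k < n" for k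
      using that by (simp add: dsym_above)
    then show ?thesis by (simp add: dsym_top)
  qed
  then show ?thesis by (simp add: Dx_bound[OF assms] del: sum.lessThan_Suc)
qed

text \<open>The commutator of a partial derivative with \<partial> lowers the order n. The recursion
  for the symbols converts this into a lowered exponent of the letter, the same shift as in
  \<open>dhat\<close>.\<close>

lemma Dx_dv: "Dx x (dv f) = dv (Dx x f) + (if snd x = 0 then 0 else Dx (fst x, snd x - 1) f)"
proof -
  obtain i m where x: "x = (i, m)" by (cases x)
  obtain M where "order_lt M f" using order_lt_ex by blast
  then have M: "order_lt (Suc M) f" by (rule order_lt_mono) simp
  have pdv: "pd j n (dv f) = dv (pd j n f) + (if n = 0 then 0 else pd j (n - 1) f)" for j n
    using pd_dv[of j n f] by (simp add: algebra_simps)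
  have M': "order_lt (Suc (Suc M)) (dv f)"
    using M by (simp add: order_lt_def pdv dv_simps)
  let ?c = "\<lambda>m n j. coeff (dsym n j i) m"
  have e: "?c m (Suc n) j = (if m = 0 then 0 else ?c (m - 1) n j) + dv (?c m n j)" for m n j
    by (simp add: dsym_Suc coeff_lamdv)
  have top: "pd j (Suc M) f = 0" for j using M by (simp add: order_lt_def)
  \<comment> \<open>The order of \<open>dv f\<close> may exceed that of f by one, whence the longer
    sum. After the index shift, \<open>pd j n f\<close> stands beside the symbol with n + 1, to
    which the recursion \<open>e\<close> applies.\<close>
  have "(\<Sum>n<Suc (Suc M). ?c m n j * pd j n (dv f)) =
     (\<Sum>n<Suc (Suc M). ?c m n j * dv (pd j n f)) + (\<Sum>n<Suc M. ?c m (Suc n) j * pd j n f)" for j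
    unfolding pdv distrib_left sum.distrib
    by (simp add: sum.lessThan_Suc_shift[of _ "Suc M"] del: sum.lessThan_Suc)
  also have "\<dots> j = (\<Sum>n<Suc M. ?c m n j * dv (pd j n f)) + (\<Sum>n<Suc M. ?c m (Suc n) j * pd j n f)" for j
    by (simp add: top dv_simps)
  also have "\<dots> j = (\<Sum>n<Suc M. dv (?c m n j * pd j n f)) +
      (if m = 0 then 0 else (\<Sum>n<Suc M. ?c (m - 1) n j * pd j n f))" for j
    by (simp add: e dv_mult sum.distrib distrib_left distrib_right algebra_simps del: sum.lessThan_Suc)
  finally have "(\<Sum>n<Suc (Suc M). ?c m n j * pd j n (dv f)) = (\<Sum>n<Suc M. dv (?c m n j * pd j n f)) +
      (if m = 0 then 0 else (\<Sum>n<Suc M. ?c (m - 1) n j * pd j n f))" for j .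
  then show ?thesis
    by (simp add: x Dx_bound[OF M] Dx_bound[OF M'] additive_map_sum[OF additive_dv] sum.distrib
        del: sum.lessThan_Suc)
qed

lemma alt_repeat:
  fixes A :: "'x list \<Rightarrow> 'v"
  assumes "alt A" "\<not> distinct xs" shows "A xs = 0"
proof -
  obtain as x bs cs where "xs = as @ [x] @ bs @ [x] @ cs" using assms(2) not_distinct_decomp by blast
  then show ?thesis using alt_swap_gen[OF assms(1), of as x bs x cs] by (intro eq_minus_zero) simp
qed

text \<open>A single derivation fails to commute with \<partial> by the derivation at the lowered
  letter, and this is the term that contraction of \<open>dhat\<close> produces.\<close>

lemma dl_dhat: "dl Dx (dhat dv A) = dhat dv (dl Dx A)"
proof
  have c: "Dx x (dhat dv A xs) = dhat dv (Dx x \<circ> A) xs +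
      (if snd x = 0 then 0 else Dx (fst x, snd x - 1) (A xs))" for x A xs
  proof (induction xs arbitrary: A)
    case Nil then show ?case by (simp add: Dx_dv)
  next
    case (Cons y xs)
    have IH: "Dx x (dhat dv A xs) = dhat dv (Dx x \<circ> A) xs +
      (if snd x = 0 then 0 else Dx (fst x, snd x - 1) (A xs))" for A by (rule Cons.IH)
    show "Dx x (dhat dv A (y # xs)) = dhat dv (Dx x \<circ> A) (y # xs) +
      (if snd x = 0 then 0 else Dx (fst x, snd x - 1) (A (y # xs)))"
      by (simp add: IH Dx_simps contr_apply)
  qed
  fix xs show "dl Dx (dhat dv A) xs = dhat dv (dl Dx A) xs"
  proof (induction xs arbitrary: A)
    case Nil then show ?case by (simp add: dv_simps)
  next
    case (Cons x xs)
    have IH: "dl Dx (dhat dv A) xs = dhat dv (dl Dx A) xs" for A by (rule Cons.IH)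
    show "dl Dx (dhat dv A) (x # xs) = dhat dv (dl Dx A) (x # xs)"
      by (simp add: IH contr_dhat dl_lin additive_Dx dhat_lin additive_dv c)
  qed
qed

end

section \<open>Elimination of variables\<close>

text \<open>Numbers the variables u_j^(n) in the lexicographic order of the filtration, so that
  elimination becomes an induction over natural numbers.\<close>

definition rank :: "nat \<Rightarrow> 'i::{finite,linorder} \<Rightarrow> nat" where
  "rank n j = n * CARD('i) + card {k. k < j}"

lemma card_less_index: "card {k. k < (j::'i::{finite,linorder})} < CARD('i)"
  by (rule psubset_card_mono) auto

lemma rank_less: "n < n' \<or> n = n' \<and> j < j' \<Longrightarrow> rank n j < rank n' (j' :: 'i::{finite,linorder})"
proof (elim disjE conjE)
  assume "n < n'"
  then have "Suc n * CARD('i) \<le> n' * CARD('i)" by (intro mult_le_mono1) simp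
  then show ?thesis using card_less_index[of j] by (simp add: rank_def)
next
  assume "n = n'" "j < j'"
  moreover from this have "card {k. k < j} < card {k. k < j'}" by (intro psubset_card_mono) auto
  ultimately show ?thesis by (simp add: rank_def)
qed

lemma rank_less_iff: "rank n j < rank n' j' \<longleftrightarrow> n < n' \<or> n = n' \<and> j < (j' :: 'i::{finite,linorder})"
  using rank_less[of n n' j j'] rank_less[of n' n j' j] by (metis less_asym linorder_neqE)

lemma rank_eq_iff: "rank n j = rank n' j' \<longleftrightarrow> n = n' \<and> j = (j' :: 'i::{finite,linorder})"
  using rank_less_iff[of n j n' j'] rank_less_iff[of n' j' n j] by (metis linorder_neqE less_irrefl)

context diff_complex
begin

definition form :: "nat \<Rightarrow> ('x list \<Rightarrow> 'v) \<Rightarrow> bool" where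
  "form k A \<longleftrightarrow> homog k A \<and> alt A \<and> fsupp A"

text \<open>Forms of degree \<open>k - 1\<close>, where only 0 has degree \<open>-1\<close>.\<close>

definition prev_form :: "nat \<Rightarrow> ('x list \<Rightarrow> 'v) \<Rightarrow> bool" where
  "prev_form k A \<longleftrightarrow> (\<forall>xs. Suc (length xs) \<noteq> k \<longrightarrow> A xs = 0) \<and> alt A \<and> fsupp A"

lemma form_add: "form k A \<Longrightarrow> form k B \<Longrightarrow> form k (A + B)"
  and form_diff: "form k A \<Longrightarrow> form k B \<Longrightarrow> form k (A - B)"
  and form_0: "form k 0"
  by (simp_all add: form_def homog_add alt_add fsupp_add homog_diff alt_diff fsupp_diff homog_0 alt_0 fsupp_0)

lemma prev_form_add: "prev_form k A \<Longrightarrow> prev_form k B \<Longrightarrow> prev_form k (A + B)"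
  by (simp add: prev_form_def alt_add fsupp_add)

lemma prev_form_0: "prev_form k 0"
  by (simp add: prev_form_def alt_0 fsupp_0)

lemma prev_form_Suc: "prev_form (Suc k) A \<longleftrightarrow> form k A"
  by (simp add: prev_form_def form_def homog_def)

lemma prev_form_zero: "prev_form 0 A \<Longrightarrow> A = 0"
  by (auto simp: prev_form_def fun_eq_iff)

text \<open>Variables and letters are paired: \<open>u\<^sub>j\<^sup>(\<^sup>n\<^sup>)\<close> is eliminated together with \<open>(j, n + N)\<close>.\<close>

definition reduced :: "nat \<Rightarrow> (('i \<times> nat) list \<Rightarrow> 'v) \<Rightarrow> bool" where
  "reduced t A \<longleftrightarrow> (\<forall>n j xs. rank n j \<ge> t \<longrightarrow> pd j n (A xs) = 0 \<and> ((j, n + N) \<in> set xs \<longrightarrow> A xs = 0))"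

lemma reducedD1: "reduced t A \<Longrightarrow> rank n j \<ge> t \<Longrightarrow> pd j n (A xs) = 0"
  and reducedD2: "reduced t A \<Longrightarrow> rank n j \<ge> t \<Longrightarrow> (j, n + N) \<in> set xs \<Longrightarrow> A xs = 0"
  by (auto simp: reduced_def)

lemma reduced_exists:
  assumes "form k A" shows "\<exists>t. reduced t A"
proof -
  have h: "homog k A" and f: "fsupp A" using assms by (auto simp: form_def)
  obtain X where X: "finite X" "\<And>xs. \<not> set xs \<subseteq> X \<Longrightarrow> A xs = 0" using fsuppE[OF f] by metis
  let ?S = "{xs. A xs \<noteq> 0}"
  have fS: "finite ?S" by (rule finite_homog_support[OF h f])
  \<comment> \<open>Bounding the ranks of the letters themselves is enough: the variable paired with
    a letter has smaller or equal rank.\<close>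
  let ?Y = "(\<Union>xs\<in>?S. {(j, n). pd j n (A xs) \<noteq> 0}) \<union> X"
  have "finite ((\<lambda>(j, n). rank n j) ` ?Y)" using fS finite_pd X(1) by auto
  then obtain t where t: "\<forall>r\<in>(\<lambda>(j, n). rank n j) ` ?Y. r < t"
    by (auto simp: finite_nat_set_iff_bounded)
  have "reduced t A" unfolding reduced_def
  proof (intro allI impI conjI)
    fix n xs and j :: 'i assume r: "rank n j \<ge> t"
    show "pd j n (A xs) = 0"
    proof (rule ccontr)
      assume p: "pd j n (A xs) \<noteq> 0"
      then have "A xs \<noteq> 0" by (auto simp: pd_simps)
      then have "(j, n) \<in> ?Y" using p by auto
      then show False using t r by force
    qed
    assume m: "(j, n + N) \<in> set xs"
    show "A xs = 0"
    proof (rule ccontr)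
      assume "A xs \<noteq> 0"
      then have "(j, n + N) \<in> ?Y" using X(2)[of xs] m by auto
      then have "rank (n + N) j < t" using t by force
      moreover have "rank n j \<le> rank (n + N) j" by (simp add: rank_def)
      ultimately show False using r by simp
    qed
  qed
  then show ?thesis ..
qed

text \<open>Antisymmetrising an arbitrary choice of preimages leaves it a right inverse, because the
  partial derivative is additive, and the filtration step is closed under the operations
  involved.\<close>

lemma odd_right_inverse:
  assumes "normal_alg pd"
  obtains G where "\<And>f. f \<in> Vfilt pd n j \<Longrightarrow> G f \<in> Vfilt pd n j"
    and "\<And>f. f \<in> Vfilt pd n j \<Longrightarrow> pd j n (G f) = f"
    and "\<And>f. G (- f) = - G f"
proof -
  have "\<forall>f\<in>Vfilt pd n j. \<exists>g\<in>Vfilt pd n j. pd j n g = f"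
    using assms unfolding normal_alg_def by (metis imageE)
  then obtain g where g: "\<And>f. f \<in> Vfilt pd n j \<Longrightarrow> g f \<in> Vfilt pd n j"
    "\<And>f. f \<in> Vfilt pd n j \<Longrightarrow> pd j n (g f) = f" by metis
  define G where "G f = smul (1/2) (g f - g (- f))" for f
  have neg: "- f \<in> Vfilt pd n j" if "f \<in> Vfilt pd n j" for f
    using that by (auto simp: Vfilt_def pd_simps)
  show thesis
  proof
    show "G f \<in> Vfilt pd n j" if "f \<in> Vfilt pd n j" for f
      using g(1)[OF that] g(1)[OF neg[OF that]] by (auto simp: G_def Vfilt_def pd_smul pd_simps)
    show "pd j n (G f) = f" if "f \<in> Vfilt pd n j" for f
      using g(2)[OF that] g(2)[OF neg[OF that]] half_double[of f] by (simp add: G_def pd_smul pd_simps)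
    show "G (- f) = - G f" for f
      by (simp add: G_def vs.scale_right_diff_distrib)
  qed
qed

lemma alt_vanish:
  fixes A :: "'x list \<Rightarrow> 'v"
  assumes "alt A" "contr x A = 0" "x \<in> set xs" shows "A xs = 0"
proof -
  obtain as bs where xs: "xs = as @ x # bs" using assms(3) by (auto simp: in_set_conv_decomp)
  have "A (x # as @ bs) = 0" using fun_cong[OF assms(2), of "as @ bs"] by (simp add: contr_apply)
  then show ?thesis using alt_move[OF assms(1), of as x bs] xs by simp
qed

section \<open>Elimination for commuting derivations with leading part
  \<partial>/\<partial>u_j^(n)\<close>

context
  fixes D :: "'i \<times> nat \<Rightarrow> 'v \<Rightarrow> 'v"
  assumes nrm: "normal_alg pd"
    and D_add: "\<And>x. additive_map (D x)"
    and D_comm: "\<And>x y a. D x (D y a) = D y (D x a)"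
    and D_pd: "\<And>x j n a. pd j n (D x a) = D x (pd j n a)"
    and D_lead: "\<And>j n f. order_lt (Suc n) f \<Longrightarrow> D (j, n + N) f = pd j n f"
begin

text \<open>The cochain \<open>\<gamma>\<close> is a primitive, with respect to \<open>u\<^sub>j\<^sup>(\<^sup>n\<^sup>)\<close>, of the contraction of \<open>A\<close> with \<open>(j, n + N)\<close>. The
right inverse of \<open>\<partial>/\<partial>u\<^sub>j\<^sup>(\<^sup>n\<^sup>)\<close> need not be linear; being odd is enough to keep \<open>\<gamma>\<close> alternating.\<close>

lemma eliminate_step:
  assumes A: "form k A" and red: "reduced (Suc (rank n (j :: 'i))) A"
    and van: "\<And>x xs. x \<in> set xs \<Longrightarrow> snd x \<ge> N \<Longrightarrow> dl D A xs = 0"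
  shows "\<exists>\<gamma>. prev_form k \<gamma> \<and> reduced (rank n j) (A - dl D \<gamma>)"
proof -
  let ?z = "(j, n + N)"
  let ?V = "Vfilt pd n j"
  obtain G where GV: "\<And>f. f \<in> ?V \<Longrightarrow> G f \<in> ?V" and pG: "\<And>f. f \<in> ?V \<Longrightarrow> pd j n (G f) = f"
    and Gm: "\<And>f. G (- f) = - G f"
    using odd_right_inverse[OF nrm, of n j] by metis
  have G0: "G 0 = 0" using Gm[of 0] by (intro eq_minus_zero) simp
  have altA: "alt A" and hA: "homog k A" and fA: "fsupp A" using A by (auto simp: form_def)
  \<comment> \<open>All variables of larger rank are gone, so the values lie in the filtration step
    where normality provides primitives.\<close>
  have AV: "A xs \<in> ?V" for xs
    using reducedD1[OF red] rank_less[of n _ j] by (fastforce simp: Vfilt_def Suc_le_eq)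
  define \<gamma> where "\<gamma> = G \<circ> contr ?z A"
  have gV: "\<gamma> xs \<in> ?V" for xs by (simp add: \<gamma>_def contr_def GV AV)
  have altg: "alt \<gamma>"
  proof (rule altI)
    show "\<gamma> (xs @ x # y # ys) = - \<gamma> (xs @ y # x # ys)" for xs x y ys
      using altD[OF alt_contr[OF altA, of ?z], of xs x y ys] by (simp add: \<gamma>_def Gm)
  qed
  have "Suc (length xs) \<noteq> k \<longrightarrow> \<gamma> xs = 0" for xs
    using hA G0 by (auto simp: \<gamma>_def contr_def homog_def)
  then have pg: "prev_form k \<gamma>"
    using altg fsupp_comp[of G, OF G0 fsupp_contr[OF fA, of ?z]] by (simp add: prev_form_def \<gamma>_def)
  \<comment> \<open>A second contraction with the same letter gives 0; so contracting the
    differential of \<gamma> leaves only the derivative of \<gamma>.\<close>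
  have cz: "contr ?z \<gamma> = 0"
    using alt_repeat[OF altA, of "?z # ?z # _"] G0 by (auto simp: \<gamma>_def contr_def fun_eq_iff)
  \<comment> \<open>Letters and variables of larger rank, already eliminated from A, do not reappear
    in \<gamma> or its differential.\<close>
  have cy: "contr (j', n' + N) \<gamma> = 0" if "rank n' j' > rank n j" for n' j'
    using reducedD2[OF red, of n' j'] that G0 by (auto simp: \<gamma>_def contr_def fun_eq_iff)
  have pdg: "pd j' n' (\<gamma> xs) = 0" if "rank n' j' > rank n j" for n' j' xs
    using gV[of xs] that by (auto simp: Vfilt_def rank_less_iff)
  have ord: "order_lt (Suc n') f" if "f \<in> ?V" "n \<le> n'" for f n'
    using that by (auto simp: Vfilt_def order_lt_def)
  have Dz: "D ?z f = pd j n f" if "f \<in> ?V" for f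
    using ord[OF that, of n] D_lead by blast
  have Dy: "D (j', n' + N) (\<gamma> xs) = 0" if "rank n' j' > rank n j" for n' j' xs
  proof -
    have "n \<le> n'" using that by (auto simp: rank_less_iff)
    then show ?thesis using D_lead[OF ord[OF gV]] pdg[OF that] by simp
  qed
  let ?B = "A - dl D \<gamma>"
  have altB: "alt ?B" using altA alt_dl[OF D_add altg] by (rule alt_diff)
  \<comment> \<open>On the filtration step the derivation at this letter is
    \<partial>/\<partial>u_j^(n), which takes \<gamma> back to the contraction of A.\<close>
  have Bz: "contr ?z ?B = 0"
    by (simp add: fun_eq_iff contr_apply cz dl_lin D_add Dz gV) (simp add: \<gamma>_def pG AV contr_apply)
  have By: "contr (j', n' + N) ?B = 0" if "rank n' j' > rank n j" for n' j'
    using reducedD2[OF red, of n' j'] that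
    by (auto simp: fun_eq_iff contr_apply cy dl_lin D_add Dy)
  have pdB: "pd j' n' (?B xs) = 0" if "rank n' j' > rank n j" for n' j' xs
  proof -
    have "pd j' n' (dl D \<gamma> xs) = dl D (pd j' n' \<circ> \<gamma>) xs"
      by (rule dl_comp) (auto simp: additive_pd D_pd)
    moreover have "pd j' n' \<circ> \<gamma> = 0" using pdg[OF that] by (auto simp: fun_eq_iff)
    ultimately have "pd j' n' (dl D \<gamma> xs) = 0" by (simp only: dl_lin D_add zero_fun_apply)
    then show ?thesis using reducedD1[OF red, of n' j' xs] that by (simp add: pd_simps)
  qed
  have BV: "?B xs \<in> ?V" for xs
    unfolding Vfilt_def mem_Collect_eq using pdB rank_less by metis
  \<comment> \<open>Here closedness is used, on words beginning with the letter. The letter is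
    absent from the remainder, so contracting its differential with the letter leaves just the
    derivative by u_j^(n).\<close>
  have pdBz: "pd j n (?B xs) = 0" for xs
  proof -
    have "dl D ?B (?z # xs) = dl D A (?z # xs) - dl D (dl D \<gamma>) (?z # xs)"
      by (simp only: dl_lin D_add minus_apply)
    also have "\<dots> = 0" using van[of ?z "?z # xs"] dl_dl[of D \<gamma>, OF D_add D_comm] by simp
    finally have "D ?z (?B xs) - dl D (contr ?z ?B) xs = 0" by simp
    then show ?thesis using Dz[OF BV] by (simp only: Bz dl_lin D_add zero_fun_apply diff_zero)
  qed
  have "reduced (rank n j) ?B" unfolding reduced_def
  proof (intro allI impI)
    fix n' xs and j' :: 'i assume "rank n j \<le> rank n' j'"
    then consider "n' = n" "j' = j" | "rank n' j' > rank n j"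
      using rank_eq_iff[of n j n' j'] by fastforce
    then show "pd j' n' (?B xs) = 0 \<and> ((j', n' + N) \<in> set xs \<longrightarrow> ?B xs = 0)"
      by cases (use pdBz pdB alt_vanish[OF altB Bz] alt_vanish[OF altB By] in blast)+
  qed
  then show ?thesis using pg by blast
qed

lemma form_dl_prev:
  assumes "prev_form k \<gamma>" and "\<And>a. finite {x. D x a \<noteq> 0}" shows "form k (dl D \<gamma>)"
proof (cases k)
  case 0
  then show ?thesis using prev_form_zero[of \<gamma>] assms by (simp add: dl_lin D_add form_0)
next
  case (Suc l)
  then have "form l \<gamma>" using assms by (simp add: prev_form_Suc)
  then show ?thesis using Suc assms(2)
    by (auto simp: form_def intro: homog_dl alt_dl fsupp_dl D_add)
qed

lemma eliminate:
  assumes "form k A" and "reduced t A"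
    and fin: "\<And>a. finite {x. D x a \<noteq> 0}"
    and van: "\<And>x xs. x \<in> set xs \<Longrightarrow> snd x \<ge> N \<Longrightarrow> dl D A xs = 0"
  shows "\<exists>\<gamma>. prev_form k \<gamma> \<and> reduced 0 (A - dl D \<gamma>)"
  using assms(1,2,4)
proof (induction t arbitrary: A)
  case 0
  have "A - dl D 0 = A" by (simp add: dl_lin D_add)
  then show ?case using 0 prev_form_0 by metis
next
  case (Suc t)
  show ?case
  proof (cases "\<exists>n j. t = rank n (j::'i)")
    case False
    then have "reduced t A"
      using Suc.prems(2) unfolding reduced_def by (metis le_antisym not_less_eq_eq)
    then show ?thesis using Suc.IH Suc.prems(1,3) by blast
  next
    case True
    then obtain n and j :: 'i where t: "t = rank n j" by blast
    obtain \<gamma> where g: "prev_form k \<gamma>" "reduced t (A - dl D \<gamma>)"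
      using eliminate_step[OF Suc.prems(1), of n j] Suc.prems(2,3) t by blast
    have "form k (A - dl D \<gamma>)" using Suc.prems(1) form_dl_prev[OF g(1) fin] by (rule form_diff)
    \<comment> \<open>Subtracting an exact form leaves the differential unchanged, so the hypothesis
      on it survives the step.\<close>
    moreover have "dl D (A - dl D \<gamma>) xs = 0" if "x \<in> set xs" "snd x \<ge> N" for x xs
      using Suc.prems(3)[OF that] dl_dl[of D \<gamma>, OF D_add D_comm] by (simp add: dl_lin D_add)
    ultimately obtain \<gamma>' where g': "prev_form k \<gamma>'" "reduced 0 (A - dl D \<gamma> - dl D \<gamma>')"
      using Suc.IH[OF _ g(2)] by blast
    moreover have "A - dl D (\<gamma> + \<gamma>') = A - dl D \<gamma> - dl D \<gamma>'" by (simp add: dl_lin D_add diff_diff_eq)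
    ultimately show ?thesis using prev_form_add[OF g(1) g'(1)] by metis
  qed
qed

end

text \<open>The image of \<open>Omega00\<close> in coordinates, see
  \<open>Omega00_iff\<close>.\<close>

definition small :: "(('i \<times> nat) list \<Rightarrow> 'v) \<Rightarrow> bool" where
  "small A \<longleftrightarrow> (\<forall>xs. A xs \<in> \<F> \<and> (\<forall>x\<in>set xs. snd x \<ge> N \<longrightarrow> A xs = 0))"

lemma small_reduced: "reduced 0 A \<Longrightarrow> small A"
proof -
  assume r: "reduced 0 A"
  have "A xs \<in> \<F>" for xs using reducedD1[OF r] by (simp add: quasiconst_def)
  moreover have "A xs = 0" if "x \<in> set xs" "snd x \<ge> N" for x xs
    using reducedD2[OF r, of "snd x - N" "fst x" xs] that by simp
  ultimately show ?thesis by (auto simp: small_def)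
qed

lemma small_tw:
  assumes T: "\<And>i j. T i j \<in> \<F>" and A: "small A" shows "small (tw T A)"
proof -
  have "(\<And>xs. A xs \<in> \<F>) \<Longrightarrow> tw T A xs \<in> \<F>" for xs A
  proof (induction xs arbitrary: A)
    case (Cons x xs)
    have "tw T (contr (i, snd x) A) xs \<in> \<F>" for i
      by (rule Cons.IH) (simp add: contr_def Cons.prems)
    then show ?case by (auto intro!: qc_sum qc_mult T)
  qed simp
  moreover have "tw T A xs = 0" if "x \<in> set xs" "snd x \<ge> N" for x xs
  proof (rule tw_zero)
    fix ys :: "('i \<times> nat) list" assume "map snd ys = map snd xs"
    then have "snd ` set ys = snd ` set xs" by (metis set_map)
    with that(1) have "snd x \<in> snd ` set ys" by simp
    then obtain y where "y \<in> set ys" "snd y = snd x" by auto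
    then show "A ys = 0" using A that(2) unfolding small_def by metis
  qed
  ultimately show ?thesis using A by (auto simp: small_def)
qed

text \<open>The elimination is carried out in the new letters. Returning to the old ones keeps
  smallness, as the matrix is quasiconstant and exponents are unchanged.\<close>

lemma reduce_to_small:
  assumes nrm: "normal_alg pd"
    and L: "\<And>i j. L $ i $ j \<in> \<F>" "K N ** L = mat 1" "L ** K N = mat 1"
    and A: "form k A" and van: "\<And>x xs. x \<in> set xs \<Longrightarrow> snd x \<ge> N \<Longrightarrow> dl Dx A xs = 0"
  shows "\<exists>\<gamma>. prev_form k \<gamma> \<and> small (A - dl Dx \<gamma>)"
proof -
  \<comment> \<open>The transpose is taken because the derivation at a letter with index i involves
    column i of K_N.\<close>
  define T where "T i j = L $ j $ i" for i j
  define S where "S i j = K N $ j $ i" for i j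
  have Tq: "T i j \<in> \<F>" and Sq: "S i j \<in> \<F>" for i j by (auto simp: T_def S_def L Kq)
  have TS: "(\<Sum>j\<in>UNIV. T i j * S j k) = (if i = k then 1 else 0)" for i k
    using arg_cong[OF L(2), of "\<lambda>M. M $ k $ i"]
    by (simp add: T_def S_def matrix_matrix_mult_def mat_def mult.commute eq_commute)
  have ST: "(\<Sum>j\<in>UNIV. S i j * T j k) = (if i = k then 1 else 0)" for i k
    using arg_cong[OF L(3), of "\<lambda>M. M $ k $ i"]
    by (simp add: T_def S_def matrix_matrix_mult_def mat_def mult.commute eq_commute)
  define D where "D x a = (\<Sum>i\<in>UNIV. T (fst x) i * Dx (i, snd x) a)" for x a
  have D_add: "additive_map (D x)" for x
    by (auto simp: D_def additive_map_def Dx_simps distrib_left sum.distrib)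
  have D_qc: "c \<in> \<F> \<Longrightarrow> D x (c * a) = c * D x a" for x c a
    by (simp add: D_def Dx_qc_mult sum_distrib_left mult.left_commute)
  have DDx: "Dx y (D x a) = D x (Dx y a)" for x y a
    unfolding D_def additive_map_sum[OF additive_Dx] Dx_qc_mult[OF Tq] Dx_commute[of y] ..
  have D_comm: "D x (D y a) = D y (D x a)" for x y a
    unfolding D_def[of x] DDx additive_map_sum[OF D_add] D_qc[OF Tq] ..
  have D_pd: "pd j n (D x a) = D x (pd j n a)" for x j n a
    by (simp add: D_def additive_map_sum[OF additive_pd] pd_qc_mult Tq pd_Dx)
  have D_lead: "D (j, n + N) f = pd j n f" if "order_lt (Suc n) f" for j n f
  proof -
    have "D (j, n + N) f = (\<Sum>i\<in>UNIV. \<Sum>l\<in>UNIV. T j i * S i l * pd l n f)"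
      by (simp add: D_def Dx_top[OF that] S_def sum_distrib_left mult.assoc)
    also have "\<dots> = (\<Sum>l\<in>UNIV. (\<Sum>i\<in>UNIV. T j i * S i l) * pd l n f)"
      by (subst sum.swap) (simp add: sum_distrib_right)
    finally show ?thesis by (simp add: TS if_distrib[of "\<lambda>a. a * _"] cong: if_cong)
  qed
  have D_fin: "finite {x. D x a \<noteq> 0}" for a
  proof -
    have "{x. D x a \<noteq> 0} \<subseteq> UNIV \<times> snd ` {x. Dx x a \<noteq> 0}"
    proof
      fix x assume "x \<in> {x. D x a \<noteq> 0}"
      then have "\<exists>i. Dx (i, snd x) a \<noteq> 0" unfolding D_def by (metis (mono_tags, lifting) mem_Collect_eq mult_zero_right sum.neutral)
      then show "x \<in> UNIV \<times> snd ` {x. Dx x a \<noteq> 0}" by (force simp: mem_Times_iff image_iff)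
    qed
    then show ?thesis using finite_Dx[of a] by (auto intro: finite_subset)
  qed
  have dT: "dl D (tw T B) = tw T (dl Dx B)" for B
    using dl_tw[where D=Dx and T=T and A=B, OF additive_Dx] by (simp add: Dx_qc_mult Tq D_def[abs_def])
  have dS: "dl Dx (tw S B) = tw S (dl D B)" for B
    using tw_tw[of S T "dl Dx (tw S B)", OF ST] tw_tw[of T S B, OF TS] dT[of "tw S B"] by simp
  have fT: "form k (tw T A)" using A by (simp add: form_def homog_tw alt_tw fsupp_tw)
  obtain t where t: "reduced t (tw T A)" using reduced_exists[OF fT] ..
  have van': "dl D (tw T A) xs = 0" if "x \<in> set xs" "snd x \<ge> N" for x xs
    unfolding dT
  proof (rule tw_zero)
    fix ys :: "('i \<times> nat) list" assume "map snd ys = map snd xs"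
    then have "snd ` set ys = snd ` set xs" by (metis set_map)
    with that(1) have "snd x \<in> snd ` set ys" by simp
    then obtain y where "y \<in> set ys" "snd y = snd x" by auto
    then show "dl Dx A ys = 0" using van[of y ys] that(2) by simp
  qed
  have "\<exists>\<gamma>. prev_form k \<gamma> \<and> reduced 0 (tw T A - dl D \<gamma>)"
  proof (rule eliminate[where D = D and t = t, OF nrm D_add D_comm D_pd _ fT t D_fin])
    show "D (j, n + N) f = pd j n f" if "order_lt (Suc n) f" for j n f using that by (rule D_lead)
    show "dl D (tw T A) xs = 0" if "x \<in> set xs" "snd x \<ge> N" for x xs using that by (rule van')
  qed
  then obtain \<gamma> where g: "prev_form k \<gamma>" "reduced 0 (tw T A - dl D \<gamma>)" by blast
  have "small (tw S (tw T A - dl D \<gamma>))" by (rule small_tw[OF Sq small_reduced[OF g(2)]])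
  also have "tw S (tw T A - dl D \<gamma>) = A - dl Dx (tw S \<gamma>)"
    using tw_tw[of S T A, OF ST] by (simp add: tw_lin dS)
  finally have "small (A - dl Dx (tw S \<gamma>))" .
  moreover have "prev_form k (tw S \<gamma>)"
    using g(1) unfolding prev_form_def by (metis alt_tw fsupp_tw length_map tw_zero)
  ultimately show ?thesis by blast
qed

lemma dl_small: "small A \<Longrightarrow> dl Dx A = 0"
proof
  fix xs assume A: "small A"
  have "(\<And>ys. A ys \<in> \<F>) \<Longrightarrow> dl Dx A xs = 0" for A
    by (induction xs arbitrary: A) (auto simp: Dx_qc contr_def)
  then show "dl Dx A xs = 0 xs" using A by (simp add: small_def)
qed

lemma form_dl: "form k A \<Longrightarrow> form (Suc k) (dl Dx A)"
  by (auto simp: form_def intro: homog_dl alt_dl fsupp_dl additive_Dx finite_Dx)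

lemma form_dl': "prev_form k A \<Longrightarrow> form k (dl Dx A)"
proof (cases k)
  case 0
  then show "prev_form k A \<Longrightarrow> form k (dl Dx A)" using prev_form_zero[of A] by (simp add: dl_lin additive_Dx form_0)
next
  case (Suc l)
  then show "prev_form k A \<Longrightarrow> form k (dl Dx A)" by (simp add: prev_form_Suc form_dl)
qed

lemma dl_dl_Dx: "dl Dx (dl Dx A) = 0"
  by (rule dl_dl[OF additive_Dx Dx_commute])

text \<open>The differential of A vanishes on words with a letter of exponent at least N, so
  elimination applies to A: it is a small form plus an exact one, and both are closed.\<close>

lemma small_exact_zero:
  assumes nrm: "normal_alg pd"
    and L: "\<And>i j. L $ i $ j \<in> \<F>" "K N ** L = mat 1" "L ** K N = mat 1"
    and A: "prev_form k A" and s: "small (dl Dx A)"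
  shows "dl Dx A = 0"
proof (cases k)
  case 0
  then show ?thesis using prev_form_zero[of A] A by (simp add: dl_lin additive_Dx)
next
  case (Suc l)
  then have fA: "form l A" using A by (simp add: prev_form_Suc)
  have "\<exists>\<gamma>. prev_form l \<gamma> \<and> small (A - dl Dx \<gamma>)"
    by (rule reduce_to_small[OF nrm L fA]) (use s in \<open>auto simp: small_def\<close>)
  then obtain \<gamma> where "small (A - dl Dx \<gamma>)" by blast
  then have "dl Dx (A - dl Dx \<gamma>) = 0" by (rule dl_small)
  then show ?thesis by (simp add: dl_lin additive_Dx dl_dl_Dx)
qed

end

section \<open>Polynomials in several variables\<close>

abbreviation "lkp \<equiv> Poly_Mapping.lookup"

text \<open>The renaming s is a parameter because a shuffle distributes the variables over two
  factors, each with its own numbering.\<close>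

definition vmon :: "(nat \<Rightarrow> nat) \<Rightarrow> nat list \<Rightarrow> (nat \<Rightarrow>\<^sub>0 nat)" where
  "vmon s ms = (\<Sum>b<length ms. Poly_Mapping.single (s b) (ms ! b))"

definition in_vars :: "nat set \<Rightarrow> 'v::zero mpol \<Rightarrow> bool" where
  "in_vars U p \<longleftrightarrow> (\<forall>m. lkp p m \<noteq> 0 \<longrightarrow> Poly_Mapping.keys m \<subseteq> U)"

lemma lookup_vmon:
  assumes "inj_on s {..<length ms}" "b < length ms" shows "lkp (vmon s ms) (s b) = ms ! b"
proof -
  have "lkp (vmon s ms) (s b) = (\<Sum>c<length ms. if c = b then ms ! c else 0)"
    unfolding vmon_def lookup_sum lookup_single when_def
    using assms by (intro sum.cong) (auto dest: inj_onD)
  then show ?thesis using assms by simp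
qed

lemma keys_vmon: "Poly_Mapping.keys (vmon s ms) \<subseteq> s ` {..<length ms}"
proof
  fix c assume "c \<in> Poly_Mapping.keys (vmon s ms)"
  then have "lkp (vmon s ms) c \<noteq> 0" by (simp add: in_keys_iff)
  then obtain b where "b \<in> {..<length ms}" "(if s b = c then ms ! b else 0) \<noteq> 0"
    unfolding vmon_def lookup_sum lookup_single when_def by (rule sum.not_neutral_contains_not_neutral)
  then show "c \<in> s ` {..<length ms}" by (metis image_eqI)
qed

lemma vmon_surj:
  assumes "inj_on s {..<k}" "Poly_Mapping.keys m \<subseteq> s ` {..<k}"
  shows "m = vmon s (map (\<lambda>b. lkp m (s b)) [0..<k])"
proof (rule poly_mapping_eqI)
  fix c
  let ?ms = "map (\<lambda>b. lkp m (s b)) [0..<k]"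
  show "lkp m c = lkp (vmon s ?ms) c"
  proof (cases "c \<in> s ` {..<k}")
    case True
    then show ?thesis using lookup_vmon[of s ?ms] assms(1) by auto
  next
    case False
    then have "c \<notin> Poly_Mapping.keys m" "c \<notin> Poly_Mapping.keys (vmon s ?ms)"
      using assms(2) keys_vmon[of s ?ms] by auto
    then show ?thesis by (simp add: in_keys_iff)
  qed
qed

lemma vmon_inj:
  assumes "inj_on s {..<k}" "length ms = k" "length ns = k" "vmon s ms = vmon s ns" shows "ms = ns"
  using assms lookup_vmon[of s ms] lookup_vmon[of s ns] by (intro nth_equalityI) auto

lemma in_varsD: "in_vars U p \<Longrightarrow> lkp p m \<noteq> 0 \<Longrightarrow> Poly_Mapping.keys m \<subseteq> U"
  by (simp add: in_vars_def)

lemma in_vars_keys: "in_vars U p \<longleftrightarrow> (\<forall>m\<in>Poly_Mapping.keys p. Poly_Mapping.keys m \<subseteq> U)"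
  by (auto simp: in_vars_def in_keys_iff)

lemma in_vars_0 [simp]: "in_vars U 0" by (simp add: in_vars_def)

lemma in_vars_subset: "in_vars U p \<Longrightarrow> U \<subseteq> W \<Longrightarrow> in_vars W p"
  by (auto simp: in_vars_def)

lemma in_vars_single: "Poly_Mapping.keys m \<subseteq> U \<Longrightarrow> in_vars U (Poly_Mapping.single m c)"
  by (auto simp: in_vars_def lookup_single when_def)

lemma in_vars_add: "in_vars U p \<Longrightarrow> in_vars U q \<Longrightarrow> in_vars U (p + q)" for p :: "'v::comm_ring_1 mpol"
  unfolding in_vars_def lookup_add by (metis add.right_neutral)

lemma in_vars_minus: "in_vars U p \<Longrightarrow> in_vars U (- p)" for p :: "'v::comm_ring_1 mpol"
  unfolding in_vars_def by simp

lemma in_vars_diff: "in_vars U p \<Longrightarrow> in_vars U q \<Longrightarrow> in_vars U (p - q)" for p :: "'v::comm_ring_1 mpol"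
  using in_vars_add[of U p "- q"] in_vars_minus[of U q] by simp

lemma in_vars_sum: "(\<And>i. i \<in> I \<Longrightarrow> in_vars U (f i)) \<Longrightarrow> in_vars U (sum f I)"
  for f :: "'i \<Rightarrow> 'v::comm_ring_1 mpol"
  by (induction I rule: infinite_finite_induct) (auto intro: in_vars_add)

lemma in_vars_mult: "in_vars U p \<Longrightarrow> in_vars U q \<Longrightarrow> in_vars U (p * q)" for p :: "'v::comm_ring_1 mpol"
proof -
  assume p: "in_vars U p" and q: "in_vars U q"
  show ?thesis unfolding in_vars_keys
  proof
    fix m assume "m \<in> Poly_Mapping.keys (p * q)"
    then obtain a b where "a \<in> Poly_Mapping.keys p" "b \<in> Poly_Mapping.keys q" "m = a + b"
      using keys_mult[of p q] by blast
    then show "Poly_Mapping.keys m \<subseteq> U" using p q keys_add[of a b] unfolding in_vars_keys by blast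
  qed
qed

lemma in_vars_mconst: "in_vars U (mconst c)"
  by (simp add: mconst_def in_vars_single)

lemma in_vars_mvar: "a \<in> U \<Longrightarrow> in_vars U (mvar a)"
  by (simp add: mvar_def in_vars_single)

lemma in_vars_1: "in_vars U (1 :: 'v::comm_ring_1 mpol)"
  by (simp add: in_vars_keys)

lemma in_vars_prod: "(\<And>i. i \<in> I \<Longrightarrow> in_vars U (f i)) \<Longrightarrow> in_vars U (prod f I)"
  for f :: "'i \<Rightarrow> 'v::comm_ring_1 mpol"
  by (induction I rule: infinite_finite_induct) (auto intro: in_vars_mult in_vars_1)

lemma in_vars_power: "in_vars U p \<Longrightarrow> in_vars U (p ^ n)" for p :: "'v::comm_ring_1 mpol"
  by (induction n) (auto intro: in_vars_mult in_vars_1)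

lemma lookup_cmap: "f 0 = 0 \<Longrightarrow> lkp (cmap f p) m = f (lkp p m)"
  by (auto simp: Poly_Mapping.map.rep_eq when_def)

lemma cmap_0 [simp]: "cmap f 0 = 0"
  by (rule poly_mapping_eqI) (simp add: Poly_Mapping.map.rep_eq)

lemma in_vars_cmap: "in_vars U p \<Longrightarrow> f 0 = 0 \<Longrightarrow> in_vars U (cmap f p)"
  unfolding in_vars_def by (metis lookup_cmap)

lemmas in_vars_intros = in_vars_add in_vars_minus in_vars_diff in_vars_sum in_vars_mult
  in_vars_mconst in_vars_mvar in_vars_1 in_vars_prod in_vars_power in_vars_0 in_vars_single

lemma mpol_eqI:
  assumes "in_vars {..<k} p" "in_vars {..<k} q"
    "\<And>ms. length ms = k \<Longrightarrow> lkp p (vmon id ms) = lkp q (vmon id ms)"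
  shows "p = q"
proof (rule poly_mapping_eqI)
  fix m
  show "lkp p m = lkp q m"
  proof (cases "Poly_Mapping.keys m \<subseteq> {..<k}")
    case True
    then have "m = vmon id (map (\<lambda>b. lkp m (id b)) [0..<k])" by (intro vmon_surj) auto
    then show ?thesis using assms(3)[of "map (\<lambda>b. lkp m (id b)) [0..<k]"] by simp
  next
    case False
    then show ?thesis using assms(1,2) by (metis in_varsD)
  qed
qed

lemma mpol_expand: "(\<Sum>m\<in>Poly_Mapping.keys p. Poly_Mapping.single m (lkp p m)) = p"
  by (rule poly_mapping_eqI)
     (simp add: lookup_sum lookup_single when_def in_keys_iff sum.delta)

text \<open>An exponent splits in only one way into parts over disjoint sets of variables, so the
  convolution has a single term.\<close>

lemma lookup_mult_disjoint:
  fixes p q :: "'v::comm_ring_1 mpol"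
  assumes "in_vars U p" "in_vars W q" "U \<inter> W = {}" "Poly_Mapping.keys mu \<subseteq> U" "Poly_Mapping.keys mw \<subseteq> W"
  shows "lkp (p * q) (mu + mw) = lkp p mu * lkp q mw"
proof -
  let ?kp = "Poly_Mapping.keys p" and ?kq = "Poly_Mapping.keys q"
  have inj: "a + b = mu + mw \<longleftrightarrow> a = mu \<and> b = mw" if "a \<in> ?kp" "b \<in> ?kq" for a b
  proof
    assume e: "a + b = mu + mw"
    have ka: "Poly_Mapping.keys a \<subseteq> U" and kb: "Poly_Mapping.keys b \<subseteq> W"
      using that assms(1,2) by (auto simp: in_vars_keys)
    have "lkp a c = lkp mu c \<and> lkp b c = lkp mw c" for c
    proof (cases "c \<in> U")
      case True
      then have "lkp b c = 0" "lkp mw c = 0" using kb assms(3,5) by (auto simp: in_keys_iff subset_eq)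
      then show ?thesis using arg_cong[OF e, of "\<lambda>m. lkp m c"] by (simp add: lookup_add)
    next
      case False
      then have "lkp a c = 0" "lkp mu c = 0" using ka assms(4) by (auto simp: in_keys_iff subset_eq)
      then show ?thesis using arg_cong[OF e, of "\<lambda>m. lkp m c"] by (simp add: lookup_add)
    qed
    then show "a = mu \<and> b = mw" by (auto intro: poly_mapping_eqI)
  qed simp
  have "p * q = (\<Sum>a\<in>?kp. \<Sum>b\<in>?kq. Poly_Mapping.single (a + b) (lkp p a * lkp q b))"
    by (subst (1) mpol_expand[of p, symmetric], subst (1) mpol_expand[of q, symmetric])
       (simp only: sum_product mult_single)
  then have "lkp (p * q) (mu + mw) = (\<Sum>a\<in>?kp. \<Sum>b\<in>?kq. if a + b = mu + mw then lkp p a * lkp q b else 0)"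
    by (simp add: lookup_sum lookup_single when_def)
  also have "\<dots> = (\<Sum>a\<in>?kp. \<Sum>b\<in>?kq. if b = mw then (if a = mu then lkp p a * lkp q b else 0) else 0)"
    using inj by (intro sum.cong refl) auto
  also have "\<dots> = (\<Sum>a\<in>?kp. if a = mu then (if mw \<in> ?kq then lkp p a * lkp q mw else 0) else 0)"
    by (intro sum.cong refl) (auto simp: sum.delta)
  also have "\<dots> = lkp p mu * lkp q mw"
    by (simp add: sum.delta in_keys_iff)
  finally show ?thesis .
qed

lemma mvar_power: "mvar a ^ n = Poly_Mapping.single (Poly_Mapping.single a n) (1::'v::comm_ring_1)"
proof (induction n)
  case (Suc n)
  have "mvar a ^ Suc n = mvar a * (Poly_Mapping.single (Poly_Mapping.single a n) (1::'v))"
    using Suc by simp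
  also have "\<dots> = Poly_Mapping.single (Poly_Mapping.single a (Suc n)) 1"
    by (simp add: mvar_def mult_single flip: single_add)
  finally show ?case .
qed simp

lemma mconst_mult_single: "mconst c * Poly_Mapping.single m d = Poly_Mapping.single m (c * d :: 'v::comm_ring_1)"
  by (simp add: mconst_def mult_single)

lemma lookup_mconst_mult: "lkp (mconst c * p) m = c * lkp p (m :: nat \<Rightarrow>\<^sub>0 nat)" for c :: "'v::comm_ring_1"
proof -
  have "mconst c * p = (\<Sum>m\<in>Poly_Mapping.keys p. Poly_Mapping.single m (c * lkp p m))"
    by (subst (1) mpol_expand[of p, symmetric]) (simp add: sum_distrib_left mconst_mult_single)
  then show ?thesis by (simp add: lookup_sum lookup_single when_def sum.delta in_keys_iff)
qed

lemma lookup_mvar_mult: "lkp (mvar a * p) m =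
    (if lkp m a = 0 then 0 else lkp p (m - Poly_Mapping.single a 1))" for p :: "'v::comm_ring_1 mpol"
proof -
  have e: "Poly_Mapping.single a (1::nat) + k = m \<longleftrightarrow> lkp m a \<noteq> 0 \<and> k = m - Poly_Mapping.single a 1" for k
  proof
    assume "Poly_Mapping.single a (1::nat) + k = m"
    then show "lkp m a \<noteq> 0 \<and> k = m - Poly_Mapping.single a 1"
      by (auto simp: lookup_add)
  next
    assume "lkp m a \<noteq> 0 \<and> k = m - Poly_Mapping.single a 1"
    then show "Poly_Mapping.single a (1::nat) + k = m"
      by (intro poly_mapping_eqI) (auto simp: lookup_add lookup_minus lookup_single when_def)
  qed
  have "mvar a * p = (\<Sum>k\<in>Poly_Mapping.keys p. Poly_Mapping.single (Poly_Mapping.single a 1 + k) (lkp p k))"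
    by (subst (1) mpol_expand[of p, symmetric]) (simp add: sum_distrib_left mvar_def mult_single)
  then have "lkp (mvar a * p) m = (\<Sum>k\<in>Poly_Mapping.keys p. if Poly_Mapping.single a 1 + k = m then lkp p k else 0)"
    by (simp only: lookup_sum lookup_single when_def)
  also have "\<dots> = (\<Sum>k\<in>Poly_Mapping.keys p. if k = m - Poly_Mapping.single a 1 then
      (if lkp m a \<noteq> 0 then lkp p k else 0) else 0)"
    by (intro sum.cong refl) (simp only: e split: if_split, blast)
  finally show ?thesis by (simp add: sum.delta in_keys_iff)
qed

section \<open>Renaming of variables\<close>

definition ren :: "(nat \<Rightarrow> nat) \<Rightarrow> (nat \<Rightarrow>\<^sub>0 nat) \<Rightarrow> (nat \<Rightarrow>\<^sub>0 nat)" where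
  "ren s m = (\<Sum>a\<in>Poly_Mapping.keys m. Poly_Mapping.single (s a) (lkp m a))"

lemma lookup_ren: "inj s \<Longrightarrow> lkp (ren s m) (s a) = lkp m a"
  by (simp add: ren_def lookup_sum lookup_single when_def inj_eq sum.delta in_keys_iff)

lemma keys_ren: "Poly_Mapping.keys (ren s m) \<subseteq> s ` Poly_Mapping.keys m"
proof
  fix c assume "c \<in> Poly_Mapping.keys (ren s m)"
  then have "lkp (ren s m) c \<noteq> 0" by (simp add: in_keys_iff)
  then obtain a where "a \<in> Poly_Mapping.keys m" "(if s a = c then lkp m a else 0) \<noteq> 0"
    unfolding ren_def lookup_sum lookup_single when_def by (rule sum.not_neutral_contains_not_neutral)
  then show "c \<in> s ` Poly_Mapping.keys m" by (metis image_eqI)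
qed

lemma ren_inj:
  assumes "inj s" "ren s m = ren s m'" shows "m = m'"
proof (rule poly_mapping_eqI)
  show "lkp m a = lkp m' a" for a
    using arg_cong[OF assms(2), of "\<lambda>m. lkp m (s a)"] by (simp add: lookup_ren[OF assms(1)])
qed

lemma ren_vmon:
  assumes s: "inj s" and t: "inj_on t {..<length ms}" shows "ren s (vmon t ms) = vmon (s \<circ> t) ms"
proof (rule poly_mapping_eqI)
  fix c
  have st: "inj_on (s \<circ> t) {..<length ms}" using s t by (meson comp_inj_on inj_on_subset subset_UNIV)
  show "lkp (ren s (vmon t ms)) c = lkp (vmon (s \<circ> t) ms) c"
  proof (cases "c \<in> (s \<circ> t) ` {..<length ms}")
    case True
    then obtain b where b: "b < length ms" "c = s (t b)" by auto
    then show ?thesis using lookup_vmon[OF st b(1)] lookup_vmon[OF t b(1)] by (simp add: lookup_ren[OF s])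
  next
    case False
    then have "c \<notin> Poly_Mapping.keys (vmon (s \<circ> t) ms)" "c \<notin> Poly_Mapping.keys (ren s (vmon t ms))"
      using keys_vmon[of "s \<circ> t" ms] keys_ren[of s "vmon t ms"] keys_vmon[of t ms] by fastforce+
    then show ?thesis by (simp add: in_keys_iff)
  qed
qed

lemma mrename_eq: "mrename s p = (\<Sum>m\<in>Poly_Mapping.keys p. Poly_Mapping.single (ren s m) (lkp p m))"
proof -
  have "(\<Prod>a\<in>A. mvar (s a) ^ f a) = Poly_Mapping.single (\<Sum>a\<in>A. Poly_Mapping.single (s a) (f a)) (1::'a)"
    if "finite A" for A f
    using that by (induction A rule: finite_induct) (auto simp: mvar_power mult_single)
  then show ?thesis by (simp add: mrename_def ren_def mconst_mult_single)
qed

lemma lookup_mrename: "inj s \<Longrightarrow> lkp (mrename s p) (ren s m) = lkp p m"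
proof -
  assume s: "inj s"
  have "lkp (mrename s p) (ren s m) = (\<Sum>k\<in>Poly_Mapping.keys p. if k = m then lkp p k else 0)"
    unfolding mrename_eq lookup_sum lookup_single when_def
    by (intro sum.cong refl) (use ren_inj[OF s] in metis)
  then show ?thesis by (simp add: in_keys_iff)
qed

lemma lookup_mrename_vmon:
  assumes "inj s" "inj_on t {..<length ms}"
  shows "lkp (mrename s p) (vmon (s \<circ> t) ms) = lkp p (vmon t ms)"
  using lookup_mrename[OF assms(1)] ren_vmon[OF assms] by metis

lemma in_vars_mrename: "in_vars U p \<Longrightarrow> in_vars (s ` U) (mrename s p)"
  unfolding mrename_eq
  by (intro in_vars_sum in_vars_single) (metis image_mono in_vars_keys keys_ren subset_trans)

lemma vmon_permute:
  assumes "s permutes {..<length ms}" shows "vmon s (permute_list s ms) = vmon id ms"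
proof -
  have "vmon s (permute_list s ms) = (\<Sum>b<length ms. Poly_Mapping.single (s b) (ms ! s b))"
    unfolding vmon_def by (intro sum.cong) (simp_all add: permute_list_nth[OF assms])
  also have "\<dots> = vmon id ms"
    unfolding vmon_def using sum.permute[OF assms, of "\<lambda>b. Poly_Mapping.single b (ms ! b)"] by (simp add: o_def)
  finally show ?thesis .
qed

lemma lookup_mrename_permute:
  assumes "s permutes {..<length ms}"
  shows "lkp (mrename s p) (vmon id ms) = lkp p (vmon id (permute_list s ms))"
  using lookup_mrename_vmon[of s id "permute_list s ms" p] permutes_inj[OF assms] vmon_permute[OF assms] by simp

lemma lookup_sign_mult: "lkp ((-1) ^ n * p) m = (-1) ^ n * lkp (p :: 'v::comm_ring_1 mpol) m"
  by (cases "even n") auto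

lemma lookup_sgn_mult: "lkp (of_int (sign s) * p) m = of_int (sign s) * lkp (p :: 'v::comm_ring_1 mpol) m"
  by (cases s rule: sign_cases) auto

section \<open>Arrays as forms\<close>

definition coef :: "('i, 'v::zero) arr \<Rightarrow> ('i \<times> nat) list \<Rightarrow> 'v" where
  "coef P xs = lkp (P (map fst xs)) (vmon id (map snd xs))"

lemma coef_zip: "length is = length ms \<Longrightarrow> coef P (zip is ms) = lkp (P is) (vmon id ms)"
  by (simp add: coef_def)

lemma split_two:
  assumes "a < b" "b < length xs"
  obtains as x bs y cs where "xs = as @ x # bs @ y # cs" "a = length as" "b = Suc (length as + length bs)"
proof -
  have 1: "xs = take a xs @ xs ! a # drop (Suc a) xs" using assms by (simp add: id_take_nth_drop)
  have 2: "drop (Suc a) xs = take (b - Suc a) (drop (Suc a) xs) @ xs ! b # drop (Suc b) xs"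
    using assms id_take_nth_drop[of "b - Suc a" "drop (Suc a) xs"] by simp
  show thesis
  proof (rule that)
    show "xs = take a xs @ xs ! a # take (b - Suc a) (drop (Suc a) xs) @ xs ! b # drop (Suc b) xs"
      using 1 2 by simp
  qed (use assms in auto)
qed

lemma alt_transpose:
  assumes A: "alt A" and "a < b" "b < length xs"
  shows "A (permute_list (Transposition.transpose a b) xs) = - (A xs :: 'w::comm_ring_1)"
proof -
  obtain as x bs y cs where e: "xs = as @ x # bs @ y # cs" "a = length as" "b = Suc (length as + length bs)"
    using split_two[OF assms(2,3)] by metis
  have "permute_list (Transposition.transpose a b) xs = as @ y # bs @ x # cs"
  proof (rule nth_equalityI)
    fix i assume "i < length (permute_list (Transposition.transpose a b) xs)"
    then have i: "i < length xs" by simp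
    have p: "Transposition.transpose a b permutes {..<length xs}"
      using assms by (intro permutes_swap_id) auto
    consider "i < a" | "i = a" | "a < i" "i < b" | "i = b" | "i > b" by linarith
    then show "permute_list (Transposition.transpose a b) xs ! i = (as @ y # bs @ x # cs) ! i"
      unfolding permute_list_nth[OF p i]
      by cases (auto simp: e nth_append nth_Cons' Transposition.transpose_def)
  qed (simp add: e)
  then show ?thesis using alt_swap_gen[OF A, of as y bs x cs] e(1) by simp
qed

lemma alt_permute:
  assumes A: "alt A" and s: "s permutes {..<length xs}"
  shows "A (permute_list s xs) = of_int (sign s) * (A xs :: 'w::comm_ring_1)"
proof -
  \<comment> \<open>Stated for all words of this length, because splitting off a transposition
    changes the word.\<close>
  have "\<forall>ys. length ys = length xs \<longrightarrow> A (permute_list s ys) = of_int (sign s) * A ys"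
    using s finite_lessThan
  proof (induction s rule: permutes_induct)
    case id then show ?case by (simp add: sign_id)
  next
    case (swap a b p)
    let ?t = "Transposition.transpose a b"
    show ?case
    proof (intro allI impI)
      fix ys :: "'a list" assume l: "length ys = length xs"
      have "A (permute_list (?t \<circ> p) ys) = A (permute_list p (permute_list ?t ys))"
        using swap l by (simp add: permute_list_compose)
      also have "\<dots> = of_int (sign p) * A (permute_list ?t ys)" using swap.IH l by simp
      also have "A (permute_list ?t ys) = - A ys"
        using alt_transpose[OF A, of a b ys] alt_transpose[OF A, of b a ys] swap.hyps l
        by (cases a b rule: linorder_cases) (auto simp: transpose_commute)
      also have "of_int (sign p) * - A ys = of_int (sign (?t \<circ> p)) * A ys"
        using swap by (simp add: sign_compose permutes_imp_permutation[of "{..<length xs}"]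
            permutation_swap_id sign_swap_id)
      finally show "A (permute_list (?t \<circ> p) ys) = of_int (sign (?t \<circ> p)) * A ys" .
    qed
  qed
  then show ?thesis by simp
qed

lemma coef_eqI:
  assumes "\<And>is. length is \<noteq> k \<Longrightarrow> P is = 0" "\<And>is. length is \<noteq> k \<Longrightarrow> Q is = 0"
    "\<And>is. in_vars {..<k} (P is)" "\<And>is. in_vars {..<k} (Q is)"
    "\<And>xs. length xs = k \<Longrightarrow> coef P xs = coef Q xs"
  shows "P = Q"
proof
  fix "is"
  show "P is = Q is"
  proof (cases "length is = k")
    case True
    show ?thesis
    proof (rule mpol_eqI[OF assms(3,4)])
      fix ms :: "nat list" assume "length ms = k"
      then show "lkp (P is) (vmon id ms) = lkp (Q is) (vmon id ms)"
        using assms(5)[of "zip is ms"] True by (simp add: coef_zip)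
    qed
  qed (use assms in auto)
qed

context diff_complex
begin

lemma finite_support_array:
  assumes "homog k A" and "fsupp A" shows "finite {ms. A (zip is ms) \<noteq> 0 \<and> length is = length ms}"
proof -
  have "{ms. A (zip is ms) \<noteq> 0 \<and> length is = length ms} \<subseteq> map snd ` {xs. A xs \<noteq> 0}"
    by (force simp: image_iff intro: exI[of _ "zip is _"])
  then show ?thesis using finite_homog_support[OF assms] finite_subset by blast
qed

text \<open>Permuting indices and variables together means permuting the letters of a word. Finite
  support holds because there are finitely many index lists and every entry is a polynomial.\<close>

lemma Omega_iff:
  fixes P :: "('i, 'v) arr"
  shows "P \<in> Omega k \<longleftrightarrow> (\<forall>is. length is \<noteq> k \<longrightarrow> P is = 0) \<and> (\<forall>is. in_vars {..<k} (P is)) \<and> form k (coef P)"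
proof -
  let ?B = "(\<forall>is. length is \<noteq> k \<longrightarrow> P is = 0) \<and> (\<forall>is. in_vars {..<k} (P is))"
  have "(\<forall>s is. s permutes {..<k} \<and> length is = k \<longrightarrow>
        mrename s (P (permute_list s is)) = of_int (sign s) * P is) \<longleftrightarrow> form k (coef P)" (is "?S \<longleftrightarrow> _") if B: ?B
  proof
    assume S: ?S
    have h: "homog k (coef P)" using B by (auto simp: homog_def coef_def)
    have perm: "coef P (permute_list s xs) = of_int (sign s) * coef P xs"
      if s: "s permutes {..<k}" and l: "length xs = k" for s xs
    proof -
      have p: "permute_list s (map f xs) = map f (permute_list s xs)" for f :: "_ \<Rightarrow> 'z"
        using s l by (simp add: permute_list_map)
      have "mrename s (P (permute_list s (map fst xs))) = of_int (sign s) * P (map fst xs)"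
        using S s l by simp
      then have "lkp (mrename s (P (permute_list s (map fst xs)))) (vmon id (map snd xs)) = of_int (sign s) * coef P xs"
        by (simp add: lookup_sgn_mult coef_def)
      then show ?thesis using s l by (simp add: lookup_mrename_permute coef_def permute_list_map)
    qed
    have "alt (coef P)"
    proof (rule altI)
      fix xs ys and x y :: "'i \<times> nat"
      let ?zs = "xs @ x # y # ys"
      show "coef P ?zs = - coef P (xs @ y # x # ys)"
      proof (cases "length ?zs = k")
        case True
        let ?t = "Transposition.transpose (length xs) (Suc (length xs))"
        have t: "?t permutes {..<length ?zs}" by (intro permutes_swap_id) auto
        have "permute_list ?t ?zs = xs @ y # x # ys"
        proof (rule nth_equalityI)
          fix i assume "i < length (permute_list ?t ?zs)"
          then have i: "i < length ?zs" by simp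
          show "permute_list ?t ?zs ! i = (xs @ y # x # ys) ! i"
            unfolding permute_list_nth[OF t i]
            by (auto simp: nth_append nth_Cons' Transposition.transpose_def)
        qed simp
        then show ?thesis using perm[of ?t ?zs] t True by (simp add: sign_swap_id)
      next
        case False
        then show ?thesis using h by (simp add: homog_def)
      qed
    qed
    moreover have "fsupp (coef P)"
    proof (rule fsuppI)
      let ?E = "\<Union>is\<in>{is :: 'i list. length is = k}. \<Union>m\<in>Poly_Mapping.keys (P is). lkp m ` {..<k}"
      have "finite {is :: 'i list. length is = k}" using finite_lists_length_eq[of "UNIV :: 'i set" k] by simp
      then show "finite ((UNIV :: 'i set) \<times> ?E)" by auto
      fix xs :: "('i \<times> nat) list" assume "\<not> set xs \<subseteq> UNIV \<times> ?E"
      then obtain x where x0: "x \<in> set xs" "x \<notin> UNIV \<times> ?E" by blast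
      then have x: "x \<in> set xs" "snd x \<notin> ?E" unfolding mem_Times_iff by blast+
      show "coef P xs = 0"
      proof (rule ccontr)
        assume nz: "coef P xs \<noteq> 0"
        then have l: "length xs = k" using h by (auto simp: homog_def)
        obtain b where b: "b < length xs" "x = xs ! b" using x(1) by (auto simp: in_set_conv_nth)
        have "vmon id (map snd xs) \<in> Poly_Mapping.keys (P (map fst xs))" using nz by (simp add: coef_def in_keys_iff)
        moreover have "lkp (vmon id (map snd xs)) b = snd x" using lookup_vmon[of id "map snd xs" b] b by simp
        ultimately have "snd x \<in> ?E" using l b by force
        then show False using x by simp
      qed
    qed
    ultimately show "form k (coef P)" using h by (simp add: form_def)
  next
    assume f: "form k (coef P)"
    show ?S
    proof (intro allI impI, elim conjE)
      fix s and "is" :: "'i list" assume s: "s permutes {..<k}" and l: "length is = k"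
      show "mrename s (P (permute_list s is)) = of_int (sign s) * P is"
      proof (rule mpol_eqI[of k])
        show "in_vars {..<k} (mrename s (P (permute_list s is)))"
          using in_vars_mrename[of "{..<k}" "P (permute_list s is)" s] B permutes_image[OF s] by auto
        show "in_vars {..<k} (of_int (sign s) * P is)"
          using B in_vars_minus by (cases s rule: sign_cases) auto
        fix ms :: "nat list" assume ml: "length ms = k"
        have "lkp (mrename s (P (permute_list s is))) (vmon id ms) = coef P (permute_list s (zip is ms))"
          using s l ml by (simp add: lookup_mrename_permute coef_def flip: permute_list_map)
        also have "\<dots> = of_int (sign s) * coef P (zip is ms)"
          using f s l ml by (intro alt_permute) (auto simp: form_def)
        finally show "lkp (mrename s (P (permute_list s is))) (vmon id ms) = lkp (of_int (sign s) * P is) (vmon id ms)"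
          using l ml by (simp add: lookup_sgn_mult coef_zip)
      qed
    qed
  qed
  then show ?thesis unfolding Omega_def in_vars_keys by auto
qed

lemma Omega_coef_eqI: "P \<in> Omega k \<Longrightarrow> Q \<in> Omega k \<Longrightarrow> coef P = coef Q \<Longrightarrow> P = Q" for P Q :: "('i, 'v) arr"
  by (rule coef_eqI[of k]) (auto simp: Omega_iff)

text \<open>The inverse of \<open>coef\<close> on forms of degree k; the sum is finite by
  \<open>finite_support_array\<close>.\<close>

definition arr_of :: "nat \<Rightarrow> (('i \<times> nat) list \<Rightarrow> 'v) \<Rightarrow> ('i, 'v) arr" where
  "arr_of k A is = (if length is = k then
     \<Sum>ms\<in>{ms. A (zip is ms) \<noteq> 0 \<and> length is = length ms}. Poly_Mapping.single (vmon id ms) (A (zip is ms)) else 0)"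

lemma coef_arr_of:
  assumes "form k A" shows "coef (arr_of k A) = A"
proof
  have h: "homog k A" "fsupp A" using assms by (auto simp: form_def)
  fix xs
  show "coef (arr_of k A) xs = A xs"
  proof (cases "length xs = k")
    case True
    let ?is = "map fst xs"
    have "coef (arr_of k A) xs = (\<Sum>ms\<in>{ms. A (zip ?is ms) \<noteq> 0 \<and> length ?is = length ms}.
        if ms = map snd xs then A (zip ?is ms) else 0)"
      using True vmon_inj[of id "length xs" _ "map snd xs"]
      by (auto simp: coef_def arr_of_def lookup_sum lookup_single when_def intro!: sum.cong)
    also have "\<dots> = A xs"
      by (subst sum.delta[OF finite_support_array[OF h]]) (auto simp: zip_map_fst_snd)
    finally show ?thesis .
  next
    case False
    then show ?thesis using h by (simp add: coef_def arr_of_def homog_def)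
  qed
qed

lemma arr_of_Omega: assumes "form k A" shows "arr_of k A \<in> Omega k"
  unfolding Omega_iff
proof (intro conjI allI)
  show "length is \<noteq> k \<longrightarrow> arr_of k A is = 0" for "is" by (simp add: arr_of_def)
  show "in_vars {..<k} (arr_of k A is)" for "is"
  proof -
    have kk: "Poly_Mapping.keys (vmon id ms) \<subseteq> {..<length ms}" for ms using keys_vmon[of id ms] by simp
    show ?thesis unfolding arr_of_def
      by (cases "length is = k") (auto intro!: in_vars_sum in_vars_single dest!: subsetD[OF kk])
  qed
  show "form k (coef (arr_of k A))" using assms by (simp add: coef_arr_of)
qed

lemma coef_add: "coef (P + Q) = coef P + coef Q" for P Q :: "('i, 'v) arr"
  by (simp add: coef_def fun_eq_iff lookup_add)

lemma coef_diff: "coef (P - Q) = coef P - coef Q" for P Q :: "('i, 'v) arr"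
  by (simp add: coef_def fun_eq_iff lookup_minus)

lemma coef_0: "coef 0 = 0"
  by (simp add: coef_def fun_eq_iff)

lemma Omega_0: "(0 :: ('i, 'v) arr) \<in> Omega k"
  by (simp add: Omega_iff coef_0 form_0)

lemma Omega_add: "P \<in> Omega k \<Longrightarrow> Q \<in> Omega k \<Longrightarrow> P + Q \<in> Omega k" for P Q :: "('i, 'v) arr"
  by (simp add: Omega_iff coef_add form_add in_vars_add)

lemma Omega_diff: "P \<in> Omega k \<Longrightarrow> Q \<in> Omega k \<Longrightarrow> P - Q \<in> Omega k" for P Q :: "('i, 'v) arr"
  by (simp add: Omega_iff coef_diff form_diff in_vars_diff)

lemma coef_smult: "coef (arr_smult f P) = (*) f \<circ> coef P"
  by (simp add: coef_def arr_smult_def fun_eq_iff lookup_mconst_mult)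

lemma form_comp: "additive_map f \<Longrightarrow> form k A \<Longrightarrow> form k (f \<circ> A)"
  by (simp add: form_def homog_comp alt_comp fsupp_comp additive_map_0)

lemma additive_scale: "additive_map ((*) (c :: 'w::comm_ring_1))"
  by (simp add: additive_map_def distrib_left)

lemma Omega_smult: "P \<in> Omega k \<Longrightarrow> arr_smult f P \<in> Omega k" for P :: "('i, 'v) arr"
  by (simp add: Omega_iff coef_smult form_comp additive_scale)
     (simp add: arr_smult_def in_vars_mult in_vars_mconst)

lemma dl_explicit:
  assumes a: "\<And>x. additive_map (D x)"
  shows "dl D A xs = (\<Sum>a<length xs. (-1) ^ a * D (xs ! a) (A (take a xs @ drop (Suc a) xs)))"
proof (induction xs arbitrary: A)
  case (Cons x xs)
  have IH: "dl D A xs = (\<Sum>a<length xs. (-1) ^ a * D (xs ! a) (A (take a xs @ drop (Suc a) xs)))" for A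
    by (rule Cons.IH)
  show "dl D A (x # xs) = (\<Sum>a<length (x # xs). (-1) ^ a * D ((x # xs) ! a) (A (take a (x # xs) @ drop (Suc a) (x # xs))))"
    by (simp add: IH sum.lessThan_Suc_shift contr_apply sum_negf del: sum.lessThan_Suc)
qed simp

lemma dhat_explicit:
  assumes a: "additive_map d"
  shows "dhat d A xs = d (A xs) +
    (\<Sum>a<length xs. if snd (xs ! a) = 0 then 0 else A (xs[a := (fst (xs ! a), snd (xs ! a) - 1)]))"
proof (induction xs arbitrary: A)
  case (Cons x xs)
  have IH: "dhat d A xs = d (A xs) +
    (\<Sum>a<length xs. if snd (xs ! a) = 0 then 0 else A (xs[a := (fst (xs ! a), snd (xs ! a) - 1)]))" for A
    by (rule Cons.IH)
  show "dhat d A (x # xs) = d (A (x # xs)) +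
    (\<Sum>a<length (x # xs). if snd ((x # xs) ! a) = 0 then 0 else
       A ((x # xs)[a := (fst ((x # xs) ! a), snd ((x # xs) ! a) - 1)]))"
    by (simp add: IH sum.lessThan_Suc_shift contr_apply del: sum.lessThan_Suc cong: if_cong)
qed simp

lemma vmon_dec:
  assumes "inj_on t {..<length ms}" "a < length ms"
  shows "vmon t ms - Poly_Mapping.single (t a) 1 = vmon t (ms[a := ms ! a - 1])"
proof (rule poly_mapping_eqI)
  fix c
  have i: "inj_on t {..<length (ms[a := ms ! a - 1])}" using assms by simp
  show "lkp (vmon t ms - Poly_Mapping.single (t a) 1) c = lkp (vmon t (ms[a := ms ! a - 1])) c"
  proof (cases "c \<in> t ` {..<length ms}")
    case True
    then obtain b where b: "b < length ms" "c = t b" by auto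
    then show ?thesis
      using lookup_vmon[OF assms(1) b(1)] lookup_vmon[OF i, of b] assms
      by (auto simp: lookup_minus lookup_single when_def inj_on_eq_iff[OF assms(1)] nth_list_update)
  next
    case False
    then have "c \<notin> Poly_Mapping.keys (vmon t ms)" "c \<notin> Poly_Mapping.keys (vmon t (ms[a := ms ! a - 1]))"
      using keys_vmon[of t ms] keys_vmon[of t "ms[a := ms ! a - 1]"] by auto
    then show ?thesis by (simp add: in_keys_iff lookup_minus)
  qed
qed

lemma coef_der: "coef (arr_der dv P) xs = dhat dv (coef P) xs"
proof -
  let ?p = "P (map fst xs)" and ?ms = "map snd xs"
  have e: "vmon id ?ms - Poly_Mapping.single a 1 = vmon id (map snd (xs[a := (fst (xs ! a), snd (xs ! a) - 1)]))"
    if "a < length xs" for a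
    using vmon_dec[of id ?ms a] that by (simp add: map_update del: One_nat_def)
  have f: "map fst (xs[a := (fst (xs ! a), m)]) = map fst xs" for a m
    by (metis list_update_id map_update fst_conv list_update_beyond nth_map not_le)
  have l: "lkp (vmon id ?ms) a = snd (xs ! a)" if "a < length xs" for a
    using lookup_vmon[of id ?ms a] that by simp
  have "coef (arr_der dv P) xs = dv (coef P xs) + (\<Sum>a<length xs. lkp (mvar a * ?p) (vmon id ?ms))"
    by (simp add: coef_def arr_der_def lookup_add lookup_cmap dv_simps sum_distrib_right lookup_sum)
  also have "(\<Sum>a<length xs. lkp (mvar a * ?p) (vmon id ?ms)) = (\<Sum>a<length xs. if snd (xs ! a) = 0 then 0 else
      coef P (xs[a := (fst (xs ! a), snd (xs ! a) - 1)]))"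
    by (intro sum.cong refl) (simp add: lookup_mvar_mult l e coef_def f del: One_nat_def)
  finally show ?thesis by (simp add: dhat_explicit[OF additive_dv])
qed

lemma form_dhat: "form k A \<Longrightarrow> form k (dhat dv A)"
  by (simp add: form_def homog_dhat alt_dhat fsupp_dhat additive_dv)

lemma Omega_der: "P \<in> Omega k \<Longrightarrow> arr_der dv P \<in> Omega k" for P :: "('i, 'v) arr"
proof -
  assume P: "P \<in> Omega k"
  have c: "coef (arr_der dv P) = dhat dv (coef P)" by (rule ext) (rule coef_der)
  show ?thesis using P unfolding Omega_iff c
  proof (intro conjI allI)
    fix "is" :: "'i list"
    show "length is \<noteq> k \<longrightarrow> arr_der dv P is = 0" using P by (auto simp: arr_der_def Omega_iff cmap_0)
    show "in_vars {..<k} (arr_der dv P is)"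
    proof (cases "length is = k")
      case True
      then show ?thesis unfolding arr_der_def using P
        by (auto simp: Omega_iff dv_simps intro!: in_vars_intros in_vars_cmap)
    next
      case False
      then show ?thesis using P by (auto simp: arr_der_def Omega_iff cmap_0)
    qed
  qed (auto simp: form_dhat)
qed

subsection \<open>The differential\<close>

text \<open>The renaming by which the remaining variables make room for \<lambda>_a.\<close>

definition shift :: "nat \<Rightarrow> nat \<Rightarrow> nat" where
  "shift a = (\<lambda>b. if b < a then b else Suc b)"

lemma inj_shift: "inj (shift a)"
  by (auto simp: inj_def shift_def split: if_splits)

lemma vmon_split:
  assumes a: "a < length ms"
  shows "vmon id ms = vmon (shift a) (take a ms @ drop (Suc a) ms) + Poly_Mapping.single a (ms ! a)"
proof (rule poly_mapping_eqI)
  fix c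
  let ?ns = "take a ms @ drop (Suc a) ms"
  have i: "inj_on (shift a) {..<length ?ns}" using inj_shift inj_on_subset by blast
  show "lkp (vmon id ms) c = lkp (vmon (shift a) ?ns + Poly_Mapping.single a (ms ! a)) c"
  proof (cases "c = a")
    case True
    have "a \<notin> Poly_Mapping.keys (vmon (shift a) ?ns)"
      using keys_vmon[of "shift a" ?ns] by (auto simp: shift_def split: if_splits)
    then show ?thesis using lookup_vmon[of id ms a] a True by (simp add: lookup_add in_keys_iff)
  next
    case False
    define b where "b = (if c < a then c else c - 1)"
    have c: "c = shift a b" using False by (auto simp: b_def shift_def)
    show ?thesis
    proof (cases "c < length ms")
      case True
      then have b: "b < length ?ns" using a False by (auto simp: b_def)
      have "?ns ! b = ms ! c" using a False True by (auto simp: b_def nth_append)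
      then show ?thesis using lookup_vmon[OF i b] lookup_vmon[of id ms c] True False c
        by (simp add: lookup_add lookup_single when_def)
    next
      case False
      have "c \<notin> Poly_Mapping.keys (vmon id ms)" "c \<notin> Poly_Mapping.keys (vmon (shift a) ?ns)"
        using keys_vmon[of id ms] keys_vmon[of "shift a" ?ns] False a
        by (auto simp: shift_def split: if_splits)
      then show ?thesis using False a by (simp add: lookup_add in_keys_iff lookup_single when_def)
    qed
  qed
qed

lemma symbol_lookup:
  "lkp (((\<lambda>p. mvar a * p + cmap dv p) ^^ n) (Ksym K N j i a)) (Poly_Mapping.single a r) = coeff (dsym n j i) r"
proof (induction n arbitrary: r)
  case 0
  have "lkp (mconst c * mvar a ^ t) (Poly_Mapping.single a r) = (if t = r then c else 0)" for c :: 'v and t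
    by (auto simp: mvar_power mconst_mult_single lookup_single when_def dest: arg_cong[of _ _ "\<lambda>m. lkp m a"])
  then show ?case by (simp add: Ksym_def lookup_sum coeff_Kpoly)
next
  case (Suc n)
  have "Poly_Mapping.single a r - Poly_Mapping.single a (1::nat) = Poly_Mapping.single a (r - 1)"
    by (simp flip: single_diff)
  then show ?case using Suc
    by (simp add: lookup_add lookup_mvar_mult lookup_cmap dv_simps dsym_Suc coeff_lamdv)
qed

lemma symbol_vars: "in_vars {a} (((\<lambda>p. mvar a * p + cmap dv p) ^^ n) (Ksym K N j i a))"
proof (induction n)
  case 0
  then show ?case by (auto simp: Ksym_def intro!: in_vars_intros)
next
  case (Suc n)
  then show ?case by (auto intro!: in_vars_intros in_vars_cmap simp: dv_simps)
qed

text \<open>Replaces the sum over all (j, n) by a finite one, with a bound that serves all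
  coefficients of p at once and does not depend on the second factor.\<close>

lemma delta_summand:
  obtains M where "\<And>m. order_lt M (lkp p m)" and
    "\<And>Q. (\<Sum>(j, n). mrename s (cmap (pd j n) p) * Q j n) = (\<Sum>j\<in>UNIV. \<Sum>n<M. mrename s (cmap (pd j n) p) * Q j n)"
proof -
  obtain M where M: "\<forall>f\<in>insert 0 (lkp p ` Poly_Mapping.keys p). order_lt M f"
    using order_lt_finite[of "insert 0 (lkp p ` Poly_Mapping.keys p)"] by auto
  have ord: "order_lt M (lkp p m)" for m
    using M by (cases "m \<in> Poly_Mapping.keys p") (auto simp: in_keys_iff)
  have z: "mrename s (cmap (pd j n) p) = 0" if "n \<ge> M" for j n
  proof -
    have "cmap (pd j n) p = 0"
      by (rule poly_mapping_eqI) (simp add: lookup_cmap pd_simps order_ltD[OF ord that])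
    then show ?thesis by (simp add: mrename_def)
  qed
  have "(\<Sum>(j, n). mrename s (cmap (pd j n) p) * Q j n) = (\<Sum>j\<in>UNIV. \<Sum>n<M. mrename s (cmap (pd j n) p) * Q j n)" for Q
    by (subst Sum_any.expand_superset[of "UNIV \<times> {..<M}"])
       (auto simp: sum.cartesian_product not_le[symmetric] z)
  then show thesis using ord that by blast
qed

text \<open>In summand a, one factor avoids \<lambda>_a and the symbol contains only \<lambda>_a.
  Coefficients of the product therefore factor, and the sum over (j, n) becomes the derivation at
  letter a.\<close>

lemma coef_delta:
  assumes P: "P \<in> Omega k" shows "coef (delta dv pd K N P) = dl Dx (coef P)"
proof
  fix xs :: "('i \<times> nat) list"
  let ?is = "map fst xs" and ?ms = "map snd xs"
  have pv: "in_vars {..<length js} (P js)" for js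
    using P by (cases "length js = k") (auto simp: Omega_iff)
  have trm: "lkp (\<Sum>(j, n). mrename (shift a) (cmap (pd j n) (P (take a ?is @ drop (Suc a) ?is))) *
       ((\<lambda>p. mvar a * p + cmap dv p) ^^ n) (Ksym K N j (?is ! a) a)) (vmon id ?ms) =
     Dx (xs ! a) (coef P (take a xs @ drop (Suc a) xs))" (is "lkp ?S _ = _") if a: "a < length xs" for a
  proof -
    let ?p = "P (take a ?is @ drop (Suc a) ?is)"
    let ?ns = "take a ?ms @ drop (Suc a) ?ms"
    let ?Q = "\<lambda>j n. ((\<lambda>p. mvar a * p + cmap dv p) ^^ n) (Ksym K N j (?is ! a) a)"
    obtain M where M: "\<And>m. order_lt M (lkp ?p m)" and S: "\<And>Q. (\<Sum>(j, n). mrename (shift a) (cmap (pd j n) ?p) * Q j n)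
        = (\<Sum>j\<in>UNIV. \<Sum>n<M. mrename (shift a) (cmap (pd j n) ?p) * Q j n)"
      using delta_summand[of ?p "shift a"] by blast
    have e: "lkp (mrename (shift a) (cmap (pd j n) ?p) * ?Q j n) (vmon id ?ms) =
        coeff (dsym n j (fst (xs ! a))) (snd (xs ! a)) * pd j n (lkp ?p (vmon id ?ns))" for j n
    proof -
      have 0: "vmon id ?ms = vmon (shift a) ?ns + Poly_Mapping.single a (?ms ! a)"
        using a by (intro vmon_split) simp
      have l: "length ?ns = length (take a ?is @ drop (Suc a) ?is)" by simp
      have 1: "in_vars (shift a ` {..<length ?ns}) (mrename (shift a) (cmap (pd j n) ?p))"
        unfolding l by (intro in_vars_mrename in_vars_cmap pv) (simp add: pd_simps)
      have 2: "shift a ` {..<length ?ns} \<inter> {a} = {}" by (auto simp: shift_def split: if_splits)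
      have "lkp (mrename (shift a) (cmap (pd j n) ?p)) (vmon (shift a) ?ns) = pd j n (lkp ?p (vmon id ?ns))"
        using lookup_mrename_vmon[OF inj_shift, of id ?ns a "cmap (pd j n) ?p"]
        by (simp add: lookup_cmap pd_simps)
      then show ?thesis unfolding 0
        using a by (subst lookup_mult_disjoint[OF 1 symbol_vars 2 keys_vmon])
          (auto simp: symbol_lookup mult.commute[of "pd j n _"] keys_vmon)
    qed
    have "lkp ?S (vmon id ?ms) = Dx (xs ! a) (lkp ?p (vmon id ?ns))"
      unfolding S lookup_sum e by (rule Dx_bound[OF M, symmetric])
    then show ?thesis by (simp only: coef_def map_append take_map drop_map)
  qed
  show "coef (delta dv pd K N P) xs = dl Dx (coef P) xs"
    unfolding dl_explicit[OF additive_Dx] coef_def[of "delta dv pd K N P"] delta_def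
    using trm by (simp add: lookup_sum lookup_sign_mult flip: shift_def)
qed

lemma delta_off:
  assumes "\<And>is. length is \<noteq> k \<Longrightarrow> P is = 0" "length is \<noteq> Suc k" shows "delta dv pd K N P is = 0"
  unfolding delta_def
proof (rule sum.neutral, rule ballI)
  fix a assume "a \<in> {..<length is}"
  then have "P (take a is @ drop (Suc a) is) = 0" using assms by (intro assms(1)) auto
  then show "(-1) ^ a * (\<Sum>(j, n). mrename (\<lambda>b. if b < a then b else Suc b)
                   (cmap (pd j n) (P (take a is @ drop (Suc a) is))) *
                 ((\<lambda>p. mvar a * p + cmap dv p) ^^ n) (Ksym K N j (is ! a) a)) = 0"
    by (simp add: mrename_def)
qed

lemma Omega_delta:
  assumes P: "P \<in> Omega k" shows "delta dv pd K N P \<in> Omega (Suc k)"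
  unfolding Omega_iff coef_delta[OF P]
proof (intro conjI allI impI)
  have off: "length is \<noteq> Suc k \<Longrightarrow> delta dv pd K N P is = 0" for "is"
    using P by (intro delta_off[of k]) (auto simp: Omega_iff)
  then show "length is \<noteq> Suc k \<Longrightarrow> delta dv pd K N P is = 0" for "is" .
  show "form (Suc k) (dl Dx (coef P))" using P by (simp add: Omega_iff form_dl)
  show "in_vars {..<Suc k} (delta dv pd K N P is)" for "is"
  proof (cases "length is = Suc k")
    case True
    show ?thesis unfolding delta_def
    proof (intro in_vars_sum in_vars_mult)
      fix a assume "a \<in> {..<length is}"
      then have a: "a < Suc k" using True by simp
      let ?p = "P (take a is @ drop (Suc a) is)"
      obtain M where S: "\<And>Q. (\<Sum>(j, n). mrename (shift a) (cmap (pd j n) ?p) * Q j n)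
        = (\<Sum>j\<in>UNIV. \<Sum>n<M. mrename (shift a) (cmap (pd j n) ?p) * Q j n)"
        using delta_summand[of ?p "shift a"] by blast
      have v: "in_vars {..<Suc k} (mrename (shift a) (cmap (pd j n) ?p))" for j n
      proof (rule in_vars_subset)
        show "in_vars (shift a ` {..<k}) (mrename (shift a) (cmap (pd j n) ?p))"
          using P by (intro in_vars_mrename in_vars_cmap) (auto simp: pd_simps Omega_iff)
        show "shift a ` {..<k} \<subseteq> {..<Suc k}" by (auto simp: shift_def)
      qed
      show "in_vars {..<Suc k} (\<Sum>(j, n). mrename (\<lambda>b. if b < a then b else Suc b)
                   (cmap (pd j n) (P (take a is @ drop (Suc a) is))) *
                 ((\<lambda>p. mvar a * p + cmap dv p) ^^ n) (Ksym K N j (is ! a) a))"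
        unfolding shift_def[symmetric] S
        using a by (intro in_vars_sum in_vars_mult v in_vars_subset[OF symbol_vars]) auto
    qed (intro in_vars_intros)
  qed (simp add: off)
qed

lemma delta_delta:
  assumes P: "P \<in> Omega k" shows "delta dv pd K N (delta dv pd K N P) = 0"
  by (rule Omega_coef_eqI[OF Omega_delta[OF Omega_delta[OF P]] Omega_0])
     (simp add: coef_delta[OF Omega_delta[OF P]] coef_delta[OF P] dl_dl_Dx coef_0)

end

section \<open>Cohomology and its dimension\<close>

lemma linear_iso_finsum:
  assumes M: "Module.module R M" "Module.module R M'" and h: "linear_iso R M M' h"
    and "finite I" "f \<in> I \<rightarrow> carrier M"
  shows "h (\<Oplus>\<^bsub>M\<^esub>i\<in>I. f i) = (\<Oplus>\<^bsub>M'\<^esub>i\<in>I. h (f i))"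
proof -
  interpret M: Module.module R M by fact
  interpret M': Module.module R M' by fact
  have hc: "x \<in> carrier M \<Longrightarrow> h x \<in> carrier M'" for x
    using h by (auto simp: linear_iso_def bij_betw_def)
  have ha: "x \<in> carrier M \<Longrightarrow> y \<in> carrier M \<Longrightarrow> h (x \<oplus>\<^bsub>M\<^esub> y) = h x \<oplus>\<^bsub>M'\<^esub> h y" for x y
    using h by (auto simp: linear_iso_def)
  have "h \<zero>\<^bsub>M\<^esub> \<oplus>\<^bsub>M'\<^esub> h \<zero>\<^bsub>M\<^esub> = h \<zero>\<^bsub>M\<^esub>" using ha[of "\<zero>\<^bsub>M\<^esub>" "\<zero>\<^bsub>M\<^esub>"] by simp
  then have h0: "h \<zero>\<^bsub>M\<^esub> = \<zero>\<^bsub>M'\<^esub>" using hc[of "\<zero>\<^bsub>M\<^esub>"] M'.add.l_cancel_one by force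
  show ?thesis using assms(4,5)
  proof (induction I rule: finite_induct)
    case (insert i I)
    then have "f i \<in> carrier M" "f \<in> I \<rightarrow> carrier M" by auto
    then show ?case using insert hc by (simp add: ha Pi_def)
  qed (simp add: h0)
qed

lemma has_dimension_iso:
  assumes M: "Module.module R M" "Module.module R M'" and h: "linear_iso R M M' h"
    and d: "has_dimension R M d"
  shows "has_dimension R M' d"
proof -
  interpret M: Module.module R M by fact
  obtain b where b: "b \<in> {..<d} \<rightarrow> carrier M" and
    ex: "\<And>x. x \<in> carrier M \<Longrightarrow> \<exists>!c. c \<in> {..<d} \<rightarrow>\<^sub>E carrier R \<and> x = (\<Oplus>\<^bsub>M\<^esub>i\<in>{..<d}. c i \<odot>\<^bsub>M\<^esub> b i)"
    using d by (auto simp: has_dimension_def)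
  have bij: "bij_betw h (carrier M) (carrier M')" and
    sm: "\<And>a x. a \<in> carrier R \<Longrightarrow> x \<in> carrier M \<Longrightarrow> h (a \<odot>\<^bsub>M\<^esub> x) = a \<odot>\<^bsub>M'\<^esub> h x"
    using h by (auto simp: linear_iso_def)
  have hb: "(\<lambda>i. h (b i)) \<in> {..<d} \<rightarrow> carrier M'" using b bij by (auto simp: bij_betw_def)
  have fs: "(\<lambda>i. c i \<odot>\<^bsub>M\<^esub> b i) \<in> {..<d} \<rightarrow> carrier M" if "c \<in> {..<d} \<rightarrow>\<^sub>E carrier R" for c
    using that b by (auto simp: PiE_def Pi_def)
  have sum: "(\<Oplus>\<^bsub>M'\<^esub>i\<in>{..<d}. c i \<odot>\<^bsub>M'\<^esub> h (b i)) = h (\<Oplus>\<^bsub>M\<^esub>i\<in>{..<d}. c i \<odot>\<^bsub>M\<^esub> b i)"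
    if c: "c \<in> {..<d} \<rightarrow>\<^sub>E carrier R" for c
  proof -
    interpret M': Module.module R M' by fact
    have "(\<Oplus>\<^bsub>M'\<^esub>i\<in>{..<d}. c i \<odot>\<^bsub>M'\<^esub> h (b i)) = (\<Oplus>\<^bsub>M'\<^esub>i\<in>{..<d}. h (c i \<odot>\<^bsub>M\<^esub> b i))"
      using c b hb by (intro M'.finsum_cong') (auto simp: sm PiE_def Pi_def)
    also have "\<dots> = h (\<Oplus>\<^bsub>M\<^esub>i\<in>{..<d}. c i \<odot>\<^bsub>M\<^esub> b i)"
      using linear_iso_finsum[OF M h _ fs[OF c]] by simp
    finally show ?thesis .
  qed
  show ?thesis unfolding has_dimension_def
  proof (intro bexI[OF _ hb] ballI)
    fix x' assume "x' \<in> carrier M'"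
    then obtain x where x: "x \<in> carrier M" "x' = h x" using bij by (auto simp: bij_betw_def)
    have "c \<in> {..<d} \<rightarrow>\<^sub>E carrier R \<and> x' = (\<Oplus>\<^bsub>M'\<^esub>i\<in>{..<d}. c i \<odot>\<^bsub>M'\<^esub> h (b i)) \<longleftrightarrow>
        c \<in> {..<d} \<rightarrow>\<^sub>E carrier R \<and> x = (\<Oplus>\<^bsub>M\<^esub>i\<in>{..<d}. c i \<odot>\<^bsub>M\<^esub> b i)" for c
      using sum[of c] M.finsum_closed[OF fs[of c]] x bij by (auto simp: bij_betw_def inj_on_def)
    then show "\<exists>!c. c \<in> {..<d} \<rightarrow>\<^sub>E carrier R \<and> x' = (\<Oplus>\<^bsub>M'\<^esub>i\<in>{..<d}. c i \<odot>\<^bsub>M'\<^esub> h (b i))"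
      using ex[OF x(1)] by simp
  qed
qed

subsection \<open>Exterior monomials\<close>

text \<open>The exterior product of the covectors dual to the listed letters.\<close>

fun ew :: "'x list \<Rightarrow> 'x list \<Rightarrow> 'w::comm_ring_1" where
  "ew [] = (\<lambda>ys. if ys = [] then 1 else 0)"
| "ew (x # xs) = wedge (\<lambda>ys. if ys = [x] then 1 else 0) (ew xs)"

lemma homog_ew: "homog (length xs) (ew xs)"
proof (induction xs)
  case (Cons x xs)
  have "homog (1 + length xs) (wedge (\<lambda>ys. if ys = [x] then 1 else 0) (ew xs) :: 'a list \<Rightarrow> 'b)"
    by (rule homog_wedge[OF _ Cons]) (auto simp: homog_def)
  then show ?case by simp
qed (auto simp: homog_def)

lemma alt_ew: "alt (ew xs)"
proof (induction xs)
  case (Cons x xs)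
  have "alt (\<lambda>ys. if ys = [x] then 1 else (0 :: 'b))" by (auto simp: alt_def)
  then show ?case using Cons by (simp add: alt_wedge)
qed (simp add: alt_def)

lemma wedge_unit: "wedge (\<lambda>ys. if ys = [] then 1 else 0) B = B"
proof
  fix xs show "wedge (\<lambda>ys. if ys = [] then 1 else 0) B xs = B xs"
  proof (induction xs arbitrary: B)
    case (Cons x xs)
    have c: "contr x (\<lambda>ys. if ys = [] then 1 else 0) = (0 :: 'a list \<Rightarrow> 'b)"
      by (simp add: contr_def fun_eq_iff)
    have s: "signed (\<lambda>ys. if ys = [] then 1 else 0) = (\<lambda>ys::'a list. if ys = [] then 1 else (0::'b))"
      by (auto simp: signed_def fun_eq_iff)
    have IH: "wedge (\<lambda>ys. if ys = [] then 1 else 0) B xs = B xs" for B :: "'a list \<Rightarrow> 'b" by (rule Cons.IH)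
    show "wedge (\<lambda>ys. if ys = [] then 1 else 0) B (x # xs) = B (x # xs)"
      by (simp only: wedge.simps c s IH contr_apply wedge_0 zero_fun_apply add_0)
  qed simp
qed

lemma wedge_vanish:
  "(\<And>xs. \<not> set xs \<subseteq> X \<Longrightarrow> A xs = 0) \<Longrightarrow> (\<And>xs. \<not> set xs \<subseteq> X \<Longrightarrow> B xs = 0) \<Longrightarrow>
      \<not> set xs \<subseteq> X \<Longrightarrow> wedge A B xs = 0"
proof (induction xs arbitrary: A B)
  case (Cons x xs)
  show ?case
  proof (cases "x \<in> X")
    case True
    then show ?thesis using Cons by (simp add: contr_apply signed_def)
  next
    case False
    then have "contr x A = 0" "contr x B = 0" using Cons.prems by (auto simp: contr_def fun_eq_iff)
    then show ?thesis by simp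
  qed
qed simp

lemma ew_vanish: "\<not> set ys \<subseteq> set xs \<Longrightarrow> ew xs ys = 0"
proof (induction xs arbitrary: ys)
  case (Cons x xs)
  show ?case unfolding ew.simps
    by (rule wedge_vanish[of "set (x # xs)"]) (use Cons in auto)
qed auto

lemma ew_diag: "distinct xs \<Longrightarrow> ew xs xs = 1"
proof (induction xs)
  case (Cons x xs)
  have "contr x (ew xs) = (0 :: 'a list \<Rightarrow> 'b)"
    using Cons.prems by (auto simp: contr_def fun_eq_iff intro!: ew_vanish)
  moreover have "contr x (\<lambda>ys. if ys = [x] then 1 else 0) = (\<lambda>ys::'a list. if ys = [] then 1 else (0::'b))"
    by (auto simp: contr_def fun_eq_iff)
  ultimately show ?case using Cons by (simp add: wedge_unit)
qed simp

context diff_complex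
begin

lemma wedge_qc: "(\<And>xs. A xs \<in> \<F>) \<Longrightarrow> (\<And>xs. B xs \<in> \<F>) \<Longrightarrow> wedge A B xs \<in> \<F>"
proof (induction xs arbitrary: A B)
  case (Cons x xs)
  have "signed A ys \<in> \<F>" for ys
    using Cons.prems(1)[of ys] by (cases "even (length ys)") (auto simp: signed_def qc_minus)
  then show ?case using Cons by (auto simp: contr_apply intro!: qc_add)
qed (auto intro: qc_mult)

lemma ew_qc: "ew xs ys \<in> \<F>"
  by (induction xs arbitrary: ys) (auto intro!: wedge_qc simp: qc_0 qc_1)

lemma form_ew: "form (length xs) (ew xs)"
  unfolding form_def by (intro conjI homog_ew alt_ew fsuppI[of "set xs"] ew_vanish) simp

lemma small_ew: "(\<And>x. x \<in> set xs \<Longrightarrow> snd x < N) \<Longrightarrow> small (ew xs)"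
  using ew_qc ew_vanish[of _ xs] unfolding small_def by (meson not_le subsetD)

subsection \<open>Cocycles, coboundaries and classes\<close>

abbreviation "Z \<equiv> cocycles dv pd K N"
abbreviation "B \<equiv> coboundaries dv pd K N"
abbreviation "cls \<equiv> coh_class dv pd K N"

lemma cocycle_iff: "P \<in> Z k \<longleftrightarrow> P \<in> Omega k \<and> dl Dx (coef P) = 0"
proof -
  have "delta dv pd K N P = 0 \<longleftrightarrow> dl Dx (coef P) = 0" if P: "P \<in> Omega k"
    using coef_delta[OF P] Omega_coef_eqI[OF Omega_delta[OF P] Omega_0] coef_0 by metis
  then show ?thesis by (auto simp: cocycles_def)
qed

text \<open>With \<open>prev_form\<close> degree 0 needs no separate treatment later: its only
  primitive is 0.\<close>

lemma coboundary_iff: "P \<in> B k \<longleftrightarrow> P \<in> Omega k \<and> (\<exists>\<gamma>. prev_form k \<gamma> \<and> coef P = dl Dx \<gamma>)"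
proof (cases k)
  case 0
  have "P = 0" if "P \<in> Omega 0" "prev_form 0 \<gamma>" "coef P = dl Dx \<gamma>" for \<gamma>
    using that Omega_coef_eqI[OF that(1) Omega_0] prev_form_zero[OF that(2)]
    by (simp add: coef_0 dl_lin additive_Dx)
  moreover have "coef 0 = dl Dx 0" by (simp add: coef_0 dl_lin additive_Dx)
  ultimately show ?thesis using 0 Omega_0 prev_form_0 by (auto simp: coboundaries_def)
next
  case (Suc l)
  have "P \<in> delta dv pd K N ` Omega l" if P: "P \<in> Omega (Suc l)" and g: "form l \<gamma>" "coef P = dl Dx \<gamma>" for \<gamma>
  proof
    note a = arr_of_Omega[OF g(1)]
    show "P = delta dv pd K N (arr_of l \<gamma>)"
      by (rule Omega_coef_eqI[OF P Omega_delta[OF a]]) (simp add: g coef_delta[OF a] coef_arr_of)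
    show "arr_of l \<gamma> \<in> Omega l" by (rule a)
  qed
  moreover have "\<exists>\<gamma>. form l \<gamma> \<and> coef (delta dv pd K N Q) = dl Dx \<gamma>" if "Q \<in> Omega l" for Q
    using that by (auto simp: coef_delta Omega_iff)
  ultimately show ?thesis using Suc Omega_delta[of _ l] by (auto simp: coboundaries_def prev_form_Suc)
qed

lemma coboundary_cocycle: "P \<in> B k \<Longrightarrow> P \<in> Z k"
  by (auto simp: coboundary_iff cocycle_iff dl_dl_Dx)

lemma Omega00_iff: "P \<in> Omega00 pd N k \<longleftrightarrow> P \<in> Omega k \<and> small (coef P)"
proof -
  have "(\<forall>is. \<forall>m\<in>Poly_Mapping.keys (P is). lkp (P is) m \<in> \<F> \<and> (\<forall>a<k. lkp m a < N)) \<longleftrightarrow> small (coef P)"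
    (is "?L \<longleftrightarrow> _") if P: "P \<in> Omega k"
  proof
    assume L: ?L
    show "small (coef P)" unfolding small_def
    proof (intro allI conjI ballI impI)
      fix xs :: "('i \<times> nat) list"
      let ?m = "vmon id (map snd xs)"
      show "coef P xs \<in> \<F>"
        using L by (cases "?m \<in> Poly_Mapping.keys (P (map fst xs))") (auto simp: coef_def in_keys_iff qc_0)
      fix x assume x: "x \<in> set xs" "N \<le> snd x"
      show "coef P xs = 0"
      proof (rule ccontr)
        assume nz: "coef P xs \<noteq> 0"
        then have l: "length xs = k" using P by (auto simp: Omega_iff form_def homog_def)
        obtain b where b: "b < length xs" "x = xs ! b" using x(1) by (auto simp: in_set_conv_nth)
        have "?m \<in> Poly_Mapping.keys (P (map fst xs))" using nz by (simp add: coef_def in_keys_iff)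
        then have "lkp ?m b < N" using L b l by blast
        then show False using lookup_vmon[of id "map snd xs" b] b x by simp
      qed
    qed
  next
    assume s: "small (coef P)"
    show ?L
    proof (intro allI ballI)
      fix "is" m assume m: "m \<in> Poly_Mapping.keys (P is)"
      then have l: "length is = k" using P by (cases "length is = k") (auto simp: Omega_iff)
      define ms where "ms = map (\<lambda>b. lkp m (id b)) [0..<k]"
      have "Poly_Mapping.keys m \<subseteq> id ` {..<k}" using P m by (auto simp: Omega_iff in_vars_keys)
      then have e: "m = vmon id ms" unfolding ms_def by (intro vmon_surj) auto
      have lm: "length ms = k" by (simp add: ms_def)
      have c: "coef P (zip is ms) = lkp (P is) m" using coef_zip[of "is" ms P] l lm by (simp flip: e)
      have s1: "coef P xs \<in> \<F>" and s2: "\<And>x. x \<in> set xs \<Longrightarrow> N \<le> snd x \<Longrightarrow> coef P xs = 0" for xs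
        using s unfolding small_def by blast+
      have "lkp (P is) m \<in> \<F>" using s1[of "zip is ms"] c by simp
      moreover have "lkp m a < N" if a: "a < k" for a
      proof (rule ccontr)
        assume "\<not> lkp m a < N"
        moreover have "(is ! a, lkp m a) \<in> set (zip is ms)"
          using a l by (force simp: in_set_zip ms_def)
        ultimately have "coef P (zip is ms) = 0" using s2[of "(is ! a, lkp m a)"] by simp
        then show False using c m by (simp add: in_keys_iff)
      qed
      ultimately show "lkp (P is) m \<in> \<F> \<and> (\<forall>a<k. lkp m a < N)" by blast
    qed
  qed
  then show ?thesis by (auto simp: Omega00_def)
qed

lemma dl_scale: "c \<in> \<F> \<Longrightarrow> dl Dx ((*) c \<circ> A) = (*) c \<circ> dl Dx A"
proof
  show "c \<in> \<F> \<Longrightarrow> dl Dx ((*) c \<circ> A) xs = ((*) c \<circ> dl Dx A) xs" for xs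
    unfolding o_apply[of "(*) c" "dl Dx A"]
    by (rule dl_comp[symmetric]) (simp_all add: additive_scale Dx_qc_mult)
qed

lemma B_0: "0 \<in> B k"
  unfolding coboundary_iff by (metis Omega_0 prev_form_0 coef_0 additive_map_0 additive_dl additive_Dx)

lemma B_add: "P \<in> B k \<Longrightarrow> Q \<in> B k \<Longrightarrow> P + Q \<in> B k"
  unfolding coboundary_iff by (metis Omega_add prev_form_add coef_add dl_add additive_Dx)

lemma prev_form_comp: "additive_map f \<Longrightarrow> prev_form k A \<Longrightarrow> prev_form k (f \<circ> A)"
  by (simp add: prev_form_def alt_comp fsupp_comp additive_map_0)

lemma B_smult: "c \<in> \<F> \<Longrightarrow> P \<in> B k \<Longrightarrow> arr_smult c P \<in> B k"
  unfolding coboundary_iff by (metis Omega_smult prev_form_comp additive_scale coef_smult dl_scale)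

lemma arr_smult_minus: "arr_smult (- 1) P = - P"
  by (simp add: arr_smult_def mconst_def single_uminus fun_eq_iff)

lemma B_minus: "P \<in> B k \<Longrightarrow> - P \<in> B k"
  using B_smult[of "- 1" P k] by (simp add: arr_smult_minus qc_minus qc_1)

lemma B_diff: "P \<in> B k \<Longrightarrow> Q \<in> B k \<Longrightarrow> P - Q \<in> B k"
  using B_add[of P k "- Q"] B_minus[of Q k] by simp

lemma prev_form_dhat: "prev_form k A \<Longrightarrow> prev_form k (dhat dv A)"
proof (cases k)
  case 0
  then show "prev_form k A \<Longrightarrow> prev_form k (dhat dv A)"
    using prev_form_zero[of A] by (simp add: dhat_lin additive_dv)
qed (simp add: prev_form_Suc form_dhat)

lemma coef_der_eq: "coef (arr_der dv P) = dhat dv (coef P)"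
  by (rule ext) (rule coef_der)

lemma B_der: "P \<in> B k \<Longrightarrow> arr_der dv P \<in> B k"
  unfolding coboundary_iff by (metis Omega_der prev_form_dhat coef_der_eq dl_dhat)

lemma Z_add: "P \<in> Z k \<Longrightarrow> Q \<in> Z k \<Longrightarrow> P + Q \<in> Z k"
  by (simp add: cocycle_iff Omega_add coef_add dl_lin additive_Dx)

lemma Z_smult: "c \<in> \<F> \<Longrightarrow> P \<in> Z k \<Longrightarrow> arr_smult c P \<in> Z k"
  by (simp add: cocycle_iff Omega_smult coef_smult dl_scale comp_forms additive_scale)

lemma Z_0: "0 \<in> Z k" by (rule coboundary_cocycle[OF B_0])

lemma Z_der: "P \<in> Z k \<Longrightarrow> arr_der dv P \<in> Z k"
  by (simp add: cocycle_iff Omega_der coef_der_eq dl_dhat dhat_lin additive_dv)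

lemma arr_smult_add: "arr_smult c (P + Q) = arr_smult c P + arr_smult c Q"
  and arr_smult_add_left: "arr_smult (c + d) P = arr_smult c P + arr_smult d P"
  and arr_smult_mult: "arr_smult (c * d) P = arr_smult c (arr_smult d P)"
  and arr_smult_1: "arr_smult 1 P = P"
  by (simp_all add: arr_smult_def fun_eq_iff mconst_def single_add distrib_left distrib_right mult_single
      flip: mult.assoc)

lemma cmap_add: "additive_map f \<Longrightarrow> cmap f (p + q) = cmap f p + cmap f q"
  by (rule poly_mapping_eqI) (simp add: lookup_cmap lookup_add additive_simps)

lemma arr_der_add: "arr_der dv (P + Q) = arr_der dv P + arr_der dv Q"
  by (simp add: arr_der_def fun_eq_iff cmap_add additive_dv algebra_simps)

lemma cls_iff: "Q \<in> cls k P \<longleftrightarrow> Q - P \<in> B k"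
  by (auto simp: coh_class_def elt_set_plus_def intro!: bexI[of _ "Q - P"])

lemma cls_eqI: "P - Q \<in> B k \<Longrightarrow> cls k P = cls k Q"
proof -
  assume d: "P - Q \<in> B k"
  have "R - P \<in> B k \<longleftrightarrow> R - Q \<in> B k" for R
    using B_add[of "R - P" k, OF _ d] B_diff[of "R - Q" k, OF _ d] by auto
  then show ?thesis by (auto simp: cls_iff)
qed

lemma cls_eq_iff: "cls k P = cls k Q \<longleftrightarrow> P - Q \<in> B k"
  using cls_eqI[of P Q k] cls_iff[of P k P] cls_iff[of P k Q] B_0[of k] by auto

lemma cls_0: "cls k 0 = B k" by (auto simp: cls_iff)

text \<open>An additive map that preserves coboundaries sends a coset into a coset; adding the
  coboundaries again fills it. Used for scalars and for \<partial>.\<close>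

lemma coset_image:
  assumes "\<And>P Q. f (P + Q) = f P + (f Q :: ('i, 'v) arr)" "\<And>P. P \<in> B k \<Longrightarrow> f P \<in> B k"
  shows "f ` cls k P + B k = cls k (f P)"
proof (intro subset_antisym subsetI)
  fix R assume "R \<in> f ` cls k P + B k"
  then obtain Q S where "Q - P \<in> B k" "S \<in> B k" "R = f Q + S" by (auto simp: set_plus_def cls_iff)
  then show "R \<in> cls k (f P)"
    using assms(1)[of "Q - P" P] assms(2) B_add[of "f (Q - P)" k S] by (simp add: cls_iff algebra_simps)
next
  fix R assume "R \<in> cls k (f P)"
  then have "R - f P \<in> B k" by (simp add: cls_iff)
  moreover have "P \<in> cls k P" by (simp add: cls_iff B_0)
  ultimately have "f P + (R - f P) \<in> f ` cls k P + B k" by (intro set_plus_intro imageI)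
  then show "R \<in> f ` cls k P + B k" by simp
qed

lemma cls_add: "cls k P + cls k Q = cls k (P + Q)"
proof (intro subset_antisym subsetI)
  fix R assume "R \<in> cls k P + cls k Q"
  then obtain P' Q' where "P' - P \<in> B k" "Q' - Q \<in> B k" "R = P' + Q'" by (auto simp: set_plus_def cls_iff)
  then show "R \<in> cls k (P + Q)" using B_add[of "P' - P" k "Q' - Q"] by (simp add: cls_iff algebra_simps)
next
  fix R assume "R \<in> cls k (P + Q)"
  then have "R - Q \<in> cls k P" "Q \<in> cls k Q" by (simp_all add: cls_iff B_0 algebra_simps)
  then have "(R - Q) + Q \<in> cls k P + cls k Q" by (rule set_plus_intro)
  then show "R \<in> cls k P + cls k Q" by simp
qed

abbreviation "H \<equiv> cohomology dv pd K N"
abbreviation "H0 \<equiv> Omega00_module pd N"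

lemma carrier_H: "carrier (H k) = cls k ` Z k" by (simp add: cohomology_def)

lemma smult_H: "c \<in> \<F> \<Longrightarrow> c \<odot>\<^bsub>H k\<^esub> cls k P = cls k (arr_smult c P)"
  by (simp add: cohomology_def coset_image arr_smult_add B_smult)

lemma ops_H: "X \<oplus>\<^bsub>H k\<^esub> Y = X + Y" "\<zero>\<^bsub>H k\<^esub> = cls k 0"
  by (simp_all add: cohomology_def cls_0)

lemma ops_H0: "P \<oplus>\<^bsub>H0 k\<^esub> Q = P + Q" "\<zero>\<^bsub>H0 k\<^esub> = 0" "c \<odot>\<^bsub>H0 k\<^esub> P = arr_smult c P"
  "carrier (H0 k) = Omega00 pd N k"
  by (simp_all add: Omega00_module_def)

lemma qc_ops: "carrier (qc_ring pd) = \<F>" "x \<oplus>\<^bsub>qc_ring pd\<^esub> y = x + y" "x \<otimes>\<^bsub>qc_ring pd\<^esub> y = x * y"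
  "\<one>\<^bsub>qc_ring pd\<^esub> = 1" "\<zero>\<^bsub>qc_ring pd\<^esub> = 0"
  by (simp_all add: qc_ring_def)

lemma cring_qc: "cring (qc_ring pd)"
proof (rule cringI)
  show "abelian_group (qc_ring pd)"
    by (rule abelian_groupI) (auto simp: qc_ops qc_add qc_0 algebra_simps intro!: bexI[of _ "- _"] qc_minus)
  show "comm_monoid (qc_ring pd)"
    by (rule comm_monoidI) (auto simp: qc_ops qc_mult qc_1 algebra_simps)
qed (auto simp: qc_ops algebra_simps)

lemma small_add: "small A \<Longrightarrow> small C \<Longrightarrow> small (A + C)"
  and small_0: "small 0"
  and small_scale: "c \<in> \<F> \<Longrightarrow> small A \<Longrightarrow> small ((*) c \<circ> A)"
  by (auto simp: small_def qc_add qc_0 qc_mult)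

lemma small_diff: "small A \<Longrightarrow> small C \<Longrightarrow> small (A - C)"
  by (auto simp: small_def qc_diff)

lemma Omega00_add: "P \<in> Omega00 pd N k \<Longrightarrow> Q \<in> Omega00 pd N k \<Longrightarrow> P + Q \<in> Omega00 pd N k"
  and Omega00_0: "0 \<in> Omega00 pd N k"
  and Omega00_smult: "c \<in> \<F> \<Longrightarrow> P \<in> Omega00 pd N k \<Longrightarrow> arr_smult c P \<in> Omega00 pd N k"
  by (simp_all add: Omega00_iff Omega_add Omega_0 Omega_smult coef_add coef_0 coef_smult small_add small_0 small_scale)

lemma Omega00_sum: "(\<And>i. i \<in> I \<Longrightarrow> f i \<in> Omega00 pd N k) \<Longrightarrow> sum f I \<in> Omega00 pd N k"
proof (induction I rule: infinite_finite_induct)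
  case (insert i I)
  then have "f i + sum f I \<in> Omega00 pd N k" by (intro Omega00_add) auto
  then show "sum f (insert i I) \<in> Omega00 pd N k" using insert.hyps by simp
next
  case (infinite I)
  then show "sum f I \<in> Omega00 pd N k" using Omega00_0 by simp
next
  case empty
  show "sum f {} \<in> Omega00 pd N k" using Omega00_0 by simp
qed

lemma Omega00_cocycle: "P \<in> Omega00 pd N k \<Longrightarrow> P \<in> Z k"
  by (simp add: Omega00_iff cocycle_iff dl_small)

lemma module_H0: "Module.module (qc_ring pd) (H0 k)"
proof (rule moduleI[OF cring_qc])
  show "abelian_group (H0 k)"
  proof (rule abelian_groupI)
    fix P assume "P \<in> carrier (H0 k)"
    then have "- P \<in> carrier (H0 k)" using Omega00_smult[of "- 1" P k]
      by (simp add: arr_smult_minus ops_H0 qc_minus qc_1)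
    then show "\<exists>Q\<in>carrier (H0 k). Q \<oplus>\<^bsub>H0 k\<^esub> P = \<zero>\<^bsub>H0 k\<^esub>" by (intro bexI[of _ "- P"]) (auto simp: ops_H0)
  qed (auto simp: ops_H0 Omega00_add Omega00_0 algebra_simps)
qed (auto simp: ops_H0 qc_ops Omega00_smult arr_smult_add arr_smult_add_left arr_smult_mult arr_smult_1)

lemma module_H: "Module.module (qc_ring pd) (H k)"
proof (rule moduleI[OF cring_qc])
  show "abelian_group (H k)"
  proof (rule abelian_groupI)
    fix X assume "X \<in> carrier (H k)"
    then obtain P where P: "P \<in> Z k" "X = cls k P" by (auto simp: carrier_H)
    have "- P \<in> Z k" using Z_smult[of "- 1" P k] P by (simp add: arr_smult_minus qc_minus qc_1)
    then show "\<exists>Y\<in>carrier (H k). Y \<oplus>\<^bsub>H k\<^esub> X = \<zero>\<^bsub>H k\<^esub>"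
      by (intro bexI[of _ "cls k (- P)"]) (auto simp: carrier_H ops_H P cls_add)
  qed (auto simp: carrier_H ops_H cls_add Z_add Z_0 algebra_simps)
qed (auto simp: carrier_H ops_H qc_ops cls_add smult_H Z_smult Z_add
      arr_smult_add arr_smult_add_left arr_smult_mult arr_smult_1 qc_add qc_mult qc_1)

text \<open>Injectivity holds because a small coboundary is 0, surjectivity because every cocycle is
  small up to a coboundary.\<close>

lemma inclusion_iso:
  assumes nrm: "normal_alg pd"
    and L: "\<And>i j. L $ i $ j \<in> \<F>" "K N ** L = mat 1" "L ** K N = mat 1"
  shows "linear_iso (qc_ring pd) (H0 k) (H k) (cls k)"
  unfolding linear_iso_def
proof (intro conjI ballI)
  show "bij_betw (cls k) (carrier (H0 k)) (carrier (H k))"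
    unfolding bij_betw_def carrier_H ops_H0
  proof (intro conjI inj_onI subset_antisym subsetI)
    fix P Q assume PQ: "P \<in> Omega00 pd N k" "Q \<in> Omega00 pd N k" and "cls k P = cls k Q"
    then have "P - Q \<in> B k" by (simp add: cls_eq_iff)
    then obtain \<gamma> where g: "prev_form k \<gamma>" "coef (P - Q) = dl Dx \<gamma>" by (auto simp: coboundary_iff)
    have "small (dl Dx \<gamma>)" using PQ g(2) by (simp add: Omega00_iff coef_diff[symmetric] flip: g(2)) (simp add: coef_diff small_diff)
    then have "coef P - coef Q = 0" using small_exact_zero[OF nrm L g(1)] g(2) by (simp add: coef_diff)
    then show "P = Q" using PQ by (intro Omega_coef_eqI[of P k]) (auto simp: Omega00_iff)
  next
    fix X assume "X \<in> cls k ` Z k"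
    then obtain P where P: "P \<in> Z k" "X = cls k P" by auto
    then have f: "form k (coef P)" and d: "dl Dx (coef P) = 0" and O: "P \<in> Omega k"
      by (auto simp: cocycle_iff Omega_iff)
    have "\<exists>\<gamma>. prev_form k \<gamma> \<and> small (coef P - dl Dx \<gamma>)"
      by (rule reduce_to_small[OF nrm L f]) (simp add: d)
    then obtain \<gamma> where g: "prev_form k \<gamma>" "small (coef P - dl Dx \<gamma>)" by blast
    let ?C = "coef P - dl Dx \<gamma>"
    have fC: "form k ?C" using f form_dl'[OF g(1)] by (rule form_diff)
    have "arr_of k ?C \<in> Omega00 pd N k"
      using arr_of_Omega[OF fC] coef_arr_of[OF fC] g(2) by (simp add: Omega00_iff)
    moreover have "P - arr_of k ?C \<in> B k"
      unfolding coboundary_iff using O arr_of_Omega[OF fC] coef_arr_of[OF fC] g(1)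
      by (auto simp: coef_diff Omega_diff intro!: exI[of _ \<gamma>])
    ultimately show "X \<in> cls k ` Omega00 pd N k" using P(2) cls_eqI by blast
  qed (auto intro: Omega00_cocycle)
qed (auto simp: ops_H0 ops_H qc_ops cls_add smult_H)

lemma coef_sum: "coef (\<Sum>i\<in>I. f i) = (\<Sum>i\<in>I. coef (f i))" for f :: "'z \<Rightarrow> ('i, 'v) arr"
  by (rule additive_map_sum[of coef]) (simp add: additive_map_def coef_add)

lemma finsum_H0: "finite I \<Longrightarrow> f \<in> I \<rightarrow> Omega00 pd N k \<Longrightarrow> (\<Oplus>\<^bsub>H0 k\<^esub>i\<in>I. f i) = (\<Sum>i\<in>I. f i)"
proof (induction I rule: finite_induct)
  interpret Module.module "qc_ring pd" "H0 k" by (rule module_H0)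
  {
    case empty show ?case by (simp add: ops_H0)
  next
    case (insert i I)
    then have "f i \<in> carrier (H0 k)" "f \<in> I \<rightarrow> carrier (H0 k)" by (auto simp: ops_H0)
    then show ?case using insert by (simp add: ops_H0)
  }
qed

text \<open>A small form is determined by its values on one ordering of each k-element set of the N
  \<ell> letters of exponent below N. The exterior monomials are dual to these evaluations.\<close>

lemma dimension_H0: "has_dimension (qc_ring pd) (H0 k) ((N * CARD('i)) choose k)"
proof -
  let ?X = "UNIV \<times> {..<N} :: ('i \<times> nat) set"
  let ?T = "{S. S \<subseteq> ?X \<and> card S = k}"
  define d where "d = (N * CARD('i)) choose k"
  have "card ?T = d" by (simp add: n_subsets d_def card_cartesian_product mult.commute)
  moreover have "finite ?T" by simp
  ultimately obtain S where S: "bij_betw S {..<d} ?T"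
    using ex_bij_betw_nat_finite[of ?T] by (auto simp: atLeast0LessThan)
  have SX: "S i \<subseteq> ?X" "card (S i) = k" "finite (S i)" if "i < d" for i
  proof -
    show 1: "S i \<subseteq> ?X" "card (S i) = k" using that bij_betwE[OF S] by auto
    show "finite (S i)" by (rule finite_subset[OF 1(1)]) simp
  qed
  have "\<forall>i<d. \<exists>xs. set xs = S i \<and> distinct xs" using SX(3) finite_distinct_list by blast
  then obtain l where l: "\<And>i. i < d \<Longrightarrow> set (l i) = S i" "\<And>i. i < d \<Longrightarrow> distinct (l i)" by metis
  have len: "length (l i) = k" if "i < d" for i
    using l[OF that] SX[OF that] distinct_card by metis
  define b where "b i = arr_of k (ew (l i))" for i
  have fe: "form k (ew (l i))" if "i < d" for i using form_ew[of "l i"] len[OF that] by simp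
  have cb: "coef (b i) = ew (l i)" if "i < d" for i unfolding b_def by (rule coef_arr_of[OF fe[OF that]])
  have bO: "b i \<in> Omega00 pd N k" if "i < d" for i
    using that cb[OF that] arr_of_Omega[OF fe[OF that]] SX(1)[OF that] l(1)[OF that]
    by (auto simp: Omega00_iff b_def intro!: small_ew)
  \<comment> \<open>Distinct sets of the same size do not contain one another, so a monomial
    vanishes on the word of a different set.\<close>
  have ewd: "ew (l i) (l j) = (if i = j then 1 else 0 :: 'v)" if "i < d" "j < d" for i j
  proof (cases "i = j")
    case True then show ?thesis using ew_diag[OF l(2)[OF that(2)]] by simp
  next
    case False
    have "\<not> S j \<subseteq> S i"
      using False that S SX card_subset_eq[of "S i" "S j"] by (auto simp: bij_betw_def inj_on_def)
    then show ?thesis using False that l(1) ew_vanish[of "l j" "l i"] by auto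
  qed
  have sumeq: "(\<Oplus>\<^bsub>H0 k\<^esub>i\<in>{..<d}. c i \<odot>\<^bsub>H0 k\<^esub> b i) = (\<Sum>i<d. arr_smult (c i) (b i))"
    if "c \<in> {..<d} \<rightarrow>\<^sub>E \<F>" for c
    using that bO by (subst finsum_H0) (auto simp: ops_H0 intro!: Omega00_smult)
  have coefsum: "coef (\<Sum>i<d. arr_smult (c i) (b i)) xs = (\<Sum>i<d. c i * ew (l i) xs)" for c xs
    by (simp add: coef_sum sum_fun_apply coef_smult cb)
  have val: "coef (\<Sum>i<d. arr_smult (c i) (b i)) (l j) = c j" if "j < d" for c j
    using that by (simp add: coefsum ewd if_distrib[of "(*) _"] cong: if_cong)
  have sumO: "(\<Sum>i<d. arr_smult (c i) (b i)) \<in> Omega00 pd N k" if "c \<in> {..<d} \<rightarrow>\<^sub>E \<F>" for c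
  proof -
    have "arr_smult (c i) (b i) \<in> Omega00 pd N k" if "i \<in> {..<d}" for i
      using that \<open>c \<in> {..<d} \<rightarrow>\<^sub>E \<F>\<close> bO by (auto intro!: Omega00_smult)
    then show ?thesis by (rule Omega00_sum)
  qed
  have "has_dimension (qc_ring pd) (H0 k) d"
    unfolding has_dimension_def ops_H0(4) qc_ops(1)
  proof (intro bexI[of _ b] ballI)
    show "b \<in> {..<d} \<rightarrow> Omega00 pd N k" using bO by auto
    fix P assume P: "P \<in> Omega00 pd N k"
    let ?c = "restrict (\<lambda>i. coef P (l i)) {..<d}"
    have c: "?c \<in> {..<d} \<rightarrow>\<^sub>E \<F>" using P by (auto simp: Omega00_iff small_def)
    let ?Q = "\<Sum>i<d. arr_smult (?c i) (b i)"
    let ?D = "coef (P - ?Q)"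
    have f: "form k ?D" and s: "small ?D"
      using P sumO[OF c] by (auto simp: Omega00_iff coef_diff Omega_iff form_diff small_diff)
    have z: "?D (l j) = 0" if "j < d" for j using val[OF that, of ?c] that by (simp add: coef_diff)
    have "?D = 0"
    proof
      fix ys show "?D ys = 0 ys"
      proof (rule ccontr)
        assume nz: "?D ys \<noteq> 0 ys"
        then have 1: "length ys = k" using f by (auto simp: form_def homog_def)
        have 2: "distinct ys" using alt_repeat[of ?D ys] f nz by (auto simp: form_def)
        have "snd x < N" if "x \<in> set ys" for x
          using s nz that unfolding small_def zero_fun_apply by (meson not_le)
        then have 3: "set ys \<subseteq> ?X" by (auto simp: mem_Times_iff)
        have "set ys \<in> ?T" using 1 2 3 distinct_card by auto
        then have "set ys \<in> S ` {..<d}" using bij_betw_imp_surj_on[OF S] by blast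
        then obtain j where j: "j < d" "S j = set ys" by auto
        \<comment> \<open>A word on which the difference does not vanish has distinct letters of
          small exponent, so it rearranges one of the chosen words.\<close>
        then have "mset ys = mset (l j)" using l[OF j(1)] 2 by (simp add: set_eq_iff_mset_eq_distinct[symmetric])
        then show False using alt_mset_zero[of ?D ys "l j"] f z[OF j(1)] nz by (simp add: form_def)
      qed
    qed
    then have PQ: "P = ?Q"
      using P sumO[OF c] by (intro Omega_coef_eqI[of P k]) (auto simp: Omega00_iff coef_diff)
    show "\<exists>!c. c \<in> {..<d} \<rightarrow>\<^sub>E \<F> \<and> P = (\<Oplus>\<^bsub>H0 k\<^esub>i\<in>{..<d}. c i \<odot>\<^bsub>H0 k\<^esub> b i)"
    proof (rule ex1I[of _ ?c])
      show "?c \<in> {..<d} \<rightarrow>\<^sub>E \<F> \<and> P = (\<Oplus>\<^bsub>H0 k\<^esub>i\<in>{..<d}. ?c i \<odot>\<^bsub>H0 k\<^esub> b i)"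
        using c PQ sumeq[OF c] by simp
      fix c' assume c': "c' \<in> {..<d} \<rightarrow>\<^sub>E \<F> \<and> P = (\<Oplus>\<^bsub>H0 k\<^esub>i\<in>{..<d}. c' i \<odot>\<^bsub>H0 k\<^esub> b i)"
      then have P': "P = (\<Sum>i<d. arr_smult (c' i) (b i))" using sumeq[of c'] by simp
      have cj: "coef P (l j) = c' j" if "j < d" for j unfolding P' by (rule val[OF that])
      show "c' = ?c"
      proof
        fix j show "c' j = ?c j"
          using c' cj[of j] by (cases "j < d") (auto simp: PiE_def extensional_def)
      qed
    qed
  qed
  then show ?thesis by (simp add: d_def)
qed

end

section \<open>Shuffles\<close>

lemma finite_permutesI:
  assumes "finite S" "inj_on p S" "p ` S \<subseteq> S" "\<And>x. x \<notin> S \<Longrightarrow> p x = x" shows "p permutes S"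
proof (rule bij_imp_permutes)
  show "bij_betw p S S" using endo_inj_surj[OF assms(1,3,2)] assms(2) by (simp add: bij_betw_def)
qed (use assms in auto)

text \<open>Adds the fixed point 0 in front. Together with \<open>down\<close> it matches the
  permutations of n points with those of n + 1 points that fix 0.\<close>

definition up :: "(nat \<Rightarrow> nat) \<Rightarrow> nat \<Rightarrow> nat" where
  "up s a = (case a of 0 \<Rightarrow> 0 | Suc b \<Rightarrow> Suc (s b))"

definition down :: "(nat \<Rightarrow> nat) \<Rightarrow> nat \<Rightarrow> nat" where
  "down s a = s (Suc a) - 1"

text \<open>The cycle that sends position q to 0. Its sign (-1)^q is the cost of moving the first
  letter of the second block to the front of the word.\<close>

definition cyc :: "nat \<Rightarrow> nat \<Rightarrow> nat" where
  "cyc q a = (if a < q then Suc a else if a = q then 0 else a)"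

definition cinv :: "nat \<Rightarrow> nat \<Rightarrow> nat" where
  "cinv q a = (if a = 0 then q else if a \<le> q then a - 1 else a)"

lemma up_simps [simp]: "up s 0 = 0" "up s (Suc a) = Suc (s a)" by (simp_all add: up_def)

lemma down_up: "down (up s) = s" by (simp add: down_def fun_eq_iff)

lemma up_permutes: "s permutes {..<n} \<Longrightarrow> up s permutes {..<Suc n}"
proof (rule finite_permutesI)
  assume s: "s permutes {..<n}"
  show "inj_on (up s) {..<Suc n}"
  proof (rule inj_onI)
    fix a b assume "up s a = up s b"
    then show "a = b" using permutes_inj[OF s] by (cases a; cases b) (simp_all add: inj_eq)
  qed
  show "up s ` {..<Suc n} \<subseteq> {..<Suc n}"
  proof (rule image_subsetI)
    fix a assume "a \<in> {..<Suc n}"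
    then show "up s a \<in> {..<Suc n}" using permutes_in_image[OF s, of "a - 1"] by (cases a) simp_all
  qed
  show "up s x = x" if "x \<notin> {..<Suc n}" for x
    using that permutes_not_in[OF s, of "x - 1"] by (cases x) auto
qed simp

lemma permutes_zero_pos:
  assumes "s permutes {..<Suc n}" "s 0 = 0" shows "0 < s (Suc a)"
proof -
  have "s (Suc a) \<noteq> s 0" using permutes_inj[OF assms(1)] by (simp add: inj_eq)
  then show ?thesis using assms(2) by simp
qed

lemma up_down:
  assumes "s permutes {..<Suc n}" "s 0 = 0" shows "up (down s) = s"
proof
  fix a show "up (down s) a = s a"
    using assms(2) permutes_zero_pos[OF assms] by (cases a) (auto simp: down_def)
qed

lemma down_permutes:
  assumes "s permutes {..<Suc n}" "s 0 = 0" shows "down s permutes {..<n}"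
proof (rule finite_permutesI)
  have pos: "0 < s (Suc a)" for a by (rule permutes_zero_pos[OF assms])
  show "inj_on (down s) {..<n}"
  proof (rule inj_onI)
    fix a b assume "down s a = down s b"
    then have "s (Suc a) = s (Suc b)" using pos[of a] pos[of b] by (simp add: down_def)
    then show "a = b" using permutes_inj[OF assms(1)] by (simp add: inj_eq)
  qed
  show "down s ` {..<n} \<subseteq> {..<n}"
  proof (rule image_subsetI)
    fix a assume "a \<in> {..<n}"
    then have "s (Suc a) < Suc n" using permutes_in_image[OF assms(1), of "Suc a"] by simp
    then show "down s a \<in> {..<n}" using pos[of a] by (simp add: down_def)
  qed
  show "down s x = x" if "x \<notin> {..<n}" for x
    using that permutes_not_in[OF assms(1), of "Suc x"] by (simp add: down_def)
qed simp

lemma sign_up: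
  assumes "s permutes {..<n}" shows "sign (up s) = sign s"
  using assms finite_lessThan[of n]
proof (induction s rule: permutes_induct)
  case id
  have "up id = id" by (auto simp: up_def fun_eq_iff split: nat.splits)
  then show "sign (up id) = sign id" by simp
next
  case (swap a b p)
  have e: "up (Transposition.transpose a b \<circ> p) = Transposition.transpose (Suc a) (Suc b) \<circ> up p"
    by (auto simp: up_def fun_eq_iff Transposition.transpose_def split: nat.splits)
  have pp: "permutation p" "permutation (up p)"
    using swap up_permutes[of p n] by (auto intro: permutes_imp_permutation[of "{..<n}"] permutes_imp_permutation[of "{..<Suc n}"])
  show "sign (up (Transposition.transpose a b \<circ> p)) = sign (Transposition.transpose a b \<circ> p)"
    unfolding e using swap pp
    by (simp add: sign_compose permutation_swap_id sign_swap_id)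
qed

lemma cyc_Suc: "cyc (Suc q) = cyc q \<circ> Transposition.transpose q (Suc q)"
  by (auto simp: cyc_def fun_eq_iff Transposition.transpose_def)

lemma cyc_props: "permutation (cyc q) \<and> sign (cyc q) = (- 1) ^ q"
proof (induction q)
  case 0
  have "cyc 0 = id" by (auto simp: cyc_def fun_eq_iff)
  then show ?case by (simp add: permutation_id)
next
  case (Suc q)
  then show "permutation (cyc (Suc q)) \<and> sign (cyc (Suc q)) = (- 1) ^ Suc q" unfolding cyc_Suc
    by (simp add: sign_compose permutation_compose permutation_swap_id sign_swap_id)
qed

lemma cyc_cinv: "cyc q (cinv q a) = a" and cinv_cyc: "cinv q (cyc q a) = a"
  by (auto simp: cyc_def cinv_def)

lemma cyc_permutes: "q < n \<Longrightarrow> cyc q permutes {..<n}"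
proof (rule finite_permutesI)
  show "inj_on (cyc q) {..<n}" by (rule inj_onI) (metis cinv_cyc)
qed (auto simp: cyc_def)

lemma cinv_permutes: "q < n \<Longrightarrow> cinv q permutes {..<n}"
proof (rule finite_permutesI)
  show "inj_on (cinv q) {..<n}" by (rule inj_onI) (metis cyc_cinv)
qed (auto simp: cinv_def)

definition mono2 :: "nat \<Rightarrow> nat \<Rightarrow> (nat \<Rightarrow> nat) \<Rightarrow> bool" where
  "mono2 q n s \<longleftrightarrow> (\<forall>a b. a < b \<longrightarrow> b < q \<longrightarrow> s a < s b) \<and> (\<forall>a b. q \<le> a \<longrightarrow> a < b \<longrightarrow> b < n \<longrightarrow> s a < s b)"

lemma shuffles_perm_iff: "s \<in> shuffles_perm q h \<longleftrightarrow> s permutes {..<q + h} \<and> mono2 q (q + h) s"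
  by (auto simp: shuffles_perm_def strict_mono_on_def mono2_def)

lemma finite_shuffles: "finite (shuffles_perm q h)"
  by (rule finite_subset[OF _ finite_permutations[of "{..<q + h}"]]) (auto simp: shuffles_perm_def)

text \<open>Both blocks are increasing, so the value 0 can only be taken at the head of one of
  them.\<close>

lemma shuffle_first:
  assumes "s \<in> shuffles_perm q h" "q + h > 0"
  shows "q > 0 \<and> s 0 = 0 \<or> h > 0 \<and> s q = 0"
proof -
  have p: "s permutes {..<q + h}" and m: "mono2 q (q + h) s" using assms by (auto simp: shuffles_perm_iff)
  obtain a where a: "a < q + h" "s a = 0"
  proof -
    have "0 \<in> s ` {..<q + h}" using permutes_image[OF p] assms(2) by simp
    then show thesis using that by auto
  qed
  show ?thesis
  proof (cases "a < q")
    case True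
    then have "0 < a \<longrightarrow> s 0 < s a" using m unfolding mono2_def by blast
    then have "a = 0" using a(2) by simp
    then show ?thesis using True a by simp
  next
    case False
    then have "q < a \<longrightarrow> s q < s a" using m a(1) unfolding mono2_def by blast
    then have "a = q" using a(2) False by simp
    then show ?thesis using a by simp
  qed
qed

lemma sum_shuffles_left:
  "(\<Sum>s\<in>{s \<in> shuffles_perm (Suc q) h. s 0 = 0}. f s) = (\<Sum>s\<in>shuffles_perm q h. f (up s))"
proof (rule sum.reindex_bij_witness[of _ up down])
  fix s assume "s \<in> {s \<in> shuffles_perm (Suc q) h. s 0 = 0}"
  then have p: "s permutes {..<Suc (q + h)}" and m: "mono2 (Suc q) (Suc (q + h)) s" and z: "s 0 = 0"
    by (auto simp: shuffles_perm_iff)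
  show "up (down s) = s" by (rule up_down[OF p z])
  then show "f (up (down s)) = f s" by simp
  have "mono2 q (q + h) (down s)"
    unfolding mono2_def down_def
  proof (intro conjI allI impI)
    fix a b assume "a < b" "b < q"
    then have "s (Suc a) < s (Suc b)" using m by (simp add: mono2_def)
    then show "s (Suc a) - 1 < s (Suc b) - 1" using permutes_zero_pos[OF p z, of a] by linarith
  next
    fix a b assume "q \<le> a" "a < b" "b < q + h"
    then have "s (Suc a) < s (Suc b)" using m by (simp add: mono2_def)
    then show "s (Suc a) - 1 < s (Suc b) - 1" using permutes_zero_pos[OF p z, of a] by linarith
  qed
  then show "down s \<in> shuffles_perm q h" using down_permutes[OF p z] by (simp add: shuffles_perm_iff)
next
  fix s assume "s \<in> shuffles_perm q h"
  then have p: "s permutes {..<q + h}" and m: "mono2 q (q + h) s" by (auto simp: shuffles_perm_iff)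
  show "down (up s) = s" by (rule down_up)
  have "mono2 (Suc q) (Suc (q + h)) (up s)"
    using m by (auto simp: mono2_def up_def split: nat.splits)
  then show "up s \<in> {s \<in> shuffles_perm (Suc q) h. s 0 = 0}"
    using up_permutes[OF p] by (simp add: shuffles_perm_iff)
qed

lemma sum_shuffles_right:
  "(\<Sum>s\<in>{s \<in> shuffles_perm q (Suc h). s q = 0}. f s) = (\<Sum>s\<in>shuffles_perm q h. f (up s \<circ> cyc q))"
proof (rule sum.reindex_bij_witness[of _ "\<lambda>s. up s \<circ> cyc q" "\<lambda>s. down (s \<circ> cinv q)"])
  fix s assume "s \<in> {s \<in> shuffles_perm q (Suc h). s q = 0}"
  then have p: "s permutes {..<Suc (q + h)}" and m: "mono2 q (Suc (q + h)) s" and z: "s q = 0"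
    by (auto simp: shuffles_perm_iff)
  let ?t = "s \<circ> cinv q"
  have pt: "?t permutes {..<Suc (q + h)}" by (intro permutes_compose[OF _ p] cinv_permutes) simp
  have zt: "?t 0 = 0" using z by (simp add: cinv_def)
  have t: "?t (Suc a) = (if a < q then s a else s (Suc a))" for a by (simp add: cinv_def)
  show e: "up (down ?t) \<circ> cyc q = s" unfolding up_down[OF pt zt] by (simp add: fun_eq_iff cinv_cyc)
  then show "f (up (down ?t) \<circ> cyc q) = f s" by simp
  have "mono2 q (q + h) (down ?t)"
    unfolding mono2_def down_def
  proof (intro conjI allI impI)
    fix a b assume "a < b" "b < q"
    then have "?t (Suc a) < ?t (Suc b)" unfolding t using m by (simp add: mono2_def)
    then show "?t (Suc a) - 1 < ?t (Suc b) - 1" using permutes_zero_pos[OF pt zt, of a] by linarith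
  next
    fix a b assume "q \<le> a" "a < b" "b < q + h"
    then have "?t (Suc a) < ?t (Suc b)" unfolding t using m by (simp add: mono2_def)
    then show "?t (Suc a) - 1 < ?t (Suc b) - 1" using permutes_zero_pos[OF pt zt, of a] by linarith
  qed
  then show "down ?t \<in> shuffles_perm q h" using down_permutes[OF pt zt] unfolding shuffles_perm_iff by blast
next
  fix s assume "s \<in> shuffles_perm q h"
  then have p: "s permutes {..<q + h}" and m: "mono2 q (q + h) s" by (auto simp: shuffles_perm_iff)
  have "up s \<circ> cyc q \<circ> cinv q = up s" by (simp add: fun_eq_iff cyc_cinv)
  then show "down (up s \<circ> cyc q \<circ> cinv q) = s" by (simp add: down_up)
  have v: "(up s \<circ> cyc q) a = (if a < q then Suc (s a) else if a = q then 0 else Suc (s (a - 1)))" for a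
    by (cases a) (auto simp: cyc_def)
  have "mono2 q (Suc (q + h)) (up s \<circ> cyc q)"
    unfolding mono2_def v
  proof (intro conjI allI impI)
    fix a b assume "q \<le> a" "a < b" "b < Suc (q + h)"
    then show "(if a < q then Suc (s a) else if a = q then 0 else Suc (s (a - 1)))
        < (if b < q then Suc (s b) else if b = q then 0 else Suc (s (b - 1)))"
      using m unfolding mono2_def by auto
  qed (use m in \<open>auto simp: mono2_def\<close>)
  moreover have "up s \<circ> cyc q permutes {..<Suc (q + h)}"
    by (intro permutes_compose cyc_permutes up_permutes p) simp
  ultimately show "up s \<circ> cyc q \<in> {s \<in> shuffles_perm q (Suc h). s q = 0}"
    using v[of q] by (simp add: shuffles_perm_iff)
qed

section \<open>The exterior product as a sum over shuffles\<close>

lemma homog_0_contr: "homog 0 A \<Longrightarrow> contr x A = 0"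
  by (auto simp: homog_def contr_def fun_eq_iff)

lemma signed_homog: "homog q A \<Longrightarrow> signed A = (*) ((-1) ^ q) \<circ> A"
proof
  show "homog q A \<Longrightarrow> signed A xs = ((*) ((-1) ^ q) \<circ> A) xs" for xs
    by (cases "length xs = q") (auto simp: signed_def homog_def)
qed

lemma wedge_scale_left:
  fixes c :: "'b::comm_ring_1" and A C :: "'a list \<Rightarrow> 'b"
  shows "wedge ((*) c \<circ> A) C xs = c * wedge A C xs"
proof (induction xs arbitrary: A C)
  case (Cons x xs)
  have IH: "wedge ((*) c \<circ> A) C xs = c * wedge A C xs" for A C :: "'a list \<Rightarrow> 'b" by (rule Cons.IH)
  have "signed ((*) c \<circ> A) = (*) c \<circ> signed A" by (auto simp: signed_def fun_eq_iff mult.left_commute)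
  then show "wedge ((*) c \<circ> A) C (x # xs) = c * wedge A C (x # xs)" by (simp add: IH distrib_left)
qed (simp add: mult.assoc)

lemma wedge_scale_right:
  fixes c :: "'b::comm_ring_1" and A C :: "'a list \<Rightarrow> 'b"
  shows "wedge A ((*) c \<circ> C) xs = c * wedge A C xs"
proof (induction xs arbitrary: A C)
  case (Cons x xs)
  have IH: "wedge A ((*) c \<circ> C) xs = c * wedge A C xs" for A C :: "'a list \<Rightarrow> 'b" by (rule Cons.IH)
  show "wedge A ((*) c \<circ> C) (x # xs) = c * wedge A C (x # xs)" by (simp add: IH distrib_left)
qed (simp add: mult.left_commute)

text \<open>Shuffles are sorted by the block that receives the first letter. The two classes give
  the two terms in the recursion of \<open>wedge\<close>; the sign of \<open>cyc\<close> becomes the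
  parity involution on A.\<close>

lemma shuffle_wedge:
  assumes "homog q A" "homog h C" "length xs = q + h"
  shows "(\<Sum>s\<in>shuffles_perm q h. of_int (sign s) * (A (map (\<lambda>a. xs ! s a) [0..<q]) * C (map (\<lambda>b. xs ! s b) [q..<q + h])))
    = wedge A C xs"
  using assms
proof (induction xs arbitrary: q h A C)
  case Nil
  have "s = id" if "s \<in> shuffles_perm 0 0" for s
    using that by (auto simp: shuffles_perm_iff permutes_def fun_eq_iff)
  moreover have "id \<in> shuffles_perm 0 0" by (auto simp: shuffles_perm_iff mono2_def permutes_id)
  ultimately have "shuffles_perm 0 0 = {id}" by auto
  then show ?case using Nil by simp
next
  case (Cons x ys)
  let ?f = "\<lambda>s. of_int (sign s) * (A (map (\<lambda>a. (x # ys) ! s a) [0..<q]) * C (map (\<lambda>b. (x # ys) ! s b) [q..<q + h]))"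
  let ?L = "{s \<in> shuffles_perm q h. q > 0 \<and> s 0 = 0}" and ?R = "{s \<in> shuffles_perm q h. h > 0 \<and> s q = 0}"
  have pos: "q + h > 0" using Cons.prems(3) by (cases q; cases h) auto
  have "shuffles_perm q h = ?L \<union> ?R" using shuffle_first[OF _ pos] by blast
  moreover have "?L \<inter> ?R = {}"
  proof -
    have "False" if "s \<in> ?L" "s \<in> ?R" for s
    proof -
      have "s 0 = s q" "q > 0" "inj s" using that permutes_inj by (auto simp: shuffles_perm_iff)
      then show False by (simp add: inj_eq)
    qed
    then show ?thesis by blast
  qed
  ultimately have split: "(\<Sum>s\<in>shuffles_perm q h. ?f s) = (\<Sum>s\<in>?L. ?f s) + (\<Sum>s\<in>?R. ?f s)"
    using finite_shuffles[of q h] by (metis (no_types, lifting) finite_Un sum.union_disjoint)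
  have left: "(\<Sum>s\<in>?L. ?f s) = wedge (contr x A) C ys"
  proof (cases q)
    case 0
    then show ?thesis using homog_0_contr[of A x] Cons.prems(1) by simp
  next
    case (Suc q')
    have "(\<Sum>s\<in>?L. ?f s) = (\<Sum>s\<in>shuffles_perm q' h. ?f (up s))"
      using sum_shuffles_left[of ?f q' h] Suc by simp
    also have "\<dots> = (\<Sum>s\<in>shuffles_perm q' h. of_int (sign s) *
       (contr x A (map (\<lambda>a. ys ! s a) [0..<q']) * C (map (\<lambda>b. ys ! s b) [q'..<q' + h])))"
    proof (intro sum.cong refl)
      fix s assume "s \<in> shuffles_perm q' h"
      then have "s permutes {..<q' + h}" by (simp add: shuffles_perm_iff)
      then have sg: "sign (up s) = sign s" by (rule sign_up)
      have 1: "map (\<lambda>a. (x # ys) ! up s a) [0..<q] = x # map (\<lambda>a. ys ! s a) [0..<q']"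
      proof -
        have "[0..<q] = 0 # map Suc [0..<q']" unfolding Suc map_Suc_upt by (rule upt_conv_Cons) simp
        then show ?thesis by simp
      qed
      have 2: "map (\<lambda>b. (x # ys) ! up s b) [q..<q + h] = map (\<lambda>b. ys ! s b) [q'..<q' + h]"
      proof -
        have "[q..<q + h] = map Suc [q'..<q' + h]" unfolding Suc map_Suc_upt by simp
        then show ?thesis by simp
      qed
      show "?f (up s) = of_int (sign s) *
       (contr x A (map (\<lambda>a. ys ! s a) [0..<q']) * C (map (\<lambda>b. ys ! s b) [q'..<q' + h]))"
        unfolding 1 2 sg contr_apply ..
    qed
    also have "\<dots> = wedge (contr x A) C ys"
      using Cons.IH[OF homog_contr[OF Cons.prems(1), of x] Cons.prems(2)] Cons.prems(3) Suc by simp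
    finally show ?thesis .
  qed
  have right: "(\<Sum>s\<in>?R. ?f s) = wedge (signed A) (contr x C) ys"
  proof (cases h)
    case 0
    then show ?thesis using homog_0_contr[of C x] Cons.prems(2) by simp
  next
    case (Suc h')
    have "(\<Sum>s\<in>?R. ?f s) = (\<Sum>s\<in>shuffles_perm q h'. ?f (up s \<circ> cyc q))"
      using sum_shuffles_right[of ?f q h'] Suc by simp
    also have "\<dots> = (\<Sum>s\<in>shuffles_perm q h'. (-1) ^ q * (of_int (sign s) *
       (A (map (\<lambda>a. ys ! s a) [0..<q]) * contr x C (map (\<lambda>b. ys ! s b) [q..<q + h']))))"
    proof (intro sum.cong refl)
      fix s assume "s \<in> shuffles_perm q h'"
      then have p: "s permutes {..<q + h'}" by (simp add: shuffles_perm_iff)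
      have pu: "permutation (up s)" using up_permutes[OF p] permutes_imp_permutation finite_lessThan by blast
      have sg: "sign (up s \<circ> cyc q) = (-1) ^ q * sign s"
        using cyc_props[of q] pu by (simp add: sign_compose sign_up[OF p])
      have v: "(up s \<circ> cyc q) a = (if a < q then Suc (s a) else if a = q then 0 else Suc (s (a - 1)))" for a
        by (cases a) (auto simp: cyc_def)
      have 1: "map (\<lambda>a. (x # ys) ! (up s \<circ> cyc q) a) [0..<q] = map (\<lambda>a. ys ! s a) [0..<q]"
        unfolding v by simp
      have u: "[q..<q + h] = q # map Suc [q..<q + h']" unfolding map_Suc_upt Suc by (simp add: upt_conv_Cons)
      have 2: "map (\<lambda>b. (x # ys) ! (up s \<circ> cyc q) b) [q..<q + h] = x # map (\<lambda>b. ys ! s b) [q..<q + h']"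
        unfolding u v by simp
      show "?f (up s \<circ> cyc q) = (-1) ^ q * (of_int (sign s) *
       (A (map (\<lambda>a. ys ! s a) [0..<q]) * contr x C (map (\<lambda>b. ys ! s b) [q..<q + h'])))"
        unfolding 1 2 sg contr_apply by (simp add: mult.assoc)
    qed
    also have "\<dots> = (-1) ^ q * wedge A (contr x C) ys"
      using Cons.IH[OF Cons.prems(1) homog_contr[OF Cons.prems(2), of x]] Cons.prems(3) Suc
      by (simp flip: sum_distrib_left)
    also have "\<dots> = wedge (signed A) (contr x C) ys"
      by (simp add: signed_homog[OF Cons.prems(1)] wedge_scale_left)
    finally show ?thesis .
  qed
  show ?case using split left right by simp
qed

section \<open>The \<open>\<lambda>\<close>-bracket in coordinates\<close>

lemma additive_map_poly: "additive_map f \<Longrightarrow> additive_map (map_poly f)"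
  by (auto simp: additive_map_def[of "map_poly f"] poly_eq_iff coeff_map_poly additive_simps)

lemma deriv_map_poly:
  assumes "deriv_map f" shows "deriv_map (map_poly f)"
  unfolding deriv_map_def
proof (intro conjI allI poly_eqI)
  have a: "additive_map f" by (rule deriv_additive[OF assms])
  then show "additive_map (map_poly f)" by (rule additive_map_poly)
  fix p q n
  show "coeff (map_poly f (p * q)) n = coeff (map_poly f p * q + p * map_poly f q) n"
    by (simp add: coeff_map_poly additive_simps[OF a] coeff_mult additive_map_sum[OF a] deriv_mult[OF assms] sum.distrib)
qed

lemma additive_funpow: "additive_map f \<Longrightarrow> additive_map (f ^^ n)" for f :: "'z::ab_group_add \<Rightarrow> 'z"
  by (induction n) (auto simp: additive_map_def)

section \<open>Partial derivatives of polynomials\<close>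

lemma lookup_mpderiv: "lkp (mpderiv a p) m = of_nat (Suc (lkp m a)) * lkp p (m + Poly_Mapping.single a 1)"
proof -
  let ?m = "m + Poly_Mapping.single a 1"
  have e: "(if k - Poly_Mapping.single a 1 = m then of_nat (lkp k a) * lkp p k else 0) =
      (if k = ?m then of_nat (lkp k a) * lkp p k else 0)" for k
  proof (cases "lkp k a = 0")
    case False
    have "k - Poly_Mapping.single a 1 = m \<longleftrightarrow> k = ?m"
    proof
      assume h: "k - Poly_Mapping.single a 1 = m"
      show "k = ?m"
      proof (rule poly_mapping_eqI)
        fix c show "lkp k c = lkp ?m c"
          using False by (auto simp: h[symmetric] lookup_add lookup_minus lookup_single when_def)
      qed
    qed simp
    then show ?thesis by simp
  qed simp
  have "lkp (mpderiv a p) m = (\<Sum>k\<in>Poly_Mapping.keys p. if k - Poly_Mapping.single a 1 = m then of_nat (lkp k a) * lkp p k else 0)"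
    by (simp only: mpderiv_def lookup_sum lookup_single when_def)
  also have "\<dots> = (\<Sum>k\<in>Poly_Mapping.keys p. if k = ?m then of_nat (lkp k a) * lkp p k else 0)"
    by (simp only: e)
  also have "\<dots> = of_nat (lkp ?m a) * lkp p ?m" by (simp add: sum.delta in_keys_iff)
  finally show ?thesis by (simp add: lookup_add)
qed

lemma additive_mpderiv: "additive_map (mpderiv a)"
  by (auto simp: additive_map_def lookup_mpderiv lookup_add distrib_left intro!: poly_mapping_eqI)

lemmas mpderiv_simps = additive_simps[OF additive_mpderiv]

lemma lookup_mpderiv_pow: "lkp p (m + Poly_Mapping.single a r) = 0 \<Longrightarrow> lkp ((mpderiv a ^^ r) p) m = 0"
proof (induction r arbitrary: m)
  case (Suc r)
  have "m + Poly_Mapping.single a 1 + Poly_Mapping.single a r = m + Poly_Mapping.single a (Suc r)"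
    by (simp add: add.assoc flip: single_add)
  then have "lkp ((mpderiv a ^^ r) p) (m + Poly_Mapping.single a 1) = 0"
    by (intro Suc.IH) (simp only: Suc.prems)
  then show ?case by (simp add: lookup_mpderiv)
qed simp

lemma mpderiv_nilpotent: "\<exists>R. \<forall>r\<ge>R. (mpderiv a ^^ r) p = 0"
proof -
  have "finite ((\<lambda>m. lkp m a) ` Poly_Mapping.keys p)" by simp
  then obtain R where R: "\<forall>n\<in>(\<lambda>m. lkp m a) ` Poly_Mapping.keys p. n < R" by (auto simp: finite_nat_set_iff_bounded)
  have "(mpderiv a ^^ r) p = 0" if "r \<ge> R" for r
  proof (rule poly_mapping_eqI)
    fix m
    have "m + Poly_Mapping.single a r \<notin> Poly_Mapping.keys p"
    proof
      assume "m + Poly_Mapping.single a r \<in> Poly_Mapping.keys p"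
      then have "lkp (m + Poly_Mapping.single a r) a < R" using R by blast
      then show False using that by (simp add: lookup_add)
    qed
    then show "lkp ((mpderiv a ^^ r) p) m = lkp 0 m"
      by (simp add: lookup_mpderiv_pow in_keys_iff)
  qed
  then show ?thesis by blast
qed

lemma mpderiv_mvar_mult: "mpderiv a (mvar a * p) = p + mvar a * mpderiv a p"
proof (rule poly_mapping_eqI)
  fix m :: "nat \<Rightarrow>\<^sub>0 nat"
  have "m - Poly_Mapping.single a 1 + Poly_Mapping.single a 1 = m" if "lkp m a \<noteq> 0"
  proof (rule poly_mapping_eqI)
    show "lkp (m - Poly_Mapping.single a 1 + Poly_Mapping.single a 1) c = lkp m c" for c
      using that by (cases "a = c") (simp_all add: lookup_add lookup_minus lookup_single)
  qed
  note m = this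
  have "lkp (mpderiv a (mvar a * p)) m = of_nat (Suc (lkp m a)) * lkp p m"
    by (simp add: lookup_mpderiv lookup_mvar_mult lookup_add)
  also have "\<dots> = lkp (p + mvar a * mpderiv a p) m"
  proof (cases "lkp m a = 0")
    case False
    then have "lkp (mvar a * mpderiv a p) m = of_nat (lkp m a) * lkp p m"
      using m by (simp add: lookup_mvar_mult lookup_mpderiv lookup_minus)
    then show ?thesis by (simp add: lookup_add distrib_right)
  qed (simp add: lookup_add lookup_mvar_mult)
  finally show "lkp (mpderiv a (mvar a * p)) m = lkp (p + mvar a * mpderiv a p) m" .
qed

text \<open>The Weyl algebra relation for the commutator of a power of the derivative with its
  variable.\<close>

lemma mpderiv_pow_mvar_mult:
  "(mpderiv a ^^ Suc r) (mvar a * p) = mvar a * (mpderiv a ^^ Suc r) p + of_nat (Suc r) * (mpderiv a ^^ r) p"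
proof (induction r)
  case (Suc r)
  have n: "mpderiv a (of_nat k * q) = of_nat k * mpderiv a q" for k q
    by (induction k) (simp_all add: mpderiv_simps distrib_right)
  show ?case
    unfolding funpow.simps(2)[of "Suc r"] o_apply Suc mpderiv_simps mpderiv_mvar_mult n
    by (simp add: algebra_simps)
qed (simp add: mpderiv_mvar_mult add.commute)

context diff_complex
begin

section \<open>The exponential of \<partial>\<close>

lemma exp_op_bound:
  assumes "\<And>r. r \<ge> R \<Longrightarrow> (mpderiv a ^^ r) p = 0"
  shows "exp_op smul dv a g p = (\<Sum>r<R. mconst (smul (1 / fact r) ((dv ^^ r) g)) * (mpderiv a ^^ r) p)"
  unfolding exp_op_def
  by (rule Sum_any.expand_superset) (use assms in \<open>auto simp: not_le[symmetric]\<close>)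

lemma exp_op_add: "exp_op smul dv a g (p + q) = exp_op smul dv a g p + exp_op smul dv a g q"
proof -
  obtain R S where R: "\<And>r. r \<ge> R \<Longrightarrow> (mpderiv a ^^ r) p = 0" and S: "\<And>r. r \<ge> S \<Longrightarrow> (mpderiv a ^^ r) q = 0"
    using mpderiv_nilpotent by metis
  let ?R = "max R S"
  note ad = additive_map_add[OF additive_funpow[OF additive_mpderiv]]
  show ?thesis
    by (simp add: exp_op_bound[of ?R] R S ad distrib_left sum.distrib)
qed

lemma additive_exp_op: "additive_map (exp_op smul dv a g)"
  by (simp add: additive_map_def exp_op_add)

lemma mconst_0 [simp]: "mconst 0 = 0" by (simp add: mconst_def)

lemma mconst_add: "mconst (c + d) = mconst c + mconst d" by (simp add: mconst_def single_add)

text \<open>By the Weyl relation, moving the variable out of the exponential leaves a term with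
  \<partial>g: the exponential substitutes \<lambda> + \<partial> for \<lambda>, where \<partial>
  acts on g alone.\<close>

lemma exp_op_mvar: "exp_op smul dv a g (mvar a * p) = mvar a * exp_op smul dv a g p + exp_op smul dv a (dv g) p"
proof -
  obtain R where R: "\<And>r. r \<ge> R \<Longrightarrow> (mpderiv a ^^ r) p = 0" using mpderiv_nilpotent by metis
  have R1: "(mpderiv a ^^ r) (mvar a * p) = 0" if "r \<ge> Suc R" for r
    using that R[of r] R[of "r - 1"] mpderiv_pow_mvar_mult[where r = "r - 1" and a = a and p = p] by simp
  let ?c = "\<lambda>r g. mconst (smul (1 / fact r) ((dv ^^ r) g))"
  \<comment> \<open>The identity (r + 1) / (r + 1)! = 1 / r!, with scalars from the base
    field.\<close>
  have c: "?c (Suc r) g * (of_nat (Suc r) * q) = ?c r (dv g) * q" for r q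
  proof -
    have n: "(of_nat k :: 'v mpol) * q = mconst (smul (of_nat k) 1) * q" for k and q :: "'v mpol"
      by (induction k) (simp_all add: vs.scale_left_distrib mconst_add distrib_right, simp add: mconst_def)
    have "mconst b * (mconst d * q) = mconst (b * d) * q" for b d :: 'v
      by (simp add: mconst_def mult_single flip: mult.assoc)
    then have "?c (Suc r) g * (of_nat (Suc r) * q) = mconst (smul (1 / fact (Suc r)) ((dv ^^ Suc r) g) * smul (of_nat (Suc r)) 1) * q"
      by (simp only: n)
    also have "smul (1 / fact (Suc r)) ((dv ^^ Suc r) g) * smul (of_nat (Suc r)) 1 = smul (1 / fact r) ((dv ^^ Suc r) g)"
    proof -
      have "smul b x * smul d 1 = smul (b * d) x" for b d and x :: 'v
      proof -
        have "x * smul d 1 = smul d x" using smul_mult[of d 1 x] by (simp add: mult.commute)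
        then have "smul b x * smul d 1 = smul b (smul d x)" using smul_mult[of b x "smul d 1"] by simp
        then show ?thesis by (simp only: vs.scale_scale)
      qed
      moreover have "1 / fact (Suc r) * of_nat (Suc r) = (1 / fact r :: 'f)"
        by (simp add: divide_simps del: of_nat_Suc)
      ultimately show ?thesis by simp
    qed
    finally show ?thesis by (simp add: funpow_swap1)
  qed
  have "exp_op smul dv a g (mvar a * p) = (\<Sum>r<Suc R. ?c r g * (mpderiv a ^^ r) (mvar a * p))"
    by (rule exp_op_bound) (rule R1)
  also have "\<dots> = mconst g * (mvar a * p) + (\<Sum>r<R. ?c (Suc r) g * (mpderiv a ^^ Suc r) (mvar a * p))"
    unfolding sum.lessThan_Suc_shift by simp
  also have "(\<Sum>r<R. ?c (Suc r) g * (mpderiv a ^^ Suc r) (mvar a * p)) =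
     (\<Sum>r<R. mvar a * (?c (Suc r) g * (mpderiv a ^^ Suc r) p)) + (\<Sum>r<R. ?c r (dv g) * (mpderiv a ^^ r) p)"
    unfolding mpderiv_pow_mvar_mult distrib_left c sum.distrib by (simp only: mult.left_commute)
  also have "(\<Sum>r<R. ?c r (dv g) * (mpderiv a ^^ r) p) = exp_op smul dv a (dv g) p"
    by (rule exp_op_bound[symmetric]) (rule R)
  also have "mconst g * (mvar a * p) + ((\<Sum>r<R. mvar a * (?c (Suc r) g * (mpderiv a ^^ Suc r) p)) + exp_op smul dv a (dv g) p)
     = mvar a * (\<Sum>r<Suc R. ?c r g * (mpderiv a ^^ r) p) + exp_op smul dv a (dv g) p"
    unfolding sum.lessThan_Suc_shift by (simp add: sum_distrib_left distrib_left mult.left_commute)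
  also have "(\<Sum>r<Suc R. ?c r g * (mpderiv a ^^ r) p) = exp_op smul dv a g p"
    by (rule exp_op_bound[symmetric]) (simp add: R)
  finally show ?thesis .
qed

lemma exp_op_single:
  assumes "lkp e a = 0" shows "exp_op smul dv a g (Poly_Mapping.single e c) = Poly_Mapping.single e (g * c)"
proof -
  have "mpderiv a (Poly_Mapping.single e c) = 0"
  proof (rule poly_mapping_eqI)
    fix m
    have "e \<noteq> m + Poly_Mapping.single a 1" using assms by (auto simp: lookup_add)
    then show "lkp (mpderiv a (Poly_Mapping.single e c)) m = lkp 0 m"
      by (simp add: lookup_mpderiv lookup_single when_def)
  qed
  then have "(mpderiv a ^^ r) (Poly_Mapping.single e c) = 0" if "r \<ge> 1" for r
    using that by (cases r) (simp_all add: funpow_swap1 additive_map_0[OF additive_funpow[OF additive_mpderiv]])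
  then show ?thesis by (simp add: exp_op_bound[of 1] mconst_mult_single)
qed

lemma exp_op_1 [simp]: "exp_op smul dv a 1 p = p"
proof -
  have "dv 1 = 0" by (rule deriv_1[OF deriv_dv])
  then have z: "(dv ^^ Suc r) 1 = 0" for r
    by (simp add: funpow_swap1 additive_map_0[OF additive_funpow[OF additive_dv]])
  obtain R where R: "\<And>r. r \<ge> R \<Longrightarrow> (mpderiv a ^^ r) p = 0" using mpderiv_nilpotent by metis
  have "exp_op smul dv a 1 p = (\<Sum>r<Suc R. mconst (smul (1 / fact r) ((dv ^^ r) 1)) * (mpderiv a ^^ r) p)"
    by (rule exp_op_bound) (simp add: R)
  also have "\<dots> = mconst 1 * p" unfolding sum.lessThan_Suc_shift z by simp
  finally show ?thesis by (simp add: mconst_def)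
qed

lemma exp_op_0 [simp]: "exp_op smul dv a 0 p = 0" "exp_op smul dv a g 0 = 0"
proof -
  have "(dv ^^ r) 0 = 0" for r by (rule additive_map_0[OF additive_funpow[OF additive_dv]])
  then show "exp_op smul dv a 0 p = 0" by (simp add: exp_op_def)
  show "exp_op smul dv a g 0 = 0" by (rule additive_map_0[OF additive_exp_op])
qed

subsection \<open>Substitution of \<open>-\<lambda>-\<partial>\<close> for the first variable\<close>

lemma additive_neg_shift: "additive_map (neg_shift dv l)"
proof -
  have "additive_map (map_poly (cmap dv))"
    by (rule additive_map_poly) (simp add: additive_map_def[of "cmap dv"] cmap_add additive_dv)
  then show ?thesis by (auto simp: additive_map_def[of "neg_shift dv l"] neg_shift_def additive_simps smult_add_right)
qed

lemmas additive_ns_pow = additive_funpow[OF additive_neg_shift]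

text \<open>The exponent that remains once the variable 0 is split off and the variable b + 1 is
  renamed to t b.\<close>

definition tail :: "(nat \<Rightarrow> nat) \<Rightarrow> nat \<Rightarrow> (nat \<Rightarrow>\<^sub>0 nat) \<Rightarrow> (nat \<Rightarrow>\<^sub>0 nat)" where
  "tail t h e = (\<Sum>b<h. Poly_Mapping.single (t b) (lkp e (Suc b)))"

text \<open>Substitutes \<open>-\<lambda> - \<lambda>\<^bsub>t 0\<^esub> - \<dots> - \<lambda>\<^bsub>t (h - 1)\<^esub> - \<partial>\<close> for the variable 0 and \<open>\<lambda>\<^bsub>t b\<^esub>\<close> for the variable \<open>b + 1\<close>.\<close>

definition Psi :: "(nat \<Rightarrow> nat) \<Rightarrow> nat \<Rightarrow> 'v mpol \<Rightarrow> 'v mpol poly" where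
  "Psi t h X = (\<Sum>e\<in>Poly_Mapping.keys X. (neg_shift dv (\<Sum>b<h. mvar (t b)) ^^ lkp e 0)
      [:mconst (lkp X e) * (\<Prod>b<h. mvar (t b) ^ lkp e (Suc b)):])"

lemma tail_monom: "mconst c * (\<Prod>b<h. mvar (t b) ^ lkp e (Suc b)) = Poly_Mapping.single (tail t h e) (c :: 'v)"
proof -
  have "(\<Prod>b<h. mvar (t b) ^ f b) = Poly_Mapping.single (\<Sum>b<h. Poly_Mapping.single (t b) (f b)) (1::'v)" for f
    by (induction h) (simp_all add: mvar_power mult_single)
  then show ?thesis by (simp add: tail_def mconst_mult_single)
qed

lemma Psi_superset:
  assumes "finite S" "Poly_Mapping.keys X \<subseteq> S"
  shows "Psi t h X = (\<Sum>e\<in>S. (neg_shift dv (\<Sum>b<h. mvar (t b)) ^^ lkp e 0) [:Poly_Mapping.single (tail t h e) (lkp X e):])"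
  unfolding Psi_def tail_monom
  by (rule sum.mono_neutral_left) (use assms in \<open>auto simp: in_keys_iff additive_map_0[OF additive_ns_pow]\<close>)

lemma Psi_add: "Psi t h (X + Y) = Psi t h X + Psi t h Y"
proof -
  let ?S = "Poly_Mapping.keys X \<union> Poly_Mapping.keys Y"
  have k: "Poly_Mapping.keys (X + Y) \<subseteq> ?S" by (rule keys_add)
  have sp: "[:Poly_Mapping.single m (a + b):] = [:Poly_Mapping.single m a:] + [:Poly_Mapping.single m b:]" for m and a b :: 'v
    by (simp add: single_add)
  have "Psi t h (X + Y) = (\<Sum>e\<in>?S. (neg_shift dv (\<Sum>b<h. mvar (t b)) ^^ lkp e 0)
      [:Poly_Mapping.single (tail t h e) (lkp X e + lkp Y e):])"
    by (subst Psi_superset[OF _ k]) (simp_all add: lookup_add)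
  also have "\<dots> = Psi t h X + Psi t h Y"
    unfolding sp additive_map_add[OF additive_ns_pow] sum.distrib
    by (simp add: Psi_superset[of ?S])
  finally show ?thesis .
qed

lemma additive_Psi: "additive_map (Psi t h)" by (simp add: additive_map_def Psi_add)

lemma Psi_single: "Psi t h (Poly_Mapping.single e c) =
    (neg_shift dv (\<Sum>b<h. mvar (t b)) ^^ lkp e 0) [:Poly_Mapping.single (tail t h e) c:]"
  by (subst Psi_superset[of "{e}"]) (simp_all)

lemma mpol_induct_additive:
  assumes "additive_map f" "additive_map g" "\<And>m c. f (Poly_Mapping.single m c) = g (Poly_Mapping.single m c)"
  shows "f (p :: 'v mpol) = g p"
proof -
  have "f p = (\<Sum>m\<in>Poly_Mapping.keys p. f (Poly_Mapping.single m (lkp p m)))"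
    by (subst (1) mpol_expand[of p, symmetric]) (rule additive_map_sum[OF assms(1)])
  also have "\<dots> = g p"
    by (subst (3) mpol_expand[of p, symmetric]) (simp add: assms(3) additive_map_sum[OF assms(2)])
  finally show ?thesis .
qed

lemma Psi_mvar: "Psi t h (mvar 0 * p) = neg_shift dv (\<Sum>b<h. mvar (t b)) (Psi t h p)"
proof (rule mpol_induct_additive)
  show "additive_map (\<lambda>p. Psi t h (mvar 0 * p))"
    by (simp add: additive_map_def distrib_left Psi_add)
  show "additive_map (\<lambda>p. neg_shift dv (\<Sum>b<h. mvar (t b)) (Psi t h p))"
    by (simp add: additive_map_def Psi_add additive_map_add[OF additive_neg_shift])
  fix m and c :: 'v
  have t: "tail t h (Poly_Mapping.single 0 1 + m) = tail t h m"
    by (simp add: tail_def lookup_add lookup_single when_def)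
  show "Psi t h (mvar 0 * Poly_Mapping.single m c) = neg_shift dv (\<Sum>b<h. mvar (t b)) (Psi t h (Poly_Mapping.single m c))"
    unfolding mvar_def mult_single Psi_single t by (simp add: lookup_add)
qed

text \<open>The Leibniz rule: the term in \<partial>g that arises from the left-hand operator is
  cancelled by the one coming from \<open>exp_op_mvar\<close>.\<close>

lemma neg_shift_smult: "neg_shift dv l (Polynomial.smult (mconst g) Y) + Polynomial.smult (mconst (dv g)) Y
    = Polynomial.smult (mconst g) (neg_shift dv l Y)"
proof (rule poly_eqI)
  fix n
  have c: "cmap dv (mconst g * q) = mconst (dv g) * q + mconst g * cmap dv q" for q
    by (rule poly_mapping_eqI) (simp add: lookup_cmap dv_simps lookup_add lookup_mconst_mult dv_mult)
  show "coeff (neg_shift dv l (Polynomial.smult (mconst g) Y) + Polynomial.smult (mconst (dv g)) Y) n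
    = coeff (Polynomial.smult (mconst g) (neg_shift dv l Y)) n"
    by (simp add: neg_shift_def coeff_map_poly c coeff_pCons algebra_simps split: nat.split)
qed

text \<open>The reason for the exponential in X^P: each power of -\<lambda> - \<partial> placed on
  the left would differentiate g, and the exponential compensates, so that g comes out as a plain
  factor. Induction on the power of the variable 0.\<close>

lemma Psi_exp: "Psi t h (exp_op smul dv 0 g p) = Polynomial.smult (mconst g) (Psi t h p)"
proof (rule mpol_induct_additive)
  show "additive_map (\<lambda>p. Psi t h (exp_op smul dv 0 g p))"
    by (simp add: additive_map_def exp_op_add Psi_add)
  show "additive_map (\<lambda>p. Polynomial.smult (mconst g) (Psi t h p))"
    by (simp add: additive_map_def Psi_add smult_add_right)
  have "Psi t h (exp_op smul dv 0 g (Poly_Mapping.single m c)) = Polynomial.smult (mconst g) (Psi t h (Poly_Mapping.single m c))"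
    if "lkp m 0 = n" for m n c g
    using that
  proof (induction n arbitrary: m g)
    case 0
    then show ?case by (simp add: exp_op_single Psi_single mconst_mult_single)
  next
    case (Suc n)
    let ?k = "m - Poly_Mapping.single 0 1"
    have m: "Poly_Mapping.single 0 1 + ?k = m"
      using Suc.prems by (intro poly_mapping_eqI) (auto simp: lookup_add lookup_minus lookup_single when_def)
    have k: "lkp ?k 0 = n" using Suc.prems by (simp add: lookup_minus)
    have s: "Poly_Mapping.single m c = mvar 0 * Poly_Mapping.single ?k c"
      unfolding mvar_def mult_single m by simp
    show ?case
      unfolding s exp_op_mvar Psi_add Psi_mvar Suc.IH[OF k] by (rule neg_shift_smult)
  qed
  then show "Psi t h (exp_op smul dv 0 g (Poly_Mapping.single m c)) = Polynomial.smult (mconst g) (Psi t h (Poly_Mapping.single m c))" for m c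
    by blast
qed

subsection \<open>Forms with coefficients in \<open>\<V>[\<lambda>]\<close>\<close>

text \<open>The operators \<open>\<lambda> + \<partial>\<close> and \<open>-\<lambda> - \<partial>\<close>; the derivation acts on arrays, hence involves the variables \<open>\<lambda>\<^sub>b\<close> too.\<close>

definition Lop :: "(('i \<times> nat) list \<Rightarrow> 'v poly) \<Rightarrow> ('i \<times> nat) list \<Rightarrow> 'v poly" where
  "Lop F = (pCons 0 \<circ> F) + dhat (map_poly dv) F"

definition NL :: "(('i \<times> nat) list \<Rightarrow> 'v poly) \<Rightarrow> ('i \<times> nat) list \<Rightarrow> 'v poly" where
  "NL F = - Lop F"

definition cst :: "('x list \<Rightarrow> 'v) \<Rightarrow> 'x list \<Rightarrow> 'v poly" where
  "cst A = (\<lambda>a. [:a:]) \<circ> A"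

text \<open>Passes from the entries of a product to forms with values in V[\<lambda>]: the exponents
  of the variables t 0, t 1, ... are fixed and \<lambda> is kept.\<close>

definition Theta :: "(nat \<Rightarrow> nat) \<Rightarrow> 'v mpol poly \<Rightarrow> nat list \<Rightarrow> 'v poly" where
  "Theta t G ns = map_poly (\<lambda>p. lkp p (vmon t ns)) G"

lemma coeff_Theta: "coeff (Theta t G ns) n = lkp (coeff G n) (vmon t ns)"
  by (simp add: Theta_def coeff_map_poly)

lemma additive_dvp: "additive_map (map_poly dv)"
  by (rule additive_map_poly[OF additive_dv])

text \<open>In coordinates \<partial> plus the sum of the variables is \<open>dhat\<close>, so the
  substituted operator acts as -\<lambda> - \<partial> on forms.\<close>

lemma Theta_neg_shift:
  assumes t: "inj_on t {..<h}" and js: "length js = h" and ns: "length ns = h"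
    and F: "\<And>ns. length ns = h \<Longrightarrow> Theta t G ns = F (zip js ns)"
  shows "Theta t (neg_shift dv (\<Sum>b<h. mvar (t b)) G) ns = NL F (zip js ns)"
proof (rule poly_eqI)
  fix n
  let ?v = "vmon t ns" and ?z = "zip js ns"
  have F': "coeff (F (zip js ms)) k = lkp (coeff G k) (vmon t ms)" if "length ms = h" for ms k
    using F[OF that] by (simp flip: coeff_Theta)
  have d: "lkp (mvar (t b) * p) ?v = (if ns ! b = 0 then 0 else lkp p (vmon t (ns[b := ns ! b - 1])))" if "b < h" for b and p :: "'v mpol"
    using that ns t lookup_vmon[of t ns b] vmon_dec[of t ns b] by (simp add: lookup_mvar_mult)
  have u: "?z[b := (fst (?z ! b), snd (?z ! b) - 1)] = zip js (ns[b := ns ! b - 1])" if "b < h" for b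
    using that js ns by (intro nth_equalityI) (auto simp: nth_list_update)
  have "coeff (dhat (map_poly dv) F ?z) n = dv (lkp (coeff G n) ?v) +
      (\<Sum>b<h. lkp (mvar (t b) * coeff G n) ?v)"
  proof -
    have "coeff (dhat (map_poly dv) F ?z) n = dv (coeff (F ?z) n) +
      (\<Sum>b<h. coeff (if snd (?z ! b) = 0 then 0 else F (?z[b := (fst (?z ! b), snd (?z ! b) - 1)])) n)"
      using js ns by (simp add: dhat_explicit[OF additive_dvp] coeff_map_poly dv_simps coeff_sum)
    also have "(\<Sum>b<h. coeff (if snd (?z ! b) = 0 then 0 else F (?z[b := (fst (?z ! b), snd (?z ! b) - 1)])) n) =
       (\<Sum>b<h. lkp (mvar (t b) * coeff G n) ?v)"
    proof (intro sum.cong refl)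
      fix b assume "b \<in> {..<h}"
      then have b: "b < h" by simp
      show "coeff (if snd (?z ! b) = 0 then 0 else F (?z[b := (fst (?z ! b), snd (?z ! b) - 1)])) n = lkp (mvar (t b) * coeff G n) ?v"
        unfolding d[OF b] u[OF b] using b js ns by (simp add: F')
    qed
    finally show ?thesis by (simp add: F'[OF ns])
  qed
  then show "coeff (Theta t (neg_shift dv (\<Sum>b<h. mvar (t b)) G) ns) n = coeff (NL F ?z) n"
    by (simp add: coeff_Theta neg_shift_def NL_def Lop_def coeff_pCons F'[OF ns] coeff_map_poly lookup_cmap dv_simps
        lookup_minus sum_distrib_right lookup_sum split: nat.split)
qed

lemma Theta_neg_shift_pow:
  assumes t: "inj_on t {..<h}" and js: "length js = h"
    and F: "\<And>ns. length ns = h \<Longrightarrow> Theta t G ns = F (zip js ns)"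
  shows "length ns = h \<Longrightarrow> Theta t ((neg_shift dv (\<Sum>b<h. mvar (t b)) ^^ r) G) ns = (NL ^^ r) F (zip js ns)"
proof (induction r arbitrary: ns)
  case (Suc r)
  show ?case unfolding funpow.simps(2) o_apply
    by (rule Theta_neg_shift[OF t js Suc.prems Suc.IH])
qed (simp add: F)

lemma Theta_add: "Theta t (G + G') ns = Theta t G ns + Theta t G' ns"
  by (simp add: poly_eq_iff coeff_Theta lookup_add)

lemma additive_Theta: "additive_map (\<lambda>G. Theta t G ns)" by (simp add: additive_map_def Theta_add)

lemma additive_Lop: "additive_map Lop"
  by (auto simp: additive_map_def[of Lop] Lop_def dhat_lin additive_dvp fun_eq_iff)

lemma additive_NL: "additive_map NL"
  by (auto simp: additive_map_def[of NL] NL_def additive_simps[OF additive_Lop])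

lemmas additive_Lpow = additive_funpow[OF additive_Lop]
lemmas additive_NLpow = additive_funpow[OF additive_NL]

definition formp :: "nat \<Rightarrow> (('i \<times> nat) list \<Rightarrow> 'v poly) \<Rightarrow> bool" where
  "formp k F \<longleftrightarrow> homog k F \<and> alt F \<and> fsupp F"

lemma formp_add: "formp k F \<Longrightarrow> formp k G \<Longrightarrow> formp k (F + G)"
  and formp_minus: "formp k F \<Longrightarrow> formp k (- F)"
  and formp_0: "formp k 0"
  by (simp_all add: formp_def homog_add alt_add fsupp_add homog_minus alt_minus fsupp_minus homog_0 alt_0 fsupp_0)

lemma formp_diff: "formp k F \<Longrightarrow> formp k G \<Longrightarrow> formp k (F - G)"
  by (simp add: formp_def homog_diff alt_diff fsupp_diff)

lemma formp_sum: "(\<And>i. i \<in> I \<Longrightarrow> formp k (f i)) \<Longrightarrow> formp k (\<Sum>i\<in>I. f i)"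
  by (simp add: formp_def homog_sum alt_sum fsupp_sum)

lemma additive_pCons0: "additive_map (pCons (0 :: 'v))"
  by (simp add: additive_map_def)

lemma formp_Lop: "formp k F \<Longrightarrow> formp k (Lop F)"
  unfolding Lop_def
  by (rule formp_add) (auto simp: formp_def homog_comp alt_comp fsupp_comp additive_pCons0
      homog_dhat alt_dhat fsupp_dhat additive_dvp)

lemma formp_NL: "formp k F \<Longrightarrow> formp k (NL F)"
  unfolding NL_def by (intro formp_minus formp_Lop)

lemma formp_Lpow: "formp k F \<Longrightarrow> formp k ((Lop ^^ n) F)"
  and formp_NLpow: "formp k F \<Longrightarrow> formp k ((NL ^^ n) F)"
  by (induction n) (auto intro: formp_Lop formp_NL)

lemma formp_wedge: "formp p F \<Longrightarrow> formp q G \<Longrightarrow> formp (p + q) (wedge F G)"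
  by (simp add: formp_def homog_wedge alt_wedge fsupp_wedge)

lemma formp_signed: "formp p F \<Longrightarrow> formp p (signed F)"
  by (simp add: formp_def homog_signed alt_signed fsupp_signed)

lemma additive_const: "additive_map (\<lambda>a :: 'v. [:a:])" by (simp add: additive_map_def)

lemma formp_cst: "form k A \<Longrightarrow> formp k (cst A)"
  unfolding cst_def by (simp add: formp_def form_def homog_comp alt_comp fsupp_comp additive_const)

lemma form_contr: "form (Suc k) A \<Longrightarrow> form k (contr x A)"
  using homog_contr[of "Suc k" A x] by (simp add: form_def alt_contr fsupp_contr)

lemma form_pd: "form k A \<Longrightarrow> form k (pd i n \<circ> A)"
  by (rule form_comp[OF additive_pd])

lemma form_coeff: "formp k F \<Longrightarrow> form k ((\<lambda>p. coeff p n) \<circ> F)"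
  by (simp add: form_def formp_def homog_comp alt_comp fsupp_comp additive_map_def)

subsection \<open>The product \<open>box\<close>\<close>

text \<open>P with first index i, after substitution of -\<lambda> - \<partial> for its first
  variable; here \<partial> includes the sum of the remaining variables.\<close>

definition Wf :: "nat \<Rightarrow> (('i \<times> nat) list \<Rightarrow> 'v) \<Rightarrow> 'i \<Rightarrow> ('i \<times> nat) list \<Rightarrow> 'v poly" where
  "Wf R A i = (\<Sum>r<R. (NL ^^ r) (cst (contr (i, r) A)))"

text \<open>The product \<open>P \<box>\<^sub>\<lambda> Q\<close> for \<open>A\<close> from \<open>P\<close> and \<open>C\<close> from \<open>Q\<close>. The numbers \<open>M\<close> and \<open>R\<close> only serve to make the sums
finite; they bound the order of the values and the degree in each variable.\<close>

definition boxf :: "nat \<Rightarrow> nat \<Rightarrow> (('i \<times> nat) list \<Rightarrow> 'v) \<Rightarrow> (('i \<times> nat) list \<Rightarrow> 'v) \<Rightarrow> ('i \<times> nat) list \<Rightarrow> 'v poly" where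
  "boxf M R A C = (\<Sum>i\<in>UNIV. \<Sum>m<M. wedge (cst (pd i m \<circ> C)) ((Lop ^^ m) (Wf R A i)))"

lemma formp_Wf: "form (Suc h) A \<Longrightarrow> formp h (Wf R A i)"
  unfolding Wf_def by (intro formp_sum formp_NLpow formp_cst form_contr)

lemma formp_boxf: "form (Suc h) A \<Longrightarrow> form q C \<Longrightarrow> formp (q + h) (boxf M R A C)"
  unfolding boxf_def by (intro formp_sum formp_wedge formp_Lpow formp_cst form_pd formp_Wf)

lemma foldr_exp_op:
  assumes "\<And>a. a \<in> set L \<Longrightarrow> c a = 0 \<or> c a = 1"
  shows "foldr (\<lambda>a. exp_op smul dv a (c a)) L z = (if \<forall>a\<in>set L. c a = 1 then z else 0)"
  using assms
proof (induction L)
  case (Cons a L)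
  then have c: "c a = 0 \<or> c a = 1" by simp
  have "foldr (\<lambda>a. exp_op smul dv a (c a)) L z = (if \<forall>a\<in>set L. c a = 1 then z else 0)"
    by (rule Cons.IH) (use Cons.prems in auto)
  then show ?case using c by (cases "c a = 1") auto
qed simp

text \<open>The only nonzero partial derivative of u_j is 1, by u_j itself. All slots but the first
  therefore have exponential 1 and fix index and order, so just the sum over the first slot
  remains.\<close>

lemma Xmap_eq:
  fixes P :: "('i, 'v) arr"
  assumes u: "diff_variables pd u" and js: "length js = h" and M: "order_lt M f"
  shows "Xmap smul dv pd (Suc h) P (f # map u js) =
    (\<Sum>i\<in>UNIV. \<Sum>m<M. exp_op smul dv 0 (pd i m f) ((- mvar 0) ^ m * P (i # js)))"
proof -
  define g where "g is ms = (if length is = Suc h \<and> length ms = Suc h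
     then foldr (\<lambda>a. exp_op smul dv a (pd (is ! a) (ms ! a) ((f # map u js) ! a))) [0..<Suc h]
            ((\<Prod>a<Suc h. (- mvar a) ^ (ms ! a)) * P is) else 0)" for "is" :: "'i list" and ms :: "nat list"
  define e where "e = (\<lambda>(i :: 'i, m :: nat). (i # js, m # replicate h 0))"
  have upd: "pd i n (u j) = (if i = j \<and> n = 0 then 1 else 0)" for i j n
    using u unfolding diff_variables_def by blast
  have g: "g (i # is) (m # ms) = (if is = js \<and> ms = replicate h 0 then
      exp_op smul dv 0 (pd i m f) ((- mvar 0) ^ m * P (i # js)) else 0)"
    if l: "length is = h" "length ms = h" for i m "is" ms
  proof -
    let ?c = "\<lambda>a. pd ((i # is) ! a) ((m # ms) ! a) ((f # map u js) ! a)"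
    have c: "?c (Suc a) = (if is ! a = js ! a \<and> ms ! a = 0 then 1 else 0)" if "a < h" for a
      using that js by (simp add: upd)
    have st: "set [Suc 0..<Suc h] = Suc ` {..<h}"
      by (simp only: set_upt image_Suc_lessThan atLeastLessThanSuc_atLeastAtMost One_nat_def)
    have all: "(\<forall>a\<in>set [Suc 0..<Suc h]. ?c a = 1) \<longleftrightarrow> is = js \<and> ms = replicate h 0"
    proof -
      have "(\<forall>a\<in>set [Suc 0..<Suc h]. ?c a = 1) \<longleftrightarrow> (\<forall>a<h. is ! a = js ! a \<and> ms ! a = 0)"
      proof -
        have "(\<forall>a\<in>Suc ` {..<h}. X a) \<longleftrightarrow> (\<forall>a<h. X (Suc a))" for X by blast
        moreover have "?c (Suc a) = 1 \<longleftrightarrow> is ! a = js ! a \<and> ms ! a = 0" if "a < h" for a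
          unfolding c[OF that] by simp
        ultimately show ?thesis unfolding st by blast
      qed
      also have "\<dots> \<longleftrightarrow> is = js \<and> ms = replicate h 0"
        using l js by (auto simp: list_eq_iff_nth_eq)
      finally show ?thesis .
    qed
    have "foldr (\<lambda>a. exp_op smul dv a (?c a)) [Suc 0..<Suc h] z = (if is = js \<and> ms = replicate h 0 then z else 0)" for z
      unfolding all[symmetric]
    proof (rule foldr_exp_op)
      fix a assume "a \<in> set [Suc 0..<Suc h]"
      then obtain b where "b < h" "a = Suc b" unfolding st by auto
      then show "?c a = 0 \<or> ?c a = 1" using c[of b] by (simp split: if_splits)
    qed
    moreover have "[0..<Suc h] = 0 # [Suc 0..<Suc h]" by (rule upt_conv_Cons) simp
    moreover have "(\<Prod>a<Suc h. (- mvar a) ^ ((m # replicate h 0) ! a)) = (- mvar 0 :: 'v mpol) ^ m"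
      unfolding prod.lessThan_Suc_shift by simp
    ultimately show ?thesis unfolding g_def using l by (simp del: upt_Suc prod.lessThan_Suc)
  qed
  have supp: "g is ms = 0" if "(is, ms) \<notin> e ` (UNIV \<times> {..<M})" for "is" ms
  proof (cases "length is = Suc h \<and> length ms = Suc h")
    case True
    then obtain i is' m ms' where d: "is = i # is'" "ms = m # ms'" "length is' = h" "length ms' = h"
      by (metis length_Suc_conv)
    show ?thesis
    proof (cases "is' = js \<and> ms' = replicate h 0 \<and> m < M")
      case True
      then have "(is, ms) = e (i, m)" by (simp add: e_def d)
      then show ?thesis using that True by blast
    next
      case False
      then show ?thesis unfolding d(1,2) g[OF d(3,4)] using order_ltD[OF M, of m i] by auto
    qed
  next
    case False
    then show ?thesis unfolding g_def by (rule if_not_P)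
  qed
  have "Xmap smul dv pd (Suc h) P (f # map u js) = (\<Sum>(is, ms). g is ms)"
    by (simp add: Xmap_def g_def)
  also have "\<dots> = (\<Sum>(is, ms)\<in>e ` (UNIV \<times> {..<M}). g is ms)"
    by (rule Sum_any.expand_superset) (use supp in auto)
  also have "\<dots> = (\<Sum>(i, m)\<in>UNIV \<times> {..<M}. g (i # js) (m # replicate h 0))"
    by (subst sum.reindex) (auto simp: inj_on_def e_def split_def)
  also have "\<dots> = (\<Sum>i\<in>UNIV. \<Sum>m<M. g (i # js) (m # replicate h 0))"
    by (simp add: sum.cartesian_product)
  finally show ?thesis using js by (simp add: g)
qed

text \<open>The monomials are sorted by the power r of the first variable; class r is the
  contraction with exponent r, to which -\<lambda> - \<partial> is applied r times.\<close>

lemma Theta_Psi: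
  assumes t: "inj_on t {..<h}" and p: "in_vars {..<Suc h} p" and js: "length js = h"
    and R: "\<And>m. lkp p m \<noteq> 0 \<Longrightarrow> lkp m 0 < R"
    and C: "\<And>r ns. length ns = h \<Longrightarrow> lkp p (vmon id (r # ns)) = C r (zip js ns)"
    and ns: "length ns = h"
  shows "Theta t (Psi t h p) ns = (\<Sum>r<R. (NL ^^ r) (cst (C r))) (zip js ns)"
proof -
  let ?\<nu> = "neg_shift dv (\<Sum>b<h. mvar (t b))"
  let ?K = "Poly_Mapping.keys p"
  define G where "G r = [:\<Sum>e\<in>{e \<in> ?K. lkp e 0 = r}. Poly_Mapping.single (tail t h e) (lkp p e):]" for r
  have pc: "[:sum f S:] = (\<Sum>e\<in>S. [:f e:])" for f :: "_ \<Rightarrow> 'v mpol" and S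
    by (rule additive_map_sum[of "\<lambda>a. [:a:]"]) (simp add: additive_map_def)
  have "Psi t h p = (\<Sum>e\<in>?K. (?\<nu> ^^ lkp e 0) [:Poly_Mapping.single (tail t h e) (lkp p e):])"
    by (rule Psi_superset) auto
  also have "\<dots> = (\<Sum>r<R. \<Sum>e\<in>{e \<in> ?K. lkp e 0 = r}. (?\<nu> ^^ lkp e 0) [:Poly_Mapping.single (tail t h e) (lkp p e):])"
    by (rule sum.group[symmetric]) (use R in \<open>auto simp: in_keys_iff\<close>)
  also have "\<dots> = (\<Sum>r<R. (?\<nu> ^^ r) (G r))"
    by (simp add: G_def pc additive_map_sum[OF additive_ns_pow])
  finally have Psi: "Psi t h p = (\<Sum>r<R. (?\<nu> ^^ r) (G r))" .
  have Gr: "Theta t (G r) ns = cst (C r) (zip js ns)" if ns: "length ns = h" for r ns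
  proof -
    have eq: "tail t h e = vmon t ns \<longleftrightarrow> e = vmon id (r # ns)" if e: "e \<in> ?K" "lkp e 0 = r" for e
    proof -
      let ?es = "map (\<lambda>b. lkp e (Suc b)) [0..<h]"
      have "Poly_Mapping.keys e \<subseteq> {..<Suc h}" using p e(1) by (auto simp: in_vars_keys)
      then have "e = vmon id (map (\<lambda>b. lkp e (id b)) [0..<Suc h])" by (intro vmon_surj) auto
      also have "map (\<lambda>b. lkp e (id b)) [0..<Suc h] = r # ?es"
        using e(2) by (simp add: map_upt_Suc del: upt_Suc)
      finally have e1: "e = vmon id (r # ?es)" .
      have e2: "tail t h e = vmon t ?es" by (simp add: tail_def vmon_def)
      show ?thesis
      proof
        assume "tail t h e = vmon t ns"
        then have "?es = ns" using vmon_inj[OF t, of ?es ns] ns e2 by simp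
        then show "e = vmon id (r # ns)" using e1 by simp
      next
        assume "e = vmon id (r # ns)"
        then have "r # ?es = r # ns" using vmon_inj[of id "Suc h" "r # ?es" "r # ns"] e1 ns by simp
        then show "tail t h e = vmon t ns" using e2 by simp
      qed
    qed
    have "lkp (\<Sum>e\<in>{e \<in> ?K. lkp e 0 = r}. Poly_Mapping.single (tail t h e) (lkp p e)) (vmon t ns)
       = (\<Sum>e\<in>{e \<in> ?K. lkp e 0 = r}. if tail t h e = vmon t ns then lkp p e else 0)"
      by (simp only: lookup_sum lookup_single when_def)
    also have "\<dots> = (\<Sum>e\<in>{e \<in> ?K. lkp e 0 = r}. if e = vmon id (r # ns) then lkp p e else 0)"
      by (rule sum.cong) (use eq in auto)
    also have "\<dots> = lkp p (vmon id (r # ns))"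
    proof -
      have "lkp (vmon id (r # ns)) 0 = r" using lookup_vmon[of id "r # ns" 0] by simp
      then show ?thesis by (simp add: sum.delta in_keys_iff)
    qed
    finally show ?thesis using C[OF ns]
      by (simp add: poly_eq_iff coeff_Theta G_def cst_def coeff_pCons split: nat.split)
  qed
  have "Theta t (Psi t h p) ns = (\<Sum>r<R. Theta t ((?\<nu> ^^ r) (G r)) ns)"
    unfolding Psi by (rule additive_map_sum[OF additive_Theta])
  also have "\<dots> = (\<Sum>r<R. (NL ^^ r) (cst (C r)) (zip js ns))"
    using Theta_neg_shift_pow[OF t js Gr ns] by simp
  finally show ?thesis by (simp add: sum_fun_apply)
qed

lemma Psi_mvar_pow: "Psi t h ((- mvar 0) ^ m * p) = ((\<lambda>G. - neg_shift dv (\<Sum>b<h. mvar (t b)) G) ^^ m) (Psi t h p)"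
proof (induction m)
  case (Suc m)
  have e: "(- mvar 0) ^ Suc m * p = - (mvar 0 * ((- mvar 0) ^ m * p))" by (simp add: mult.assoc)
  show ?case unfolding e additive_map_minus[OF additive_Psi] Psi_mvar Suc by simp
qed simp

lemma Theta_shift_pow:
  assumes t: "inj_on t {..<h}" and js: "length js = h"
    and F: "\<And>ns. length ns = h \<Longrightarrow> Theta t G ns = F (zip js ns)"
  shows "length ns = h \<Longrightarrow> Theta t (((\<lambda>G. - neg_shift dv (\<Sum>b<h. mvar (t b)) G) ^^ r) G) ns = (Lop ^^ r) F (zip js ns)"
proof (induction r arbitrary: ns)
  case (Suc r)
  show ?case unfolding funpow.simps(2) o_apply
    using Theta_neg_shift[OF t js Suc.prems Suc.IH] additive_map_minus[OF additive_Theta]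
    by (simp add: NL_def)
qed (simp add: F)

text \<open>The factor (-\<lambda>_0)^m turns into (\<lambda> + \<partial>)^m, because \<lambda>_0
  is replaced by -\<lambda> - \<partial>.\<close>

lemma Theta_Xmap:
  assumes u: "diff_variables pd u" and js: "length js = h" and M: "order_lt M f" and t: "inj_on t {..<h}"
    and P: "\<And>is. in_vars {..<Suc h} (P is)" and R: "\<And>i r xs. r \<ge> R \<Longrightarrow> coef P ((i, r) # xs) = 0"
    and PO: "\<And>is. length is \<noteq> Suc h \<Longrightarrow> P is = 0"
    and ns: "length ns = h"
  shows "Theta t (Psi t h (Xmap smul dv pd (Suc h) P (f # map u js))) ns =
    (\<Sum>i\<in>UNIV. \<Sum>m<M. Polynomial.smult (pd i m f) ((Lop ^^ m) (Wf R (coef P) i) (zip js ns)))"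
proof -
  have "Theta t (Psi t h (exp_op smul dv 0 (pd i m f) ((- mvar 0) ^ m * P (i # js)))) ns =
     Polynomial.smult (pd i m f) ((Lop ^^ m) (Wf R (coef P) i) (zip js ns))" for i m
  proof -
    have "Theta t (Psi t h (P (i # js))) ns = Wf R (coef P) i (zip js ns)" if "length ns = h" for ns
      unfolding Wf_def
    proof (rule Theta_Psi[OF t P js _ _ that])
      show "lkp (P (i # js)) (vmon id (r # ns)) = contr (i, r) (coef P) (zip js ns)" if "length ns = h" for r ns
        using that js by (simp add: contr_def coef_def)
      show "lkp m 0 < R" if "lkp (P (i # js)) m \<noteq> 0" for m
      proof (rule ccontr)
        assume r: "\<not> lkp m 0 < R"
        have "Poly_Mapping.keys m \<subseteq> {..<Suc h}" using in_varsD[OF P that] .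
        then have "m = vmon id (map (\<lambda>b. lkp m (id b)) [0..<Suc h])" by (intro vmon_surj) auto
        then have m: "m = vmon id (lkp m 0 # map (\<lambda>b. lkp m (Suc b)) [0..<h])" by (simp add: map_upt_Suc del: upt_Suc)
        have "coef P ((i, lkp m 0) # zip js (map (\<lambda>b. lkp m (Suc b)) [0..<h])) = lkp (P (i # js)) m"
          using js by (simp add: coef_def flip: m)
        then show False using that R[of "lkp m 0"] r by simp
      qed
    qed
    then have "Theta t (((\<lambda>G. - neg_shift dv (\<Sum>b<h. mvar (t b)) G) ^^ m) (Psi t h (P (i # js)))) ns =
       (Lop ^^ m) (Wf R (coef P) i) (zip js ns)"
      by (intro Theta_shift_pow[OF t js _ ns])
    then show ?thesis
      by (simp add: Psi_exp Psi_mvar_pow poly_eq_iff coeff_Theta lookup_mconst_mult)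
  qed
  then show ?thesis
    by (simp add: Xmap_eq[OF u js M] additive_map_sum[OF additive_Psi] additive_map_sum[OF additive_Theta])
qed

section \<open>Variables and coefficients of the product\<close>

definition pvars :: "nat set \<Rightarrow> 'v mpol poly \<Rightarrow> bool" where
  "pvars U G \<longleftrightarrow> (\<forall>n. in_vars U (coeff G n))"

lemma pvars_neg_shift: "in_vars U l \<Longrightarrow> pvars U G \<Longrightarrow> pvars U (neg_shift dv l G)"
  unfolding pvars_def neg_shift_def
  by (auto simp: coeff_map_poly coeff_pCons dv_simps intro!: in_vars_intros in_vars_cmap split: nat.split)

lemma pvars_neg_shift_pow: "in_vars U l \<Longrightarrow> pvars U G \<Longrightarrow> pvars U ((neg_shift dv l ^^ n) G)"
  by (induction n) (auto intro: pvars_neg_shift)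

lemma pvars_sum: "(\<And>i. i \<in> I \<Longrightarrow> pvars U (f i)) \<Longrightarrow> pvars U (sum f I)"
  unfolding pvars_def by (auto simp: coeff_sum intro!: in_vars_sum)

lemma pvars_const: "in_vars U c \<Longrightarrow> pvars U [:c:]"
  unfolding pvars_def by (auto simp: coeff_pCons split: nat.split)

lemma in_vars_sum_mvar: "t ` {..<h} \<subseteq> U \<Longrightarrow> in_vars U (\<Sum>b<h. mvar (t b) :: 'v mpol)"
  by (auto intro!: in_vars_sum in_vars_mvar)

lemma pvars_Psi: "pvars (t ` {..<h}) (Psi t h X)"
  unfolding Psi_def
  by (intro pvars_sum pvars_neg_shift_pow pvars_const in_vars_sum_mvar in_vars_mult in_vars_mconst
      in_vars_prod in_vars_power in_vars_mvar) auto

lemma coeff_sgn_mult: "coeff (of_int (sign s) * G) n = of_int (sign s) * coeff (G :: 'v mpol poly) n"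
  by (cases s rule: sign_cases) auto

lemma vmon_join:
  "vmon t xs = (\<Sum>b<q. Poly_Mapping.single (t b) (xs ! b)) + (\<Sum>b<h. Poly_Mapping.single (t (q + b)) (xs ! (q + b)))"
  if "length xs = q + h"
proof -
  have "(\<Sum>b<q + h. f b) = (\<Sum>b<q. f b) + (\<Sum>b<h. f (q + b))" for f :: "nat \<Rightarrow> nat \<Rightarrow>\<^sub>0 nat"
    by (induction h) (simp_all add: add.assoc)
  then show ?thesis using that by (simp add: vmon_def)
qed

text \<open>A shuffle gives one group of variables to Q and the other to P, so coefficients factor.
  The signed sum over shuffles is then an exterior product.\<close>

lemma box_entry:
  fixes P Q :: "('i, 'v) arr"
  assumes u: "diff_variables pd u" and P: "P \<in> Omega (Suc h)" and Q: "Q \<in> Omega q"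
    and M: "\<And>xs. order_lt M (coef Q xs)" and R: "\<And>i r xs. r \<ge> R \<Longrightarrow> coef P ((i, r) # xs) = 0"
    and li: "length is = q + h"
  shows "length ms = q + h \<Longrightarrow> lkp (coeff (box smul dv pd u (Suc h) q P Q is) n) (vmon id ms) =
      coeff (boxf M R (coef P) (coef Q) (zip is ms)) n"
    and "pvars {..<q + h} (box smul dv pd u (Suc h) q P Q is)"
proof -
  define S where "S = shuffles_perm q h"
  define iq where "iq s = map (\<lambda>a. is ! s a) [0..<q]" for s
  define js where "js s = map (\<lambda>b. is ! s b) [q..<q + h]" for s
  define Qs where "Qs s = mrename s (Q (iq s))" for s
  define t where "t s b = s (q + b)" for s :: "nat \<Rightarrow> nat" and b
  define g where "g s k = Psi (t s) h (Xmap smul dv pd (Suc h) P (lkp (Qs s) k # map u (js s)))" for s k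
  have box: "box smul dv pd u (Suc h) q P Q is = (\<Sum>s\<in>S. of_int (sign s) *
      (\<Sum>k\<in>Poly_Mapping.keys (Qs s). Polynomial.smult (Poly_Mapping.single k 1) (g s k)))"
    unfolding box_def by (simp add: li Let_def S_def g_def Psi_def Qs_def iq_def js_def t_def o_def)
  have perm: "s permutes {..<q + h}" if "s \<in> S" for s using that by (simp add: S_def shuffles_perm_def)
  have inj: "inj s" if "s \<in> S" for s using permutes_inj[OF perm[OF that]] .
  have Qv: "in_vars (s ` {..<q}) (Qs s)" for s
    unfolding Qs_def using Q by (intro in_vars_mrename) (auto simp: Omega_iff)
  have kv: "in_vars (s ` {..<q}) (Poly_Mapping.single k (1::'v))" if "k \<in> Poly_Mapping.keys (Qs s)" for s k
    using Qv[of s] that unfolding in_vars_keys by (intro in_vars_single[unfolded in_vars_keys]) blast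
  have gv: "in_vars (t s ` {..<h}) (coeff (g s k) n)" for s k n
    using pvars_Psi unfolding g_def pvars_def by blast
  have im: "s ` {..<q} \<subseteq> {..<q + h}" "t s ` {..<h} \<subseteq> {..<q + h}" if "s \<in> S" for s
    using permutes_in_image[OF perm[OF that]] by (auto simp: t_def image_subset_iff)
  show "pvars {..<q + h} (box smul dv pd u (Suc h) q P Q is)"
    unfolding box
  proof (rule pvars_sum)
    fix s assume s: "s \<in> S"
    have "in_vars {..<q + h} (coeff (\<Sum>k\<in>Poly_Mapping.keys (Qs s). Polynomial.smult (Poly_Mapping.single k 1) (g s k)) n)" for n
      unfolding coeff_sum coeff_smult
      by (intro in_vars_sum in_vars_mult in_vars_subset[OF kv im(1)[OF s]] in_vars_subset[OF gv im(2)[OF s]])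
    then show "pvars {..<q + h} (of_int (sign s) * (\<Sum>k\<in>Poly_Mapping.keys (Qs s). Polynomial.smult (Poly_Mapping.single k 1) (g s k)))"
      unfolding pvars_def coeff_sgn_mult by (cases s rule: sign_cases) (auto intro: in_vars_minus)
  qed
  assume lm: "length ms = q + h"
  let ?z = "zip is ms"
  let ?F = "\<lambda>i m. (Lop ^^ m) (Wf R (coef P) i)"
  have fP: "form (Suc h) (coef P)" and fQ: "form q (coef Q)" using P Q by (auto simp: Omega_iff)
  have summand: "lkp (coeff (\<Sum>k\<in>Poly_Mapping.keys (Qs s). Polynomial.smult (Poly_Mapping.single k 1) (g s k)) n) (vmon id ms) =
     (\<Sum>i\<in>UNIV. \<Sum>m<M. coeff (cst (pd i m \<circ> coef Q) (map (\<lambda>a. ?z ! s a) [0..<q]) * ?F i m (map (\<lambda>b. ?z ! s b) [q..<q + h])) n)"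
    if s: "s \<in> S" for s
  proof -
    define mq where "mq = map (\<lambda>a. ms ! s a) [0..<q]"
    define mh where "mh = map (\<lambda>b. ms ! s b) [q..<q + h]"
    define mu where "mu = vmon s mq"
    define om where "om = vmon (t s) mh"
    have sl: "s a < q + h" if "a < q + h" for a using permutes_in_image[OF perm[OF s], of a] that by simp
    \<comment> \<open>The exponent splits into mu on the variables of Q and om on those of
      P.\<close>
    have "vmon id ms = vmon s (permute_list s ms)" using vmon_permute[of s ms] perm[OF s] lm by simp
    also have "\<dots> = mu + om"
    proof -
      have p: "permute_list s ms ! b = ms ! s b" if "b < q + h" for b
        using permute_list_nth[of s ms b] perm[OF s] lm that by simp
      have "vmon s (permute_list s ms) = (\<Sum>b<q. Poly_Mapping.single (s b) (permute_list s ms ! b)) +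
          (\<Sum>b<h. Poly_Mapping.single (s (q + b)) (permute_list s ms ! (q + b)))"
        by (rule vmon_join) (simp add: lm)
      also have "\<dots> = mu + om"
        unfolding mu_def om_def vmon_def
        by (intro arg_cong2[of _ _ _ _ "(+)"] sum.cong) (auto simp: mq_def mh_def t_def p)
      finally show ?thesis .
    qed
    finally have e: "vmon id ms = mu + om" .
    have mul: "Poly_Mapping.keys mu \<subseteq> s ` {..<q}" and oml: "Poly_Mapping.keys om \<subseteq> t s ` {..<h}"
      using keys_vmon[of s mq] keys_vmon[of "t s" mh] by (auto simp: mu_def om_def mq_def mh_def)
    have ieq: "s a = s b \<longleftrightarrow> a = b" for a b using inj[OF s] by (rule inj_eq)
    have dis: "s ` {..<q} \<inter> t s ` {..<h} = {}" by (auto simp: t_def ieq)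
    have tinj: "inj_on (t s) {..<h}" by (rule inj_onI) (simp add: t_def ieq)
    let ?f = "coef Q (zip (iq s) mq)"
    have Qmu: "lkp (Qs s) mu = ?f"
      using lookup_mrename_vmon[OF inj[OF s], of id mq "Q (iq s)"] by (simp add: Qs_def mu_def coef_zip iq_def mq_def)
    have jl: "length (js s) = h" "length mh = h" by (simp_all add: js_def mh_def)
    have val: "lkp (coeff (Psi (t s) h (Xmap smul dv pd (Suc h) P (?f # map u (js s)))) n) om =
      (\<Sum>i\<in>UNIV. \<Sum>m<M. pd i m ?f * coeff (?F i m (zip (js s) mh)) n)"
    proof -
      have "Theta (t s) (Psi (t s) h (Xmap smul dv pd (Suc h) P (?f # map u (js s)))) mh =
        (\<Sum>i\<in>UNIV. \<Sum>m<M. Polynomial.smult (pd i m ?f) (?F i m (zip (js s) mh)))"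
        by (rule Theta_Xmap[OF u jl(1) M tinj _ R _ jl(2)]) (use P in \<open>auto simp: Omega_iff\<close>)
      from arg_cong[OF this, of "\<lambda>p. coeff p n"] show ?thesis by (simp add: coeff_Theta om_def coeff_sum)
    qed
    have "lkp (coeff (\<Sum>k\<in>Poly_Mapping.keys (Qs s). Polynomial.smult (Poly_Mapping.single k 1) (g s k)) n) (vmon id ms)
      = (\<Sum>k\<in>Poly_Mapping.keys (Qs s). lkp (Poly_Mapping.single k 1 * coeff (g s k) n) (mu + om))"
      by (simp add: coeff_sum lookup_sum e)
    \<comment> \<open>The two groups of variables are disjoint, so only the monomial mu of the entry
      of Q contributes.\<close>
    also have "\<dots> = (\<Sum>k\<in>Poly_Mapping.keys (Qs s). if k = mu then lkp (coeff (g s k) n) om else 0)"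
      by (intro sum.cong refl, subst lookup_mult_disjoint[OF kv gv dis mul oml]) (auto simp: lookup_single when_def)
    also have "\<dots> = (if mu \<in> Poly_Mapping.keys (Qs s) then lkp (coeff (g s mu) n) om else 0)"
      by simp
    also have "\<dots> = (\<Sum>i\<in>UNIV. \<Sum>m<M. pd i m ?f * coeff (?F i m (zip (js s) mh)) n)"
      using val Qmu by (auto simp: g_def in_keys_iff pd_simps)
    finally have fin: "lkp (coeff (\<Sum>k\<in>Poly_Mapping.keys (Qs s). Polynomial.smult (Poly_Mapping.single k 1) (g s k)) n) (vmon id ms)
      = (\<Sum>i\<in>UNIV. \<Sum>m<M. pd i m ?f * coeff (?F i m (zip (js s) mh)) n)" .
    show ?thesis
    proof -
      have 1: "map (\<lambda>a. ?z ! s a) [0..<q] = zip (iq s) mq"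
        using sl li lm by (intro nth_equalityI) (auto simp: iq_def mq_def)
      have 2: "map (\<lambda>b. ?z ! s b) [q..<q + h] = zip (js s) mh"
        using sl li lm by (intro nth_equalityI) (auto simp: js_def mh_def)
      show ?thesis unfolding 1 2 fin by (simp add: cst_def)
    qed
  qed
  have hom: "homog q (cst (pd i m \<circ> coef Q))" "homog h (?F i m)" for i m
    using formp_cst[OF form_pd[OF fQ, of i m]] formp_Lpow[OF formp_Wf[OF fP], of m R i] by (auto simp: formp_def)
  have zl: "length ?z = q + h" using li lm by simp
  have "lkp (coeff (box smul dv pd u (Suc h) q P Q is) n) (vmon id ms) = (\<Sum>s\<in>S. of_int (sign s) *
     (\<Sum>i\<in>UNIV. \<Sum>m<M. coeff (cst (pd i m \<circ> coef Q) (map (\<lambda>a. ?z ! s a) [0..<q]) * ?F i m (map (\<lambda>b. ?z ! s b) [q..<q + h])) n))"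
    unfolding box coeff_sum[of _ S] lookup_sum[of _ S] coeff_sgn_mult lookup_sgn_mult
    by (intro sum.cong refl) (simp only: summand)
  also have "\<dots> = (\<Sum>i\<in>UNIV. \<Sum>m<M. \<Sum>s\<in>S. of_int (sign s) *
     coeff (cst (pd i m \<circ> coef Q) (map (\<lambda>a. ?z ! s a) [0..<q]) * ?F i m (map (\<lambda>b. ?z ! s b) [q..<q + h])) n)"
    unfolding sum_distrib_left by (subst sum.swap, intro sum.cong refl, rule sum.swap)
  also have "\<dots> = (\<Sum>i\<in>UNIV. \<Sum>m<M. coeff (wedge (cst (pd i m \<circ> coef Q)) (?F i m) ?z) n)"
  proof (intro sum.cong refl)
    fix i m
    have c: "coeff (of_int (sign s) * p) n = of_int (sign s) * coeff (p :: 'v poly) n" for s :: "nat \<Rightarrow> nat" and p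
      by (cases s rule: sign_cases) auto
    show "(\<Sum>s\<in>S. of_int (sign s) *
     coeff (cst (pd i m \<circ> coef Q) (map (\<lambda>a. ?z ! s a) [0..<q]) * ?F i m (map (\<lambda>b. ?z ! s b) [q..<q + h])) n)
      = coeff (wedge (cst (pd i m \<circ> coef Q)) (?F i m) ?z) n"
      unfolding shuffle_wedge[OF hom zl, symmetric] S_def coeff_sum c ..
  qed
  also have "\<dots> = coeff (boxf M R (coef P) (coef Q) ?z) n"
    by (simp add: boxf_def sum_fun_apply coeff_sum)
  finally show "lkp (coeff (box smul dv pd u (Suc h) q P Q is) n) (vmon id ms) =
      coeff (boxf M R (coef P) (coef Q) ?z) n" .
qed

subsection \<open>The substitution \<open>\<lambda> \<mapsto> -\<lambda>-\<partial>\<close>\<close>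

text \<open>The substitution \<open>\<lambda> \<mapsto> -\<lambda> - \<partial>\<close> in polynomials of degree at most \<open>D\<close>.\<close>

definition Phi :: "nat \<Rightarrow> (('i \<times> nat) list \<Rightarrow> 'v poly) \<Rightarrow> ('i \<times> nat) list \<Rightarrow> 'v poly" where
  "Phi D F = (\<Sum>n\<le>D. (NL ^^ n) (cst ((\<lambda>p. coeff p n) \<circ> F)))"

lemma additive_cst: "additive_map cst"
  by (simp add: additive_map_def cst_def fun_eq_iff)

lemma additive_Phi: "additive_map (Phi D)"
proof -
  have "(\<lambda>p. coeff p n) \<circ> (F + G) = ((\<lambda>p. coeff p n) \<circ> F) + ((\<lambda>p. coeff p n) \<circ> G)" for F G :: "('i \<times> nat) list \<Rightarrow> 'v poly" and n
    by (simp add: fun_eq_iff)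
  then show ?thesis
    by (simp add: additive_map_def[of "Phi D"] Phi_def additive_map_add[OF additive_cst] additive_map_add[OF additive_NLpow] sum.distrib)
qed

lemma Phi_lam: "Phi (Suc D) (pCons 0 \<circ> F) = NL (Phi D F)"
proof -
  have 0: "(\<lambda>p. coeff p 0) \<circ> (pCons 0 \<circ> F) = 0" and
    s: "(\<lambda>p. coeff p (Suc n)) \<circ> (pCons 0 \<circ> F) = (\<lambda>p. coeff p n) \<circ> F" for n
    by (auto simp: fun_eq_iff)
  show ?thesis unfolding Phi_def sum.atMost_Suc_shift 0 s
    by (simp add: additive_map_0[OF additive_cst] additive_map_sum[OF additive_NL])
qed

definition deg_le :: "nat \<Rightarrow> (('i \<times> nat) list \<Rightarrow> 'v poly) \<Rightarrow> bool" where
  "deg_le k F \<longleftrightarrow> (\<forall>n>k. (\<lambda>p. coeff p n) \<circ> F = 0)"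

lemma Phi_extend: "deg_le k F \<Longrightarrow> k \<le> D \<Longrightarrow> Phi D F = Phi k F"
  unfolding Phi_def
  by (rule sum.mono_neutral_right) (auto simp: deg_le_def additive_map_0[OF additive_cst] additive_map_0[OF additive_NLpow])

lemma cst_dhat: "cst (dhat dv A) = dhat (map_poly dv) (cst A)"
proof
  fix xs show "cst (dhat dv A) xs = dhat (map_poly dv) (cst A) xs"
  proof (induction xs arbitrary: A)
    case Nil then show ?case by (simp add: cst_def map_poly_pCons dv_simps)
  next
    case (Cons x xs)
    have IH: "cst (dhat dv A) xs = dhat (map_poly dv) (cst A) xs" for A by (rule Cons.IH)
    have c: "contr x (cst A) = cst (contr x A)" by (simp add: cst_def)
    show "cst (dhat dv A) (x # xs) = dhat (map_poly dv) (cst A) (x # xs)"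
      by (simp add: c IH[symmetric]) (simp add: cst_def)
  qed
qed

lemma coeff_dhat: "(\<lambda>p. coeff p n) \<circ> dhat (map_poly dv) F = dhat dv ((\<lambda>p. coeff p n) \<circ> F)"
proof
  fix xs show "((\<lambda>p. coeff p n) \<circ> dhat (map_poly dv) F) xs = dhat dv ((\<lambda>p. coeff p n) \<circ> F) xs"
  proof (induction xs arbitrary: F)
    case Nil then show ?case by (simp add: coeff_map_poly dv_simps)
  next
    case (Cons x xs)
    have IH: "coeff (dhat (map_poly dv) F xs) n = dhat dv ((\<lambda>p. coeff p n) \<circ> F) xs" for F
    proof -
      have "((\<lambda>p. coeff p n) \<circ> dhat (map_poly dv) F) xs = dhat dv ((\<lambda>p. coeff p n) \<circ> F) xs" by (rule Cons.IH)
      then show ?thesis by (simp only: o_apply)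
    qed
    show "((\<lambda>p. coeff p n) \<circ> dhat (map_poly dv) F) (x # xs) = dhat dv ((\<lambda>p. coeff p n) \<circ> F) (x # xs)"
      by (simp add: IH)
  qed
qed

lemma dhat_Lop: "dhat (map_poly dv) (Lop F) = Lop (dhat (map_poly dv) F)"
proof -
  have "dhat (map_poly dv) (pCons 0 \<circ> F) = pCons 0 \<circ> dhat (map_poly dv) F"
  proof
    fix xs show "dhat (map_poly dv) (pCons 0 \<circ> F) xs = (pCons 0 \<circ> dhat (map_poly dv) F) xs"
    proof (induction xs arbitrary: F)
      case Nil then show ?case by (simp add: map_poly_pCons dv_simps)
    next
      case (Cons x xs)
      have IH: "dhat (map_poly dv) (pCons 0 \<circ> F) xs = (pCons 0 \<circ> dhat (map_poly dv) F) xs" for F :: "('i \<times> nat) list \<Rightarrow> 'v poly"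
        by (rule Cons.IH)
      show "dhat (map_poly dv) (pCons 0 \<circ> F) (x # xs) = (pCons 0 \<circ> dhat (map_poly dv) F) (x # xs)"
        by (simp add: IH)
    qed
  qed
  then show ?thesis unfolding Lop_def by (simp add: dhat_add[OF additive_dvp])
qed

lemma dhat_NLpow: "dhat (map_poly dv) ((NL ^^ n) F) = (NL ^^ n) (dhat (map_poly dv) F)"
proof (induction n)
  case (Suc n)
  have "dhat (map_poly dv) (NL F) = NL (dhat (map_poly dv) F)" for F
    unfolding NL_def additive_map_minus[OF additive_dhat[OF additive_dvp]] dhat_Lop ..
  then show ?case unfolding funpow.simps(2) o_apply Suc[symmetric] .
qed simp

lemma Phi_dhat: "Phi D (dhat (map_poly dv) F) = dhat (map_poly dv) (Phi D F)"
  unfolding Phi_def coeff_dhat cst_dhat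
  by (simp add: additive_map_sum[OF additive_dhat[OF additive_dvp]] dhat_NLpow)

lemma pCons_scale:
  fixes F :: "'z \<Rightarrow> 'v poly" shows "pCons 0 \<circ> F = (*) [:0, 1:] \<circ> F"
  by (rule ext) (simp add: poly_eq_iff coeff_pCons split: nat.split)

text \<open>Multiplication by \<lambda> can be attached to either factor: here to the second one, in
  \<open>NL_wedge\<close> to the first.\<close>

lemma Lop_wedge: "Lop (wedge X Y) = wedge (dhat (map_poly dv) X) Y + wedge X (Lop Y)"
proof -
  have "pCons 0 \<circ> wedge X Y = wedge X (pCons 0 \<circ> Y)"
    unfolding pCons_scale by (simp add: fun_eq_iff wedge_scale_right)
  then show ?thesis unfolding Lop_def
    by (simp add: dhat_wedge[OF deriv_map_poly[OF deriv_dv]] wedge_lin algebra_simps)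
qed

lemma NL_wedge: "NL (wedge X Y) = wedge (NL X) Y - wedge X (dhat (map_poly dv) Y)"
proof -
  have "pCons 0 \<circ> wedge X Y = wedge (pCons 0 \<circ> X) Y"
    unfolding pCons_scale by (simp add: fun_eq_iff wedge_scale_left)
  then show ?thesis unfolding NL_def Lop_def
    by (simp add: dhat_wedge[OF deriv_map_poly[OF deriv_dv]] wedge_lin algebra_simps)
qed

lemma deg_le_add: "deg_le k F \<Longrightarrow> deg_le k G \<Longrightarrow> deg_le k (F + G)"
  and deg_le_diff: "deg_le k F \<Longrightarrow> deg_le k G \<Longrightarrow> deg_le k (F - G)"
  and deg_le_mono: "deg_le k F \<Longrightarrow> k \<le> l \<Longrightarrow> deg_le l F"
  by (auto simp: deg_le_def fun_eq_iff)

lemma deg_le_lam: "deg_le k F \<Longrightarrow> deg_le (Suc k) (pCons 0 \<circ> F)"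
  by (auto simp: deg_le_def fun_eq_iff coeff_pCons split: nat.split)

lemma deg_le_dhat: "deg_le k F \<Longrightarrow> deg_le k (dhat (map_poly dv) F)"
  by (auto simp: deg_le_def coeff_dhat dhat_lin additive_dv)

text \<open>Substituting -\<lambda> - \<partial>, where \<partial> acts on the whole product,
  changes \<lambda> + (\<partial> on C) into -\<lambda> - (\<partial> on A): the operator moves from
  the right factor to the left one.\<close>

lemma Phi_wedge:
  "deg_le k (wedge (cst A) ((Lop ^^ k) (cst C))) \<and>
   Phi k (wedge (cst A) ((Lop ^^ k) (cst C))) = wedge ((NL ^^ k) (cst A)) (cst C)"
proof (induction k arbitrary: A)
  case 0
  have "wedge (cst A) (cst C) = cst (wedge A C)" for A
  proof
    fix xs show "wedge (cst A) (cst C) xs = cst (wedge A C) xs"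
    proof (induction xs arbitrary: A C)
      case (Cons x xs)
      have IH: "wedge (cst A) (cst C) xs = cst (wedge A C) xs" for A C :: "('i \<times> nat) list \<Rightarrow> 'v" by (rule Cons.IH)
      have c: "contr x (cst A) = cst (contr x A)" for A by (simp add: cst_def)
      have s: "signed (cst A) = cst (signed A)" for A :: "('i \<times> nat) list \<Rightarrow> 'v"
        unfolding cst_def by (simp add: signed_comp[OF additive_const])
      show "wedge (cst A) (cst C) (x # xs) = cst (wedge A C) (x # xs)"
        by (simp add: c s IH) (simp add: cst_def)
    qed (simp add: cst_def)
  qed
  moreover have "(\<lambda>p. coeff p 0) \<circ> cst A = A" "n > 0 \<Longrightarrow> (\<lambda>p. coeff p n) \<circ> cst A = 0" for n and A :: "('i \<times> nat) list \<Rightarrow> 'v"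
    by (auto simp: cst_def fun_eq_iff coeff_pCons split: nat.split)
  ultimately show ?case by (auto simp: deg_le_def Phi_def)
next
  case (Suc k)
  let ?W = "wedge (cst A) ((Lop ^^ k) (cst C))" and ?V = "wedge (cst (dhat dv A)) ((Lop ^^ k) (cst C))"
  let ?X = "(NL ^^ k) (cst A)"
  have IH: "deg_le k ?W" "Phi k ?W = wedge ?X (cst C)" using Suc.IH[of A] by blast+
  have IHV: "deg_le k ?V" "Phi k ?V = wedge ((NL ^^ k) (cst (dhat dv A))) (cst C)" using Suc.IH[of "dhat dv A"] by blast+
  \<comment> \<open>Acting on C alone is acting on the product minus acting on A; the substitution
    is known on each of the three terms.\<close>
  have e: "wedge (cst A) ((Lop ^^ Suc k) (cst C)) = (pCons 0 \<circ> ?W) + dhat (map_poly dv) ?W - ?V"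
    using Lop_wedge[of "cst A" "(Lop ^^ k) (cst C)"] unfolding Lop_def[of ?W] cst_dhat by (simp add: algebra_simps)
  have d: "deg_le (Suc k) (wedge (cst A) ((Lop ^^ Suc k) (cst C)))"
    unfolding e by (intro deg_le_add deg_le_diff deg_le_lam IH deg_le_mono[OF deg_le_dhat[OF IH(1)]] deg_le_mono[OF IHV(1)]) auto
  have PV: "Phi (Suc k) ?V = wedge (dhat (map_poly dv) ?X) (cst C)"
    using Phi_extend[OF IHV(1) le_SucI[OF order_refl]] IHV(2) by (simp only: cst_dhat dhat_NLpow)
  have PW: "Phi (Suc k) (dhat (map_poly dv) ?W) = dhat (map_poly dv) (wedge ?X (cst C))"
    using Phi_extend[OF deg_le_dhat[OF IH(1)] le_SucI[OF order_refl]] IH(2) by (simp only: Phi_dhat)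
  have "Phi (Suc k) (wedge (cst A) ((Lop ^^ Suc k) (cst C))) = NL (wedge ?X (cst C)) + dhat (map_poly dv) (wedge ?X (cst C)) -
      wedge (dhat (map_poly dv) ?X) (cst C)"
    unfolding e additive_map_add[OF additive_Phi] additive_map_diff[OF additive_Phi] Phi_lam IH(2) PW PV ..
  also have "\<dots> = wedge ((NL ^^ Suc k) (cst A)) (cst C)"
    by (simp add: NL_wedge dhat_wedge[OF deriv_map_poly[OF deriv_dv]] algebra_simps)
  finally show ?case using d by blast
qed

text \<open>A sign as an operator on forms, so that it passes through every additive operator by one
  lemma and parities are compared once at the end.\<close>

definition sg :: "nat \<Rightarrow> (('i \<times> nat) list \<Rightarrow> 'v poly) \<Rightarrow> ('i \<times> nat) list \<Rightarrow> 'v poly" where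
  "sg n F = (if even n then F else - F)"

lemma sg_additive: "additive_map f \<Longrightarrow> f (sg n F) = sg n (f F)"
  by (simp add: sg_def additive_map_minus)

lemma sg_sg: "sg m (sg n F) = sg (m + n) F"
  by (simp add: sg_def)

lemma sg_cong: "(even m \<longleftrightarrow> even n) \<Longrightarrow> sg m F = sg n F"
  by (simp add: sg_def)

lemma sg_scale: "sg n F xs = (- 1) ^ n * F xs"
  by (simp add: sg_def)

lemma NL_pow: "(NL ^^ n) F = sg n ((Lop ^^ n) F)"
proof (induction n)
  case (Suc n)
  have "(NL ^^ Suc n) F = NL (sg n ((Lop ^^ n) F))" unfolding funpow.simps(2) o_apply Suc ..
  also have "\<dots> = sg (Suc n) ((Lop ^^ Suc n) F)" unfolding NL_def sg_additive[OF additive_Lop] by (simp add: sg_def)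
  finally show ?case .
qed (simp add: sg_def)

lemma Lop_add_pow: "(Lop ^^ m) ((Lop ^^ n) F) = (Lop ^^ (m + n)) F"
  by (simp add: funpow_add)

text \<open>The variational derivative of A by u_i, with -\<lambda> - \<partial> in place of
  -\<partial>.\<close>

definition Vf :: "nat \<Rightarrow> (('i \<times> nat) list \<Rightarrow> 'v) \<Rightarrow> 'i \<Rightarrow> ('i \<times> nat) list \<Rightarrow> 'v poly" where
  "Vf M A i = (\<Sum>m<M. (NL ^^ m) (cst (pd i m \<circ> A)))"

text \<open>The bracket after the substitution in its second product has been carried out and the
  factors have been exchanged, so that both halves have the same shape.\<close>

definition brf :: "nat \<Rightarrow> nat \<Rightarrow> (('i \<times> nat) list \<Rightarrow> 'v) \<Rightarrow> (('i \<times> nat) list \<Rightarrow> 'v) \<Rightarrow> ('i \<times> nat) list \<Rightarrow> 'v poly" where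
  "brf M R A C = boxf M R A C - (\<Sum>i\<in>UNIV. \<Sum>r<R. wedge (signed (cst (contr (i, r) C))) ((Lop ^^ r) (Vf M A i)))"

lemma formp_Vf: "form k A \<Longrightarrow> formp k (Vf M A i)"
  unfolding Vf_def by (intro formp_sum formp_NLpow formp_cst form_pd)

lemma formp_brf: "form (Suc h) A \<Longrightarrow> form (Suc l) C \<Longrightarrow> formp (Suc (h + l)) (brf M R A C)"
proof -
  assume A: "form (Suc h) A" and C: "form (Suc l) C"
  have "formp (l + Suc h) (\<Sum>i\<in>UNIV. \<Sum>r<R. wedge (signed (cst (contr (i, r) C))) ((Lop ^^ r) (Vf M A i)))"
    by (intro formp_sum formp_wedge formp_signed formp_cst form_contr C formp_Lpow formp_Vf A)
  moreover have "formp (Suc l + h) (boxf M R A C)" by (rule formp_boxf[OF A C])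
  ultimately show ?thesis unfolding brf_def by (intro formp_diff) (simp_all add: add.commute)
qed

lemma signed_formp: "formp k F \<Longrightarrow> signed F = sg k F"
  unfolding formp_def using signed_homog[of k F] by (auto simp: fun_eq_iff sg_scale)

lemma wedge_commute_formp: "formp p X \<Longrightarrow> formp q Y \<Longrightarrow> wedge X Y = sg (p * q) (wedge Y X)"
  using wedge_commute[of p X q Y] by (auto simp: formp_def fun_eq_iff sg_scale)

lemmas sg_lin = sg_additive[OF additive_wedge_left] sg_additive[OF additive_wedge_right]

text \<open>\<open>Phi_wedge\<close> moves the operators to the other factor and graded
  commutativity exchanges the factors; what remains is a comparison of signs. The degree in
  \<lambda> stays below M + R.\<close>

lemma bracket_form:
  assumes A: "form (Suc h) A" and C: "form (Suc l) C" and D: "M + R \<le> D"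
  shows "boxf M R A C - sg ((h + 2) * (l + 2)) (Phi D (boxf M R C A)) = brf M R A C"
proof -
  have 1: "Phi D (wedge (cst (pd i m \<circ> A)) ((Lop ^^ m) ((NL ^^ r) (cst (contr (i, r) C))))) =
     sg (Suc h * l + l) (wedge (signed (cst (contr (i, r) C))) ((Lop ^^ r) ((NL ^^ m) (cst (pd i m \<circ> A)))))"
    if m: "m < M" and r: "r < R" for i m r
  proof -
    let ?E = "cst (pd i m \<circ> A)" and ?Y = "cst (contr (i, r) C)"
    note W = Phi_wedge[of "m + r" "pd i m \<circ> A" "contr (i, r) C"]
    have fE: "formp (Suc h) ((Lop ^^ (m + r)) ?E)" by (intro formp_Lpow formp_cst form_pd A)
    have fY: "formp l ?Y" by (intro formp_cst form_contr C)
    have "Phi D (wedge ?E ((Lop ^^ m) ((NL ^^ r) ?Y))) = sg r (Phi D (wedge ?E ((Lop ^^ (m + r)) ?Y)))"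
      unfolding NL_pow sg_additive[OF additive_Lpow] sg_lin sg_additive[OF additive_Phi] Lop_add_pow ..
    also have "Phi D (wedge ?E ((Lop ^^ (m + r)) ?Y)) = wedge ((NL ^^ (m + r)) ?E) ?Y"
      using W Phi_extend[of "m + r" _ D] m r D by simp
    also have "\<dots> = sg (m + r) (wedge ((Lop ^^ (m + r)) ?E) ?Y)" unfolding NL_pow sg_lin ..
    also have "wedge ((Lop ^^ (m + r)) ?E) ?Y = sg (Suc h * l) (wedge ?Y ((Lop ^^ (m + r)) ?E))"
      by (rule wedge_commute_formp[OF fE fY])
    finally have "Phi D (wedge ?E ((Lop ^^ m) ((NL ^^ r) ?Y))) = sg (r + (m + r + Suc h * l)) (wedge ?Y ((Lop ^^ (m + r)) ?E))"
      unfolding sg_sg .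
    moreover have "sg (Suc h * l + l) (wedge (signed ?Y) ((Lop ^^ r) ((NL ^^ m) ?E))) =
        sg (Suc h * l + l + (m + l)) (wedge ?Y ((Lop ^^ (r + m)) ?E))"
      unfolding signed_formp[OF fY] NL_pow sg_additive[OF additive_Lpow] sg_lin Lop_add_pow sg_sg ..
    moreover have "sg (r + (m + r + Suc h * l)) F = sg (Suc h * l + l + (m + l)) F" for F
    proof (rule sg_cong)
      have "even (r + (m + r + n)) \<longleftrightarrow> even (n + l + (m + l))" for n by auto
      then show "even (r + (m + r + Suc h * l)) \<longleftrightarrow> even (Suc h * l + l + (m + l))" .
    qed
    ultimately show ?thesis by (simp add: add.commute)
  qed
  have "Phi D (boxf M R C A) = (\<Sum>i\<in>UNIV. \<Sum>m<M. \<Sum>r<R. Phi D (wedge (cst (pd i m \<circ> A)) ((Lop ^^ m) ((NL ^^ r) (cst (contr (i, r) C))))))"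
    unfolding boxf_def Wf_def additive_map_sum[OF additive_Lpow] additive_map_sum[OF additive_wedge_right]
      additive_map_sum[OF additive_Phi] ..
  also have "\<dots> = (\<Sum>i\<in>UNIV. \<Sum>m<M. \<Sum>r<R. sg (Suc h * l + l) (wedge (signed (cst (contr (i, r) C))) ((Lop ^^ r) ((NL ^^ m) (cst (pd i m \<circ> A))))))"
    by (intro sum.cong refl 1) auto
  also have "\<dots> = (\<Sum>i\<in>UNIV. \<Sum>r<R. \<Sum>m<M. sg (Suc h * l + l) (wedge (signed (cst (contr (i, r) C))) ((Lop ^^ r) ((NL ^^ m) (cst (pd i m \<circ> A))))))"
    by (intro sum.cong refl sum.swap)
  also have "\<dots> = sg (Suc h * l + l) (\<Sum>i\<in>UNIV. \<Sum>r<R. wedge (signed (cst (contr (i, r) C))) ((Lop ^^ r) (Vf M A i)))"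
  proof -
    have s: "sg n (sum f I) = (\<Sum>i\<in>I. sg n (f i))" for n I and f :: "_ \<Rightarrow> ('i \<times> nat) list \<Rightarrow> 'v poly"
      by (simp add: sg_def sum_negf)
    show ?thesis unfolding Vf_def additive_map_sum[OF additive_Lpow] additive_map_sum[OF additive_wedge_right] s ..
  qed
  finally have P: "Phi D (boxf M R C A) = sg (Suc h * l + l) (\<Sum>i\<in>UNIV. \<Sum>r<R. wedge (signed (cst (contr (i, r) C))) ((Lop ^^ r) (Vf M A i)))" .
  \<comment> \<open>Both exponents have the parity of h l, so the two signs cancel.\<close>
  have "sg ((h + 2) * (l + 2)) (sg (Suc h * l + l) F) = F" for F
  proof -
    have "(h + 2) * (l + 2) + (Suc h * l + l) = 2 * (h * l + h + 2 * l + 2)" by (simp add: algebra_simps)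
    then have "even ((h + 2) * (l + 2) + (Suc h * l + l))" by (simp only: dvd_triv_left)
    then have "sg ((h + 2) * (l + 2) + (Suc h * l + l)) F = F" unfolding sg_def by (simp only: if_True)
    then show ?thesis by (simp only: sg_sg)
  qed
  then show ?thesis unfolding P brf_def by simp
qed

subsection \<open>Coefficients of the bracket\<close>

lemma form_bounds:
  fixes A :: "('i \<times> nat) list \<Rightarrow> 'v"
  assumes "form k A"
  shows "\<exists>M. \<forall>xs. order_lt M (A xs)" and "\<exists>R. \<forall>i r xs. r \<ge> R \<longrightarrow> A ((i, r) # xs) = 0" (is ?T)
proof -
  have h: "homog k A" and f: "fsupp A" using assms by (auto simp: form_def)
  have "finite (A ` {xs. A xs \<noteq> 0})" using finite_homog_support[OF h f] by simp
  then obtain M where M: "\<forall>a\<in>insert 0 (A ` {xs. A xs \<noteq> 0}). order_lt M a"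
    using order_lt_finite[of "insert 0 (A ` {xs. A xs \<noteq> 0})"] by auto
  have "order_lt M (A xs)" for xs using M by (cases "A xs = 0") auto
  then show "\<exists>M. \<forall>xs. order_lt M (A xs)" by blast
  obtain X where X: "finite X" "\<And>xs. \<not> set xs \<subseteq> X \<Longrightarrow> A xs = 0" using fsuppE[OF f] by metis
  have "finite (snd ` X)" using X(1) by simp
  then obtain R where R: "\<forall>r\<in>snd ` X. r < R" unfolding finite_nat_set_iff_bounded by blast
  have "A ((i, r) # xs) = 0" if "r \<ge> R" for i r xs
    using R that by (intro X(2)) force
  then show ?T by blast
qed

lemma bracket_entries:
  fixes P Q :: "('i, 'v) arr"
  assumes u: "diff_variables pd u" and P: "P \<in> Omega (Suc h)" and Q: "Q \<in> Omega (Suc l)"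
    and MP: "\<And>xs. order_lt M (coef P xs)" and MQ: "\<And>xs. order_lt M (coef Q xs)"
    and RP: "\<And>i r xs. r \<ge> R \<Longrightarrow> coef P ((i, r) # xs) = 0" and RQ: "\<And>i r xs. r \<ge> R \<Longrightarrow> coef Q ((i, r) # xs) = 0"
  shows "bracket_coeff smul dv pd u (Suc h) (Suc l) n P Q \<in> Omega (Suc (h + l))"
    and "coef (bracket_coeff smul dv pd u (Suc h) (Suc l) n P Q) = (\<lambda>p. coeff p n) \<circ> brf M R (coef P) (coef Q)"
proof -
  let ?k = "Suc (h + l)"
  let ?b = "bracket_coeff smul dv pd u (Suc h) (Suc l) n P Q"
  let ?g = "\<lambda>is. box smul dv pd u (Suc l) (Suc h) Q P is"
  let ?F = "boxf M R (coef Q) (coef P)"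
  have fP: "form (Suc h) (coef P)" and fQ: "form (Suc l) (coef Q)" using P Q by (auto simp: Omega_iff)
  have off: "?b is = 0" if "length is \<noteq> ?k" for "is"
    using that by (simp add: bracket_coeff_def lambda_bracket_def box_def add.commute)
  have E1: "lkp (coeff (box smul dv pd u (Suc h) (Suc l) P Q is) n) (vmon id ms) = coeff (boxf M R (coef P) (coef Q) (zip is ms)) n"
    and V1: "pvars {..<?k} (box smul dv pd u (Suc h) (Suc l) P Q is)"
    if "length is = ?k" "length ms = ?k" for "is" ms n
  proof -
    have l1: "length is = Suc l + h" "length ms = Suc l + h" using that by simp_all
    show "lkp (coeff (box smul dv pd u (Suc h) (Suc l) P Q is) n) (vmon id ms) = coeff (boxf M R (coef P) (coef Q) (zip is ms)) n"
      by (rule box_entry(1)[OF u P Q MQ RP l1])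
    show "pvars {..<?k} (box smul dv pd u (Suc h) (Suc l) P Q is)"
      using box_entry(2)[OF u P Q MQ RP l1(1)] by (simp add: add.commute)
  qed
  have E2: "lkp (coeff (?g is) n) (vmon id ms) = coeff (?F (zip is ms)) n" and V2: "pvars {..<?k} (?g is)"
    if "length is = ?k" "length ms = ?k" for "is" ms n
  proof -
    have l1: "length is = Suc h + l" "length ms = Suc h + l" using that by simp_all
    show "lkp (coeff (?g is) n) (vmon id ms) = coeff (?F (zip is ms)) n"
      by (rule box_entry(1)[OF u Q P MP RQ l1])
    show "pvars {..<?k} (?g is)"
      using box_entry(2)[OF u Q P MP RQ l1(1)] by simp
  qed
  have "finite {is :: 'i list. length is = ?k}" using finite_lists_length_eq[of "UNIV :: 'i set" ?k] by simp
  then have "finite ((\<lambda>is. degree (?g is)) ` {is. length is = ?k})" by simp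
  then obtain D0 where D0: "\<forall>d\<in>(\<lambda>is. degree (?g is)) ` {is. length is = ?k}. d < D0"
    unfolding finite_nat_set_iff_bounded by blast
  \<comment> \<open>Large enough for the degrees of all entries and for
    \<open>bracket_form\<close>.\<close>
  define D where "D = max D0 (M + R)"
  define G2 where "G2 is = (\<Sum>n\<le>degree (?g is). (neg_shift dv (\<Sum>a<length is. mvar a) ^^ n) [:coeff (?g is) n:])" for "is"
  have G2D: "G2 is = (\<Sum>n\<le>D. (neg_shift dv (\<Sum>a<?k. mvar a) ^^ n) [:coeff (?g is) n:])" if "length is = ?k" for "is"
    unfolding G2_def that
  proof (rule sum.mono_neutral_left)
    show "{..degree (?g is)} \<subseteq> {..D}" using D0 that by (force simp: D_def)
    show "\<forall>n\<in>{..D} - {..degree (?g is)}. (neg_shift dv (\<Sum>a<?k. mvar a) ^^ n) [:coeff (?g is) n:] = 0"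
      by (auto simp: coeff_eq_0 additive_map_0[OF additive_ns_pow])
  qed simp
  have T2: "Theta id (G2 is) ms = Phi D ?F (zip is ms)" if li: "length is = ?k" and lm: "length ms = ?k" for "is" ms
  proof -
    have "Theta id ((neg_shift dv (\<Sum>b<?k. mvar (id b)) ^^ n) [:coeff (?g is) n:]) ms =
        (NL ^^ n) (cst ((\<lambda>p. coeff p n) \<circ> ?F)) (zip is ms)" for n
    proof (rule Theta_neg_shift_pow[OF _ li _ lm])
      show "Theta id [:coeff (?g is) n:] ns = cst ((\<lambda>p. coeff p n) \<circ> ?F) (zip is ns)" if "length ns = ?k" for ns
        using E2[OF li that] by (simp add: poly_eq_iff coeff_Theta cst_def coeff_pCons split: nat.split)
    qed simp
    then show ?thesis unfolding G2D[OF li] additive_map_sum[OF additive_Theta] Phi_def sum_fun_apply by simp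
  qed
  have entry: "lambda_bracket smul dv pd u (Suc h) (Suc l) P Q is =
      box smul dv pd u (Suc h) (Suc l) P Q is - (-1) ^ ((h + 2) * (l + 2)) * G2 is" for "is"
    by (simp add: lambda_bracket_def G2_def Let_def)
  have sgn: "coeff ((-1) ^ m * G) n = (-1) ^ m * coeff (G :: 'v mpol poly) n" for m G n
    by (cases "even m") auto
  have sgn': "coeff ((-1) ^ m * G) n = (-1) ^ m * coeff (G :: 'v poly) n" for m G n
    by (cases "even m") auto
  have cf: "coef ?b = (\<lambda>p. coeff p n) \<circ> brf M R (coef P) (coef Q)"
  proof
    fix xs :: "('i \<times> nat) list"
    show "coef ?b xs = ((\<lambda>p. coeff p n) \<circ> brf M R (coef P) (coef Q)) xs"
    proof (cases "length xs = ?k")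
      case True
      let ?is = "map fst xs" and ?ms = "map snd xs"
      have z: "zip ?is ?ms = xs" by (rule zip_map_fst_snd)
      have l: "length ?is = ?k" "length ?ms = ?k" using True by auto
      have "lkp (coeff (G2 ?is) n) (vmon id ?ms) = coeff (Phi D ?F xs) n"
        using T2[OF l] by (simp add: z flip: coeff_Theta)
      then have "coef ?b xs = coeff (boxf M R (coef P) (coef Q) xs) n - (-1) ^ ((h + 2) * (l + 2)) * coeff (Phi D ?F xs) n"
        unfolding coef_def bracket_coeff_def entry coeff_diff lookup_minus sgn lookup_sign_mult E1[OF l] z by simp
      also have "\<dots> = coeff ((boxf M R (coef P) (coef Q) - sg ((h + 2) * (l + 2)) (Phi D ?F)) xs) n"
        by (simp only: minus_apply coeff_diff sg_scale sgn')
      also have "\<dots> = coeff (brf M R (coef P) (coef Q) xs) n"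
        using bracket_form[OF fP fQ, of M R D] by (simp add: D_def)
      finally show ?thesis by simp
    next
      case False
      then show ?thesis using off formp_brf[OF fP fQ, of M R]
        by (simp add: coef_def formp_def homog_def)
    qed
  qed
  show "coef ?b = (\<lambda>p. coeff p n) \<circ> brf M R (coef P) (coef Q)" by (rule cf)
  show "?b \<in> Omega ?k" unfolding Omega_iff cf
  proof (intro conjI allI impI)
    show "?b is = 0" if "length is \<noteq> ?k" for "is" using off[OF that] .
    show "form ?k ((\<lambda>p. coeff p n) \<circ> brf M R (coef P) (coef Q))" by (intro form_coeff formp_brf fP fQ)
    show "in_vars {..<?k} (?b is)" for "is"
    proof (cases "length is = ?k")
      case True
      then have v: "pvars {..<?k} (box smul dv pd u (Suc h) (Suc l) P Q is)" "pvars {..<?k} (?g is)"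
        using V1[of "is" "replicate ?k 0"] V2[of "is" "replicate ?k 0"] by auto
      have "pvars {..<?k} (G2 is)" unfolding G2_def True
        by (intro pvars_sum pvars_neg_shift_pow pvars_const in_vars_sum in_vars_mvar) (use v in \<open>auto simp: pvars_def\<close>)
      then show ?thesis using v(1) unfolding bracket_coeff_def entry coeff_diff sgn pvars_def
        by (cases "even ((h + 2) * (l + 2))") (auto intro!: in_vars_intros)
    qed (simp add: off)
  qed
qed

end

lemma sum_rotate:
  "(\<Sum>r\<in>A. \<Sum>j\<in>B. \<Sum>n\<in>C. f r j n) = (\<Sum>j\<in>B. \<Sum>n\<in>C. \<Sum>r\<in>A. f r j n)"
proof -
  have "(\<Sum>r\<in>A. \<Sum>j\<in>B. \<Sum>n\<in>C. f r j n) = (\<Sum>j\<in>B. \<Sum>r\<in>A. \<Sum>n\<in>C. f r j n)" by (rule sum.swap)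
  also have "\<dots> = (\<Sum>j\<in>B. \<Sum>n\<in>C. \<Sum>r\<in>A. f r j n)" by (intro sum.cong refl sum.swap)
  finally show ?thesis .
qed

context diff_complex
begin

subsection \<open>Operators with coefficients\<close>

definition sc :: "'v \<Rightarrow> (('i \<times> nat) list \<Rightarrow> 'v poly) \<Rightarrow> ('i \<times> nat) list \<Rightarrow> 'v poly" where
  "sc c F = Polynomial.smult c \<circ> F"

lemma additive_sc: "additive_map (sc c)"
  by (simp add: additive_map_def sc_def fun_eq_iff smult_add_right)

lemma sc_0 [simp]: "sc 0 F = 0" and sc_add_left: "sc (a + b) F = sc a F + sc b F" and sc_minus_left: "sc (- a) F = - sc a F"
  by (auto simp: sc_def fun_eq_iff smult_add_left)

lemma sc_scale: "sc c F = (*) [:c:] \<circ> F" by (simp add: sc_def fun_eq_iff)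

lemma wedge_sc: "wedge (sc c X) Y = wedge X (sc c Y)"
  unfolding sc_scale by (simp add: fun_eq_iff wedge_scale_left wedge_scale_right)

lemma dhat_sc: "dhat (map_poly dv) (sc c F) = sc c (dhat (map_poly dv) F) + sc (dv c) F"
proof
  have d: "map_poly dv (Polynomial.smult c p) = Polynomial.smult c (map_poly dv p) + Polynomial.smult (dv c) p" for p
    by (simp add: poly_eq_iff coeff_map_poly dv_simps dv_mult add.commute)
  fix xs show "dhat (map_poly dv) (sc c F) xs = (sc c (dhat (map_poly dv) F) + sc (dv c) F) xs"
  proof (induction xs arbitrary: F)
    case Nil then show ?case by (simp add: sc_def d)
  next
    case (Cons x xs)
    have IH: "dhat (map_poly dv) (sc c F) xs = (sc c (dhat (map_poly dv) F) + sc (dv c) F) xs" for F by (rule Cons.IH)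
    have ct: "contr x (sc c F) = sc c (contr x F)" for F by (simp add: sc_def)
    show "dhat (map_poly dv) (sc c F) (x # xs) = (sc c (dhat (map_poly dv) F) + sc (dv c) F) (x # xs)"
      by (simp add: ct IH) (simp add: sc_def contr_apply smult_add_right)
  qed
qed

lemma Lop_sc: "Lop (sc c F) = sc c (Lop F) + sc (dv c) F"
proof -
  have "pCons 0 \<circ> sc c F = sc c (pCons 0 \<circ> F)" by (auto simp: sc_def fun_eq_iff)
  then show ?thesis unfolding Lop_def by (simp add: dhat_sc additive_map_add[OF additive_sc] add.assoc)
qed

lemma NL_sc: "NL (sc c F) + sc (dv c) F = sc c (NL F)"
  unfolding NL_def Lop_sc additive_map_minus[OF additive_sc] by simp

text \<open>The differential operator with symbol \<open>p\<close> applied at \<open>\<lambda> + \<partial>\<close>, and its adjoint; skewadjointness of \<open>K\<close> turns one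
into the negative of the other.\<close>

definition lop :: "nat \<Rightarrow> 'v poly \<Rightarrow> (('i \<times> nat) list \<Rightarrow> 'v poly) \<Rightarrow> ('i \<times> nat) list \<Rightarrow> 'v poly" where
  "lop S p F = (\<Sum>s<S. sc (coeff p s) ((Lop ^^ s) F))"

definition rop :: "nat \<Rightarrow> 'v poly \<Rightarrow> (('i \<times> nat) list \<Rightarrow> 'v poly) \<Rightarrow> ('i \<times> nat) list \<Rightarrow> 'v poly" where
  "rop S p F = (\<Sum>s<S. (NL ^^ s) (sc (coeff p s) F))"

definition below :: "nat \<Rightarrow> 'v poly \<Rightarrow> bool" where
  "below S p \<longleftrightarrow> (\<forall>s\<ge>S. coeff p s = 0)"

lemma below_lamdv: "below S p \<Longrightarrow> below (Suc S) (lamdv p)"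
  by (auto simp: below_def coeff_lamdv dv_simps)

lemma lop_extend: "below S p \<Longrightarrow> S \<le> S' \<Longrightarrow> lop S' p F = lop S p F"
  unfolding lop_def by (rule sum.mono_neutral_right) (auto simp: below_def)

lemma rop_extend: "below S p \<Longrightarrow> S \<le> S' \<Longrightarrow> rop S' p F = rop S p F"
  unfolding rop_def
  by (rule sum.mono_neutral_right) (auto simp: below_def additive_map_0[OF additive_NLpow])

lemma additive_lop: "additive_map (\<lambda>p. lop S p F)"
  by (simp add: additive_map_def lop_def sc_add_left sum.distrib)

lemma additive_lop_arg: "additive_map (lop S p)"
  by (simp add: additive_map_def lop_def additive_map_add[OF additive_sc] additive_map_add[OF additive_Lpow] sum.distrib)

text \<open>Applying \<lambda> + \<partial> to a symbol composes its operator with \<lambda> +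
  \<partial> on the left; for the adjoint in \<open>rop_lamdv\<close> it composes with -\<lambda> -
  \<partial> on the right.\<close>

lemma lop_lamdv:
  assumes "below S p" shows "lop (Suc S) (lamdv p) F = Lop (lop S p F)"
proof -
  have "lop (Suc S) (lamdv p) F = (\<Sum>s<Suc S. sc (if s = 0 then 0 else coeff p (s - 1)) ((Lop ^^ s) F)) +
      (\<Sum>s<Suc S. sc (dv (coeff p s)) ((Lop ^^ s) F))"
    unfolding lop_def coeff_lamdv sc_add_left sum.distrib ..
  also have "(\<Sum>s<Suc S. sc (if s = 0 then 0 else coeff p (s - 1)) ((Lop ^^ s) F)) = (\<Sum>s<S. sc (coeff p s) (Lop ((Lop ^^ s) F)))"
    unfolding sum.lessThan_Suc_shift by simp
  also have "(\<Sum>s<Suc S. sc (dv (coeff p s)) ((Lop ^^ s) F)) = (\<Sum>s<S. sc (dv (coeff p s)) ((Lop ^^ s) F))"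
    using assms by (simp add: below_def dv_simps)
  finally show ?thesis unfolding lop_def[of S] additive_map_sum[OF additive_Lop] Lop_sc sum.distrib .
qed

lemma rop_lamdv:
  assumes "below S p" shows "rop (Suc S) (lamdv p) F = rop S p (NL F)"
proof -
  have "rop (Suc S) (lamdv p) F = (\<Sum>s<Suc S. (NL ^^ s) (sc (if s = 0 then 0 else coeff p (s - 1)) F)) +
      (\<Sum>s<Suc S. (NL ^^ s) (sc (dv (coeff p s)) F))"
    unfolding rop_def coeff_lamdv sc_add_left additive_map_add[OF additive_NLpow] sum.distrib ..
  also have "(\<Sum>s<Suc S. (NL ^^ s) (sc (if s = 0 then 0 else coeff p (s - 1)) F)) = (\<Sum>s<S. (NL ^^ s) (NL (sc (coeff p s) F)))"
    unfolding sum.lessThan_Suc_shift by (simp add: funpow_swap1)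
  also have "(\<Sum>s<Suc S. (NL ^^ s) (sc (dv (coeff p s)) F)) = (\<Sum>s<S. (NL ^^ s) (sc (dv (coeff p s)) F))"
    using assms by (simp add: below_def dv_simps additive_map_0[OF additive_NLpow])
  finally show ?thesis unfolding rop_def[of S] NL_sc[symmetric] additive_map_add[OF additive_NLpow] sum.distrib .
qed

lemma below_dsym: "below (Suc N + n) (dsym n j i)"
  by (auto simp: below_def dsym_above)

lemma lop_dsym: "lop (Suc N + n) (dsym n j i) F = (Lop ^^ n) (lop (Suc N) (Kpoly j i) F)"
proof (induction n)
  case (Suc n)
  then show ?case using lop_lamdv[OF below_dsym[of n j i], of F] by (simp add: dsym_Suc)
qed simp

lemma rop_dsym: "rop (Suc N + n) (dsym n j i) F = rop (Suc N) (Kpoly j i) ((NL ^^ n) F)"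
proof (induction n arbitrary: F)
  case (Suc n)
  have "rop (Suc (Suc N + n)) (lamdv (dsym n j i)) F = rop (Suc N + n) (dsym n j i) (NL F)"
    by (rule rop_lamdv[OF below_dsym])
  also have "\<dots> = rop (Suc N) (Kpoly j i) ((NL ^^ n) (NL F))" by (rule Suc.IH)
  finally show ?case by (simp add: dsym_Suc funpow_swap1)
qed simp

lemma below_nlam: "below (Suc t) (((\<lambda>p. - lamdv p) ^^ t) [:c:])"
proof (induction t)
  case 0 then show ?case by (auto simp: below_def coeff_pCons split: nat.split)
next
  case (Suc t)
  then have "below (Suc (Suc t)) (lamdv (((\<lambda>p. - lamdv p) ^^ t) [:c:]))" by (rule below_lamdv)
  then show ?case by (simp add: below_def)
qed

text \<open>Moves the coefficient from the right of the operator to the left; the resulting symbol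
  (-\<lambda> - \<partial>)^t c is the one in the definition of \<open>skewadjoint\<close>.\<close>

lemma NL_pow_sc: "(NL ^^ t) (sc c F) = lop (Suc t) (((\<lambda>p. - lamdv p) ^^ t) [:c:]) F"
proof (induction t)
  case 0 then show ?case by (simp add: lop_def)
next
  case (Suc t)
  have "(NL ^^ Suc t) (sc c F) = - Lop (lop (Suc t) (((\<lambda>p. - lamdv p) ^^ t) [:c:]) F)"
    by (simp only: funpow.simps(2) o_apply Suc NL_def)
  also have "\<dots> = lop (Suc (Suc t)) (- lamdv (((\<lambda>p. - lamdv p) ^^ t) [:c:])) F"
    unfolding lop_lamdv[OF below_nlam, symmetric] additive_map_minus[OF additive_lop] ..
  finally show ?case by simp
qed

lemma skew_poly:
  assumes "skewadjoint dv K N"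
  shows "(\<Sum>t\<le>N. ((\<lambda>p. - lamdv p) ^^ t) [:K t $ j $ i:]) = - Kpoly i j"
proof (rule poly_eqI)
  fix r
  have s: "Poly_Mapping.single 0 r - Poly_Mapping.single 0 (1::nat) = Poly_Mapping.single (0::nat) (r - 1)" for r
    by (simp flip: single_diff)
  have l: "lkp (((\<lambda>p. - (mvar 0 * p) - cmap dv p) ^^ t) (mconst c)) (Poly_Mapping.single 0 r) =
      coeff (((\<lambda>p. - lamdv p) ^^ t) [:c:]) r" for t c r
  proof (induction t arbitrary: r)
    case 0
    have "(0 = Poly_Mapping.single (0::nat) r) = (r = 0)" by (metis lookup_single_eq lookup_zero single_zero)
    then show ?case by (auto simp: mconst_def lookup_single when_def coeff_pCons split: nat.split)
  next
    case (Suc t)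
    then show ?case
      by (simp add: lookup_minus lookup_mvar_mult s[unfolded single_one] lookup_cmap dv_simps coeff_lamdv del: One_nat_def)
  qed
  have "(\<Sum>n\<le>N. ((\<lambda>p. - (mvar 0 * p) - cmap dv p) ^^ n) (mconst (K n $ j $ i))) = - Ksym K N i j 0"
    using assms unfolding skewadjoint_def by blast
  from arg_cong[OF this, of "\<lambda>p. lkp p (Poly_Mapping.single 0 r)"]
  show "coeff (\<Sum>t\<le>N. ((\<lambda>p. - lamdv p) ^^ t) [:K t $ j $ i:]) r = coeff (- Kpoly i j) r"
    using symbol_lookup[of 0 0 i j r] by (simp add: lookup_sum l coeff_sum)
qed

lemma rop_Kpoly:
  assumes "skewadjoint dv K N"
  shows "rop (Suc N) (Kpoly j i) F = - lop (Suc N) (Kpoly i j) F"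
proof -
  have "rop (Suc N) (Kpoly j i) F = (\<Sum>t\<le>N. (NL ^^ t) (sc (K t $ j $ i) F))"
    unfolding rop_def lessThan_Suc_atMost by (intro sum.cong) (auto simp: coeff_Kpoly)
  also have "\<dots> = (\<Sum>t\<le>N. lop (Suc N) (((\<lambda>p. - lamdv p) ^^ t) [:K t $ j $ i:]) F)"
    unfolding NL_pow_sc by (intro sum.cong refl lop_extend[symmetric] below_nlam) auto
  also have "\<dots> = lop (Suc N) (- Kpoly i j) F"
    unfolding skew_poly[OF assms, symmetric] additive_map_sum[OF additive_lop] ..
  finally show ?thesis unfolding additive_map_minus[OF additive_lop] .
qed

subsection \<open>The bracket of cocycles\<close>

definition Dp :: "'i \<times> nat \<Rightarrow> 'v poly \<Rightarrow> 'v poly" where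
  "Dp x = map_poly (Dx x)"

lemma deriv_Dp: "deriv_map (Dp x)" unfolding Dp_def by (rule deriv_map_poly[OF deriv_Dx])

lemma additive_Dp: "additive_map (Dp x)" by (rule deriv_additive[OF deriv_Dp])

lemmas dlp_add = additive_dl[of Dp, OF additive_Dp]

lemma dl_cst: "dl Dp (cst A) = cst (dl Dx A)"
proof
  fix xs show "dl Dp (cst A) xs = cst (dl Dx A) xs"
    unfolding cst_def o_apply[of "\<lambda>a. [:a:]" "dl Dx A"]
    by (rule dl_comp[symmetric]) (simp_all add: additive_const Dp_def map_poly_pCons Dx_simps)
qed

lemma coeff_dlp: "(\<lambda>p. coeff p n) \<circ> dl Dp F = dl Dx ((\<lambda>p. coeff p n) \<circ> F)"
proof
  fix xs show "((\<lambda>p. coeff p n) \<circ> dl Dp F) xs = dl Dx ((\<lambda>p. coeff p n) \<circ> F) xs"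
    unfolding o_apply[of "\<lambda>p. coeff p n" "dl Dp F"]
    by (rule dl_comp) (simp_all add: additive_map_def Dp_def coeff_map_poly Dx_simps)
qed

lemma form_poly_eqI:
  fixes F G :: "('i \<times> nat) list \<Rightarrow> 'v poly"
  assumes "\<And>n. (\<lambda>p. coeff p n) \<circ> F = (\<lambda>p. coeff p n) \<circ> G" shows "F = G"
  using assms by (auto simp: fun_eq_iff poly_eq_iff)

lemma dl_Lop: "dl Dp (Lop F) = Lop (dl Dp F)"
proof (rule form_poly_eqI)
  have ca: "(\<lambda>p. coeff p n) \<circ> (F + G) = ((\<lambda>p. coeff p n) \<circ> F) + ((\<lambda>p. coeff p n) \<circ> G)" for F G :: "('i \<times> nat) list \<Rightarrow> 'v poly" and n
    by (simp add: fun_eq_iff)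
  have c0: "(\<lambda>p. coeff p n) \<circ> (pCons 0 \<circ> F) = (case n of 0 \<Rightarrow> 0 | Suc m \<Rightarrow> (\<lambda>p. coeff p m) \<circ> F)" for F :: "('i \<times> nat) list \<Rightarrow> 'v poly" and n
    by (auto simp: fun_eq_iff coeff_pCons split: nat.split)
  fix n
  show "(\<lambda>p. coeff p n) \<circ> dl Dp (Lop F) = (\<lambda>p. coeff p n) \<circ> Lop (dl Dp F)"
    unfolding coeff_dlp Lop_def ca c0 coeff_dhat
    by (cases n) (simp_all add: dl_lin additive_Dx dl_dhat coeff_dlp)
qed

lemma dl_Lpow: "dl Dp ((Lop ^^ n) F) = (Lop ^^ n) (dl Dp F)"
  by (induction n) (simp_all add: dl_Lop)

lemma dl_NLpow: "dl Dp ((NL ^^ n) F) = (NL ^^ n) (dl Dp F)"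
  unfolding NL_pow sg_additive[OF dlp_add] dl_Lpow ..

lemma dl_pd: "dl Dx (pd i n \<circ> A) = pd i n \<circ> dl Dx A"
proof
  fix xs show "dl Dx (pd i n \<circ> A) xs = (pd i n \<circ> dl Dx A) xs"
    unfolding o_apply[of "pd i n" "dl Dx A"] by (rule dl_comp[symmetric]) (simp_all add: additive_pd pd_Dx)
qed

lemma dl_Wf: "dl Dp (Wf R A i) = (\<Sum>r<R. (NL ^^ r) (cst (dl Dx (contr (i, r) A))))"
  unfolding Wf_def additive_map_sum[OF dlp_add] dl_NLpow dl_cst ..

lemma dl_Vf: "dl Dp (Vf M A i) = Vf M (dl Dx A) i"
  unfolding Vf_def additive_map_sum[OF dlp_add] dl_NLpow dl_cst dl_pd ..

lemma cst_Dx: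
  assumes "\<And>xs. order_lt M (A xs)"
  shows "cst (Dx (i, r) \<circ> A) = (\<Sum>j\<in>UNIV. \<Sum>n<M. sc (coeff (dsym n j i) r) (cst (pd j n \<circ> A)))"
proof
  fix xs
  have pc: "[:sum f S:] = (\<Sum>e\<in>S. [:f e:])" for f :: "_ \<Rightarrow> 'v" and S
    by (rule additive_map_sum[of "\<lambda>a. [:a:]"]) (simp add: additive_map_def)
  show "cst (Dx (i, r) \<circ> A) xs = (\<Sum>j\<in>UNIV. \<Sum>n<M. sc (coeff (dsym n j i) r) (cst (pd j n \<circ> A))) xs"
    by (simp add: cst_def Dx_bound[OF assms] pc sum_fun_apply sc_def)
qed

text \<open>Cartan's formula writes the contraction of the differential of \<gamma> as a derivative
  of \<gamma> minus an exact form; the contraction of the closed form C has a derivative of C as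
  differential. By skewadjointness the sum with derivatives of \<gamma> is minus the sum with those
  of C, which is what the differential of the second sum on the right requires.\<close>

lemma bracket_exact:
  assumes skew: "skewadjoint dv K N"
    and g: "\<And>xs. order_lt M (\<gamma> xs)" and C: "\<And>xs. order_lt M (C xs)" and R: "Suc N + M \<le> R"
    and closed: "dl Dx C = 0"
  shows "brf M R (dl Dx \<gamma>) C = dl Dp (- (\<Sum>i\<in>UNIV. \<Sum>m<M. wedge (signed (cst (pd i m \<circ> C))) ((Lop ^^ m) (Wf R \<gamma> i)))
    - (\<Sum>i\<in>UNIV. \<Sum>r<R. wedge (cst (contr (i, r) C)) ((Lop ^^ r) (Vf M \<gamma> i))))"
proof -
  let ?E = "\<lambda>i m. cst (pd i m \<circ> C)" and ?I = "\<lambda>i r. cst (contr (i, r) C)" and ?V = "Vf M \<gamma>" and ?W = "Wf R \<gamma>"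
  let ?S = "Suc N"
  define U where "U i = (\<Sum>r<R. (NL ^^ r) (cst (Dx (i, r) \<circ> \<gamma>)))" for i
  have dE: "dl Dp (?E i m) = 0" for i m
    by (simp add: dl_cst dl_pd closed comp_forms additive_pd additive_map_0[OF additive_cst])
  have dsE: "dl Dp (signed (?E i m)) = 0" for i m
    using dl_signed[of Dp "?E i m", OF additive_Dp] dE by simp
  have dI: "dl Dp (?I i r) = cst (Dx (i, r) \<circ> C)" for i r
  proof -
    have "dl Dx (contr (i, r) C) = (Dx (i, r) \<circ> C) - contr (i, r) (dl Dx C)" by simp
    then show ?thesis by (simp add: dl_cst closed)
  qed
  have WA: "Wf R (dl Dx \<gamma>) i = U i - dl Dp (?W i)" for i
    unfolding dl_Wf U_def Wf_def[of _ "dl Dx \<gamma>"] contr_dl additive_map_diff[OF additive_cst] additive_map_diff[OF additive_NLpow] sum_subtractf ..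
  have dw1: "dl Dp (wedge (signed (?E i m)) Y) = wedge (?E i m) (dl Dp Y)" for i m Y
    unfolding dl_wedge[of Dp, OF deriv_Dp] dsE by simp
  have dw2: "dl Dp (wedge (?I i r) Y) = wedge (cst (Dx (i, r) \<circ> C)) Y + wedge (signed (?I i r)) (dl Dp Y)" for i r Y
    unfolding dl_wedge[of Dp, OF deriv_Dp] dI ..
  \<comment> \<open>The derivatives of \<gamma> assemble to the adjoint of K applied to its
    variational derivative, and \<open>rop_Kpoly\<close> replaces the adjoint by -K.\<close>
  have U: "U i = - (\<Sum>j\<in>UNIV. lop ?S (Kpoly i j) (?V j))" for i
  proof -
    have "U i = (\<Sum>r<R. \<Sum>j\<in>UNIV. \<Sum>n<M. (NL ^^ r) (sc (coeff (dsym n j i) r) (cst (pd j n \<circ> \<gamma>))))"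
      unfolding U_def cst_Dx[OF g] additive_map_sum[OF additive_NLpow] ..
    also have "\<dots> = (\<Sum>j\<in>UNIV. \<Sum>n<M. rop R (dsym n j i) (cst (pd j n \<circ> \<gamma>)))"
      unfolding rop_def by (rule sum_rotate)
    also have "\<dots> = (\<Sum>j\<in>UNIV. \<Sum>n<M. - lop ?S (Kpoly i j) ((NL ^^ n) (cst (pd j n \<circ> \<gamma>))))"
    proof (intro sum.cong refl)
      fix j n assume "n \<in> {..<M}"
      then have "rop R (dsym n j i) (cst (pd j n \<circ> \<gamma>)) = rop (?S + n) (dsym n j i) (cst (pd j n \<circ> \<gamma>))"
        using R by (intro rop_extend[OF below_dsym]) simp
      then show "rop R (dsym n j i) (cst (pd j n \<circ> \<gamma>)) = - lop ?S (Kpoly i j) ((NL ^^ n) (cst (pd j n \<circ> \<gamma>)))"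
        unfolding rop_dsym rop_Kpoly[OF skew] .
    qed
    finally show ?thesis unfolding Vf_def additive_map_sum[OF additive_lop_arg] sum_negf .
  qed
  \<comment> \<open>The coefficients of the derivations move to the right factor and reassemble
    there to (\<lambda> + \<partial>)^n composed with K.\<close>
  have T2: "(\<Sum>i\<in>UNIV. \<Sum>r<R. wedge (cst (Dx (i, r) \<circ> C)) ((Lop ^^ r) (?V i))) =
      (\<Sum>j\<in>UNIV. \<Sum>n<M. wedge (?E j n) ((Lop ^^ n) (\<Sum>i\<in>UNIV. lop ?S (Kpoly j i) (?V i))))"
  proof -
    have 1: "(\<Sum>r<R. wedge (cst (Dx (i, r) \<circ> C)) ((Lop ^^ r) (?V i))) =
       (\<Sum>j\<in>UNIV. \<Sum>n<M. wedge (?E j n) ((Lop ^^ n) (lop ?S (Kpoly j i) (?V i))))" for i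
    proof -
      have "(\<Sum>r<R. wedge (cst (Dx (i, r) \<circ> C)) ((Lop ^^ r) (?V i))) =
         (\<Sum>r<R. \<Sum>j\<in>UNIV. \<Sum>n<M. wedge (?E j n) (sc (coeff (dsym n j i) r) ((Lop ^^ r) (?V i))))"
        unfolding cst_Dx[OF C] additive_map_sum[OF additive_wedge_left] wedge_sc ..
      also have "\<dots> = (\<Sum>j\<in>UNIV. \<Sum>n<M. \<Sum>r<R. wedge (?E j n) (sc (coeff (dsym n j i) r) ((Lop ^^ r) (?V i))))"
        by (rule sum_rotate)
      also have "\<dots> = (\<Sum>j\<in>UNIV. \<Sum>n<M. wedge (?E j n) (lop R (dsym n j i) (?V i)))"
        unfolding lop_def additive_map_sum[OF additive_wedge_right] ..
      also have "\<dots> = (\<Sum>j\<in>UNIV. \<Sum>n<M. wedge (?E j n) ((Lop ^^ n) (lop ?S (Kpoly j i) (?V i))))"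
      proof (intro sum.cong refl)
        fix j n assume "n \<in> {..<M}"
        then have "lop R (dsym n j i) (?V i) = lop (?S + n) (dsym n j i) (?V i)"
          using R by (intro lop_extend[OF below_dsym]) simp
        then show "wedge (?E j n) (lop R (dsym n j i) (?V i)) = wedge (?E j n) ((Lop ^^ n) (lop ?S (Kpoly j i) (?V i)))"
          unfolding lop_dsym by simp
      qed
      finally show ?thesis .
    qed
    show ?thesis unfolding 1 additive_map_sum[OF additive_Lpow] additive_map_sum[OF additive_wedge_right]
      by (rule sum_rotate)
  qed
  have "brf M R (dl Dx \<gamma>) C = (\<Sum>i\<in>UNIV. \<Sum>m<M. wedge (?E i m) ((Lop ^^ m) (U i)))
     - (\<Sum>i\<in>UNIV. \<Sum>m<M. wedge (?E i m) (dl Dp ((Lop ^^ m) (?W i))))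
     - (\<Sum>i\<in>UNIV. \<Sum>r<R. wedge (signed (?I i r)) (dl Dp ((Lop ^^ r) (?V i))))"
    unfolding brf_def boxf_def WA dl_Vf[symmetric] additive_map_diff[OF additive_Lpow] additive_map_diff[OF additive_wedge_right]
      sum_subtractf dl_Lpow ..
  also have "(\<Sum>i\<in>UNIV. \<Sum>m<M. wedge (?E i m) ((Lop ^^ m) (U i))) =
      - (\<Sum>i\<in>UNIV. \<Sum>r<R. wedge (cst (Dx (i, r) \<circ> C)) ((Lop ^^ r) (?V i)))"
    unfolding T2 U additive_map_minus[OF additive_Lpow] additive_map_minus[OF additive_wedge_right] sum_negf ..
  also have "- (\<Sum>i\<in>UNIV. \<Sum>r<R. wedge (cst (Dx (i, r) \<circ> C)) ((Lop ^^ r) (?V i)))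
     - (\<Sum>i\<in>UNIV. \<Sum>m<M. wedge (?E i m) (dl Dp ((Lop ^^ m) (?W i))))
     - (\<Sum>i\<in>UNIV. \<Sum>r<R. wedge (signed (?I i r)) (dl Dp ((Lop ^^ r) (?V i))))
     = - (\<Sum>i\<in>UNIV. \<Sum>m<M. dl Dp (wedge (signed (?E i m)) ((Lop ^^ m) (?W i))))
       - (\<Sum>i\<in>UNIV. \<Sum>r<R. dl Dp (wedge (?I i r) ((Lop ^^ r) (?V i))))"
    unfolding dw1 dw2 sum.distrib by (simp add: algebra_simps)
  finally show ?thesis
    unfolding additive_map_diff[OF dlp_add] additive_map_minus[OF dlp_add] additive_map_sum[OF dlp_add] .
qed

lemma pd_small: "small A \<Longrightarrow> pd i m \<circ> A = 0"
  by (auto simp: small_def fun_eq_iff qc_D)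

text \<open>A small form has zero variational derivative, so one half of the bracket is absent. In
  the other half the partial derivatives of C see only its exact part.\<close>

lemma small_bracket_exact:
  assumes A: "small A" and C: "C = C0 + dl Dx \<eta>" "small C0"
  shows "brf M R A C = dl Dp (\<Sum>i\<in>UNIV. \<Sum>m<M. wedge (cst (pd i m \<circ> \<eta>)) ((Lop ^^ m) (Wf R A i)))"
proof -
  have V: "Vf M A i = 0" for i
    unfolding Vf_def pd_small[OF A] by (simp add: additive_map_0[OF additive_cst] additive_map_0[OF additive_NLpow])
  have "small (contr x A)" for x using A by (auto simp: small_def contr_def)
  then have "dl Dp (Wf R A i) = 0" for i
    unfolding dl_Wf by (simp add: dl_small additive_map_0[OF additive_cst] additive_map_0[OF additive_NLpow])
  then have dW: "dl Dp ((Lop ^^ m) (Wf R A i)) = 0" for i m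
    unfolding dl_Lpow by (simp add: additive_map_0[OF additive_Lpow])
  have E: "cst (pd i m \<circ> C) = dl Dp (cst (pd i m \<circ> \<eta>))" for i m
    by (simp add: C(1) comp_forms additive_pd pd_small[OF C(2)] dl_cst dl_pd)
  have "brf M R A C = boxf M R A C"
    unfolding brf_def V by (simp add: additive_map_0[OF additive_Lpow])
  also have "\<dots> = (\<Sum>i\<in>UNIV. \<Sum>m<M. dl Dp (wedge (cst (pd i m \<circ> \<eta>)) ((Lop ^^ m) (Wf R A i))))"
    unfolding boxf_def E dl_wedge[of Dp, OF deriv_Dp] dW by simp
  finally show ?thesis unfolding additive_map_sum[OF dlp_add] .
qed

lemma brf_add: "brf M R (A + A') C = brf M R A C + brf M R A' C"
proof -
  have W: "Wf R (A + A') i = Wf R A i + Wf R A' i" for i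
    by (simp add: Wf_def additive_map_add[OF additive_cst] additive_map_add[OF additive_NLpow] sum.distrib)
  have V: "Vf M (A + A') i = Vf M A i + Vf M A' i" for i
    by (simp add: Vf_def comp_add_form[OF additive_pd] additive_map_add[OF additive_cst]
        additive_map_add[OF additive_NLpow] sum.distrib)
  show ?thesis
    unfolding brf_def boxf_def W V additive_map_add[OF additive_Lpow] wedge_add_right sum.distrib by (simp add: algebra_simps)
qed

text \<open>\<open>Wf\<close> lowers the degree of \<gamma> by one and X has degree l + 1. For h = 0
  there is nothing to contract and the product is 0.\<close>

lemma formp_wedge_Wf:
  assumes X: "formp (Suc l) X" and g: "form h \<gamma>"
  shows "formp (h + l) (wedge X ((Lop ^^ m) (Wf R \<gamma> i)))"
proof (cases h)
  case 0
  have "contr x \<gamma> = 0" for x using homog_0_contr[of \<gamma> x] g 0 by (simp add: form_def)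
  then have "Wf R \<gamma> i = 0"
    by (simp add: Wf_def additive_map_0[OF additive_cst] additive_map_0[OF additive_NLpow])
  then show ?thesis by (simp add: additive_map_0[OF additive_Lpow] formp_0)
next
  case (Suc h')
  then have "formp (Suc l + h') (wedge X ((Lop ^^ m) (Wf R \<gamma> i)))"
    using g by (intro formp_wedge[OF X] formp_Lpow formp_Wf) simp
  then show ?thesis using Suc by (simp add: add.commute)
qed

section \<open>Brackets with quasiconstant entries\<close>

lemma mrename_qc: "(\<And>m. lkp p m \<in> \<F>) \<Longrightarrow> lkp (mrename s p) k \<in> \<F>"
  unfolding mrename_eq lookup_sum lookup_single when_def by (intro qc_sum) (simp add: qc_0)

text \<open>Every term of the product contains a partial derivative of a coefficient of the second
  array.\<close>

lemma box_qc:
  assumes Q: "\<And>js m. lkp (Q js) m \<in> \<F>" shows "box smul dv pd u p q P Q is = 0"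
proof -
  have "Xmap smul dv pd (Suc h) P (f # fs) = 0" if "f \<in> \<F>" for h f fs
  proof -
    have "foldr (\<lambda>a. exp_op smul dv a (pd (is ! a) (ms ! a) ((f # fs) ! a))) [0..<Suc h] z = 0"
      for "is" :: "'i list" and ms z
    proof -
      have u: "[0..<Suc h] = 0 # [Suc 0..<Suc h]" by (rule upt_conv_Cons) simp
      show ?thesis unfolding u by (simp add: qc_D[OF that] del: upt_Suc)
    qed
    then show ?thesis by (simp add: Xmap_def del: upt_Suc cong: if_cong)
  qed
  moreover have "lkp (mrename s (Q js)) k \<in> \<F>" for s js k by (rule mrename_qc) (rule Q)
  ultimately show ?thesis by (simp add: box_def Let_def split: nat.split)
qed

lemma Omega00_qc: "P \<in> Omega00 pd N k \<Longrightarrow> lkp (P is) m \<in> \<F>"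
  by (cases "m \<in> Poly_Mapping.keys (P is)") (auto simp: Omega00_def in_keys_iff qc_0)

lemma bracket_zero:
  assumes "\<And>is. box smul dv pd u p q P Q is = 0" "\<And>is. box smul dv pd u q p Q P is = 0"
  shows "bracket_coeff smul dv pd u p q n P Q = 0"
  by (simp add: bracket_coeff_def lambda_bracket_def assms fun_eq_iff)

lemma bracket_Omega00:
  "P \<in> Omega00 pd N p \<Longrightarrow> Q \<in> Omega00 pd N q \<Longrightarrow> bracket_coeff smul dv pd u p q n P Q = 0"
  by (intro bracket_zero box_qc) (auto intro: Omega00_qc)

context
  fixes L :: "(('v, 'i) vec, 'i) vec"
  assumes nrm: "normal_alg pd"
    and L: "\<And>i j. L $ i $ j \<in> \<F>" "K N ** L = mat 1" "L ** K N = mat 1"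
begin

lemma cocycle_decompose:
  assumes "P \<in> Z k" obtains \<gamma> where "prev_form k \<gamma>" "small (coef P - dl Dx \<gamma>)"
proof -
  have f: "form k (coef P)" and d: "dl Dx (coef P) = 0" using assms by (auto simp: cocycle_iff Omega_iff)
  have "\<exists>\<gamma>. prev_form k \<gamma> \<and> small (coef P - dl Dx \<gamma>)"
    by (rule reduce_to_small[OF nrm L f]) (simp add: d)
  then show thesis using that by blast
qed

lemma cocycle_0: "P \<in> Z 0 \<Longrightarrow> P \<in> Omega00 pd N 0"
proof -
  assume P: "P \<in> Z 0"
  obtain \<gamma> where g: "prev_form 0 \<gamma>" "small (coef P - dl Dx \<gamma>)" using cocycle_decompose[OF P] by blast
  have "dl Dx \<gamma> = 0" using prev_form_zero[OF g(1)] by (simp add: dl_lin additive_Dx)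
  then show ?thesis using g(2) P by (simp add: Omega00_iff cocycle_iff)
qed

text \<open>P is a small form plus an exact one. \<open>small_bracket_exact\<close> treats the small
  part, using the decomposition of Q as well; \<open>bracket_exact\<close> treats the exact part,
  using only that Q is closed.\<close>

lemma bracket_cocycles:
  assumes skew: "skewadjoint dv K N" and u: "diff_variables pd u" and P: "P \<in> Z p" and Q: "Q \<in> Z q"
  shows "bracket_coeff smul dv pd u p q n P Q \<in> B (p + q - 1)"
proof -
  \<comment> \<open>A cocycle of degree 0 is quasiconstant, so its bracket with anything is 0; this
    also covers the truncated degree for p = q = 0.\<close>
  consider "p = 0" | "q = 0" | h l where "p = Suc h" "q = Suc l" by (meson not0_implies_Suc)
  then show ?thesis
  proof cases
    case 1
    then have "P \<in> Omega00 pd N 0" using P cocycle_0 by simp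
    then have "box smul dv pd u q p Q P is = 0" for "is" by (intro box_qc) (auto intro: Omega00_qc)
    moreover have "box smul dv pd u p q P Q is = 0" for "is" using 1 by (simp add: box_def)
    ultimately show ?thesis using bracket_zero B_0 by simp
  next
    case 2
    then have "Q \<in> Omega00 pd N 0" using Q cocycle_0 by simp
    then have "box smul dv pd u p q P Q is = 0" for "is" by (intro box_qc) (auto intro: Omega00_qc)
    moreover have "box smul dv pd u q p Q P is = 0" for "is" using 2 by (simp add: box_def)
    ultimately show ?thesis using bracket_zero B_0 by simp
  next
    case (3 h l)
    have PO: "P \<in> Omega (Suc h)" and QO: "Q \<in> Omega (Suc l)" and closed: "dl Dx (coef Q) = 0"
      using P Q 3 by (auto simp: cocycle_iff)
    have fP: "form (Suc h) (coef P)" and fQ: "form (Suc l) (coef Q)" using PO QO by (auto simp: Omega_iff)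
    obtain \<gamma> where g: "form h \<gamma>" "small (coef P - dl Dx \<gamma>)"
      using cocycle_decompose[OF P] 3(1) prev_form_Suc by metis
    obtain \<eta> where e: "form l \<eta>" "small (coef Q - dl Dx \<eta>)"
      using cocycle_decompose[OF Q] 3(2) prev_form_Suc by metis
    let ?A = "coef P - dl Dx \<gamma>"
    have fA: "form (Suc h) ?A" by (intro form_diff fP form_dl g)
    obtain M1 M2 M3 where Ms: "\<And>xs. order_lt M1 (coef P xs)" "\<And>xs. order_lt M2 (coef Q xs)" "\<And>xs. order_lt M3 (\<gamma> xs)"
      using form_bounds(1)[OF fP] form_bounds(1)[OF fQ] form_bounds(1)[OF g(1)] by blast
    define M where "M = M1 + M2 + M3"
    have M: "order_lt M (coef P xs)" "order_lt M (coef Q xs)" "order_lt M (\<gamma> xs)" for xs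
      using Ms[of xs] by (auto simp: M_def elim!: order_lt_mono)
    obtain R1 R2 where Rs: "\<And>i r xs. r \<ge> R1 \<Longrightarrow> coef P ((i, r) # xs) = 0" "\<And>i r xs. r \<ge> R2 \<Longrightarrow> coef Q ((i, r) # xs) = 0"
      using form_bounds(2)[OF fP] form_bounds(2)[OF fQ] by blast
    \<comment> \<open>Beyond the first letters of P and Q, this covers every symbol with n < M,
      since its degree is at most n + N.\<close>
    define R where "R = R1 + R2 + (Suc N + M)"
    have R: "coef P ((i, r) # xs) = 0" "coef Q ((i, r) # xs) = 0" if "r \<ge> R" for i r xs
      using that Rs by (auto simp: R_def)
    let ?b = "bracket_coeff smul dv pd u (Suc h) (Suc l) n P Q"
    have bO: "?b \<in> Omega (Suc (h + l))"
      by (rule bracket_entries(1)[OF u PO QO M(1) M(2) R])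
    have bc: "coef ?b = (\<lambda>p. coeff p n) \<circ> brf M R (coef P) (coef Q)"
      by (rule bracket_entries(2)[OF u PO QO M(1) M(2) R])
    define Y1 where "Y1 = (\<Sum>i\<in>UNIV. \<Sum>m<M. wedge (cst (pd i m \<circ> \<eta>)) ((Lop ^^ m) (Wf R ?A i)))"
    define Y2 where "Y2 = - (\<Sum>i\<in>UNIV. \<Sum>m<M. wedge (signed (cst (pd i m \<circ> coef Q))) ((Lop ^^ m) (Wf R \<gamma> i)))
      - (\<Sum>i\<in>UNIV. \<Sum>r<R. wedge (cst (contr (i, r) (coef Q))) ((Lop ^^ r) (Vf M \<gamma> i)))"
    have "brf M R ?A (coef Q) = dl Dp Y1"
      unfolding Y1_def by (rule small_bracket_exact[OF g(2) _ e(2)]) simp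
    moreover have "brf M R (dl Dx \<gamma>) (coef Q) = dl Dp Y2"
      unfolding Y2_def by (rule bracket_exact[OF skew M(3) M(2) _ closed]) (simp add: R_def)
    ultimately have br: "brf M R (coef P) (coef Q) = dl Dp (Y1 + Y2)"
      using brf_add[of M R ?A "dl Dx \<gamma>" "coef Q"] by (simp add: additive_map_add[OF dlp_add])
    have "formp (l + h) Y1" unfolding Y1_def
      by (intro formp_sum formp_wedge formp_cst form_pd e formp_Lpow formp_Wf fA)
    moreover have "formp (h + l) Y2"
    proof -
      have "formp (h + l) (\<Sum>i\<in>UNIV. \<Sum>r<R. wedge (cst (contr (i, r) (coef Q))) ((Lop ^^ r) (Vf M \<gamma> i)))"
        unfolding add.commute[of h]
        by (intro formp_sum formp_wedge formp_cst form_contr fQ formp_Lpow formp_Vf g)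
      then show ?thesis unfolding Y2_def
        by (intro formp_diff[rotated], assumption, intro formp_minus formp_sum formp_wedge_Wf formp_signed formp_cst form_pd fQ g)
    qed
    ultimately have "formp (h + l) (Y1 + Y2)" by (intro formp_add) (simp_all add: add.commute)
    then have "form (h + l) ((\<lambda>p. coeff p n) \<circ> (Y1 + Y2))" by (rule form_coeff)
    moreover have "coef ?b = dl Dx ((\<lambda>p. coeff p n) \<circ> (Y1 + Y2))" unfolding bc br by (rule coeff_dlp)
    ultimately have "?b \<in> B (Suc (h + l))"
      using bO unfolding coboundary_iff prev_form_Suc by blast
    then show ?thesis using 3 by simp
  qed
qed

lemma Z_cls: "P \<in> Z k \<Longrightarrow> P' \<in> cls k P \<Longrightarrow> P' \<in> Z k"
  using Z_add[of P k "P' - P"] coboundary_cocycle[of "P' - P" k] by (simp add: cls_iff)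

lemma bracket_descends_skew:
  assumes skew: "skewadjoint dv K N" and u: "diff_variables pd u"
  shows "bracket_descends smul dv pd u K N"
  unfolding bracket_descends_def carrier_H
proof (intro allI ballI)
  fix p q n X Y assume "X \<in> cls p ` Z p" "Y \<in> cls q ` Z q"
  then obtain P Q where P: "P \<in> Z p" "X = cls p P" and Q: "Q \<in> Z q" "Y = cls q Q" by auto
  let ?k = "p + q - 1"
  let ?S = "{bracket_coeff smul dv pd u p q n P Q |P Q. P \<in> X \<and> Q \<in> Y}"
  have S: "?S \<subseteq> B ?k"
  proof
    fix R assume "R \<in> ?S"
    then obtain P' Q' where R: "R = bracket_coeff smul dv pd u p q n P' Q'" and "P' \<in> X" "Q' \<in> Y" by blast
    then have "P' \<in> Z p" "Q' \<in> Z q" using Z_cls[OF P(1)] Z_cls[OF Q(1)] unfolding P(2) Q(2) by simp_all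
    then show "R \<in> B ?k" unfolding R by (rule bracket_cocycles[OF skew u])
  qed
  have "P \<in> X" "Q \<in> Y" using P Q by (simp_all add: cls_iff B_0)
  then have b: "bracket_coeff smul dv pd u p q n P Q \<in> ?S" by blast
  \<comment> \<open>A nonempty set of coboundaries, enlarged by all coboundaries, is the zero
    class.\<close>
  have "?S + B ?k = B ?k"
  proof (intro subset_antisym subsetI)
    show "R \<in> B ?k" if "R \<in> ?S + B ?k" for R
      using that S B_add by (auto elim!: set_plus_elim)
    show "R \<in> ?S + B ?k" if "R \<in> B ?k" for R
    proof -
      let ?b = "bracket_coeff smul dv pd u p q n P Q"
      have "?b + (R - ?b) \<in> ?S + B ?k" using b S B_diff[OF that] by (intro set_plus_intro) auto
      then show ?thesis by simp
    qed
  qed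
  moreover have "cls ?k 0 \<in> cls ?k ` Z ?k" by (rule imageI) (rule Z_0)
  ultimately show "coh_bracket smul dv pd u K N p q n X Y \<in> cls ?k ` Z ?k"
    unfolding coh_bracket_def by (simp only: cls_0)
qed

end

text \<open>Once the bracket of classes is known to be a class, it is identified by a single member:
  the bracket of the representatives, which is 0 by \<open>bracket_Omega00\<close>.\<close>

lemma bracket_class:
  assumes d: "bracket_descends smul dv pd u K N" and P: "P \<in> Omega00 pd N p" and Q: "Q \<in> Omega00 pd N q"
  shows "coh_bracket smul dv pd u K N p q n (cls p P) (cls q Q) =
    cls (p + q - 1) (bracket_coeff smul dv pd u p q n P Q)"
proof -
  let ?k = "p + q - 1"
  let ?X = "coh_bracket smul dv pd u K N p q n (cls p P) (cls q Q)"
  have "?X \<in> carrier (H ?k)"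
    using d Omega00_cocycle[OF P] Omega00_cocycle[OF Q] unfolding bracket_descends_def carrier_H by blast
  then obtain R where R: "?X = cls ?k R" unfolding carrier_H by blast
  have "bracket_coeff smul dv pd u p q n P Q + 0 \<in> ?X"
    unfolding coh_bracket_def using cls_iff[of P p P] cls_iff[of Q q Q] B_0 by (intro set_plus_intro) auto
  then have "0 \<in> cls ?k R" unfolding R bracket_Omega00[OF P Q] by simp
  then have "cls ?k R = cls ?k 0" using cls_eqI[of 0 R ?k] by (simp add: cls_iff)
  then show ?thesis unfolding R bracket_Omega00[OF P Q] .
qed

lemma coh_der_cls: "coh_der dv pd K N k (cls k P) = cls k (arr_der dv P)"
  unfolding coh_der_def by (rule coset_image) (simp_all add: arr_der_add B_der)

end

theorem theorem11p2:
  fixes smul :: "'f::field_char_0 \<Rightarrow> 'v::comm_ring_1 \<Rightarrow> 'v"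
    and dv :: "'v \<Rightarrow> 'v"
    and pd :: "'i::{finite,linorder} \<Rightarrow> nat \<Rightarrow> 'v \<Rightarrow> 'v"
    and K :: "nat \<Rightarrow> (('v, 'i) vec, 'i) vec"
    and N :: nat
  assumes "diff_function_algebra smul dv pd"
    and "normal_alg pd"
    and "field (qc_ring pd)"
    and "\<And>n i j. n \<le> N \<Longrightarrow> K n $ i $ j \<in> quasiconst pd"
    and "\<exists>L. (\<forall>i j. L $ i $ j \<in> quasiconst pd) \<and> K N ** L = mat 1 \<and> L ** K N = mat 1"
  shows
    \<comment> \<open>\<open>(\<Omega>\<^sub>0\<^sub>0, 0)\<close> is a subcomplex of \<open>(\<Omega>, \<delta>)\<close> and the inclusion is bijective and linear on cohomology\<close>
    "(\<forall>k. delta dv pd K N ` Omega k \<subseteq> Omega (Suc k) \<and>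
          (\<forall>P\<in>Omega k. delta dv pd K N (delta dv pd K N P) = 0) \<and>
          Omega00 pd N k \<subseteq> cocycles dv pd K N k \<and>
          Module.module (qc_ring pd) (Omega00_module pd N k) \<and>
          Module.module (qc_ring pd) (cohomology dv pd K N k) \<and>
          linear_iso (qc_ring pd) (Omega00_module pd N k) (cohomology dv pd K N k)
            (coh_class dv pd K N k))
     \<comment> \<open>compatibility with \<open>\<partial>\<close>, which descends to cohomology\<close>
     \<and> (\<forall>k. (\<forall>X\<in>carrier (cohomology dv pd K N k).
               coh_der dv pd K N k X \<in> carrier (cohomology dv pd K N k)) \<and>
            (\<forall>P\<in>Omega00 pd N k.
               coh_der dv pd K N k (coh_class dv pd K N k P) = coh_class dv pd K N k (arr_der dv P)))
     \<comment> \<open>compatibility with the \<open>\<lambda>\<close>-bracket\<close>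
     \<and> (\<forall>u. diff_variables pd u \<longrightarrow>
          (\<forall>p q n. \<forall>P\<in>Omega00 pd N p. \<forall>Q\<in>Omega00 pd N q.
             bracket_coeff smul dv pd u p q n P Q = 0) \<and>
          (skewadjoint dv K N \<longrightarrow> bracket_descends smul dv pd u K N) \<and>
          (bracket_descends smul dv pd u K N \<longrightarrow>
             (\<forall>p q n. \<forall>P\<in>Omega00 pd N p. \<forall>Q\<in>Omega00 pd N q.
                coh_bracket smul dv pd u K N p q n (coh_class dv pd K N p P) (coh_class dv pd K N q Q) =
                coh_class dv pd K N (p + q - 1) (bracket_coeff smul dv pd u p q n P Q))))
     \<comment> \<open>dimension\<close>
     \<and> (\<forall>k. has_dimension (qc_ring pd) (cohomology dv pd K N k) ((N * CARD('i)) choose k))"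
proof -
  interpret diff_complex smul dv pd K N
    using assms(1,4) by (intro diff_complex.intro diff_complex_axioms.intro)
  obtain L where L: "\<And>i j. L $ i $ j \<in> quasiconst pd" "K N ** L = mat 1" "L ** K N = mat 1"
    using assms(5) by blast
  note iso = inclusion_iso[OF assms(2) L]
  show ?thesis
  proof (intro conjI allI impI ballI)
    fix k
    show "delta dv pd K N ` Omega k \<subseteq> Omega (Suc k)" using Omega_delta by blast
    show "delta dv pd K N (delta dv pd K N P) = 0" if "P \<in> Omega k" for P :: "('i, 'v) arr"
      using that by (rule delta_delta)
    show "Omega00 pd N k \<subseteq> Z k" using Omega00_cocycle by blast
    show "Module.module (qc_ring pd) (H0 k)" by (rule module_H0)
    show "Module.module (qc_ring pd) (H k)" by (rule module_H)
    show "linear_iso (qc_ring pd) (H0 k) (H k) (cls k)" by (rule iso)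
    show "coh_der dv pd K N k X \<in> carrier (H k)" if "X \<in> carrier (H k)" for X
      using that Z_der by (auto simp: carrier_H coh_der_cls)
    show "coh_der dv pd K N k (cls k P) = cls k (arr_der dv P)" for P by (rule coh_der_cls)
    show "has_dimension (qc_ring pd) (H k) ((N * CARD('i)) choose k)"
      by (rule has_dimension_iso[OF module_H0 module_H iso dimension_H0])
  next
    fix u p q n P Q
    assume u: "diff_variables pd u"
    show "bracket_coeff smul dv pd u p q n P Q = 0" if "P \<in> Omega00 pd N p" "Q \<in> Omega00 pd N q"
      using that by (rule bracket_Omega00)
    show "bracket_descends smul dv pd u K N" if "skewadjoint dv K N"
      by (rule bracket_descends_skew[OF assms(2) L that u])
    show "coh_bracket smul dv pd u K N p q n (cls p P) (cls q Q) =
        cls (p + q - 1) (bracket_coeff smul dv pd u p q n P Q)"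
      if "bracket_descends smul dv pd u K N" "P \<in> Omega00 pd N p" "Q \<in> Omega00 pd N q"
      using that by (rule bracket_class)
  qed
qed

end
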